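(* Let $P$ be a submonoid of a group $G$ with $P\neq\{e\}$, and let $G_0=\{g\in G: gP\cap S\neq\emptyset\text{ and }g^{-1}P\cap S\neq\emptyset\text{ for all nonempty constructible right ideals }S\text{ of }P\}$. Any of the following (equivalent) conditions implies that $\partial\mathcal T_\lambda(P)$ is purely infinite simple: (1) the partial action of $G$ on $\partial\Omega_P$ is topologically free; (2) the partial action of $G_0$ on $\partial\Omega_P$ is topologically free; (3) for every $g\in G_0$, $g\neq e$, and for every $p\in P$, there is $q\in pP$ with $qP\cap gqP=\emptyset$; (4) for all $p,t\in P$ with $p\neq t$, there is $s\in P$ such that $psP\cap tsP=\emptyset$; (5) every proper ideal of $\mathbb C\times_{\mathbb C^P}P$ is contained in the kernel of the canonical map $\Lambda_\partial\colon\mathbb C\times_{\mathbb C^P}P\to\partial\mathcal T_\lambda(P)$. The converse implication also holds if we further have $\mathbb C\times_{\mathbb C^P}P\cong\partial\mathcal T_\lambda(P)$ via the canonical map $\Lambda_\partial$.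
   Context: $P$ is a submonoid of a group $G$ with identity $e$. Ideals of $\mathrm C^*$-algebras are closed and two-sided. A word is a finite sequence $\alpha=(p_1,p_2,\ldots,p_{2k-1},p_{2k})$ of even length $2k\ge 0$ with entries in $P$. Put $\dot\alpha:=p_1^{-1}p_2\cdots p_{2k-1}^{-1}p_{2k}\in G$ (equal to $e$ for the empty word); $\alpha$ is neutral if $\dot\alpha=e$. Put $\tilde\alpha:=(p_{2k},\ldots,p_1)$ and $K(\alpha):=P\cap p_{2k}^{-1}p_{2k-1}P\cap p_{2k}^{-1}p_{2k-1}p_{2k-2}^{-1}p_{2k-3}P\cap\cdots\cap p_{2k}^{-1}p_{2k-1}\cdots p_2^{-1}p_1P$ (equal to $P$ for the empty word). The constructible right ideals of $P$ are the members of $\mathfrak J:=\{K(\alpha):\alpha\text{ a word}\}$. For $w\colon P\to B$, $\dot w_\alpha:=w_{p_1}^*w_{p_2}\cdots w_{p_{2k-1}}^*w_{p_{2k}}$. $\hat{\mathfrak J}$ is the compact space (pointwise convergence) of nonzero functions $\chi\colon\mathfrak J\to\{0,1\}$ with $\chi(R\cap S)=\chi(R)\chi(S)$ and $\chi(\emptyset)=0$ if $\emptyset\in\mathfrak J$; $\Omega_P\subseteq\hat{\mathfrak J}$ is the closed subspace of those $\chi$ such that $S=\bigcup_{i=1}^nS_i$ in $\mathfrak J$ and $\chi(S)=1$ imply $\chi(S_i)=1$ for some $i$; it is the spectrum of $D_r:=\overline{\mathrm{span}}\{\mathbb 1_S:S\in\mathfrak J\}\subseteq\ell^\infty(P)$.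 $G$ acts partially on $\Omega_P$: $U_{g^{-1}}:=\{\chi\in\Omega_P:\chi(K(\alpha))=1\text{ for some }\alpha\text{ with }\dot\alpha=g\}$ and $\hat\gamma_g\colon U_{g^{-1}}\to U_g$ is the homeomorphism determined by $\hat\gamma_g(\chi)(K(\beta))=\chi(g^{-1}K(\beta))=\chi(K(\tilde\beta))$ for $\dot\beta=g^{-1}$. $\partial\Omega_P$ is the closure of the set of $\chi\in\hat{\mathfrak J}$ for which $\chi^{-1}(1)$ is maximal (among the sets $\chi'^{-1}(1)$, $\chi'\in\hat{\mathfrak J}$); it is a closed invariant subset of $\Omega_P$, on which $G$ and its subgroup $G_0$ act partially by restriction. A partial action is topologically free if for each group element $g\neq e$ the set of points in the domain of the partial homeomorphism of $g$ that it fixes has empty interior. The boundary quotient is $\partial\mathcal T_\lambda(P)\cong\mathrm C(\partial\Omega_P)\rtimes_rG$ (reduced partial crossed product). The covariance algebra $\mathbb C\times_{\mathbb C^P}P$ is the universal $\mathrm C^*$-algebra for strongly covariant isometric representations of $P$: with $L_p\delta_q=\delta_{pq}$ on $\ell^2(P)$ (so $\dot L_\alpha=\mathbb 1_{K(\alpha)}\in D_r$ for neutral $\alpha$), $\Delta_F:=\{p\in P:\forall g\in F,\ pP\cap gP=\emptyset\text{ or }pP\cap gP=pP\}$ for finite $F\subseteq G$, and $D_r^{\mathrm o}:=\{b\in D_r:\lim_F\|b|_{\ell^2(\Delta_F)}\|=0\}$ (limit over finite $F\subseteq G$ directed by inclusion), a representation $w$ of $P$ by isometries is strongly covariant if $\dot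 L_\alpha\mapsto\dot w_\alpha$ ($\alpha$ neutral) extends to a well-defined $*$-homomorphism on $D_r$ vanishing on $D_r^{\mathrm o}$. There is an isomorphism $\mathbb C\times_{\mathbb C^P}P\cong\mathrm C(\partial\Omega_P)\rtimes G$ (full partial crossed product) identifying the canonical generator $j_p$ with the image of $\mathbb 1_{pP}\delta_p$; $\Lambda_\partial$ is the composition of this isomorphism with the canonical map from the full to the reduced crossed product $\mathrm C(\partial\Omega_P)\rtimes_rG\cong\partial\mathcal T_\lambda(P)$. *)

theory Defs
  imports "HOL-Analysis.Analysis" "HOL-Algebra.Module" "HOL-Algebra.Ideal"
begin

section \<open>The Hilbert space of square-summable families\<close>

typedef 'i ell2 = "{x :: 'i \<Rightarrow> complex. (\<lambda>i. (cmod (x i))\<^sup>2) summable_on UNIV}"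
  morphisms coord Abs_ell2
  by (rule exI[of _ "\<lambda>_. 0"]) simp

setup_lifting type_definition_ell2

lemma summable_coord: "(\<lambda>i. (cmod (coord x i))\<^sup>2) summable_on UNIV"
  using coord by auto

lemma sq_summable_add:
  fixes x y :: "'i \<Rightarrow> complex"
  assumes "(\<lambda>i. (cmod (x i))\<^sup>2) summable_on UNIV" "(\<lambda>i. (cmod (y i))\<^sup>2) summable_on UNIV"
  shows "(\<lambda>i. (cmod (x i + y i))\<^sup>2) summable_on UNIV"
proof (rule summable_on_comparison_test)
  show "(\<lambda>i. 2 * (cmod (x i))\<^sup>2 + 2 * (cmod (y i))\<^sup>2) summable_on UNIV"
    by (intro summable_on_add summable_on_cmult_right assms)
  show "(cmod (x i + y i))\<^sup>2 \<le> 2 * (cmod (x i))\<^sup>2 + 2 * (cmod (y i))\<^sup>2" for i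
  proof -
    have "(cmod (x i + y i))\<^sup>2 \<le> (cmod (x i) + cmod (y i))\<^sup>2"
      by (intro power_mono norm_triangle_ineq) simp
    also have "\<dots> \<le> 2 * (cmod (x i))\<^sup>2 + 2 * (cmod (y i))\<^sup>2"
      using sum_squares_bound[of "cmod (x i)" "cmod (y i)"] by (simp add: power2_sum)
    finally show ?thesis .
  qed
qed auto

lemma sq_summable_mult:
  fixes x :: "'i \<Rightarrow> complex"
  assumes "(\<lambda>i. (cmod (x i))\<^sup>2) summable_on UNIV"
  shows "(\<lambda>i. (cmod (c * x i))\<^sup>2) summable_on UNIV"
  using summable_on_cmult_right[OF assms, of "(cmod c)\<^sup>2"]
  by (simp add: norm_mult power_mult_distrib)

instantiation ell2 :: (type) real_vector
begin
lift_definition zero_ell2 :: "'a ell2" is "\<lambda>_. 0" by simp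
lift_definition plus_ell2 :: "'a ell2 \<Rightarrow> 'a ell2 \<Rightarrow> 'a ell2" is "\<lambda>x y i. x i + y i"
  by (simp add: sq_summable_add)
lift_definition uminus_ell2 :: "'a ell2 \<Rightarrow> 'a ell2" is "\<lambda>x i. - x i" by simp
definition minus_ell2 :: "'a ell2 \<Rightarrow> 'a ell2 \<Rightarrow> 'a ell2" where "minus_ell2 x y = x + (- y)"
lift_definition scaleR_ell2 :: "real \<Rightarrow> 'a ell2 \<Rightarrow> 'a ell2" is "\<lambda>r x i. complex_of_real r * x i"
  by (simp only: mem_Collect_eq sq_summable_mult)
instance
proof
  fix a b c :: "'a ell2" and r s :: real
  show "a + b + c = a + (b + c)" by transfer (simp add: algebra_simps)
  show "a + b = b + a" by transfer (simp add: algebra_simps)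
  show "0 + a = a" by transfer simp
  show "- a + a = 0" by transfer simp
  show "a - b = a + - b" by (rule minus_ell2_def)
  show "r *\<^sub>R (a + b) = r *\<^sub>R a + r *\<^sub>R b" by transfer (simp add: algebra_simps)
  show "(r + s) *\<^sub>R a = r *\<^sub>R a + s *\<^sub>R a" by transfer (simp add: algebra_simps)
  show "r *\<^sub>R s *\<^sub>R a = (r * s) *\<^sub>R a" by transfer (simp add: algebra_simps)
  show "1 *\<^sub>R a = a" by transfer simp
qed
end

lift_definition scaleC :: "complex \<Rightarrow> 'i ell2 \<Rightarrow> 'i ell2" is "\<lambda>c x i. c * x i"
  by (simp only: mem_Collect_eq sq_summable_mult)

definition cinner :: "'i ell2 \<Rightarrow> 'i ell2 \<Rightarrow> complex" where
  "cinner x y = (\<Sum>\<^sub>\<infinity>i. cnj (coord x i) * coord y i)"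

lemma cinner_summable: "(\<lambda>i. cnj (coord x i) * coord y i) summable_on UNIV"
proof (rule Infinite_Sum.abs_summable_summable, rule Infinite_Sum.abs_summable_product)
  show "(\<lambda>i. cmod (cnj (coord x i) * cnj (coord x i))) summable_on UNIV"
    using summable_coord[of x] by (simp add: norm_mult power2_eq_square)
  show "(\<lambda>i. cmod (coord y i * coord y i)) summable_on UNIV"
    using summable_coord[of y] by (simp add: norm_mult power2_eq_square)
qed

lemma cinner_commute: "cinner y x = cnj (cinner x y)"
  unfolding cinner_def by (subst infsum_cnj[symmetric]) (simp add: mult.commute)

lemma cinner_add_left: "cinner (x + y) z = cinner x z + cinner y z"
proof -
  have "cinner (x + y) z
      = (\<Sum>\<^sub>\<infinity>i. cnj (coord x i) * coord z i + cnj (coord y i) * coord z i)"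
    unfolding cinner_def by (simp add: plus_ell2.rep_eq algebra_simps)
  also have "\<dots> = cinner x z + cinner y z"
    unfolding cinner_def by (intro infsum_add cinner_summable)
  finally show ?thesis .
qed

lemma cinner_scaleR_left: "cinner (scaleR r x) y = complex_of_real r * cinner x y"
  unfolding cinner_def by (simp add: scaleR_ell2.rep_eq mult.assoc infsum_cmult_right')

lemma cinner_self: "cinner x x = complex_of_real (\<Sum>\<^sub>\<infinity>i. (cmod (coord x i))\<^sup>2)"
proof -
  have "((\<lambda>i. complex_of_real ((cmod (coord x i))\<^sup>2)) has_sum
      complex_of_real (\<Sum>\<^sub>\<infinity>i. (cmod (coord x i))\<^sup>2)) UNIV"
    using has_sum_infsum[OF summable_coord[of x]] by (rule has_sum_of_real)
  then show ?thesis
    unfolding cinner_def using complex_norm_square by (simp add: infsumI mult.commute)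
qed

instantiation ell2 :: (type) real_inner
begin
definition inner_ell2 :: "'a ell2 \<Rightarrow> 'a ell2 \<Rightarrow> real" where
  "inner_ell2 x y = Re (cinner x y)"
definition norm_ell2 :: "'a ell2 \<Rightarrow> real" where
  "norm_ell2 x = sqrt (Re (cinner x x))"
definition sgn_ell2 :: "'a ell2 \<Rightarrow> 'a ell2" where
  "sgn_ell2 x = inverse (norm x) *\<^sub>R x"
definition dist_ell2 :: "'a ell2 \<Rightarrow> 'a ell2 \<Rightarrow> real" where
  "dist_ell2 x y = norm (x - y)"
definition uniformity_ell2 :: "('a ell2 \<times> 'a ell2) filter" where
  "uniformity_ell2 = (INF e\<in>{0 <..}. principal {(x, y). dist x y < e})"
definition open_ell2 :: "'a ell2 set \<Rightarrow> bool" where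
  "open_ell2 U \<longleftrightarrow> (\<forall>x\<in>U. eventually (\<lambda>(x', y). x' = x \<longrightarrow> y \<in> U) uniformity)"
instance
proof
  fix x y z :: "'a ell2" and r :: real
  show "inner x y = inner y x"
    unfolding inner_ell2_def by (subst cinner_commute) simp
  show "inner (x + y) z = inner x z + inner y z"
    unfolding inner_ell2_def by (simp add: cinner_add_left)
  show "inner (r *\<^sub>R x) y = r * inner x y"
    unfolding inner_ell2_def by (simp add: cinner_scaleR_left)
  show "0 \<le> inner x x"
    unfolding inner_ell2_def by (simp add: cinner_self infsum_nonneg)
  show "inner x x = 0 \<longleftrightarrow> x = 0"
  proof
    assume "inner x x = 0"
    then have 0: "(\<Sum>\<^sub>\<infinity>i. (cmod (coord x i))\<^sup>2) = 0"
      unfolding inner_ell2_def by (simp add: cinner_self)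
    have "(cmod (coord x i))\<^sup>2 = 0" for i
      by (rule nonneg_infsum_le_0D[OF _ summable_coord[of x]]) (use 0 in auto)
    then show "x = 0" by transfer auto
  next
    assume "x = 0"
    then show "inner x x = 0"
      unfolding inner_ell2_def cinner_def by (simp add: zero_ell2.rep_eq)
  qed
  show "norm x = sqrt (inner x x)"
    unfolding inner_ell2_def norm_ell2_def by simp
qed (rule sgn_ell2_def dist_ell2_def uniformity_ell2_def open_ell2_def)+
end

type_synonym 'i op = "'i ell2 \<Rightarrow>\<^sub>L 'i ell2"

section \<open>C*-algebras\<close>

text \<open>A C*-algebra is a carrier set together with its operations. All algebras below are unital;
  the non-unital hereditary subalgebras occur as subsets.\<close>

record 'a cstar = "(complex, 'a) module" +
  star :: "'a \<Rightarrow> 'a"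
  nrm :: "'a \<Rightarrow> real"

definition cl :: "'a cstar \<Rightarrow> 'a set \<Rightarrow> 'a set" where
  "cl A X = {a \<in> carrier A. \<forall>e>0. \<exists>x\<in>X. nrm A (a \<ominus>\<^bsub>A\<^esub> x) < e}"

inductive_set lin_span :: "'a cstar \<Rightarrow> 'a set \<Rightarrow> 'a set" for A X where
  zero: "\<zero>\<^bsub>A\<^esub> \<in> lin_span A X"
| step: "x \<in> X \<Longrightarrow> y \<in> lin_span A X \<Longrightarrow> (c \<odot>\<^bsub>A\<^esub> x) \<oplus>\<^bsub>A\<^esub> y \<in> lin_span A X"

definition cstar_sub :: "'a cstar \<Rightarrow> 'a set \<Rightarrow> bool" where
  "cstar_sub A B \<longleftrightarrow> B \<subseteq> carrier A \<and> \<zero>\<^bsub>A\<^esub> \<in> B \<and>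
     (\<forall>x\<in>B. \<forall>y\<in>B. x \<oplus>\<^bsub>A\<^esub> y \<in> B \<and> x \<otimes>\<^bsub>A\<^esub> y \<in> B) \<and>
     (\<forall>x\<in>B. star A x \<in> B \<and> (\<forall>c. c \<odot>\<^bsub>A\<^esub> x \<in> B)) \<and> cl A B \<subseteq> B"

definition cstar_gen :: "'a cstar \<Rightarrow> 'a set \<Rightarrow> 'a set" where
  "cstar_gen A X = \<Inter>{B. cstar_sub A B \<and> X \<subseteq> B}"

definition star_hom :: "'a cstar \<Rightarrow> 'b cstar \<Rightarrow> ('a \<Rightarrow> 'b) \<Rightarrow> bool" where
  "star_hom A B f \<longleftrightarrow> f \<in> ring_hom A B \<and> f \<in> extensional (carrier A) \<and>
     (\<forall>x\<in>carrier A. f (star A x) = star B (f x) \<and> (\<forall>c. f (c \<odot>\<^bsub>A\<^esub> x) = c \<odot>\<^bsub>B\<^esub> f x))"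

definition star_iso :: "'a cstar \<Rightarrow> 'b cstar \<Rightarrow> ('a \<Rightarrow> 'b) \<Rightarrow> bool" where
  "star_iso A B f \<longleftrightarrow> star_hom A B f \<and> bij_betw f (carrier A) (carrier B)"

text \<open>Closed two-sided ideals. Since the algebras are unital, ring ideals are complex subspaces.\<close>

definition cstar_ideal :: "'a cstar \<Rightarrow> 'a set \<Rightarrow> bool" where
  "cstar_ideal A I \<longleftrightarrow> ideal I A \<and> cl A I \<subseteq> I"

definition positive :: "'a cstar \<Rightarrow> 'a \<Rightarrow> bool" where
  "positive A a \<longleftrightarrow> (\<exists>x\<in>carrier A. a = star A x \<otimes>\<^bsub>A\<^esub> x)"

definition hereditary_sub :: "'a cstar \<Rightarrow> 'a set \<Rightarrow> bool" where
  "hereditary_sub A B \<longleftrightarrow> cstar_sub A B \<and>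
     (\<forall>a b. positive A a \<and> b \<in> B \<and> positive A b \<and> positive A (b \<ominus>\<^bsub>A\<^esub> a) \<longrightarrow> a \<in> B)"

definition projection :: "'a cstar \<Rightarrow> 'a \<Rightarrow> bool" where
  "projection A p \<longleftrightarrow> p \<in> carrier A \<and> star A p = p \<and> p \<otimes>\<^bsub>A\<^esub> p = p"

definition infinite_projection :: "'a cstar \<Rightarrow> 'a \<Rightarrow> bool" where
  "infinite_projection A p \<longleftrightarrow> projection A p \<and>
     (\<exists>q. projection A q \<and> p \<otimes>\<^bsub>A\<^esub> q = q \<and> q \<noteq> p \<and>
       (\<exists>v\<in>carrier A. star A v \<otimes>\<^bsub>A\<^esub> v = p \<and> v \<otimes>\<^bsub>A\<^esub> star A v = q))"

definition simple_cstar :: "'a cstar \<Rightarrow> bool" where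
  "simple_cstar A \<longleftrightarrow> carrier A \<noteq> {\<zero>\<^bsub>A\<^esub>} \<and>
     (\<forall>I. cstar_ideal A I \<longrightarrow> I = {\<zero>\<^bsub>A\<^esub>} \<or> I = carrier A)"

definition purely_infinite_simple :: "'a cstar \<Rightarrow> bool" where
  "purely_infinite_simple A \<longleftrightarrow> simple_cstar A \<and>
     (\<forall>B. hereditary_sub A B \<and> B \<noteq> {\<zero>\<^bsub>A\<^esub>} \<longrightarrow> (\<exists>p\<in>B. infinite_projection A p))"

definition complex_cstar :: "complex cstar" where
  "complex_cstar = \<lparr>carrier = UNIV, mult = (*), one = 1, zero = 0, add = (+), smult = (*),
     star = cnj, nrm = cmod\<rparr>"

definition adj :: "'i op \<Rightarrow> 'i op" where
  "adj T = (THE S. \<forall>x y. cinner (blinfun_apply S x) y = cinner x (blinfun_apply T y))"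

text \<open>The type of operators only provides real-linear maps, hence the condition on the carrier.\<close>

definition bounded_ops :: "'i op cstar" where
  "bounded_ops =
     \<lparr>carrier = {T. \<forall>c x. blinfun_apply T (scaleC c x) = scaleC c (blinfun_apply T x)},
      mult = (o\<^sub>L), one = id_blinfun, zero = 0, add = (+),
      smult = (\<lambda>c T. Blinfun (\<lambda>x. scaleC c (blinfun_apply T x))),
      star = adj, nrm = norm\<rparr>"

text \<open>The C*-algebra of bounded families in \<open>A\<close> indexed by \<open>I\<close>.\<close>

definition bounded_families :: "'r set \<Rightarrow> 'a cstar \<Rightarrow> ('r \<Rightarrow> 'a) cstar" where
  "bounded_families I A =
     \<lparr>carrier = {f \<in> I \<rightarrow>\<^sub>E carrier A. bdd_above ((\<lambda>i. nrm A (f i)) ` I)},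
      mult = (\<lambda>f h. \<lambda>i\<in>I. f i \<otimes>\<^bsub>A\<^esub> h i), one = (\<lambda>i\<in>I. \<one>\<^bsub>A\<^esub>),
      zero = (\<lambda>i\<in>I. \<zero>\<^bsub>A\<^esub>), add = (\<lambda>f h. \<lambda>i\<in>I. f i \<oplus>\<^bsub>A\<^esub> h i),
      smult = (\<lambda>c f. \<lambda>i\<in>I. c \<odot>\<^bsub>A\<^esub> f i),
      star = (\<lambda>f. \<lambda>i\<in>I. star A (f i)),
      nrm = (\<lambda>f. Sup (insert 0 ((\<lambda>i. nrm A (f i)) ` I)))\<rparr>"

section \<open>Words, constructible right ideals and their spectrum\<close>

definition is_word :: "'g set \<Rightarrow> 'g list \<Rightarrow> bool" where
  "is_word P \<alpha> \<longleftrightarrow> even (length \<alpha>) \<and> set \<alpha> \<subseteq> P"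

fun wdot :: "'g monoid \<Rightarrow> 'g list \<Rightarrow> 'g" where
  "wdot G (p # q # \<alpha>) = inv\<^bsub>G\<^esub> p \<otimes>\<^bsub>G\<^esub> q \<otimes>\<^bsub>G\<^esub> wdot G \<alpha>"
| "wdot G _ = \<one>\<^bsub>G\<^esub>"

text \<open>The translates of \<open>P\<close> intersected in \<open>K(\<alpha>)\<close> are those by the inverses of \<open>\<beta>\<close> dotted, for
  \<open>\<beta>\<close> a suffix of \<open>\<alpha>\<close> of even length; the empty suffix gives \<open>P\<close> itself.\<close>

fun K :: "'g monoid \<Rightarrow> 'g set \<Rightarrow> 'g list \<Rightarrow> 'g set" where
  "K G P (p # q # \<alpha>) = K G P \<alpha> \<inter> ((inv\<^bsub>G\<^esub> (wdot G (p # q # \<alpha>))) <#\<^bsub>G\<^esub> P)"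
| "K G P _ = P"

definition constructible :: "'g monoid \<Rightarrow> 'g set \<Rightarrow> 'g set set" where
  "constructible G P = {K G P \<alpha> | \<alpha>. is_word P \<alpha>}"

text \<open>Functions to \<open>{0, 1}\<close> on the constructible ideals are predicates on all sets that are
  false elsewhere, so that pointwise convergence is the product topology of the function type.\<close>

definition spectrum_J :: "'g monoid \<Rightarrow> 'g set \<Rightarrow> ('g set \<Rightarrow> bool) set" where
  "spectrum_J G P = {\<omega>. (\<forall>S. \<omega> S \<longrightarrow> S \<in> constructible G P) \<and> (\<exists>S. \<omega> S) \<and> \<not> \<omega> {} \<and>
     (\<forall>R\<in>constructible G P. \<forall>S\<in>constructible G P. \<omega> (R \<inter> S) \<longleftrightarrow> \<omega> R \<and> \<omega> S)}"

definition Omega :: "'g monoid \<Rightarrow> 'g set \<Rightarrow> ('g set \<Rightarrow> bool) set" where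
  "Omega G P = {\<omega> \<in> spectrum_J G P. \<forall>S\<in>constructible G P. \<forall>\<S>.
     finite \<S> \<and> \<S> \<subseteq> constructible G P \<and> S = \<Union>\<S> \<and> \<omega> S \<longrightarrow> (\<exists>T\<in>\<S>. \<omega> T)}"

definition boundary :: "'g monoid \<Rightarrow> 'g set \<Rightarrow> ('g set \<Rightarrow> bool) set" where
  "boundary G P = closure {\<omega> \<in> spectrum_J G P. \<forall>\<omega>'\<in>spectrum_J G P.
     {S. \<omega> S} \<subseteq> {S. \<omega>' S} \<longrightarrow> {S. \<omega>' S} = {S. \<omega> S}}"

section \<open>Partial actions and their crossed products\<close>

text \<open>A partial action of a group on a space \<open>X\<close> is given by the domains \<open>D g\<close> and the partial
  homeomorphisms \<open>\<theta> g : D g \<rightarrow> D (inv g)\<close>. Thus \<open>D g\<close> is the set usually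
  written with index \<open>inv g\<close>.\<close>

definition topologically_free ::
    "'g monoid \<Rightarrow> 'g set \<Rightarrow> 'x::topological_space set \<Rightarrow> ('g \<Rightarrow> 'x set) \<Rightarrow> ('g \<Rightarrow> 'x \<Rightarrow> 'x) \<Rightarrow> bool" where
  "topologically_free G H X D \<theta> \<longleftrightarrow>
     (\<forall>g\<in>H. g \<noteq> \<one>\<^bsub>G\<^esub> \<longrightarrow> top_of_set X interior_of {x \<in> D g. \<theta> g x = x} = {})"

text \<open>The functions \<open>f\<close> for which \<open>f \<delta>\<^sub>g\<close> is in the crossed product: those in \<open>C\<^sub>0\<close> of the range
  of \<open>\<theta> g\<close>, extended by zero. Here \<open>X\<close> is compact and the range is open in \<open>X\<close>.\<close>

definition fibre ::
    "'g monoid \<Rightarrow> 'x::topological_space set \<Rightarrow> ('g \<Rightarrow> 'x set) \<Rightarrow> 'g \<Rightarrow> ('x \<Rightarrow> complex) set" where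
  "fibre G X D g = {f. continuous_on X f \<and> (\<forall>x. x \<notin> D (inv\<^bsub>G\<^esub> g) \<longrightarrow> f x = 0)}"

text \<open>The coefficients of \<open>(f \<delta>\<^sub>g) (f' \<delta>\<^sub>h)\<close> at \<open>\<delta>\<^sub>g\<^sub>h\<close> and of the adjoint of \<open>f \<delta>\<^sub>g\<close> at
  \<open>\<delta>\<close> of the inverse of \<open>g\<close>.\<close>

definition cp_mult ::
    "'g monoid \<Rightarrow> ('g \<Rightarrow> 'x set) \<Rightarrow> ('g \<Rightarrow> 'x \<Rightarrow> 'x) \<Rightarrow> 'g \<Rightarrow> ('x \<Rightarrow> complex) \<Rightarrow> ('x \<Rightarrow> complex) \<Rightarrow> 'x \<Rightarrow> complex" where
  "cp_mult G D \<theta> g f f' =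
     (\<lambda>x. if x \<in> D (inv\<^bsub>G\<^esub> g) then f x * f' (\<theta> (inv\<^bsub>G\<^esub> g) x) else 0)"

definition cp_star ::
    "('g \<Rightarrow> 'x set) \<Rightarrow> ('g \<Rightarrow> 'x \<Rightarrow> 'x) \<Rightarrow> 'g \<Rightarrow> ('x \<Rightarrow> complex) \<Rightarrow> 'x \<Rightarrow> complex" where
  "cp_star D \<theta> g f = (\<lambda>x. if x \<in> D g then cnj (f (\<theta> g x)) else 0)"

text \<open>Nondegenerate *-representations \<open>\<rho>\<close> of the algebraic crossed product on a Hilbert space,
  \<open>\<rho> g f\<close> being the image of \<open>f \<delta>\<^sub>g\<close>.\<close>

definition cp_rep ::
    "'g monoid \<Rightarrow> 'x::topological_space set \<Rightarrow> ('g \<Rightarrow> 'x set) \<Rightarrow> ('g \<Rightarrow> 'x \<Rightarrow> 'x) \<Rightarrow>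
     ('g \<Rightarrow> ('x \<Rightarrow> complex) \<Rightarrow> 'i op) \<Rightarrow> bool" where
  "cp_rep G X D \<theta> \<rho> \<longleftrightarrow>
     (\<forall>g\<in>carrier G. \<forall>f\<in>fibre G X D g.
        \<rho> g f \<in> carrier bounded_ops \<and>
        (\<forall>f'\<in>fibre G X D g. \<rho> g (\<lambda>x. f x + f' x) = \<rho> g f \<oplus>\<^bsub>bounded_ops\<^esub> \<rho> g f') \<and>
        (\<forall>c. \<rho> g (\<lambda>x. c * f x) = c \<odot>\<^bsub>bounded_ops\<^esub> \<rho> g f) \<and>
        (\<forall>h\<in>carrier G. \<forall>f'\<in>fibre G X D h.
           \<rho> (g \<otimes>\<^bsub>G\<^esub> h) (cp_mult G D \<theta> g f f') = \<rho> g f \<otimes>\<^bsub>bounded_ops\<^esub> \<rho> h f') \<and>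
        \<rho> (inv\<^bsub>G\<^esub> g) (cp_star D \<theta> g f) = star bounded_ops (\<rho> g f)) \<and>
     \<rho> \<one>\<^bsub>G\<^esub> (\<lambda>x. of_bool (x \<in> X)) = \<one>\<^bsub>bounded_ops\<^esub>"

text \<open>The full crossed product is the completion of the algebraic one in the direct sum of all
  its representations on the Hilbert space of families indexed by \<open>'i\<close>. This is the enveloping
  C*-algebra as soon as \<open>'i\<close> is infinite and at least of the density character of the enveloping
  algebra, since then every cyclic representation is contained in one on this space.\<close>

definition full_gen ::
    "'g monoid \<Rightarrow> 'x::topological_space set \<Rightarrow> ('g \<Rightarrow> 'x set) \<Rightarrow> ('g \<Rightarrow> 'x \<Rightarrow> 'x) \<Rightarrow>
     'g \<Rightarrow> ('x \<Rightarrow> complex) \<Rightarrow> (('g \<Rightarrow> ('x \<Rightarrow> complex) \<Rightarrow> 'i op) \<Rightarrow> 'i op)" where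
  "full_gen G X D \<theta> g f = (\<lambda>\<rho>\<in>Collect (cp_rep G X D \<theta>). \<rho> g f)"

definition full_cp ::
    "'g monoid \<Rightarrow> 'x::topological_space set \<Rightarrow> ('g \<Rightarrow> 'x set) \<Rightarrow> ('g \<Rightarrow> 'x \<Rightarrow> 'x) \<Rightarrow>
     (('g \<Rightarrow> ('x \<Rightarrow> complex) \<Rightarrow> 'i op) \<Rightarrow> 'i op) cstar" where
  "full_cp G X D \<theta> =
     (let B = bounded_families (Collect (cp_rep G X D \<theta>)) bounded_ops
      in B\<lparr>carrier := cl B (lin_span B
           {full_gen G X D \<theta> g f | g f. g \<in> carrier G \<and> f \<in> fibre G X D g})\<rparr>)"

text \<open>The regular representation, induced from multiplication of functions on \<open>\<ell>\<^sup>2(X)\<close>: it acts on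
  \<open>\<ell>\<^sup>2\<close> of the pairs \<open>(h, x)\<close> with \<open>x \<in> D h\<close>, and \<open>f \<delta>\<^sub>g\<close> maps the basis vector at \<open>(h, x)\<close>
  to \<open>f (\<theta> (g h) x)\<close> times the one at \<open>(g h, x)\<close> if \<open>x \<in> D (g h)\<close>, and to \<open>0\<close> otherwise. All
  operators vanish on the complement of this subspace, so the unit is its projection.\<close>

definition reg_gen ::
    "'g monoid \<Rightarrow> 'x::topological_space set \<Rightarrow> ('g \<Rightarrow> 'x set) \<Rightarrow> ('g \<Rightarrow> 'x \<Rightarrow> 'x) \<Rightarrow>
     'g \<Rightarrow> ('x \<Rightarrow> complex) \<Rightarrow> ('g \<times> 'x) op" where
  "reg_gen G X D \<theta> g f = Blinfun (\<lambda>\<xi>. Abs_ell2 (\<lambda>(k, x).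
     if k \<in> carrier G \<and> x \<in> D k \<and> x \<in> D (inv\<^bsub>G\<^esub> g \<otimes>\<^bsub>G\<^esub> k)
     then f (\<theta> k x) * coord \<xi> (inv\<^bsub>G\<^esub> g \<otimes>\<^bsub>G\<^esub> k, x) else 0))"

definition reduced_cp ::
    "'g monoid \<Rightarrow> 'x::topological_space set \<Rightarrow> ('g \<Rightarrow> 'x set) \<Rightarrow> ('g \<Rightarrow> 'x \<Rightarrow> 'x) \<Rightarrow>
     ('g \<times> 'x) op cstar" where
  "reduced_cp G X D \<theta> = bounded_ops
     \<lparr>carrier := cl bounded_ops (lin_span bounded_ops
        {reg_gen G X D \<theta> g f | g f. g \<in> carrier G \<and> f \<in> fibre G X D g}),
      one := reg_gen G X D \<theta> \<one>\<^bsub>G\<^esub> (\<lambda>x. of_bool (x \<in> X))\<rparr>"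

definition full_to_reduced ::
    "'g monoid \<Rightarrow> 'x::topological_space set \<Rightarrow> ('g \<Rightarrow> 'x set) \<Rightarrow> ('g \<Rightarrow> 'x \<Rightarrow> 'x) \<Rightarrow>
     (('g \<Rightarrow> ('x \<Rightarrow> complex) \<Rightarrow> 'i op) \<Rightarrow> 'i op) \<Rightarrow> ('g \<times> 'x) op" where
  "full_to_reduced G X D \<theta> = (THE \<Psi>. star_hom (full_cp G X D \<theta>) (reduced_cp G X D \<theta>) \<Psi> \<and>
     (\<forall>g\<in>carrier G. \<forall>f\<in>fibre G X D g. \<Psi> (full_gen G X D \<theta> g f) = reg_gen G X D \<theta> g f))"

section \<open>The partial action on the boundary and the boundary quotient\<close>

definition Omega_dom :: "'g monoid \<Rightarrow> 'g set \<Rightarrow> 'g \<Rightarrow> ('g set \<Rightarrow> bool) set" where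
  "Omega_dom G P g = {\<omega> \<in> Omega G P. \<exists>\<alpha>. is_word P \<alpha> \<and> wdot G \<alpha> = g \<and> \<omega> (K G P \<alpha>)}"

definition Omega_act :: "'g monoid \<Rightarrow> 'g set \<Rightarrow> 'g \<Rightarrow> ('g set \<Rightarrow> bool) \<Rightarrow> ('g set \<Rightarrow> bool)" where
  "Omega_act G P g \<omega> = (THE \<psi>. \<psi> \<in> Omega_dom G P (inv\<^bsub>G\<^esub> g) \<and>
     (\<forall>\<beta>. is_word P \<beta> \<and> wdot G \<beta> = inv\<^bsub>G\<^esub> g \<longrightarrow> \<psi> (K G P \<beta>) = \<omega> (K G P (rev \<beta>))))"

definition boundary_dom :: "'g monoid \<Rightarrow> 'g set \<Rightarrow> 'g \<Rightarrow> ('g set \<Rightarrow> bool) set" where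
  "boundary_dom G P g = Omega_dom G P g \<inter> boundary G P"

definition boundary_quotient :: "'g monoid \<Rightarrow> 'g set \<Rightarrow> ('g \<times> ('g set \<Rightarrow> bool)) op cstar" where
  "boundary_quotient G P =
     reduced_cp G (boundary G P) (boundary_dom G P) (Omega_act G P)"

definition G0 :: "'g monoid \<Rightarrow> 'g set \<Rightarrow> 'g set" where
  "G0 G P = {g \<in> carrier G. \<forall>S\<in>constructible G P. S \<noteq> {} \<longrightarrow>
     (g <#\<^bsub>G\<^esub> P) \<inter> S \<noteq> {} \<and> ((inv\<^bsub>G\<^esub> g) <#\<^bsub>G\<^esub> P) \<inter> S \<noteq> {}}"

section \<open>The covariance algebra\<close>

definition ind :: "'g set \<Rightarrow> 'g set \<Rightarrow> 'g \<Rightarrow> complex" where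
  "ind P S = (\<lambda>p\<in>P. of_bool (p \<in> S))"

definition D_r :: "'g monoid \<Rightarrow> 'g set \<Rightarrow> ('g \<Rightarrow> complex) cstar" where
  "D_r G P = (let B = bounded_families P complex_cstar
     in B\<lparr>carrier := cl B (lin_span B (ind P ` constructible G P))\<rparr>)"

definition Delta :: "'g monoid \<Rightarrow> 'g set \<Rightarrow> 'g set \<Rightarrow> 'g set" where
  "Delta G P F = {p \<in> P. \<forall>g\<in>F. (p <#\<^bsub>G\<^esub> P) \<inter> (g <#\<^bsub>G\<^esub> P) = {} \<or>
     (p <#\<^bsub>G\<^esub> P) \<inter> (g <#\<^bsub>G\<^esub> P) = p <#\<^bsub>G\<^esub> P}"

definition D_r_o :: "'g monoid \<Rightarrow> 'g set \<Rightarrow> ('g \<Rightarrow> complex) set" where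
  "D_r_o G P = {b \<in> carrier (D_r G P).
     ((\<lambda>F. Sup (insert 0 ((\<lambda>p. cmod (b p)) ` Delta G P F))) \<longlongrightarrow> 0)
       (finite_subsets_at_top (carrier G))}"

definition isometric_rep :: "'g monoid \<Rightarrow> 'g set \<Rightarrow> 'a cstar \<Rightarrow> ('g \<Rightarrow> 'a) \<Rightarrow> bool" where
  "isometric_rep G P A w \<longleftrightarrow> w \<in> P \<rightarrow>\<^sub>E carrier A \<and> w \<one>\<^bsub>G\<^esub> = \<one>\<^bsub>A\<^esub> \<and>
     (\<forall>p\<in>P. \<forall>q\<in>P. w (p \<otimes>\<^bsub>G\<^esub> q) = w p \<otimes>\<^bsub>A\<^esub> w q) \<and>
     (\<forall>p\<in>P. star A (w p) \<otimes>\<^bsub>A\<^esub> w p = \<one>\<^bsub>A\<^esub>)"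

fun rep_dot :: "'a cstar \<Rightarrow> ('g \<Rightarrow> 'a) \<Rightarrow> 'g list \<Rightarrow> 'a" where
  "rep_dot A w (p # q # \<alpha>) = star A (w p) \<otimes>\<^bsub>A\<^esub> w q \<otimes>\<^bsub>A\<^esub> rep_dot A w \<alpha>"
| "rep_dot A w _ = \<one>\<^bsub>A\<^esub>"

text \<open>For a neutral word the corresponding product of the left regular isometries and their
  adjoints is the operator of multiplication by the indicator function of \<open>K(\<alpha>)\<close>.\<close>

definition strongly_covariant :: "'g monoid \<Rightarrow> 'g set \<Rightarrow> 'a cstar \<Rightarrow> ('g \<Rightarrow> 'a) \<Rightarrow> bool" where
  "strongly_covariant G P A w \<longleftrightarrow> isometric_rep G P A w \<and>
     (\<exists>\<phi>. star_hom (D_r G P) A \<phi> \<and>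
       (\<forall>\<alpha>. is_word P \<alpha> \<and> wdot G \<alpha> = \<one>\<^bsub>G\<^esub> \<longrightarrow> \<phi> (ind P (K G P \<alpha>)) = rep_dot A w \<alpha>) \<and>
       (\<forall>b\<in>D_r_o G P. \<phi> b = \<zero>\<^bsub>A\<^esub>))"

text \<open>The universal algebra is generated by the direct sum of all strongly covariant
  representations on the Hilbert space of families indexed by \<open>'g \<times> nat\<close>. Every C*-algebra
  generated by isometries indexed by a subset of \<open>'g\<close> has a faithful unital representation there
  (unless it is zero), so this algebra has the universal property for strongly covariant
  representations in arbitrary C*-algebras. The same index type serves for the full crossed
  product of the action on the boundary, which is generated by elements indexed by a set of
  words over \<open>'g\<close>.\<close>

definition cov_reps :: "'g monoid \<Rightarrow> 'g set \<Rightarrow> ('g \<Rightarrow> ('g \<times> nat) op) set" where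
  "cov_reps G P = {w. strongly_covariant G P bounded_ops w}"

definition cov_gen ::
    "'g monoid \<Rightarrow> 'g set \<Rightarrow> 'g \<Rightarrow> (('g \<Rightarrow> ('g \<times> nat) op) \<Rightarrow> ('g \<times> nat) op)" where
  "cov_gen G P p = (\<lambda>w\<in>cov_reps G P. w p)"

definition covariance_algebra ::
    "'g monoid \<Rightarrow> 'g set \<Rightarrow> (('g \<Rightarrow> ('g \<times> nat) op) \<Rightarrow> ('g \<times> nat) op) cstar" where
  "covariance_algebra G P = (let B = bounded_families (cov_reps G P) bounded_ops
     in B\<lparr>carrier := cstar_gen B (cov_gen G P ` P)\<rparr>)"

type_synonym 'g full_boundary_elt =
  "('g \<Rightarrow> (('g set \<Rightarrow> bool) \<Rightarrow> complex) \<Rightarrow> ('g \<times> nat) op) \<Rightarrow> ('g \<times> nat) op"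

definition full_boundary_cp :: "'g monoid \<Rightarrow> 'g set \<Rightarrow> 'g full_boundary_elt cstar" where
  "full_boundary_cp G P = full_cp G (boundary G P) (boundary_dom G P) (Omega_act G P)"

text \<open>The function \<open>\<omega> \<mapsto> \<omega> (p P)\<close> is \<open>1\<^bsub>pP\<^esub>\<close> under the identification of \<open>D_r\<close> with the
  continuous functions on its spectrum, restricted to the boundary.\<close>

definition covariance_iso ::
    "'g monoid \<Rightarrow> 'g set \<Rightarrow> (('g \<Rightarrow> ('g \<times> nat) op) \<Rightarrow> ('g \<times> nat) op) \<Rightarrow> 'g full_boundary_elt" where
  "covariance_iso G P = (THE \<Phi>. star_iso (covariance_algebra G P) (full_boundary_cp G P) \<Phi> \<and>
     (\<forall>p\<in>P. \<Phi> (cov_gen G P p) =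
        full_gen G (boundary G P) (boundary_dom G P) (Omega_act G P) p
          (\<lambda>\<omega>. of_bool (\<omega> \<in> boundary G P \<and> \<omega> (p <#\<^bsub>G\<^esub> P)))))"

definition Lambda_boundary ::
    "'g monoid \<Rightarrow> 'g set \<Rightarrow> (('g \<Rightarrow> ('g \<times> nat) op) \<Rightarrow> ('g \<times> nat) op) \<Rightarrow>
     ('g \<times> ('g set \<Rightarrow> bool)) op" where
  "Lambda_boundary G P = compose (carrier (covariance_algebra G P))
     (full_to_reduced G (boundary G P) (boundary_dom G P) (Omega_act G P))
     (covariance_iso G P)"

end

theory Submission
  imports Defs
begin

text \<open>Membership in the boundary is a finitary condition: \<open>x\<close> lies in it iff for every finite set of
  constructible ideals the values of \<open>x\<close> are those forced on some principal ideal \<open>pP\<close>. This makes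
  the equivalence of the first four conditions combinatorial. Under the fourth one every element
  of the algebraic crossed product becomes a scalar multiple of the projection \<open>1\<^bsub>rP\<^esub>\<close> when
  compressed by it, for a suitable \<open>r\<close>; the scalar is the value of the conditional expectation
  onto the functions on the boundary at a prescribed point. Hence the expectation vanishes on
  proper ideals, and every nonzero hereditary subalgebra of the reduced crossed product contains a
  projection equivalent to some \<open>1\<^bsub>rP\<^esub>\<close>, which is infinite. If the fourth condition fails for
  \<open>p\<close> and \<open>t\<close>, these act equally on the boundary, so that the permutation representation on an
  orbit does not separate the isometries of \<open>p\<close> and \<open>t\<close>, whereas the regular representation does.\<close>

section \<open>Constructible right ideals\<close>

text \<open>The covariance algebra and the full crossed product are concrete direct sums of
  representations on families indexed by \<open>'g \<times> nat\<close>, and the maps between the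
  algebras are definite descriptions, so existence and uniqueness of each map must be proved. A
  strongly covariant representation need not factor through the reduced crossed product; only its
  part in a single degree \<open>g\<close> is controlled by the reduced norm. It is therefore
  extended degree by degree, each piece being the closure of a bounded linear relation. The regular
  representation is indexed by pairs that include boundary points, possibly too many for the
  prescribed Hilbert space; it is cut into slices over single points, and each slice, after passing
  to a multiple, becomes a representation on that space. The analysis rests on Banach's fixed point
  theorem: it yields inverses and square roots close to a projection, hence boundedness of
  homomorphisms with constant 2, inverse square roots in corners and domination in hereditary
  subalgebras.\<close>

locale group_submonoid = group G for G :: "'g monoid" (structure) +
  fixes P :: "'g set"
  assumes submonoid_P: "submonoid P G"
begin

abbreviation "J \<equiv> constructible G P"
abbreviation "X \<equiv> boundary G P"
abbreviation "act \<equiv> Omega_act G P"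

lemma P_carrier [simp]: "p \<in> P \<Longrightarrow> p \<in> carrier G"
  using submonoid_P by (rule submonoid.mem_carrier)

lemma P_sub: "P \<subseteq> carrier G"
  by auto

lemma P_mult [simp]: "p \<in> P \<Longrightarrow> q \<in> P \<Longrightarrow> p \<otimes> q \<in> P"
  using submonoid_P by (rule submonoid.m_closed)

lemma P_one [simp]: "\<one> \<in> P"
  using submonoid_P by (rule submonoid.one_closed)

lemma mem_lcoset_iff:
  assumes "g \<in> carrier G" "S \<subseteq> carrier G"
  shows "x \<in> g <# S \<longleftrightarrow> x \<in> carrier G \<and> inv g \<otimes> x \<in> S"
proof
  assume "x \<in> g <# S"
  then obtain s where s: "s \<in> S" "x = g \<otimes> s" by (auto simp: l_coset_def)
  then show "x \<in> carrier G \<and> inv g \<otimes> x \<in> S"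
    using assms by (auto simp: m_assoc[symmetric] subset_eq)
next
  assume x: "x \<in> carrier G \<and> inv g \<otimes> x \<in> S"
  then have "x = g \<otimes> (inv g \<otimes> x)"
    using assms by (simp add: m_assoc[symmetric])
  then show "x \<in> g <# S" using x by (auto simp: l_coset_def)
qed

lemma is_word_Nil [simp]: "is_word P []"
  and is_word_Cons2 [simp]: "is_word P (p # q # \<alpha>) \<longleftrightarrow> p \<in> P \<and> q \<in> P \<and> is_word P \<alpha>"
  and is_word_single [simp]: "\<not> is_word P [p]"
  by (auto simp: is_word_def)

lemma is_word_append [simp]: "is_word P \<alpha> \<Longrightarrow> is_word P \<beta> \<Longrightarrow> is_word P (\<alpha> @ \<beta>)"
  by (auto simp: is_word_def)

lemma is_word_rev [simp]: "is_word P (rev \<alpha>) = is_word P \<alpha>"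
  by (auto simp: is_word_def)

lemma word_induct [consumes 1, case_names Nil step]:
  assumes "is_word P \<alpha>" "Q []"
    "\<And>p q \<alpha>. p \<in> P \<Longrightarrow> q \<in> P \<Longrightarrow> is_word P \<alpha> \<Longrightarrow> Q \<alpha> \<Longrightarrow> Q (p # q # \<alpha>)"
  shows "Q \<alpha>"
  using assms(1) by (induct \<alpha> rule: induct_list012) (auto intro: assms)

lemma wdot_closed [simp]: "is_word P \<alpha> \<Longrightarrow> wdot G \<alpha> \<in> carrier G"
  by (induct \<alpha> rule: word_induct) auto

lemma wdot_append: "is_word P \<alpha> \<Longrightarrow> is_word P \<beta> \<Longrightarrow> wdot G (\<alpha> @ \<beta>) = wdot G \<alpha> \<otimes> wdot G \<beta>"
  by (induct \<alpha> rule: word_induct) (auto simp: m_assoc)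

lemma wdot_rev: "is_word P \<alpha> \<Longrightarrow> wdot G (rev \<alpha>) = inv (wdot G \<alpha>)"
  by (induct \<alpha> rule: word_induct) (auto simp: wdot_append inv_mult_group)

lemma K_sub_P: "is_word P \<alpha> \<Longrightarrow> K G P \<alpha> \<subseteq> P"
  by (induct \<alpha> rule: word_induct) auto

lemma K_step:
  assumes "p \<in> P" "q \<in> P" "is_word P \<alpha>"
  shows "x \<in> K G P (p # q # \<alpha>) \<longleftrightarrow> x \<in> K G P \<alpha> \<and> inv p \<otimes> q \<otimes> wdot G \<alpha> \<otimes> x \<in> P"
  using assms K_sub_P[of \<alpha>] by (auto simp: mem_lcoset_iff subset_eq)

text \<open>The even suffixes of \<open>\<alpha> @ \<beta>\<close> are those of
  \<open>\<beta>\<close> and the words \<open>\<gamma> @ \<beta>\<close> with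
  \<open>\<gamma>\<close> a suffix of \<open>\<alpha>\<close>. Since dots multiply, the latter
  impose on \<open>x\<close> the conditions that the suffixes of \<open>\<alpha>\<close> impose on
  \<open>wdot G \<beta> \<otimes> x\<close>.\<close>

lemma K_append:
  assumes "is_word P \<alpha>" "is_word P \<beta>"
  shows "x \<in> K G P (\<alpha> @ \<beta>) \<longleftrightarrow> x \<in> K G P \<beta> \<and> wdot G \<beta> \<otimes> x \<in> K G P \<alpha>"
  using assms
proof (induct \<alpha> rule: word_induct)
  case Nil
  have "x \<in> K G P \<beta> \<Longrightarrow> wdot G \<beta> \<otimes> x \<in> P" using Nil
    by (induct \<beta> rule: word_induct) (auto simp: K_step simp del: K.simps(1))
  then show ?case by auto
next
  case (step p q \<alpha>)
  have "x \<in> K G P \<beta> \<Longrightarrow> x \<in> carrier G" using K_sub_P[of \<beta>] step by auto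
  then show ?case using step by (auto simp: K_step wdot_append m_assoc simp del: K.simps(1))
qed

text \<open>Left multiplication by the dot of \<open>\<alpha>\<close> reverses the chain of partial
  products that must lie in \<open>P\<close>. In the induction the two letters removed from the
  front of \<open>\<alpha>\<close> are the last two of the reversed word, where
  \<open>K_append\<close> splits it.\<close>

lemma K_rev:
  assumes "is_word P \<alpha>" "x \<in> carrier G"
  shows "x \<in> K G P (rev \<alpha>) \<longleftrightarrow> inv (wdot G \<alpha>) \<otimes> x \<in> K G P \<alpha>"
  using assms
proof (induct \<alpha> arbitrary: x rule: word_induct)
  case Nil
  then show ?case by simp
next
  case (step p q \<alpha>)
  have K2: "x \<in> K G P [q, p] \<longleftrightarrow> x \<in> P \<and> inv q \<otimes> p \<otimes> x \<in> P" for x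
    using step(1,2) K_step[of q p "[]" x] by (auto simp del: K.simps(1))
  have inP: "z \<in> K G P \<alpha> \<Longrightarrow> wdot G \<alpha> \<otimes> z \<in> P" for z
    using K_append[of "[]" \<alpha> z] step by simp
  have w: "is_word P (rev \<alpha>)" "is_word P [q,p]" using step by auto
  let ?y = "inv q \<otimes> p \<otimes> x"
  let ?z = "inv (wdot G \<alpha>) \<otimes> ?y"
  have c: "?y \<in> carrier G" "?z \<in> carrier G" using step by auto
  have "x \<in> K G P (rev (p # q # \<alpha>)) \<longleftrightarrow> x \<in> P \<and> ?y \<in> P \<and> ?z \<in> K G P \<alpha>"
    using K_append[OF w, of x] step c by (simp add: K2 m_assoc del: K.simps(1))
  moreover have "wdot G \<alpha> \<otimes> ?z = ?y" using step c by (simp add: m_assoc[symmetric])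
  moreover have "inv (wdot G (p # q # \<alpha>)) \<otimes> x = ?z"
    using step by (simp add: inv_mult_group m_assoc)
  moreover have "inv p \<otimes> q \<otimes> wdot G \<alpha> \<otimes> ?z = x"
  proof -
    have "inv p \<otimes> q \<otimes> wdot G \<alpha> \<otimes> ?z = inv p \<otimes> q \<otimes> (wdot G \<alpha> \<otimes> ?z)"
      using step c by (simp add: m_assoc)
    also have "\<dots> = inv p \<otimes> q \<otimes> ?y" using \<open>wdot G \<alpha> \<otimes> ?z = ?y\<close> by simp
    also have "\<dots> = x" using step(1,2,5) by (simp add: m_assoc inv_solve_left' flip: m_assoc[of q "inv q"])
    finally show ?thesis .
  qed
  ultimately show ?case
    using step inP[of ?z] by (auto simp: K_step simp del: K.simps(1) wdot.simps)
qed

text \<open>The constructible ideals inside which left translation by \<open>g\<close> stays in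
  \<open>P\<close>; a point of the boundary lies in the domain of \<open>g\<close> iff it contains
  one of them. The family spares carrying the words along.\<close>

definition jd :: "'g \<Rightarrow> 'g set set" where
  "jd g = {K G P \<alpha> | \<alpha>. is_word P \<alpha> \<and> wdot G \<alpha> = g}"

lemma jdI: "is_word P \<alpha> \<Longrightarrow> wdot G \<alpha> = g \<Longrightarrow> K G P \<alpha> \<in> jd g"
  by (auto simp: jd_def)

lemma jd_carrier: "S \<in> jd g \<Longrightarrow> g \<in> carrier G"
  by (auto simp: jd_def)

lemma jd_J: "S \<in> jd g \<Longrightarrow> S \<in> J"
  by (auto simp: jd_def constructible_def)

lemma jd_mem: "S \<in> jd g \<Longrightarrow> p \<in> S \<Longrightarrow> p \<in> P \<and> g \<otimes> p \<in> P"
  using K_append[of "[]"] K_sub_P by (fastforce simp: jd_def)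

lemma J_sub: "S \<in> J \<Longrightarrow> S \<subseteq> P"
  using K_sub_P by (auto simp: constructible_def)

text \<open>The word \<open>rev \<beta> @ \<beta>\<close> is neutral and has the same ideal as
  \<open>\<beta>\<close>, so appending it intersects with this ideal without changing the
  dot.\<close>

lemma jd_Int:
  assumes "S \<in> jd g" "T \<in> J"
  shows "S \<inter> T \<in> jd g"
proof -
  obtain \<alpha> where a: "is_word P \<alpha>" "wdot G \<alpha> = g" "S = K G P \<alpha>" using assms by (auto simp: jd_def)
  obtain \<beta> where b: "is_word P \<beta>" "T = K G P \<beta>" using assms by (auto simp: constructible_def)
  have "x \<in> K G P (rev \<beta> @ \<beta>) \<longleftrightarrow> x \<in> K G P \<beta>" for x
    using b K_sub_P[of \<beta>] by (auto simp: K_append K_rev m_assoc[symmetric])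
  moreover have "wdot G (rev \<beta> @ \<beta>) = \<one>" using b by (simp add: wdot_append wdot_rev)
  ultimately have "K G P (\<alpha> @ (rev \<beta> @ \<beta>)) = S \<inter> T" "wdot G (\<alpha> @ (rev \<beta> @ \<beta>)) = g"
    using a b K_sub_P[of \<beta>] K_append[OF a(1), of "rev \<beta> @ \<beta>"] wdot_append[OF a(1), of "rev \<beta> @ \<beta>"] by auto
  then show ?thesis using jdI[of "\<alpha> @ (rev \<beta> @ \<beta>)" g] a b by (simp del: append_assoc)
qed

text \<open>Concatenating words composes the partial translations, by \<open>h\<close> and then by
  \<open>g\<close>.\<close>

lemma jd_comp:
  assumes "S \<in> jd h" "T \<in> jd g"
  shows "{p \<in> S. h \<otimes> p \<in> T} \<in> jd (g \<otimes> h)"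
proof -
  obtain \<alpha> where a: "is_word P \<alpha>" "wdot G \<alpha> = g" "T = K G P \<alpha>" using assms by (auto simp: jd_def)
  obtain \<beta> where b: "is_word P \<beta>" "wdot G \<beta> = h" "S = K G P \<beta>" using assms by (auto simp: jd_def)
  have "{p \<in> S. h \<otimes> p \<in> T} = K G P (\<alpha> @ \<beta>)" using a b by (auto simp: K_append)
  then show ?thesis using a b by (auto intro!: jdI simp: wdot_append)
qed

lemma lcoset_K:
  assumes "is_word P \<alpha>"
  shows "wdot G \<alpha> <# K G P \<alpha> = K G P (rev \<alpha>)"
  using assms K_sub_P[of \<alpha>] K_sub_P[of "rev \<alpha>"] by (auto simp: mem_lcoset_iff K_rev subset_eq)

lemma jd_inv: "S \<in> jd g \<Longrightarrow> g <# S \<in> jd (inv g)"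
proof -
  assume "S \<in> jd g"
  then obtain \<alpha> where a: "is_word P \<alpha>" "wdot G \<alpha> = g" "S = K G P \<alpha>" by (auto simp: jd_def)
  then show ?thesis using jdI[of "rev \<alpha>" "inv g"] lcoset_K[of \<alpha>] by (simp add: wdot_rev)
qed

lemma P_jd: "p \<in> P \<Longrightarrow> P \<in> jd p"
proof -
  assume p: "p \<in> P"
  have "x \<in> K G P [\<one>, p] \<longleftrightarrow> x \<in> P" for x
    using p K_step[of \<one> p "[]" x] by (auto simp del: K.simps(1))
  then have "K G P [\<one>, p] = P" by blast
  then show ?thesis using p jdI[of "[\<one>, p]" p] by simp
qed

lemma P_J [simp]: "P \<in> J"
  using P_jd[of \<one>] jd_J by auto

text \<open>Every constructible ideal comes from a neutral word, because it equals its intersection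
  with \<open>P\<close>, which is the ideal of a word with dot one.\<close>

lemma J_jd1: "S \<in> J \<Longrightarrow> S \<in> jd \<one>"
  using jd_Int[OF P_jd[of \<one>], of S] J_sub[of S] by (simp add: Int_absorb1)

lemma J_jd: "S \<in> J \<longleftrightarrow> S \<in> jd \<one>"
  using J_jd1 jd_J by blast

lemma J_Int [simp]: "S \<in> J \<Longrightarrow> T \<in> J \<Longrightarrow> S \<inter> T \<in> J"
  using jd_Int[of S \<one> T] by (simp add: J_jd)

lemma pr_jd: "p \<in> P \<Longrightarrow> p <# P \<in> jd (inv p)"
  using jd_inv[OF P_jd] .

lemma pr_J [simp]: "p \<in> P \<Longrightarrow> p <# P \<in> J"
  using pr_jd jd_J by blast

lemma pr_iff: "x \<in> g <# P \<longleftrightarrow> (\<exists>q\<in>P. x = g \<otimes> q)"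
  by (auto simp: l_coset_def)

lemma J_ideal:
  assumes "S \<in> J" "p \<in> S" "q \<in> P"
  shows "p \<otimes> q \<in> S"
proof -
  obtain \<alpha> where a: "is_word P \<alpha>" "S = K G P \<alpha>" using assms by (auto simp: constructible_def)
  show ?thesis using a(1) assms(2) unfolding a(2)
  proof (induct \<alpha> rule: word_induct)
    case Nil
    then show ?case using assms(3) by simp
  next
    case (step r s \<alpha>)
    then have "p \<in> carrier G" using K_sub_P[of \<alpha>] by (auto simp: K_step simp del: K.simps(1))
    then have "inv r \<otimes> s \<otimes> wdot G \<alpha> \<otimes> (p \<otimes> q) = inv r \<otimes> s \<otimes> wdot G \<alpha> \<otimes> p \<otimes> q"
      using step assms(3) by (simp add: m_assoc)
    then show ?case using step assms(3) by (simp add: K_step del: K.simps(1))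
  qed
qed

lemma pr_sub: "S \<in> J \<Longrightarrow> p \<in> S \<Longrightarrow> p <# P \<subseteq> S"
  by (auto simp: pr_iff J_ideal)

lemma pr_self [simp]: "p \<in> P \<Longrightarrow> p \<in> p <# P"
  by (auto simp: pr_iff intro: bexI[of _ \<one>])

lemma pr_P: "p \<in> P \<Longrightarrow> x \<in> p <# P \<Longrightarrow> x \<in> P"
  by (auto simp: pr_iff)

lemma pr_trans: "p \<in> P \<Longrightarrow> x \<in> p <# P \<Longrightarrow> x <# P \<subseteq> p <# P"
  by (rule pr_sub) auto

text \<open>Divide by \<open>a\<close>, which is possible on \<open>aP\<close>, then multiply by
  \<open>b\<close>, which is possible everywhere.\<close>

lemma pr_jd2: "a \<in> P \<Longrightarrow> b \<in> P \<Longrightarrow> a <# P \<in> jd (b \<otimes> inv a)"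
proof -
  assume a: "a \<in> P" "b \<in> P"
  have "{p \<in> a <# P. inv a \<otimes> p \<in> P} = a <# P" using a by (auto simp: pr_iff m_assoc[symmetric])
  then show ?thesis using jd_comp[OF pr_jd[OF a(1)] P_jd[OF a(2)]] by simp
qed

lemma pr_jdg: "a \<in> P \<Longrightarrow> g \<in> carrier G \<Longrightarrow> g \<otimes> a \<in> P \<Longrightarrow> a <# P \<in> jd g"
  using pr_jd2[of a "g \<otimes> a"] by (simp add: m_assoc)

section \<open>Characters in the boundary\<close>

text \<open>The element \<open>p\<close> forces the values of \<open>x\<close> on \<open>F\<close>: every character of the boundary that contains
  \<open>pP\<close> agrees with \<open>x\<close> there.\<close>

definition decides :: "'g \<Rightarrow> ('g set \<Rightarrow> bool) \<Rightarrow> 'g set set \<Rightarrow> bool" where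
  "decides p x F \<longleftrightarrow> p \<in> P \<and> (\<forall>S\<in>F. if x S then p \<in> S else (p <# P) \<inter> S = {})"

lemma decides_mono: "decides p x F \<Longrightarrow> F' \<subseteq> F \<Longrightarrow> decides p x F'"
  unfolding decides_def by blast

lemma decides_ext: "F \<subseteq> J \<Longrightarrow> decides p x F \<Longrightarrow> q \<in> p <# P \<Longrightarrow> decides q x F"
proof -
  assume F: "F \<subseteq> J" "decides p x F" "q \<in> p <# P"
  then have p: "p \<in> P" by (simp add: decides_def)
  have "if x S then q \<in> S else (q <# P) \<inter> S = {}" if "S \<in> F" for S
  proof (cases "x S")
    case True
    then show ?thesis using that F pr_sub[of S p] by (auto simp: decides_def)
  next
    case False
    then have "(p <# P) \<inter> S = {}" using that F by (auto simp: decides_def)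
    then show ?thesis using False pr_trans[OF p F(3)] by auto
  qed
  then show ?thesis using pr_P[OF p F(3)] by (auto simp: decides_def)
qed

definition maxchar :: "('g set \<Rightarrow> bool) set" where
  "maxchar = {\<omega> \<in> spectrum_J G P. \<forall>\<omega>'\<in>spectrum_J G P.
     {S. \<omega> S} \<subseteq> {S. \<omega>' S} \<longrightarrow> {S. \<omega>' S} = {S. \<omega> S}}"

lemma boundary_closure: "X = closure maxchar"
  by (simp add: boundary_def maxchar_def)

text \<open>Zorn's lemma for the characters containing \<open>pP\<close>, identified with their sets
  of members; the ideals containing \<open>p\<close> form one. A larger character still contains
  \<open>pP\<close>, so maximality among these is maximality among all characters.\<close>

lemma maxchar_exists:
  assumes p: "p \<in> P"
  shows "\<exists>x\<in>maxchar. x (p <# P)"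
proof -
  let ?A = "{Collect x | x. x \<in> spectrum_J G P \<and> x (p <# P)}"
  have "(\<lambda>S. S \<in> J \<and> p \<in> S) \<in> spectrum_J G P" using p by (auto simp: spectrum_J_def intro: exI[of _ P])
  then have ne: "?A \<noteq> {}" using p by auto
  have "\<exists>M\<in>?A. \<forall>Y\<in>?A. M \<subseteq> Y \<longrightarrow> Y = M"
  proof (rule subset_Zorn_nonempty[OF ne])
    fix C assume C: "C \<noteq> {}" "subset.chain ?A C"
    have CA: "\<And>F. F \<in> C \<Longrightarrow> (\<lambda>S. S \<in> F) \<in> spectrum_J G P \<and> p <# P \<in> F"
      using C(2) by (auto simp: subset.chain_def)
    have lin: "\<And>F F'. F \<in> C \<Longrightarrow> F' \<in> C \<Longrightarrow> F \<subseteq> F' \<or> F' \<subseteq> F"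
      using C(2) by (auto simp: subset.chain_def)
    have "(\<lambda>S. S \<in> \<Union>C) \<in> spectrum_J G P"
      unfolding spectrum_J_def mem_Collect_eq
    proof (intro conjI ballI allI impI)
      show "S \<in> J" if "S \<in> \<Union>C" for S using that CA by (auto simp: spectrum_J_def)
      show "\<exists>S. S \<in> \<Union>C" using C(1) CA by blast
      show "{} \<notin> \<Union>C" using CA by (auto simp: spectrum_J_def)
      fix R S assume RS: "R \<in> J" "S \<in> J"
      show "R \<inter> S \<in> \<Union>C \<longleftrightarrow> R \<in> \<Union>C \<and> S \<in> \<Union>C"
      proof
        assume "R \<inter> S \<in> \<Union>C"
        then show "R \<in> \<Union>C \<and> S \<in> \<Union>C" using CA RS by (auto simp: spectrum_J_def)
      next
        assume "R \<in> \<Union>C \<and> S \<in> \<Union>C"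
        then obtain F F' where F: "F \<in> C" "F' \<in> C" "R \<in> F" "S \<in> F'" by auto
        then obtain F'' where "F'' \<in> C" "R \<in> F''" "S \<in> F''" using lin by blast
        moreover have "R \<inter> S \<in> F''"
          using CA[OF \<open>F'' \<in> C\<close>] RS \<open>R \<in> F''\<close> \<open>S \<in> F''\<close> by (simp add: spectrum_J_def)
        ultimately show "R \<inter> S \<in> \<Union>C" by blast
      qed
    qed
    moreover have "p <# P \<in> \<Union>C" using C(1) CA by auto
    ultimately show "\<Union>C \<in> ?A" by (auto intro!: exI[of _ "\<lambda>S. S \<in> \<Union>C"])
  qed
  then obtain x where x: "x \<in> spectrum_J G P" "x (p <# P)"
    "\<And>y. y \<in> spectrum_J G P \<Longrightarrow> y (p <# P) \<Longrightarrow> Collect x \<subseteq> Collect y \<Longrightarrow> Collect y = Collect x"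
    by auto
  then have "x \<in> maxchar" by (auto simp: maxchar_def)
  then show ?thesis using x(2) by auto
qed

text \<open>Otherwise the constructible ideals that contain some \<open>T \<inter> S\<close> with
  \<open>T\<close> in \<open>x\<close> would form a character strictly larger than
  \<open>x\<close>.\<close>

lemma maxchar_disjoint:
  assumes x: "x \<in> maxchar" and S: "S \<in> J" "\<not> x S"
  shows "\<exists>T. x T \<and> T \<inter> S = {}"
proof (rule ccontr)
  assume no: "\<not> ?thesis"
  have xs: "x \<in> spectrum_J G P" using x by (auto simp: maxchar_def)
  then have xJ: "\<And>T. x T \<Longrightarrow> T \<in> J" and xI: "\<And>R S. R \<in> J \<Longrightarrow> S \<in> J \<Longrightarrow> x (R \<inter> S) \<longleftrightarrow> x R \<and> x S"
    and xne: "\<exists>T. x T" by (auto simp: spectrum_J_def)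
  define y where "y R \<longleftrightarrow> R \<in> J \<and> (\<exists>T. x T \<and> T \<inter> S \<subseteq> R)" for R
  have "y \<in> spectrum_J G P"
    unfolding spectrum_J_def mem_Collect_eq
  proof (intro conjI ballI allI impI)
    show "R \<in> J" if "y R" for R using that by (simp add: y_def)
    obtain T where "x T" using xne by auto
    then have "y S" using S unfolding y_def by blast
    then show "\<exists>R. y R" ..
    show "\<not> y {}" using no by (auto simp: y_def)
    fix R R' assume RR: "R \<in> J" "R' \<in> J"
    show "y (R \<inter> R') \<longleftrightarrow> y R \<and> y R'"
    proof
      assume "y R \<and> y R'"
      then obtain T T' where T: "x T" "x T'" "T \<inter> S \<subseteq> R" "T' \<inter> S \<subseteq> R'" by (auto simp: y_def)
      then have "x (T \<inter> T')" "T \<inter> T' \<inter> S \<subseteq> R \<inter> R'" using xI xJ by auto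
      then show "y (R \<inter> R')" using RR by (auto simp: y_def)
    qed (use RR in \<open>auto simp: y_def\<close>)
  qed
  moreover have "Collect x \<subseteq> Collect y" using xJ by (auto simp: y_def)
  moreover have "y S" using S xne unfolding y_def by blast
  ultimately show False using x S by (auto simp: maxchar_def)
qed

text \<open>By \<open>maxchar_disjoint\<close> each ideal of \<open>F\<close> outside
  \<open>x\<close> is disjoint from a member of \<open>x\<close>. Intersecting these members with
  the ideals of \<open>F\<close> in \<open>x\<close> gives a member of \<open>x\<close>, hence a
  nonempty set, and any of its points will do.\<close>

lemma maxchar_decides:
  assumes x: "x \<in> maxchar" and F: "finite F" "F \<subseteq> J"
  shows "\<exists>p. decides p x F"
proof -
  have xs: "x \<in> spectrum_J G P" using x by (auto simp: maxchar_def)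
  then have xJ: "\<And>T. x T \<Longrightarrow> T \<in> J" and xI: "\<And>R S. R \<in> J \<Longrightarrow> S \<in> J \<Longrightarrow> x (R \<inter> S) \<longleftrightarrow> x R \<and> x S"
    and xne: "\<exists>T. x T" and x0: "\<not> x {}" by (auto simp: spectrum_J_def)
  have "\<exists>T. x T \<and> (\<forall>S\<in>F. if x S then T \<subseteq> S else T \<inter> S = {})"
    using F
  proof (induct F)
    case empty
    then show ?case using xne by auto
  next
    case (insert S F)
    then obtain T where T: "x T" "\<forall>S\<in>F. if x S then T \<subseteq> S else T \<inter> S = {}" by auto
    obtain U where U: "x U" "if x S then U \<subseteq> S else U \<inter> S = {}"
      using maxchar_disjoint[OF x, of S] insert by (cases "x S") auto
    have "x (T \<inter> U)" using T U xI xJ by auto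
    moreover have "\<forall>R\<in>insert S F. if x R then T \<inter> U \<subseteq> R else T \<inter> U \<inter> R = {}"
      using T(2) U(2) by (auto split: if_splits)
    ultimately show ?case by blast
  qed
  then obtain T where T: "x T" "\<forall>S\<in>F. if x S then T \<subseteq> S else T \<inter> S = {}" by blast
  obtain p where p: "p \<in> T" using T x0 by (metis ex_in_conv)
  have "p <# P \<subseteq> T" using pr_sub p T xJ by auto
  moreover have "p \<in> P" using p T xJ J_sub by auto
  ultimately have "decides p x F" using T(2) p by (fastforce simp: decides_def)
  then show ?thesis ..
qed

text \<open>A basic neighbourhood constrains finitely many coordinates. In one direction a maximal
  character close to \<open>x\<close> supplies the deciding element; conversely, a maximal character
  containing \<open>pP\<close>, for \<open>p\<close> deciding the constrained coordinates, agrees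
  with \<open>x\<close> there.\<close>

lemma boundary_iff:
  "x \<in> X \<longleftrightarrow> (\<forall>S. x S \<longrightarrow> S \<in> J) \<and> (\<forall>F. finite F \<and> F \<subseteq> J \<longrightarrow> (\<exists>p. decides p x F))"
proof
  assume x: "x \<in> X"
  have nb: "\<exists>y\<in>maxchar. \<forall>S\<in>F. y S = x S" if F: "finite F" for F
  proof -
    let ?U = "\<Inter>S\<in>F. (\<lambda>y. y S) -` {x S}"
    have "open ((\<lambda>y. y S) -` {x S})" for S :: "'g set"
      by (rule open_vimage) (auto simp: open_discrete)
    then have "open ?U" using F by (intro open_INT) auto
    moreover have "x \<in> ?U" by auto
    ultimately have "?U \<inter> maxchar \<noteq> {}"
      using x open_Int_closure_eq_empty[of ?U maxchar] unfolding boundary_closure by blast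
    then show ?thesis by blast
  qed
  show "(\<forall>S. x S \<longrightarrow> S \<in> J) \<and> (\<forall>F. finite F \<and> F \<subseteq> J \<longrightarrow> (\<exists>p. decides p x F))"
  proof (intro conjI allI impI)
    fix S assume S: "x S"
    obtain y where y: "y \<in> maxchar" "\<forall>R\<in>{S}. y R = x R" using nb[of "{S}"] by blast
    then have "y \<in> spectrum_J G P" "y S" using S by (simp_all add: maxchar_def)
    then show "S \<in> J" by (simp add: spectrum_J_def)
  next
    fix F assume F: "finite F \<and> F \<subseteq> J"
    then obtain y where y: "y \<in> maxchar" "\<forall>S\<in>F. y S = x S" using nb by blast
    obtain p where "decides p y F" using maxchar_decides[OF y(1), of F] F by blast
    then have "decides p x F" using y(2) by (simp add: decides_def)
    then show "\<exists>p. decides p x F" ..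
  qed
next
  assume x: "(\<forall>S. x S \<longrightarrow> S \<in> J) \<and> (\<forall>F. finite F \<and> F \<subseteq> J \<longrightarrow> (\<exists>p. decides p x F))"
  have "U \<inter> maxchar \<noteq> {}" if U: "open U" "x \<in> U" for U
  proof -
    have "openin (product_topology (\<lambda>_. euclidean) UNIV) U"
      using U(1) by (simp only: euclidean_product_topology open_openin[symmetric])
    from product_topology_open_contains_basis[OF this U(2)]
    obtain Z where Z: "x \<in> Pi\<^sub>E UNIV Z" "finite {i. Z i \<noteq> topspace euclidean}" "Pi\<^sub>E UNIV Z \<subseteq> U"
      by blast
    then have Zf: "finite {i. Z i \<noteq> UNIV}" by simp
    let ?F = "{i. Z i \<noteq> UNIV}"
    have "finite (?F \<inter> J)" "?F \<inter> J \<subseteq> J" using Zf by auto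
    from x[THEN conjunct2, rule_format, OF conjI, OF this]
    obtain p where p: "decides p x (?F \<inter> J)" ..
    then have pP: "p \<in> P" unfolding decides_def by (rule conjunct1)
    obtain y where y: "y \<in> maxchar" "y (p <# P)" using maxchar_exists[OF pP] by blast
    have ys: "y \<in> spectrum_J G P" using y(1) by (simp add: maxchar_def)
    have "y S = x S" if S: "S \<in> ?F" for S
    proof (cases "S \<in> J")
      case False
      then show ?thesis using x ys by (auto simp: spectrum_J_def)
    next
      case True
      have yI: "y ((p <# P) \<inter> S) \<longleftrightarrow> y S" using ys y pP True by (auto simp: spectrum_J_def)
      show ?thesis
      proof (cases "x S")
        case True
        then have "p <# P \<subseteq> S" using p S \<open>S \<in> J\<close> pr_sub by (auto simp: decides_def)
        then have "(p <# P) \<inter> S = p <# P" by auto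
        then show ?thesis using yI y True by auto
      next
        case False
        then have "(p <# P) \<inter> S = {}" using p S \<open>S \<in> J\<close> by (auto simp: decides_def)
        then show ?thesis using yI ys False by (auto simp: spectrum_J_def)
      qed
    qed
    then have "y i \<in> Z i" for i using Z(1) by (cases "Z i = UNIV") (auto simp: PiE_iff)
    then have "y \<in> Pi\<^sub>E UNIV Z" by (simp add: PiE_iff)
    then show ?thesis using y(1) Z(3) by blast
  qed
  note meets = this
  show "x \<in> X"
  proof (rule ccontr)
    assume "x \<notin> X"
    then have "(- closure maxchar) \<inter> maxchar \<noteq> {}"
      by (intro meets) (auto simp: boundary_closure)
    then show False using closure_subset[of maxchar] by blast
  qed
qed

end

section \<open>Elementary properties of boundary points\<close>

context group_submonoid begin

lemma X_J: "x \<in> X \<Longrightarrow> x S \<Longrightarrow> S \<in> J"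
  unfolding boundary_iff by blast

lemma X_decides: "x \<in> X \<Longrightarrow> finite F \<Longrightarrow> F \<subseteq> J \<Longrightarrow> \<exists>p. decides p x F"
  unfolding boundary_iff by blast

lemma X_exists: "p \<in> P \<Longrightarrow> \<exists>x\<in>X. x (p <# P)"
  using maxchar_exists[of p] closure_subset[of maxchar] unfolding boundary_closure by blast

lemma X_Int:
  assumes "x \<in> X" "S \<in> J" "T \<in> J"
  shows "x (S \<inter> T) \<longleftrightarrow> x S \<and> x T"
proof -
  have 1: "finite {S, T, S \<inter> T}" "{S, T, S \<inter> T} \<subseteq> J" using assms by auto
  obtain p where p: "p \<in> P" "\<forall>R\<in>{S, T, S \<inter> T}. if x R then p \<in> R else (p <# P) \<inter> R = {}"
    using X_decides[OF assms(1) 1] by (auto simp: decides_def)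
  have "p \<in> p <# P" using p by simp
  then show ?thesis using p(2) by (auto split: if_splits)
qed

lemma X_empty: "x \<in> X \<Longrightarrow> \<not> x {}"
proof
  assume x: "x \<in> X" "x {}"
  have "{{} :: 'g set} \<subseteq> J" using X_J[OF x] by simp
  from X_decides[OF x(1) _ this] obtain p where "decides p x {{}}" by auto
  then show False using x(2) by (simp add: decides_def)
qed

lemma X_mono: "x \<in> X \<Longrightarrow> x S \<Longrightarrow> S \<subseteq> T \<Longrightarrow> T \<in> J \<Longrightarrow> x T"
  using X_Int[of x S T] X_J[of x S] by (metis inf.absorb1)

lemma X_disjoint: "x \<in> X \<Longrightarrow> x S \<Longrightarrow> x T \<Longrightarrow> S \<inter> T \<noteq> {}"
  using X_Int[of x S T] X_J[of x S] X_J[of x T] X_empty[of x] by metis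

lemma X_P: "x \<in> X \<Longrightarrow> x P"
proof -
  assume x: "x \<in> X"
  obtain p where "decides p x {P}" using X_decides[OF x, of "{P}"] by auto
  then have "p \<in> P" "if x P then p \<in> P else (p <# P) \<inter> P = {}" by (auto simp: decides_def)
  then show ?thesis using pr_self[of p] by (meson disjoint_iff)
qed

lemma X_eqI: "x \<in> X \<Longrightarrow> y \<in> X \<Longrightarrow> (\<And>S. S \<in> J \<Longrightarrow> x S = y S) \<Longrightarrow> x = y"
proof (rule ext)
  fix S assume "x \<in> X" "y \<in> X" "\<And>S. S \<in> J \<Longrightarrow> x S = y S"
  then show "x S = y S" using X_J[of x S] X_J[of y S] by (cases "S \<in> J") auto
qed

lemma decides_agree:
  assumes "decides p x F" "F \<subseteq> J" "y \<in> X" "y (p <# P)" "S \<in> F"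
  shows "y S = x S"
proof (cases "x S")
  case True
  then have "p <# P \<subseteq> S" using assms pr_sub[of S p] by (auto simp: decides_def)
  then show ?thesis using X_mono[OF assms(3,4), of S] assms(2,5) True by blast
next
  case False
  then have "(p <# P) \<inter> S = {}" using assms by (auto simp: decides_def)
  then show ?thesis using X_disjoint[OF assms(3,4), of S] False by blast
qed

text \<open>An element deciding \<open>S\<close> and its finitely many pieces lies in
  \<open>S\<close>, hence in one of the pieces, which is then in \<open>x\<close>.\<close>

lemma X_Omega: "X \<subseteq> Omega G P"
proof (rule subsetI)
  fix x assume x: "x \<in> X"
  have "x \<in> spectrum_J G P"
    unfolding spectrum_J_def mem_Collect_eq
  proof (intro conjI ballI allI impI)
    show "\<exists>S. x S" using X_P[OF x] ..
  qed (use X_J[OF x] X_empty[OF x] X_Int[OF x] in simp_all)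
  moreover have "\<exists>T\<in>\<S>. x T" if S: "S \<in> J" "finite \<S>" "\<S> \<subseteq> J" "S = \<Union>\<S>" "x S" for S \<S>
  proof -
    have "finite (insert S \<S>)" "insert S \<S> \<subseteq> J" using S by simp_all
    then obtain p where p: "decides p x (insert S \<S>)" using X_decides[OF x] by blast
    have "p \<in> S" "p \<in> p <# P" using p \<open>x S\<close> by (auto simp: decides_def)
    then obtain T where T: "T \<in> \<S>" "p \<in> T" using S(4) by auto
    have "if x T then p \<in> T else (p <# P) \<inter> T = {}" using p T(1) by (simp add: decides_def)
    then have "x T" using T(2) \<open>p \<in> p <# P\<close> by (meson disjoint_iff)
    then show ?thesis using T by blast
  qed
  ultimately show "x \<in> Omega G P" by (auto simp: Omega_def)
qed

text \<open>Coordinates outside \<open>J\<close> are false at every point of the boundary, so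
  members of \<open>J\<close> suffice to describe a neighbourhood.\<close>

lemma basic_nbhd:
  assumes "x \<in> X" "open U" "x \<in> U"
  shows "\<exists>F. finite F \<and> F \<subseteq> J \<and> (\<forall>y\<in>X. (\<forall>S\<in>F. y S = x S) \<longrightarrow> y \<in> U)"
proof -
  have "openin (product_topology (\<lambda>_. euclidean) UNIV) U"
    using assms(2) by (simp only: euclidean_product_topology open_openin[symmetric])
  from product_topology_open_contains_basis[OF this assms(3)]
  obtain Z where Z: "x \<in> Pi\<^sub>E UNIV Z" "finite {i. Z i \<noteq> topspace euclidean}" "Pi\<^sub>E UNIV Z \<subseteq> U"
    by blast
  have "y \<in> U" if y: "y \<in> X" "\<forall>S\<in>{i. Z i \<noteq> UNIV} \<inter> J. y S = x S" for y
  proof -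
    have "y S \<in> Z S" for S
    proof (cases "Z S = UNIV")
      case False
      have "y S = x S" using y False X_J[OF y(1)] X_J[OF assms(1)] by (cases "S \<in> J") auto
      then show ?thesis using Z(1) by (simp add: PiE_iff)
    qed simp
    then have "y \<in> Pi\<^sub>E UNIV Z" by (simp add: PiE_iff)
    then show ?thesis using Z(3) by blast
  qed
  moreover have "finite ({i. Z i \<noteq> UNIV} \<inter> J)" using Z(2) by simp
  ultimately show ?thesis by (intro exI[of _ "{i. Z i \<noteq> UNIV} \<inter> J"]) auto
qed

lemma open_cylinder: "open {x. x S = (b :: bool)}" for S :: "'b set"
proof -
  have "open ((\<lambda>y :: 'b set \<Rightarrow> bool. y S) -` {b})"
    by (rule open_vimage) (auto simp: open_discrete)
  then show ?thesis by (simp add: vimage_def)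
qed

section \<open>The partial action on the boundary\<close>

abbreviation "bd \<equiv> boundary_dom G P"

lemma bd_iff: "x \<in> bd g \<longleftrightarrow> x \<in> X \<and> (\<exists>S\<in>jd g. x S)"
  using X_Omega by (auto simp: boundary_dom_def Omega_dom_def jd_def)

lemma bd_X: "x \<in> bd g \<Longrightarrow> x \<in> X"
  by (simp add: bd_iff)

lemma pullback_jd: "S \<in> jd g \<Longrightarrow> T \<in> J \<Longrightarrow> {p \<in> S. g \<otimes> p \<in> T} \<in> jd g"
  using jd_comp[of S g T \<one>] by (simp add: J_jd jd_carrier)

text \<open>If \<open>p\<close> decides the pulled back ideals for \<open>x\<close>, then
  \<open>g \<otimes> p\<close> decides the ideals themselves for the transported character, which
  therefore lies in the boundary. The definite description prescribes values on
  \<open>jd (inv g)\<close> only; but some \<open>K G P \<beta>\<close> of this family is in the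
  character, and its intersection with any \<open>T\<close> is in the family again, which fixes the
  value at \<open>T\<close>.\<close>

lemma act_eq:
  assumes x: "x \<in> X" and S: "S \<in> jd g" "x S"
  shows "act g x = (\<lambda>T. T \<in> J \<and> x {p \<in> S. g \<otimes> p \<in> T})" (is "_ = ?y")
    and act_mem_X: "(\<lambda>T. T \<in> J \<and> x {p \<in> S. g \<otimes> p \<in> T}) \<in> X"
proof -
  have g: "g \<in> carrier G" using S jd_carrier by auto
  have SP: "\<And>p. p \<in> S \<Longrightarrow> p \<in> carrier G" using jd_mem[OF S(1)] by auto
  show y: "?y \<in> X"
    unfolding boundary_iff
  proof (intro conjI allI impI)
    fix F assume F: "finite F \<and> F \<subseteq> J"
    let ?F = "insert S ((\<lambda>T. {p \<in> S. g \<otimes> p \<in> T}) ` F)"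
    have "{p \<in> S. g \<otimes> p \<in> T} \<in> J" if "T \<in> F" for T
      using pullback_jd[OF S(1)] jd_J F that by blast
    then have "finite ?F" "?F \<subseteq> J" using F jd_J[OF S(1)] by auto
    then obtain p where p: "decides p x ?F" using X_decides[OF x] by blast
    then have pS: "p \<in> S" and pP: "p \<in> P" using S by (auto simp: decides_def)
    have gp: "g \<otimes> p \<in> P" using jd_mem[OF S(1) pS] by simp
    have "if ?y T then g \<otimes> p \<in> T else (g \<otimes> p <# P) \<inter> T = {}" if T: "T \<in> F" for T
    proof (cases "x {p \<in> S. g \<otimes> p \<in> T}")
      case True
      then have "p \<in> {p \<in> S. g \<otimes> p \<in> T}" using p T by (auto simp: decides_def)
      then show ?thesis using True T F by auto
    next
      case False
      then have e: "(p <# P) \<inter> {p \<in> S. g \<otimes> p \<in> T} = {}" using p T by (auto simp: decides_def)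
      have "g \<otimes> p \<otimes> q \<notin> T" if "q \<in> P" for q
      proof
        assume "g \<otimes> p \<otimes> q \<in> T"
        then have "p \<otimes> q \<in> {p \<in> S. g \<otimes> p \<in> T}"
          using J_ideal[OF jd_J[OF S(1)] pS that] g pP that by (simp add: m_assoc)
        moreover have "p \<otimes> q \<in> p <# P" using that by (auto simp: pr_iff)
        ultimately show False using e by blast
      qed
      then show ?thesis using False by (auto simp: pr_iff)
    qed
    then have "decides (g \<otimes> p) ?y F" using gp by (simp add: decides_def)
    then show "\<exists>p. decides p ?y F" ..
  qed simp
  have e: "{p \<in> S. g \<otimes> p \<in> g <# S} = S" by (auto simp: l_coset_def)
  have rel: "?y (K G P \<beta>) = x (K G P (rev \<beta>))" if b: "is_word P \<beta>" "wdot G \<beta> = inv g" for \<beta>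
  proof -
    have "{p \<in> S. g \<otimes> p \<in> K G P \<beta>} = S \<inter> K G P (rev \<beta>)"
      using b g SP by (auto simp: K_rev)
    moreover have "K G P \<beta> \<in> J" "K G P (rev \<beta>) \<in> J" using b by (auto simp: constructible_def) 
    ultimately show ?thesis using X_Int[OF x jd_J[OF S(1)]] S(2) by auto
  qed
  show "act g x = ?y"
    unfolding Omega_act_def
  proof (rule the_equality)
    have "?y (g <# S)" using S(2) jd_J[OF jd_inv[OF S(1)]] by (simp add: e)
    then have "?y \<in> bd (inv g)" using y jd_inv[OF S(1)] unfolding bd_iff by blast
    then show "?y \<in> Omega_dom G P (inv g) \<and>
      (\<forall>\<beta>. is_word P \<beta> \<and> wdot G \<beta> = inv g \<longrightarrow> ?y (K G P \<beta>) = x (K G P (rev \<beta>)))"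
      using rel by (auto simp: boundary_dom_def)
  next
    fix z assume z: "z \<in> Omega_dom G P (inv g) \<and>
      (\<forall>\<beta>. is_word P \<beta> \<and> wdot G \<beta> = inv g \<longrightarrow> z (K G P \<beta>) = x (K G P (rev \<beta>)))"
    then obtain \<beta> where b: "is_word P \<beta>" "wdot G \<beta> = inv g" "z (K G P \<beta>)" by (auto simp: Omega_dom_def)
    have zs: "z \<in> spectrum_J G P" using z by (simp add: Omega_dom_def Omega_def)
    have yb: "?y (K G P \<beta>)" using rel[OF b(1,2)] z b by blast
    have bJ: "K G P \<beta> \<in> J" using b by (auto simp: constructible_def)
    show "z = ?y"
    proof
      fix T
      show "z T = ?y T"
      proof (cases "T \<in> J")
        case True
        have "K G P \<beta> \<inter> T \<in> jd (inv g)" using jd_Int[OF jdI[OF b(1,2)] True] .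
        then obtain \<gamma> where c: "is_word P \<gamma>" "wdot G \<gamma> = inv g" "K G P \<beta> \<inter> T = K G P \<gamma>"
          by (auto simp: jd_def)
        have "z T = z (K G P \<gamma>)" using zs b(3) bJ True by (simp add: spectrum_J_def flip: c(3))
        also have "\<dots> = ?y (K G P \<gamma>)" using rel[OF c(1,2)] z c by blast
        also have "\<dots> = ?y T" using X_Int[OF y bJ True] yb unfolding c(3)[symmetric] by blast
        finally show ?thesis .
      next
        case False
        then show ?thesis using zs by (auto simp: spectrum_J_def)
      qed
    qed
  qed
qed

lemma act_iff: "x \<in> X \<Longrightarrow> S \<in> jd g \<Longrightarrow> x S \<Longrightarrow> T \<in> J \<Longrightarrow> act g x T \<longleftrightarrow> x {p \<in> S. g \<otimes> p \<in> T}"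
  using act_eq[of x S g] by simp

lemma act_X: "x \<in> bd g \<Longrightarrow> act g x \<in> X"
  using act_eq act_mem_X by (auto simp: bd_iff)

lemma act_bd:
  assumes "x \<in> bd g"
  shows "act g x \<in> bd (inv g)"
proof -
  obtain S where S: "x \<in> X" "S \<in> jd g" "x S" using assms by (auto simp: bd_iff)
  have e: "{p \<in> S. g \<otimes> p \<in> g <# S} = S" by (auto simp: l_coset_def)
  have "act g x (g <# S)" using act_iff[OF S jd_J[OF jd_inv[OF S(2)]]] S(3) by (simp add: e)
  then show ?thesis using act_X[OF assms] jd_inv[OF S(2)] unfolding bd_iff by blast
qed

lemma X_bd_one: "x \<in> X \<Longrightarrow> x \<in> bd \<one>"
  using P_jd[of \<one>] X_P by (auto simp: bd_iff)

lemma act_one: "x \<in> X \<Longrightarrow> act \<one> x = x"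
proof (rule X_eqI)
  assume x: "x \<in> X"
  then show "act \<one> x \<in> X" using act_X X_bd_one by blast
  fix T assume T: "T \<in> J"
  then have "{p \<in> P. \<one> \<otimes> p \<in> T} = T" using J_sub[OF T] P_sub by (auto simp: subset_eq)
  then show "act \<one> x T = x T" using act_iff[OF x P_jd[OF P_one] X_P[OF x] T] by simp
qed

lemma act_comp:
  assumes "x \<in> bd h" "act h x \<in> bd g"
  shows "x \<in> bd (g \<otimes> h)" "act (g \<otimes> h) x = act g (act h x)"
proof -
  obtain S where S: "x \<in> X" "S \<in> jd h" "x S" using assms by (auto simp: bd_iff)
  obtain T where T: "act h x \<in> X" "T \<in> jd g" "act h x T" using assms by (auto simp: bd_iff)
  let ?R = "{p \<in> S. h \<otimes> p \<in> T}"
  have c: "g \<in> carrier G" "h \<in> carrier G" using S T jd_carrier by auto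
  have R: "?R \<in> jd (g \<otimes> h)" using jd_comp[OF S(2) T(2)] .
  have xR: "x ?R" using act_iff[OF S jd_J[OF T(2)]] T(3) by simp
  then show b: "x \<in> bd (g \<otimes> h)" using S(1) R unfolding bd_iff by blast
  show "act (g \<otimes> h) x = act g (act h x)"
  proof (rule X_eqI)
    show "act (g \<otimes> h) x \<in> X" using act_X[OF b] .
    show "act g (act h x) \<in> X" using act_X[OF assms(2)] .
    fix U assume U: "U \<in> J"
    have "{p \<in> ?R. g \<otimes> h \<otimes> p \<in> U} = {p \<in> S. h \<otimes> p \<in> {p \<in> T. g \<otimes> p \<in> U}}"
      using c jd_mem[OF S(2)] by (auto simp: m_assoc)
    then show "act (g \<otimes> h) x U = act g (act h x) U"
      using act_iff[OF S(1) R xR U] act_iff[OF T U] act_iff[OF S jd_J[OF pullback_jd[OF T(2) U]]] by simp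
  qed
qed

lemma act_inv:
  assumes "x \<in> bd g"
  shows "act (inv g) (act g x) = x"
proof -
  have "g \<in> carrier G" using assms jd_carrier by (auto simp: bd_iff)
  then show ?thesis using act_comp(2)[OF assms act_bd[OF assms]] act_one[OF bd_X[OF assms]] by simp
qed

lemma bd_P: "p \<in> P \<Longrightarrow> x \<in> X \<Longrightarrow> x \<in> bd p"
  using P_jd[of p] X_P by (auto simp: bd_iff)

lemma act_P: "p \<in> P \<Longrightarrow> x \<in> X \<Longrightarrow> T \<in> J \<Longrightarrow> act p x T \<longleftrightarrow> x {q \<in> P. p \<otimes> q \<in> T}"
  using act_iff[of x P p T] P_jd[of p] X_P[of x] by blast

lemma bd_inv_P: "p \<in> P \<Longrightarrow> x \<in> bd (inv p) \<longleftrightarrow> x \<in> X \<and> x (p <# P)"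
proof
  assume p: "p \<in> P" and "x \<in> bd (inv p)"
  then obtain S where S: "x \<in> X" "S \<in> jd (inv p)" "x S" by (auto simp: bd_iff)
  have "S \<subseteq> p <# P" using jd_mem[OF S(2)] p by (auto simp: mem_lcoset_iff P_sub)
  then show "x \<in> X \<and> x (p <# P)" using X_mono[OF S(1,3)] p S(1) by auto
next
  assume "p \<in> P" "x \<in> X \<and> x (p <# P)"
  then show "x \<in> bd (inv p)" using pr_jd[of p] by (auto simp: bd_iff)
qed

section \<open>Topological freeness\<close>

definition cond3 :: bool where
  "cond3 \<longleftrightarrow> (\<forall>g\<in>G0 G P. g \<noteq> \<one> \<longrightarrow> (\<forall>p\<in>P. \<exists>q \<in> p <# P. (q <# P) \<inter> ((g \<otimes> q) <# P) = {}))"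

definition cond4 :: bool where
  "cond4 \<longleftrightarrow> (\<forall>p\<in>P. \<forall>t\<in>P. p \<noteq> t \<longrightarrow> (\<exists>s\<in>P. ((p \<otimes> s) <# P) \<inter> ((t \<otimes> s) <# P) = {}))"

abbreviation "top_free H \<equiv> topologically_free G H X bd act"

lemma top_free_mono: "H \<subseteq> H' \<Longrightarrow> top_free H' \<Longrightarrow> top_free H"
  unfolding topologically_free_def by blast

lemma G0_carrier: "G0 G P \<subseteq> carrier G"
  by (auto simp: G0_def)

text \<open>The points of the domain of \<open>g\<close> that contain \<open>pP\<close> form a
  nonempty open set, so one of them, \<open>x\<close>, is moved, and some \<open>T\<close> separates
  it from its image. If \<open>q\<close> decides \<open>pP\<close>, \<open>S\<close>,
  \<open>T\<close> and the pullback of \<open>T\<close>, then one of \<open>qP\<close> and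
  \<open>gqP\<close> is inside \<open>T\<close> and the other is disjoint from
  \<open>T\<close>.\<close>

lemma top_free_cond3:
  assumes "top_free (G0 G P)"
  shows cond3
  unfolding cond3_def
proof (intro ballI impI)
  fix g p assume g: "g \<in> G0 G P" "g \<noteq> \<one>" and p: "p \<in> P"
  have gc: "g \<in> carrier G" using g by (simp add: G0_def)
  let ?W = "{x \<in> X. x (p <# P) \<and> x \<in> bd g}"
  have "?W = X \<inter> (\<Union>S\<in>jd g. {x. x (p <# P) = True} \<inter> {x. x S = True})"
    by (auto simp: bd_iff)
  moreover have "open (\<Union>S\<in>jd g. {x. x (p <# P) = True} \<inter> {x. x S = True})"
    by (intro open_UN ballI open_Int open_cylinder)
  ultimately have W: "openin (top_of_set X) ?W" using openin_open by blast
  \<comment> \<open>Membership in \<open>G0\<close> makes the open set nonempty: it yields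
    \<open>p \<otimes> a\<close> in \<open>pP\<close> whose translate by \<open>g\<close> is in
    \<open>P\<close>.\<close>
  have "(inv g <# P) \<inter> (p <# P) \<noteq> {}" using g p pr_J[OF p] pr_self[OF p] unfolding G0_def by blast
  then obtain a b where ab: "a \<in> P" "b \<in> P" "inv g \<otimes> b = p \<otimes> a" by (auto simp: l_coset_def)
  have "g \<otimes> (inv g \<otimes> b) = b" using gc ab(2) by (simp add: m_assoc[symmetric])
  then have "g \<otimes> (p \<otimes> a) = b" by (simp only: ab(3))
  then have jg: "(p \<otimes> a) <# P \<in> jd g" using pr_jdg[of "p \<otimes> a" g] ab p gc by simp
  obtain x0 where x0: "x0 \<in> X" "x0 ((p \<otimes> a) <# P)" using X_exists[of "p \<otimes> a"] p ab by auto
  have "x0 (p <# P)" using X_mono[OF x0 pr_trans[OF p]] ab p by (auto simp: pr_iff)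
  then have "x0 \<in> ?W" using x0 jg by (auto simp: bd_iff)
  moreover have "top_of_set X interior_of {x \<in> bd g. act g x = x} = {}"
    using assms g by (simp add: topologically_free_def)
  ultimately have "\<not> ?W \<subseteq> {x \<in> bd g. act g x = x}"
    using interior_of_maximal[OF _ W] by blast
  then obtain x where x: "x \<in> X" "x (p <# P)" "x \<in> bd g" "act g x \<noteq> x" by auto
  obtain S where S: "S \<in> jd g" "x S" using x by (auto simp: bd_iff)
  obtain T where T: "T \<in> J" "act g x T \<noteq> x T" using X_eqI[OF act_X[OF x(3)] x(1)] x(4) by blast
  let ?T = "{q \<in> S. g \<otimes> q \<in> T}"
  have aT: "act g x T = x ?T" using act_iff[OF x(1) S T(1)] .
  have TJ: "?T \<in> J" using pullback_jd[OF S(1) T(1)] jd_J by blast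
  have gm: "\<And>q r. q \<in> S \<Longrightarrow> r \<in> P \<Longrightarrow> g \<otimes> q \<otimes> r = g \<otimes> (q \<otimes> r) \<and> q \<otimes> r \<in> S"
    using gc jd_mem[OF S(1)] J_ideal[OF jd_J[OF S(1)]] by (simp add: m_assoc)
  have "finite {p <# P, S, T, ?T}" "{p <# P, S, T, ?T} \<subseteq> J" using S T TJ p jd_J by auto
  then obtain q where q: "decides q x {p <# P, S, T, ?T}" using X_decides[OF x(1)] by blast
  then have qp: "q \<in> P" "q \<in> p <# P" "q \<in> S" using x S by (auto simp: decides_def)
  have "(q <# P) \<inter> ((g \<otimes> q) <# P) = {}"
  proof (cases "x T")
    case True
    then have "q \<in> T" "(q <# P) \<inter> ?T = {}" using q T aT by (auto simp: decides_def)
    have "g \<otimes> q \<otimes> r \<notin> q <# P" if r: "r \<in> P" for r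
    proof
      assume "g \<otimes> q \<otimes> r \<in> q <# P"
      then have "q \<otimes> r \<in> ?T" using pr_sub[OF T(1) \<open>q \<in> T\<close>] gm[OF qp(3) r] by auto
      moreover have "q \<otimes> r \<in> q <# P" using r unfolding pr_iff by blast
      ultimately show False using \<open>(q <# P) \<inter> ?T = {}\<close> by blast
    qed
    moreover have "\<exists>r\<in>P. z = g \<otimes> q \<otimes> r" if "z \<in> (g \<otimes> q) <# P" for z
      using that unfolding pr_iff .
    ultimately show ?thesis by blast
  next
    case False
    then have "q \<in> ?T" "(q <# P) \<inter> T = {}" using q T aT by (auto simp: decides_def)
    moreover have "(g \<otimes> q) <# P \<subseteq> T" using \<open>q \<in> ?T\<close> pr_sub[OF T(1)] by blast
    ultimately show ?thesis by blast
  qed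
  then show "\<exists>q \<in> p <# P. (q <# P) \<inter> ((g \<otimes> q) <# P) = {}" using qp by blast
qed

lemma lcoset_translate:
  assumes "g \<in> carrier G" "a \<in> carrier G" "b \<in> carrier G"
  shows "((g \<otimes> a) <# P) \<inter> ((g \<otimes> b) <# P) = {} \<longleftrightarrow> (a <# P) \<inter> (b <# P) = {}"
proof -
  have "(\<exists>p\<in>P. \<exists>q\<in>P. g \<otimes> a \<otimes> p = g \<otimes> b \<otimes> q) \<longleftrightarrow> (\<exists>p\<in>P. \<exists>q\<in>P. a \<otimes> p = b \<otimes> q)"
    using assms by (simp add: m_assoc)
  moreover have "(x <# P) \<inter> (y <# P) = {} \<longleftrightarrow> \<not> (\<exists>p\<in>P. \<exists>q\<in>P. x \<otimes> p = y \<otimes> q)" for x y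
    by (auto simp: l_coset_def)
  ultimately show ?thesis by blast
qed

lemma lcoset_mult_sub:
  assumes "g \<in> carrier G" "a \<in> P"
  shows "(g \<otimes> a) <# P \<subseteq> g <# P"
proof
  fix x assume "x \<in> (g \<otimes> a) <# P"
  then obtain q where "q \<in> P" "x = g \<otimes> a \<otimes> q" unfolding pr_iff by blast
  then have "a \<otimes> q \<in> P" "x = g \<otimes> (a \<otimes> q)" using assms by (simp_all add: m_assoc)
  then show "x \<in> g <# P" unfolding pr_iff by (rule bexI[rotated])
qed

text \<open>With \<open>g = inv p \<otimes> t\<close> the claim becomes disjointness of
  \<open>sP\<close> and \<open>gsP\<close>. For \<open>g\<close> in \<open>G0\<close> this is the
  hypothesis at the base point one; otherwise a nonempty constructible ideal \<open>S\<close>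
  missing one of the translates of \<open>P\<close> by \<open>g\<close> and \<open>inv g\<close>
  supplies it for every \<open>s\<close> in \<open>S\<close>.\<close>

lemma cond3_cond4:
  assumes cond3
  shows cond4
  unfolding cond4_def
proof (intro ballI impI)
  fix p t assume pt: "p \<in> P" "t \<in> P" "p \<noteq> t"
  define g where "g = inv p \<otimes> t"
  have pg: "p \<otimes> g = t" using pt(1,2) by (simp add: g_def m_assoc[symmetric])
  have g: "g \<in> carrier G" using pt(1,2) by (simp add: g_def)
  have g1: "g \<noteq> \<one>" using pt pg by (metis P_carrier r_one)
  have gs: "p \<otimes> (g \<otimes> s) = t \<otimes> s" if "s \<in> P" for s
    using pt g that by (simp add: m_assoc[symmetric] pg)
  have "\<exists>s\<in>P. (s <# P) \<inter> ((g \<otimes> s) <# P) = {}"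
  proof (cases "g \<in> G0 G P")
    case True
    then obtain s where "s \<in> \<one> <# P" "(s <# P) \<inter> ((g \<otimes> s) <# P) = {}"
      using assms g1 P_one unfolding cond3_def by blast
    then show ?thesis using pr_P[OF P_one, of s] by blast
  next
    case False
    then obtain S where S: "S \<in> J" "S \<noteq> {}" "(g <# P) \<inter> S = {} \<or> (inv g <# P) \<inter> S = {}"
      using g by (auto simp: G0_def)
    then obtain s where s: "s \<in> S" by blast
    have sP: "s \<in> P" "s <# P \<subseteq> S" using s J_sub[OF S(1)] pr_sub[OF S(1) s] by blast+
    have 1: "(g \<otimes> s) <# P \<subseteq> g <# P" using lcoset_mult_sub[OF g sP(1)] .
    have 2: "(inv g <# P) \<inter> (s <# P) = {} \<Longrightarrow> (s <# P) \<inter> ((g \<otimes> s) <# P) = {}"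
    proof -
      assume a: "(inv g <# P) \<inter> (s <# P) = {}"
      have "(inv g \<otimes> s) <# P \<subseteq> inv g <# P" using lcoset_mult_sub[OF inv_closed[OF g] sP(1)] .
      then have "((inv g \<otimes> s) <# P) \<inter> (s <# P) = {}" using a by blast
      then have "((inv g \<otimes> s) <# P) \<inter> ((inv g \<otimes> (g \<otimes> s)) <# P) = {}"
        using g sP by (simp add: m_assoc[symmetric])
      then show ?thesis using lcoset_translate[of "inv g" s "g \<otimes> s"] g sP by auto
    qed
    show ?thesis using S(3) sP 1 2 by blast
  qed
  then obtain s where s: "s \<in> P" "(s <# P) \<inter> ((g \<otimes> s) <# P) = {}" by auto
  then have "((p \<otimes> s) <# P) \<inter> ((t \<otimes> s) <# P) = {}"
    using lcoset_translate[of p s "g \<otimes> s"] g pt gs by simp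
  then show "\<exists>s\<in>P. ((p \<otimes> s) <# P) \<inter> ((t \<otimes> s) <# P) = {}" using s by blast
qed

text \<open>If a neighbourhood of \<open>x\<close> were fixed by \<open>g\<close>, a deciding
  \<open>p\<close> would give a whole cylinder of fixed points. After refining \<open>p\<close> to
  \<open>p \<otimes> s\<close> with \<open>psP\<close> and \<open>gpsP\<close> disjoint, a fixed
  point containing \<open>psP\<close> would contain both ideals.\<close>

lemma cond4_top_free:
  assumes cond4
  shows "top_free (carrier G)"
  unfolding topologically_free_def
proof (intro ballI impI, rule ccontr)
  fix g assume g: "g \<in> carrier G" "g \<noteq> \<one>"
    and "top_of_set X interior_of {x \<in> bd g. act g x = x} \<noteq> {}"
  then obtain x W where x: "x \<in> W" "openin (top_of_set X) W" "W \<subseteq> {x \<in> bd g. act g x = x}"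
    unfolding interior_of_def by blast
  then obtain U where U: "open U" "W = X \<inter> U" by (auto simp: openin_open)
  have xX: "x \<in> X" "x \<in> U" using x(1) U(2) by blast+
  have xg: "x \<in> bd g" using x(1,3) by blast
  obtain F where F: "finite F" "F \<subseteq> J" "\<And>y. y \<in> X \<Longrightarrow> (\<forall>S\<in>F. y S = x S) \<Longrightarrow> y \<in> U"
    using basic_nbhd[OF xX(1) U(1) xX(2)] by blast
  obtain S where S: "S \<in> jd g" "x S" using xg unfolding bd_iff by blast
  have "finite (insert S F)" "insert S F \<subseteq> J" using F S jd_J by auto
  then obtain p where p: "decides p x (insert S F)" using X_decides[OF xX(1)] by blast
  have pS: "p \<in> S" "p \<in> P" "decides p x F" using p S decides_mono[OF p] by (auto simp: decides_def)
  have gp: "g \<otimes> p \<in> P" using jd_mem[OF S(1) pS(1)] by simp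
  have "p \<noteq> g \<otimes> p" using r_cancel_one'[of p g] g pS by auto
  then obtain s where s: "s \<in> P" "((p \<otimes> s) <# P) \<inter> ((g \<otimes> p \<otimes> s) <# P) = {}"
    using assms pS gp unfolding cond4_def by blast
  obtain y where y: "y \<in> X" "y ((p \<otimes> s) <# P)" using X_exists[of "p \<otimes> s"] pS s by auto
  have yp: "y (p <# P)" using X_mono[OF y pr_trans] pS s by (auto simp: pr_iff)
  have "y \<in> U" using F(3)[OF y(1)] decides_agree[OF pS(3) F(2) y(1) yp] by blast
  then have fixy: "act g y = y" using x(3) U(2) y(1) by blast
  have yS: "y S" using X_mono[OF y(1) yp pr_sub] S(1) jd_J pS(1) by blast
  have "(p \<otimes> s) <# P \<subseteq> {q \<in> S. g \<otimes> q \<in> (g \<otimes> p \<otimes> s) <# P}"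
    (is "_ \<subseteq> ?R")
  proof
    fix z assume "z \<in> (p \<otimes> s) <# P"
    then obtain a where a: "a \<in> P" "z = p \<otimes> s \<otimes> a" by (auto simp: pr_iff)
    then have "z = p \<otimes> (s \<otimes> a)" "g \<otimes> z = g \<otimes> p \<otimes> s \<otimes> a" using pS(2) s(1) g(1) by (simp_all add: m_assoc)
    then show "z \<in> ?R"
      using J_ideal[OF jd_J[OF S(1)] pS(1), of "s \<otimes> a"] a s(1) by (auto simp: pr_iff)
  qed
  moreover have gps: "(g \<otimes> p \<otimes> s) <# P \<in> J" using gp s by simp
  ultimately have "y {q \<in> S. g \<otimes> q \<in> (g \<otimes> p \<otimes> s) <# P}"
    using X_mono[OF y] pullback_jd[OF S(1)] jd_J by blast
  then have "y ((g \<otimes> p \<otimes> s) <# P)" using act_iff[OF y(1) S(1) yS gps] fixy by simp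
  then show False using X_disjoint[OF y(1) y(2)] s(2) by blast
qed

text \<open>The form of the condition used for compressions: \<open>g\<close> ranges over the group
  and \<open>q\<close> is sought below a given \<open>r\<close>. If some \<open>s\<close> in
  \<open>rP\<close> has its translate in \<open>P\<close>, the condition applies to \<open>s\<close>
  and \<open>g \<otimes> s\<close>; otherwise \<open>rP\<close> and \<open>grP\<close> are already
  disjoint.\<close>

lemma cond4_refine:
  assumes cond4 "g \<in> carrier G" "g \<noteq> \<one>" "r \<in> P"
  shows "\<exists>q \<in> r <# P. (q <# P) \<inter> ((g \<otimes> q) <# P) = {}"
proof (cases "\<exists>s \<in> r <# P. g \<otimes> s \<in> P")
  case True
  then obtain s where s: "s \<in> r <# P" "g \<otimes> s \<in> P" by auto
  then have sP: "s \<in> P" using pr_P assms by auto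
  have "s \<noteq> g \<otimes> s" using r_cancel_one'[OF P_carrier[OF sP] assms(2)] assms(3) by blast
  then obtain t where t: "t \<in> P" "((s \<otimes> t) <# P) \<inter> ((g \<otimes> s \<otimes> t) <# P) = {}"
    using assms(1)[unfolded cond4_def, rule_format, OF sP s(2)] by blast
  have st: "s \<otimes> t \<in> r <# P" using J_ideal[OF pr_J[OF assms(4)] s(1) t(1)] .
  have "g \<otimes> s \<otimes> t = g \<otimes> (s \<otimes> t)" using sP assms(2) t(1) by (simp add: m_assoc)
  then show ?thesis using t(2) st by metis
next
  case False
  have "(r <# P) \<inter> ((g \<otimes> r) <# P) = {}"
  proof (rule ccontr)
    assume "\<not> ?thesis"
    then obtain a b where ab: "a \<in> P" "b \<in> P" "r \<otimes> a = g \<otimes> r \<otimes> b" by (auto simp: l_coset_def)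
    have "g \<otimes> (r \<otimes> b) = r \<otimes> a" using assms ab by (simp add: m_assoc)
    then have "g \<otimes> (r \<otimes> b) \<in> P" using P_mult[OF assms(4) ab(1)] by (simp only:)
    moreover have "r \<otimes> b \<in> r <# P" using ab unfolding pr_iff by blast
    ultimately show False using False by blast
  qed
  then show ?thesis using pr_self[OF assms(4)] by blast
qed

end

section \<open>Abstract C*-algebras\<close>

text \<open>The inequality \<open>norm_star_sum\<close> is the only consequence of positivity that is needed; with
  \<open>s = 0\<close> it is the C*-identity.\<close>

locale calg = ring A for A :: "'a cstar" (structure) +
  assumes smult_closed [simp]: "x \<in> carrier A \<Longrightarrow> c \<odot> x \<in> carrier A"
    and smult_add: "x \<in> carrier A \<Longrightarrow> y \<in> carrier A \<Longrightarrow> c \<odot> (x \<oplus> y) = c \<odot> x \<oplus> c \<odot> y"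
    and add_smult: "x \<in> carrier A \<Longrightarrow> (c + d) \<odot> x = c \<odot> x \<oplus> d \<odot> x"
    and smult_smult: "x \<in> carrier A \<Longrightarrow> c \<odot> (d \<odot> x) = (c * d) \<odot> x"
    and one_smult [simp]: "x \<in> carrier A \<Longrightarrow> 1 \<odot> x = x"
    and smult_l: "x \<in> carrier A \<Longrightarrow> y \<in> carrier A \<Longrightarrow> (c \<odot> x) \<otimes> y = c \<odot> (x \<otimes> y)"
    and smult_r: "x \<in> carrier A \<Longrightarrow> y \<in> carrier A \<Longrightarrow> x \<otimes> (c \<odot> y) = c \<odot> (x \<otimes> y)"
    and star_closed [simp]: "x \<in> carrier A \<Longrightarrow> star A x \<in> carrier A"
    and star_star [simp]: "x \<in> carrier A \<Longrightarrow> star A (star A x) = x"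
    and star_add: "x \<in> carrier A \<Longrightarrow> y \<in> carrier A \<Longrightarrow> star A (x \<oplus> y) = star A x \<oplus> star A y"
    and star_mult: "x \<in> carrier A \<Longrightarrow> y \<in> carrier A \<Longrightarrow> star A (x \<otimes> y) = star A y \<otimes> star A x"
    and star_smult: "x \<in> carrier A \<Longrightarrow> star A (c \<odot> x) = cnj c \<odot> star A x"
    and nrm_nonneg [simp]: "x \<in> carrier A \<Longrightarrow> 0 \<le> nrm A x"
    and nrm_zero_iff: "x \<in> carrier A \<Longrightarrow> nrm A x = 0 \<longleftrightarrow> x = \<zero>"
    and nrm_add: "x \<in> carrier A \<Longrightarrow> y \<in> carrier A \<Longrightarrow> nrm A (x \<oplus> y) \<le> nrm A x + nrm A y"
    and nrm_smult: "x \<in> carrier A \<Longrightarrow> nrm A (c \<odot> x) = cmod c * nrm A x"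
    and nrm_mult: "x \<in> carrier A \<Longrightarrow> y \<in> carrier A \<Longrightarrow> nrm A (x \<otimes> y) \<le> nrm A x * nrm A y"
    and nrm_star [simp]: "x \<in> carrier A \<Longrightarrow> nrm A (star A x) = nrm A x"
    and norm_star_sum: "x \<in> carrier A \<Longrightarrow> s \<in> carrier A \<Longrightarrow>
      (nrm A x)\<^sup>2 \<le> nrm A (star A x \<otimes> x \<oplus> star A s \<otimes> s)"
    and complete: "(\<And>n. \<sigma> n \<in> carrier A) \<Longrightarrow>
      (\<forall>e>0. \<exists>N. \<forall>m\<ge>N. \<forall>n\<ge>N. nrm A (\<sigma> m \<ominus> \<sigma> n) < e) \<Longrightarrow>
      \<exists>l\<in>carrier A. \<forall>e>0. \<exists>N. \<forall>n\<ge>N. nrm A (\<sigma> (n :: nat) \<ominus> l) < e"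
begin

lemma zero_smult [simp]: "x \<in> carrier A \<Longrightarrow> 0 \<odot> x = \<zero>"
  using add_smult[of x 0 0] by (metis add.r_cancel_one' add_0 smult_closed)

lemma smult_zero [simp]: "c \<odot> \<zero> = \<zero>"
  using smult_add[of \<zero> \<zero> c] by (metis add.r_cancel_one' l_zero smult_closed zero_closed)

lemma neg_smult: "x \<in> carrier A \<Longrightarrow> \<ominus> x = (-1) \<odot> x"
  using add_smult[of x 1 "-1"] by (intro minus_equality) (auto simp: a_comm)

lemma minus_smult: "x \<in> carrier A \<Longrightarrow> y \<in> carrier A \<Longrightarrow> x \<ominus> y = x \<oplus> (-1) \<odot> y"
  by (simp add: a_minus_def neg_smult)

lemma smult_minus: "x \<in> carrier A \<Longrightarrow> y \<in> carrier A \<Longrightarrow> c \<odot> (x \<ominus> y) = c \<odot> x \<ominus> c \<odot> y"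
  by (simp add: minus_smult smult_add smult_smult)

lemma star_zero [simp]: "star A \<zero> = \<zero>"
  using star_smult[of \<zero> 0] by simp

lemma star_minus: "x \<in> carrier A \<Longrightarrow> y \<in> carrier A \<Longrightarrow> star A (x \<ominus> y) = star A x \<ominus> star A y"
  by (simp add: minus_smult star_add star_smult)

lemma star_one [simp]: "star A \<one> = \<one>"
  using star_mult[of \<one> "star A \<one>"] by (simp del: star_closed) (metis one_closed r_one star_closed star_star)

lemma nrm_zero [simp]: "nrm A \<zero> = 0"
  by (simp add: nrm_zero_iff)

lemma nrm_pos: "x \<in> carrier A \<Longrightarrow> x \<noteq> \<zero> \<Longrightarrow> 0 < nrm A x"
  using nrm_nonneg[of x] nrm_zero_iff[of x] by linarith

lemma nrm_neg [simp]: "x \<in> carrier A \<Longrightarrow> nrm A (\<ominus> x) = nrm A x"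
  by (simp add: neg_smult nrm_smult)

lemma nrm_minus_le: "x \<in> carrier A \<Longrightarrow> y \<in> carrier A \<Longrightarrow> nrm A (x \<ominus> y) \<le> nrm A x + nrm A y"
  using nrm_add[of x "\<ominus> y"] by (simp add: a_minus_def)

lemma nrm_minus_commute: "x \<in> carrier A \<Longrightarrow> y \<in> carrier A \<Longrightarrow> nrm A (x \<ominus> y) = nrm A (y \<ominus> x)"
  using nrm_neg[of "x \<ominus> y"] by (simp add: minus_add a_minus_def a_comm)

lemma minus_telescope:
  "x \<in> carrier A \<Longrightarrow> y \<in> carrier A \<Longrightarrow> z \<in> carrier A \<Longrightarrow> (x \<ominus> y) \<oplus> (y \<ominus> z) = x \<ominus> z"
  by algebra

lemma nrm_triangle:
  "x \<in> carrier A \<Longrightarrow> y \<in> carrier A \<Longrightarrow> z \<in> carrier A \<Longrightarrow> nrm A (x \<ominus> z) \<le> nrm A (x \<ominus> y) + nrm A (y \<ominus> z)"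
  using nrm_add[of "x \<ominus> y" "y \<ominus> z"] by (simp add: minus_telescope)

lemma nrm_le_minus: "x \<in> carrier A \<Longrightarrow> y \<in> carrier A \<Longrightarrow> nrm A x \<le> nrm A (x \<ominus> y) + nrm A y"
  using nrm_triangle[of x y \<zero>] by (simp add: a_minus_def)

lemma minus_eq_zero: "x \<in> carrier A \<Longrightarrow> y \<in> carrier A \<Longrightarrow> x \<ominus> y = \<zero> \<longleftrightarrow> x = y"
  by (metis a_minus_def a_inv_closed minus_equality minus_minus r_neg)

lemma eq_if_close:
  assumes "x \<in> carrier A" "y \<in> carrier A" "\<And>e. 0 < e \<Longrightarrow> nrm A (x \<ominus> y) \<le> e"
  shows "x = y"
proof -
  have "nrm A (x \<ominus> y) \<le> 0" by (rule field_le_epsilon) (use assms in simp)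
  moreover have "0 \<le> nrm A (x \<ominus> y)" using assms by (intro nrm_nonneg) simp
  ultimately have "nrm A (x \<ominus> y) = 0" by simp
  then have "x \<ominus> y = \<zero>" using nrm_zero_iff[of "x \<ominus> y"] assms by simp
  then show ?thesis using assms minus_eq_zero by blast
qed

lemma cstar_identity: "x \<in> carrier A \<Longrightarrow> nrm A (star A x \<otimes> x) = (nrm A x)\<^sup>2"
  using norm_star_sum[of x \<zero>] nrm_mult[of "star A x" x] by (simp add: power2_eq_square)

lemma star_mult_zero: "x \<in> carrier A \<Longrightarrow> star A x \<otimes> x = \<zero> \<Longrightarrow> x = \<zero>"
  using cstar_identity[of x] nrm_zero_iff[of x] by simp

text \<open>An inequality, because the zero algebra satisfies the axioms.\<close>

lemma nrm_one_le: "nrm A \<one> \<le> 1"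
proof -
  have "(nrm A \<one>)\<^sup>2 = nrm A \<one>" using cstar_identity[of \<one>] by simp
  then have "nrm A \<one> = 0 \<or> nrm A \<one> = 1" by (simp add: power2_eq_square)
  then show ?thesis by auto
qed

lemma nrm_mult_diff:
  assumes "x \<in> carrier A" "y \<in> carrier A" "x' \<in> carrier A" "y' \<in> carrier A"
  shows "nrm A (x \<otimes> y \<ominus> x' \<otimes> y') \<le> nrm A x * nrm A (y \<ominus> y') + nrm A (x \<ominus> x') * nrm A y'"
proof -
  have "x \<otimes> y \<ominus> x' \<otimes> y' = x \<otimes> (y \<ominus> y') \<oplus> (x \<ominus> x') \<otimes> y'"
    using assms by algebra
  also have "nrm A \<dots> \<le> nrm A (x \<otimes> (y \<ominus> y')) + nrm A ((x \<ominus> x') \<otimes> y')"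
    using assms by (intro nrm_add) auto
  also have "\<dots> \<le> nrm A x * nrm A (y \<ominus> y') + nrm A (x \<ominus> x') * nrm A y'"
    using assms by (intro add_mono nrm_mult) auto
  finally show ?thesis .
qed

lemma nrm_add_diff:
  assumes "x \<in> carrier A" "y \<in> carrier A" "x' \<in> carrier A" "y' \<in> carrier A"
  shows "nrm A ((x \<oplus> y) \<ominus> (x' \<oplus> y')) \<le> nrm A (x \<ominus> x') + nrm A (y \<ominus> y')"
proof -
  have "(x \<oplus> y) \<ominus> (x' \<oplus> y') = (x \<ominus> x') \<oplus> (y \<ominus> y')" using assms by algebra
  then show ?thesis using nrm_add[of "x \<ominus> x'" "y \<ominus> y'"] assms by simp
qed

subsection \<open>Closures and linear spans\<close>

lemma cl_carrier: "cl A Y \<subseteq> carrier A"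
  by (auto simp: cl_def)

lemma cl_subset: "Y \<subseteq> carrier A \<Longrightarrow> Y \<subseteq> cl A Y"
proof
  fix y assume y: "Y \<subseteq> carrier A" "y \<in> Y"
  then have "nrm A (y \<ominus> y) < e" if "0 < e" for e using that by (simp add: minus_eq_zero[THEN iffD2] subset_eq)
  then show "y \<in> cl A Y" using y by (auto simp: cl_def)
qed

lemma cl_mono: "Y \<subseteq> Z \<Longrightarrow> cl A Y \<subseteq> cl A Z"
  unfolding cl_def by blast

lemma cl_approx: "a \<in> cl A Y \<Longrightarrow> 0 < e \<Longrightarrow> \<exists>y\<in>Y. nrm A (a \<ominus> y) < e"
  by (simp add: cl_def)

lemma cl_cl: "Y \<subseteq> carrier A \<Longrightarrow> cl A (cl A Y) \<subseteq> cl A Y"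
proof
  fix a assume Y: "Y \<subseteq> carrier A" and a: "a \<in> cl A (cl A Y)"
  have ac: "a \<in> carrier A" using a by (simp add: cl_def)
  have "\<exists>y\<in>Y. nrm A (a \<ominus> y) < e" if e: "0 < e" for e
  proof -
    obtain b where b: "b \<in> cl A Y" "nrm A (a \<ominus> b) < e/2" using cl_approx[OF a, of "e/2"] e by auto
    obtain y where y: "y \<in> Y" "nrm A (b \<ominus> y) < e/2" using cl_approx[OF b(1), of "e/2"] e by auto
    have "b \<in> carrier A" "y \<in> carrier A" using b y Y cl_carrier by auto
    then show ?thesis using nrm_triangle[OF ac, of b y] b y by force
  qed
  then show "a \<in> cl A Y" using ac by (simp add: cl_def)
qed

lemma lin_span_carrier: "Y \<subseteq> carrier A \<Longrightarrow> x \<in> lin_span A Y \<Longrightarrow> x \<in> carrier A"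
  by (rotate_tac 1, induct rule: lin_span.induct) (auto simp: subset_eq)

lemma lin_span_add:
  assumes "Y \<subseteq> carrier A" "x \<in> lin_span A Y" "y \<in> lin_span A Y"
  shows "x \<oplus> y \<in> lin_span A Y"
  using assms(2)
proof induct
  case zero
  then show ?case using assms lin_span_carrier by simp
next
  case (step x' z c)
  then have "c \<odot> x' \<oplus> (z \<oplus> y) \<in> lin_span A Y" by (intro lin_span.step)
  then show ?case using assms step lin_span_carrier by (simp add: a_assoc subset_eq)
qed

lemma lin_span_smult:
  assumes "Y \<subseteq> carrier A" "x \<in> lin_span A Y"
  shows "c \<odot> x \<in> lin_span A Y"
  using assms(2)
proof induct
  case zero
  then show ?case by (simp add: lin_span.zero)
next
  case (step x' z d)
  then have "(c * d) \<odot> x' \<oplus> (c \<odot> z) \<in> lin_span A Y" by (intro lin_span.step)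
  then show ?case using assms step lin_span_carrier[OF assms(1) step(2)]
    by (simp add: smult_add smult_smult subset_eq)
qed

lemma lin_span_base: "Y \<subseteq> carrier A \<Longrightarrow> x \<in> Y \<Longrightarrow> x \<in> lin_span A Y"
  using lin_span.step[OF _ lin_span.zero, of x Y A 1] by (auto simp: subset_eq)

lemma lin_span_minus:
  "Y \<subseteq> carrier A \<Longrightarrow> x \<in> lin_span A Y \<Longrightarrow> y \<in> lin_span A Y \<Longrightarrow> x \<ominus> y \<in> lin_span A Y"
  using lin_span_add[of Y x "(-1) \<odot> y"] lin_span_smult[of Y y "-1"]
  by (simp add: minus_smult lin_span_carrier)

lemma lin_span_sub:
  assumes "Y \<subseteq> carrier A" "Z \<subseteq> lin_span A Y"
  shows "lin_span A Z \<subseteq> lin_span A Y"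
proof
  fix x assume "x \<in> lin_span A Z"
  then show "x \<in> lin_span A Y"
    by induct (use assms in \<open>auto intro!: lin_span.zero lin_span_add lin_span_smult\<close>)
qed

text \<open>Three generating sets, since products of elements of degrees \<open>g\<close> and
  \<open>h\<close> have degree \<open>gh\<close>; for a single set see
  \<open>lin_span_mult\<close>.\<close>

lemma lin_span_mult_gen:
  assumes Y: "Y \<subseteq> carrier A" and Z: "Z \<subseteq> carrier A" and W: "W \<subseteq> carrier A"
    and YZ: "\<And>x y. x \<in> Y \<Longrightarrow> y \<in> Z \<Longrightarrow> x \<otimes> y \<in> lin_span A W"
    and x: "x \<in> lin_span A Y" and y: "y \<in> lin_span A Z"
  shows "x \<otimes> y \<in> lin_span A W"
proof -
  have 1: "x \<otimes> y \<in> lin_span A W" if "x \<in> Y" for x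
    using y
  proof induct
    case zero
    then show ?case using that Y lin_span.zero by (simp add: subset_eq)
  next
    case (step y' z c)
    have m: "x \<in> carrier A" "y' \<in> carrier A" "z \<in> carrier A"
      using step that Y Z lin_span_carrier by auto
    have "x \<otimes> (c \<odot> y' \<oplus> z) = c \<odot> (x \<otimes> y') \<oplus> x \<otimes> z" using m by (simp add: r_distr smult_r)
    then show ?case using step that W YZ by (simp add: lin_span_add lin_span_smult)
  qed
  show ?thesis
    using x
  proof induct
    case zero
    then show ?case using y Z lin_span.zero lin_span_carrier by simp
  next
    case (step x' z c)
    have m: "x' \<in> carrier A" "y \<in> carrier A" "z \<in> carrier A"
      using step y Y Z lin_span_carrier by auto
    have "(c \<odot> x' \<oplus> z) \<otimes> y = c \<odot> (x' \<otimes> y) \<oplus> z \<otimes> y" using m by (simp add: l_distr smult_l)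
    then show ?case using step 1 W by (simp add: lin_span_add lin_span_smult)
  qed
qed

lemmas lin_span_mult = lin_span_mult_gen[where Y = Y and Z = Y and W = Y for Y]

lemma lin_span_star:
  assumes Y: "Y \<subseteq> carrier A" "Z \<subseteq> carrier A" "\<And>x. x \<in> Y \<Longrightarrow> star A x \<in> lin_span A Z" and x: "x \<in> lin_span A Y"
  shows "star A x \<in> lin_span A Z"
  using x
proof induct
  case zero
  then show ?case using lin_span.zero by simp
next
  case (step x' z c)
  then have m: "x' \<in> carrier A" "z \<in> carrier A" using Y lin_span_carrier by auto
  then have "star A (c \<odot> x' \<oplus> z) = cnj c \<odot> star A x' \<oplus> star A z" by (simp add: star_add star_smult)
  then show ?case using step Y by (simp add: lin_span_add lin_span_smult)
qed

lemma cl_add: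
  assumes Y: "Y \<subseteq> carrier A" "\<And>x y. x \<in> Y \<Longrightarrow> y \<in> Y \<Longrightarrow> x \<oplus> y \<in> Y" and ab: "a \<in> cl A Y" "b \<in> cl A Y"
  shows "a \<oplus> b \<in> cl A Y"
proof -
  have c: "a \<in> carrier A" "b \<in> carrier A" using ab cl_carrier by auto
  have "\<exists>y\<in>Y. nrm A (a \<oplus> b \<ominus> y) < e" if e: "0 < e" for e
  proof -
    obtain x where x: "x \<in> Y" "nrm A (a \<ominus> x) < e/2" using cl_approx[OF ab(1), of "e/2"] e by auto
    obtain y where y: "y \<in> Y" "nrm A (b \<ominus> y) < e/2" using cl_approx[OF ab(2), of "e/2"] e by auto
    have "nrm A (a \<oplus> b \<ominus> (x \<oplus> y)) < e" using nrm_add_diff[of a b x y] c x y Y(1) by force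
    then show ?thesis using Y(2) x y by blast
  qed
  then show ?thesis using c by (simp add: cl_def)
qed

lemma cl_smult:
  assumes Y: "Y \<subseteq> carrier A" "\<And>x. x \<in> Y \<Longrightarrow> c \<odot> x \<in> Y" and a: "a \<in> cl A Y"
  shows "c \<odot> a \<in> cl A Y"
proof -
  have ac: "a \<in> carrier A" using a cl_carrier by auto
  have "\<exists>y\<in>Y. nrm A (c \<odot> a \<ominus> y) < e" if e: "0 < e" for e
  proof -
    have p: "0 < e / (cmod c + 1)" using e by (simp add: add_nonneg_pos)
    obtain x where x: "x \<in> Y" "nrm A (a \<ominus> x) < e / (cmod c + 1)" using cl_approx[OF a p] by auto
    have xc: "x \<in> carrier A" using x Y by auto
    have "nrm A (c \<odot> a \<ominus> c \<odot> x) = cmod c * nrm A (a \<ominus> x)"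
      using ac xc by (simp add: nrm_smult flip: smult_minus)
    also have "\<dots> \<le> (cmod c + 1) * nrm A (a \<ominus> x)" using ac xc by (intro mult_right_mono) auto
    also have "\<dots> < e" using x(2) p by (simp add: pos_less_divide_eq add_nonneg_pos mult.commute)
    finally show ?thesis using Y(2) x by blast
  qed
  then show ?thesis using ac by (simp add: cl_def)
qed

lemma cl_star:
  assumes Y: "Y \<subseteq> carrier A" "\<And>x. x \<in> Y \<Longrightarrow> star A x \<in> Z" and a: "a \<in> cl A Y"
  shows "star A a \<in> cl A Z"
proof -
  have ac: "a \<in> carrier A" using a cl_carrier by auto
  have "\<exists>y\<in>Z. nrm A (star A a \<ominus> y) < e" if e: "0 < e" for e
  proof -
    obtain x where x: "x \<in> Y" "nrm A (a \<ominus> x) < e" using cl_approx[OF a e] by auto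
    have xc: "x \<in> carrier A" using x Y by auto
    have "nrm A (star A a \<ominus> star A x) = nrm A (a \<ominus> x)"
      using ac xc by (simp flip: star_minus)
    then show ?thesis using Y(2)[OF x(1)] x(2) by (intro bexI[of _ "star A x"]) simp
  qed
  then show ?thesis using ac by (simp add: cl_def)
qed

lemma cl_mult_gen:
  assumes "Y \<subseteq> carrier A" "Z \<subseteq> carrier A" "\<And>x y. x \<in> Y \<Longrightarrow> y \<in> Z \<Longrightarrow> x \<otimes> y \<in> W"
    and ab: "a \<in> cl A Y" "b \<in> cl A Z"
  shows "a \<otimes> b \<in> cl A W"
proof -
  have c: "a \<in> carrier A" "b \<in> carrier A" using ab cl_carrier by auto
  have "\<exists>y\<in>W. nrm A (a \<otimes> b \<ominus> y) < e" if e: "0 < e" for e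
  proof -
    define d where "d = min 1 (e / (nrm A a + nrm A b + 2))"
    have s: "0 < nrm A a + nrm A b + 2" using c by (simp add: add_nonneg_pos)
    have d: "0 < d" "d \<le> 1" "d \<le> e / (nrm A a + nrm A b + 2)"
      using e s by (auto simp: d_def)
    then have d': "d * (nrm A a + nrm A b + 2) \<le> e" using s by (simp add: pos_le_divide_eq)
    obtain x where x: "x \<in> Y" "nrm A (a \<ominus> x) < d" using cl_approx[OF ab(1) d(1)] by auto
    obtain y where y: "y \<in> Z" "nrm A (b \<ominus> y) < d" using cl_approx[OF ab(2) d(1)] by auto
    have xy: "x \<in> carrier A" "y \<in> carrier A" using x y assms by auto
    have ny: "nrm A y \<le> nrm A b + 1" using nrm_le_minus[of y b] nrm_minus_commute[of b y] xy c y d by simp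
    have "nrm A (a \<otimes> b \<ominus> x \<otimes> y) \<le> nrm A a * nrm A (b \<ominus> y) + nrm A (a \<ominus> x) * nrm A y"
      using nrm_mult_diff c xy by blast
    also have "\<dots> \<le> nrm A a * d + d * (nrm A b + 1)"
      using x y c xy ny d by (intro add_mono mult_mono) auto
    also have "\<dots> < d * (nrm A a + nrm A b + 2)" using d by (simp add: algebra_simps)
    finally show ?thesis using assms(3) x y d' by force
  qed
  then show ?thesis using c by (simp add: cl_def)
qed

lemmas cl_mult = cl_mult_gen[where Y = Y and Z = Y and W = Y for Y]

lemma cstar_sub_cl_lin_span:
  assumes Y: "Y \<subseteq> carrier A" "\<And>x y. x \<in> Y \<Longrightarrow> y \<in> Y \<Longrightarrow> x \<otimes> y \<in> lin_span A Y"
    "\<And>x. x \<in> Y \<Longrightarrow> star A x \<in> lin_span A Y"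
  shows "cstar_sub A (cl A (lin_span A Y))"
proof -
  have s: "lin_span A Y \<subseteq> carrier A" using lin_span_carrier[OF Y(1)] by auto
  show ?thesis unfolding cstar_sub_def
  proof (intro conjI ballI allI)
    show "\<zero> \<in> cl A (lin_span A Y)" using cl_subset[OF s] lin_span.zero by auto
    show "cl A (cl A (lin_span A Y)) \<subseteq> cl A (lin_span A Y)" by (rule cl_cl[OF s])
    fix x y assume x: "x \<in> cl A (lin_span A Y)"
    show "star A x \<in> cl A (lin_span A Y)" by (rule cl_star[OF s lin_span_star[OF Y(1,1,3)] x])
    show "c \<odot> x \<in> cl A (lin_span A Y)" for c by (rule cl_smult[OF s lin_span_smult[OF Y(1)] x])
    assume y: "y \<in> cl A (lin_span A Y)"
    show "x \<oplus> y \<in> cl A (lin_span A Y)" by (rule cl_add[OF s lin_span_add[OF Y(1)] x y])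
    show "x \<otimes> y \<in> cl A (lin_span A Y)" by (rule cl_mult[OF s s lin_span_mult[OF Y(1,1,1,2)] x y])
  qed (use cl_carrier in auto)
qed

lemma cstar_sub_cl_lin_span_subset:
  assumes "cstar_sub A B" "Y \<subseteq> B"
  shows "cl A (lin_span A Y) \<subseteq> B"
proof -
  have "x \<in> B" if "x \<in> lin_span A Y" for x
    using that by induct (use assms in \<open>auto simp: cstar_sub_def\<close>)
  then have "cl A (lin_span A Y) \<subseteq> cl A B" by (intro cl_mono) auto
  then show ?thesis using assms(1) by (auto simp: cstar_sub_def)
qed

subsection \<open>Subalgebras\<close>

text \<open>Negation is a description relative to the carrier, so its agreement on a subalgebra has
  to be derived from uniqueness of negatives there. The two conclusions share the verification that
  \<open>B\<close> is an additive group.\<close>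

lemma sub_minus:
  assumes B: "cstar_sub A B" and "x \<in> B" "y \<in> B"
  shows "x \<ominus>\<^bsub>A\<lparr>carrier := B, one := u\<rparr>\<^esub> y = x \<ominus> y"
    and sub_ring: "(\<And>x. x \<in> B \<Longrightarrow> u \<otimes> x = x \<and> x \<otimes> u = x) \<Longrightarrow> u \<in> B \<Longrightarrow> ring (A\<lparr>carrier := B, one := u\<rparr>)"
proof -
  let ?A = "A\<lparr>carrier := B, one := u\<rparr>"
  have Bc: "\<And>x. x \<in> B \<Longrightarrow> x \<in> carrier A" using B by (auto simp: cstar_sub_def)
  have neg: "\<ominus> x \<in> B" if "x \<in> B" for x using B that neg_smult[OF Bc[OF that]] by (simp add: cstar_sub_def)
  have ag: "abelian_group ?A"
    by (rule abelian_groupI)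
      (use B Bc neg in \<open>auto simp: cstar_sub_def a_assoc a_comm[of _ "\<ominus> _"] r_neg l_neg intro: a_comm intro!: bexI[of _ "\<ominus> _"]\<close>)
  have "\<ominus>\<^bsub>?A\<^esub> y = \<ominus> y"
    by (rule abelian_group.minus_equality[OF ag]) (use assms(3) neg Bc in \<open>auto simp: l_neg r_neg\<close>)
  then show "x \<ominus>\<^bsub>?A\<^esub> y = x \<ominus> y" by (simp add: a_minus_def)
  assume u: "\<And>x. x \<in> B \<Longrightarrow> u \<otimes> x = x \<and> x \<otimes> u = x" "u \<in> B"
  show "ring ?A"
    by (rule ringI[OF ag]) (use u B Bc in \<open>auto simp: cstar_sub_def m_assoc l_distr r_distr intro!: monoidI\<close>)
qed

text \<open>The unit \<open>u\<close> may differ from that of \<open>A\<close>: the regular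
  representation of a crossed product vanishes on a complement, so its unit can be a proper
  projection.\<close>

lemma calg_sub:
  assumes B: "cstar_sub A B" and u: "\<And>x. x \<in> B \<Longrightarrow> u \<otimes> x = x \<and> x \<otimes> u = x" "u \<in> B"
  shows "calg (A\<lparr>carrier := B, one := u\<rparr>)"
proof -
  let ?A = "A\<lparr>carrier := B, one := u\<rparr>"
  have Bc: "\<And>x. x \<in> B \<Longrightarrow> x \<in> carrier A" using B by (auto simp: cstar_sub_def)
  note m = sub_minus[OF B, of _ _ u]
  interpret B: ring ?A by (rule sub_ring[OF B u(2) u(2) u])
  show ?thesis
  proof (unfold_locales, goal_cases)
    \<comment> \<open>Cases are numbered like the axioms of \<open>calg\<close>; 20 is completeness,
      which holds since \<open>B\<close> is closed.\<close>
    case (20 \<sigma>)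
    have "\<exists>l\<in>carrier A. \<forall>e>0. \<exists>N. \<forall>n\<ge>N. nrm A (\<sigma> n \<ominus> l) < e"
      by (rule complete) (use 20 Bc m in auto)
    then obtain l where l: "l \<in> carrier A" "\<forall>e>0. \<exists>N. \<forall>n\<ge>N. nrm A (\<sigma> n \<ominus> l) < e" by blast
    have "\<exists>y\<in>B. nrm A (l \<ominus> y) < e" if "0 < e" for e
    proof -
      obtain N where "nrm A (\<sigma> N \<ominus> l) < e" using l(2) \<open>0 < e\<close> by blast
      then show ?thesis using 20(1)[of N] Bc l(1) nrm_minus_commute[of l "\<sigma> N"]
        by (intro bexI[of _ "\<sigma> N"]) auto
    qed
    then have "l \<in> cl A B" using l(1) by (simp add: cl_def)
    then have "l \<in> B" using B by (auto simp: cstar_sub_def)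
    then show ?case using l 20(1) m by (intro bexI[of _ l]) auto
  qed (use B Bc in \<open>auto simp: cstar_sub_def smult_add add_smult smult_smult smult_l smult_r
      star_add star_mult star_smult nrm_zero_iff nrm_add nrm_smult nrm_mult norm_star_sum\<close>)
qed

lemma cl_sub:
  assumes B: "cstar_sub A B" and "Y \<subseteq> B"
  shows "cl (A\<lparr>carrier := B, one := u\<rparr>) Y = cl A Y"
proof -
  have clB: "cl A Y \<subseteq> B" using B cl_mono[OF assms(2)] by (auto simp: cstar_sub_def)
  have BA: "B \<subseteq> carrier A" using B by (simp add: cstar_sub_def)
  have m: "a \<ominus>\<^bsub>A\<lparr>carrier := B, one := u\<rparr>\<^esub> x = a \<ominus> x" if "a \<in> B" "x \<in> Y" for a x
    using sub_minus[OF B that(1)] that(2) assms(2) by blast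
  have "cl (A\<lparr>carrier := B, one := u\<rparr>) Y = {a \<in> B. \<forall>e>0. \<exists>x\<in>Y. nrm A (a \<ominus> x) < e}"
    by (simp add: cl_def m cong: conj_cong bex_cong)
  also have "\<dots> = cl A Y" using clB BA by (auto simp: cl_def)
  finally show ?thesis .
qed

lemma lin_span_sub_eq: "lin_span (A\<lparr>carrier := B, one := u\<rparr>) Y = lin_span A Y"
proof (intro equalityI subsetI)
  fix x assume "x \<in> lin_span (A\<lparr>carrier := B, one := u\<rparr>) Y"
  then show "x \<in> lin_span A Y" by induct (auto intro: lin_span.intros)
next
  fix x assume "x \<in> lin_span A Y"
  then show "x \<in> lin_span (A\<lparr>carrier := B, one := u\<rparr>) Y"
    by induct (use lin_span.zero[of "A\<lparr>carrier := B, one := u\<rparr>"] lin_span.step[of _ _ _ "A\<lparr>carrier := B, one := u\<rparr>"] in auto)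
qed

lemma cstar_gen_sub: "Y \<subseteq> carrier A \<Longrightarrow> cstar_sub A (cstar_gen A Y)"
proof -
  assume Y: "Y \<subseteq> carrier A"
  have A: "cstar_sub A (carrier A)" by (auto simp: cstar_sub_def cl_def)
  have "cl A (cstar_gen A Y) \<subseteq> B" if "cstar_sub A B" "Y \<subseteq> B" for B
  proof -
    have "cstar_gen A Y \<subseteq> B" using that by (auto simp: cstar_gen_def)
    then have "cl A (cstar_gen A Y) \<subseteq> cl A B" by (rule cl_mono)
    then show ?thesis using that by (auto simp: cstar_sub_def)
  qed
  then have "cl A (cstar_gen A Y) \<subseteq> cstar_gen A Y" by (auto simp: cstar_gen_def)
  moreover have "cstar_gen A Y \<subseteq> carrier A" using A Y by (auto simp: cstar_gen_def)
  ultimately show ?thesis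
    unfolding cstar_sub_def by (auto simp: cstar_gen_def cstar_sub_def)
qed

lemma cstar_gen_base: "Y \<subseteq> cstar_gen A Y"
  by (auto simp: cstar_gen_def)

lemma cstar_gen_least: "cstar_sub A B \<Longrightarrow> Y \<subseteq> B \<Longrightarrow> cstar_gen A Y \<subseteq> B"
  by (auto simp: cstar_gen_def)

end

context calg begin

subsection \<open>Inverses and square roots near a projection\<close>

lemma contraction:
  assumes S: "S \<subseteq> carrier A" "S \<noteq> {}" "cl A S \<subseteq> S" and F: "\<And>x. x \<in> S \<Longrightarrow> F x \<in> S" and k: "k < 1"
    and lip: "\<And>x y. x \<in> S \<Longrightarrow> y \<in> S \<Longrightarrow> nrm A (F x \<ominus> F y) \<le> k * nrm A (x \<ominus> y)"
  shows "\<exists>x\<in>S. F x = x"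
proof -
  \<comment> \<open>The default 0 off \<open>S\<close> keeps the distance nonnegative and symmetric
    everywhere, as \<open>Metric_space\<close> demands.\<close>
  define d where "d x y = (if x \<in> S \<and> y \<in> S then nrm A (x \<ominus> y) else 0)" for x y
  have Sc: "\<And>x. x \<in> S \<Longrightarrow> x \<in> carrier A" using S by auto
  interpret M: Metric_space S d
  proof
    fix x y z
    show "0 \<le> d x y" by (simp add: d_def Sc)
    show "d x y = d y x" using nrm_minus_commute Sc by (simp add: d_def)
    assume x: "x \<in> S" "y \<in> S"
    then show "d x y = 0 \<longleftrightarrow> x = y" by (simp add: d_def Sc nrm_zero_iff minus_eq_zero)
    assume "z \<in> S"
    then show "d x z \<le> d x y + d y z" using x nrm_triangle Sc by (simp add: d_def)
  qed
  have "M.mcomplete"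
    unfolding M.mcomplete_def
  proof (intro allI impI)
    fix \<sigma> assume "M.MCauchy \<sigma>"
    then have \<sigma>: "\<And>n. \<sigma> n \<in> S" "\<forall>e>0. \<exists>N. \<forall>n n'. N \<le> n \<longrightarrow> N \<le> n' \<longrightarrow> d (\<sigma> n) (\<sigma> n') < e"
      by (auto simp: M.MCauchy_def)
    then have "\<forall>e>0. \<exists>N. \<forall>m\<ge>N. \<forall>n\<ge>N. nrm A (\<sigma> m \<ominus> \<sigma> n) < e" by (simp add: d_def)
    then obtain l where l: "l \<in> carrier A" "\<forall>e>0. \<exists>N. \<forall>n\<ge>N. nrm A (\<sigma> n \<ominus> l) < e"
      using complete[of \<sigma>] \<sigma>(1) Sc by auto
    have "\<exists>y\<in>S. nrm A (l \<ominus> y) < e" if "0 < e" for e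
    proof -
      obtain N where "nrm A (\<sigma> N \<ominus> l) < e" using l(2) \<open>0 < e\<close> by blast
      then show ?thesis using \<sigma>(1)[of N] Sc l(1) nrm_minus_commute[of l "\<sigma> N"]
        by (intro bexI[of _ "\<sigma> N"]) auto
    qed
    then have "l \<in> S" using l(1) S(3) by (auto simp: cl_def)
    then show "\<exists>x. limitin M.mtopology \<sigma> x sequentially"
      using l \<sigma>(1) by (intro exI[of _ l]) (simp add: M.limit_metric_sequentially d_def)
  qed
  moreover have "d (F x) (F y) \<le> k * d x y" if "x \<in> S" "y \<in> S" for x y
    using that lip F by (simp add: d_def)
  ultimately show ?thesis
    using M.Banach_fixedpoint_thm[of F k] S(2) F k by (metis Pi_I)
qed

text \<open>With \<open>y = h \<ominus> c\<close> the elements \<open>h \<ominus> h y^n\<close> lie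
  in the ideal, because \<open>h \<ominus> y = c\<close> does, and they converge to \<open>h\<close>
  geometrically.\<close>

lemma ideal_near_unit:
  assumes I: "cstar_ideal A I" and h: "h \<in> carrier A" "h \<otimes> h = h"
    and c: "c \<in> I" "h \<otimes> c = c" "nrm A (h \<ominus> c) < 1"
  shows "h \<in> I"
proof -
  interpret I: ideal I A using I by (simp add: cstar_ideal_def)
  have cc: "c \<in> carrier A" using c(1) by (rule I.a_Hcarr)
  define y where "y = h \<ominus> c"
  have y: "y \<in> carrier A" using h cc by (simp add: y_def)
  have hy: "h \<otimes> y = y" using h cc c by (simp add: y_def a_minus_def r_distr r_minus)
  have mem: "h \<ominus> h \<otimes> y [^] (n :: nat) \<in> I" for n
  proof (induct n)
    case 0
    then show ?case using h by (simp add: minus_eq_zero[THEN iffD2])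
  next
    case (Suc n)
    have p: "y [^] n \<in> carrier A" using y by simp
    have "h \<ominus> h \<otimes> y [^] Suc n = (h \<ominus> h \<otimes> y) \<oplus> (h \<ominus> h \<otimes> y [^] n) \<otimes> y"
      using h y p unfolding nat_pow_Suc by algebra
    moreover have "h \<ominus> y = c" using h cc unfolding y_def by algebra
    ultimately show ?case using Suc c y hy I.I_r_closed by simp
  qed
  have pow: "nrm A (h \<otimes> y [^] (n :: nat)) \<le> nrm A h * nrm A y ^ n" for n
  proof (induct n)
    case 0
    then show ?case using h by simp
  next
    case (Suc n)
    have "nrm A (h \<otimes> y [^] Suc n) = nrm A ((h \<otimes> y [^] n) \<otimes> y)" using h y by (simp add: m_assoc)
    also have "\<dots> \<le> nrm A (h \<otimes> y [^] n) * nrm A y" using h y by (intro nrm_mult) auto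
    also have "\<dots> \<le> nrm A h * nrm A y ^ n * nrm A y" using Suc y by (intro mult_right_mono) auto
    finally show ?case by (simp add: mult_ac)
  qed
  have "\<exists>x\<in>I. nrm A (h \<ominus> x) < e" if e: "0 < e" for e
  proof -
    have "(\<lambda>n. nrm A h * nrm A y ^ n) \<longlonglongrightarrow> nrm A h * 0"
      using c(3) y by (intro tendsto_mult tendsto_const LIMSEQ_power_zero) (simp add: y_def)
    then have "\<forall>\<^sub>F n in sequentially. nrm A h * nrm A y ^ n < e" using e by (intro order_tendstoD(2)) auto
    then obtain n where "nrm A h * nrm A y ^ n < e" by (meson eventually_sequentially order_refl)
    moreover have "h \<ominus> (h \<ominus> h \<otimes> y [^] n) = h \<otimes> y [^] n"
      using h(1) nat_pow_closed[OF y, of n] by algebra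
    ultimately show ?thesis using mem[of n] pow[of n] by (intro bexI[of _ "h \<ominus> h \<otimes> y [^] n"]) auto
  qed
  then have "h \<in> cl A I" using h by (simp add: cl_def)
  then show ?thesis using I by (auto simp: cstar_ideal_def)
qed

text \<open>The fixed points of the maps sending \<open>r\<close> to \<open>h + y r\<close> and
  \<open>q\<close> to \<open>h + q y\<close> are a right and a left inverse of \<open>h - y\<close>
  in the corner of \<open>h\<close>, hence equal.\<close>

lemma corner_inverse:
  assumes h: "h \<in> carrier A" "h \<otimes> h = h" and y: "y \<in> carrier A" "h \<otimes> y = y" "y \<otimes> h = y" "nrm A y \<le> 1/2"
  shows "\<exists>r\<in>carrier A. h \<otimes> r = r \<and> r \<otimes> h = r \<and> (h \<ominus> y) \<otimes> r = h \<and> r \<otimes> (h \<ominus> y) = h"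
proof -
  have c: "cl A (carrier A) \<subseteq> carrier A" by (auto simp: cl_def)
  have "\<exists>r\<in>carrier A. h \<oplus> y \<otimes> r = r"
  proof (rule contraction[OF _ _ c, of _ "1/2"])
    fix r s assume rs: "r \<in> carrier A" "s \<in> carrier A"
    have "h \<oplus> y \<otimes> r \<ominus> (h \<oplus> y \<otimes> s) = y \<otimes> (r \<ominus> s)" using h y rs by algebra
    then have "nrm A (h \<oplus> y \<otimes> r \<ominus> (h \<oplus> y \<otimes> s)) \<le> nrm A y * nrm A (r \<ominus> s)" using nrm_mult y rs by simp
    also have "\<dots> \<le> 1/2 * nrm A (r \<ominus> s)" using y rs by (intro mult_right_mono) auto
    finally show "nrm A (h \<oplus> y \<otimes> r \<ominus> (h \<oplus> y \<otimes> s)) \<le> 1/2 * nrm A (r \<ominus> s)" .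
  qed (use h y in auto)
  then obtain r where r: "r \<in> carrier A" "h \<oplus> y \<otimes> r = r" by blast
  have "\<exists>r\<in>carrier A. h \<oplus> r \<otimes> y = r"
  proof (rule contraction[OF _ _ c, of _ "1/2"])
    fix r s assume rs: "r \<in> carrier A" "s \<in> carrier A"
    have "h \<oplus> r \<otimes> y \<ominus> (h \<oplus> s \<otimes> y) = (r \<ominus> s) \<otimes> y" using h y rs by algebra
    then have "nrm A (h \<oplus> r \<otimes> y \<ominus> (h \<oplus> s \<otimes> y)) \<le> nrm A (r \<ominus> s) * nrm A y" using nrm_mult y rs by simp
    also have "\<dots> \<le> nrm A (r \<ominus> s) * (1/2)" using y rs by (intro mult_left_mono) auto
    finally show "nrm A (h \<oplus> r \<otimes> y \<ominus> (h \<oplus> s \<otimes> y)) \<le> 1/2 * nrm A (r \<ominus> s)" by simp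
  qed (use h y in auto)
  then obtain q where q: "q \<in> carrier A" "h \<oplus> q \<otimes> y = q" by blast
  have hr: "h \<otimes> r = r"
  proof -
    have "h \<otimes> r = h \<otimes> (h \<oplus> y \<otimes> r)" by (simp only: r(2))
    also have "\<dots> = h \<oplus> y \<otimes> r" using h y r(1) by (simp add: r_distr m_assoc[symmetric])
    finally show ?thesis by (simp only: r(2))
  qed
  have qh: "q \<otimes> h = q"
  proof -
    have "q \<otimes> h = (h \<oplus> q \<otimes> y) \<otimes> h" by (simp only: q(2))
    also have "\<dots> = h \<oplus> q \<otimes> y" using h y q(1) by (simp add: l_distr m_assoc)
    finally show ?thesis by (simp only: q(2))
  qed
  have 1: "(h \<ominus> y) \<otimes> r = h"
  proof -
    have "(h \<ominus> y) \<otimes> r = h \<otimes> r \<ominus> y \<otimes> r" using h y r(1) by algebra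
    also have "\<dots> = (h \<oplus> y \<otimes> r) \<ominus> y \<otimes> r" by (simp only: hr r(2))
    also have "\<dots> = h" using h y r(1) by algebra
    finally show ?thesis .
  qed
  have 2: "q \<otimes> (h \<ominus> y) = h"
  proof -
    have "q \<otimes> (h \<ominus> y) = q \<otimes> h \<ominus> q \<otimes> y" using h y q(1) by algebra
    also have "\<dots> = (h \<oplus> q \<otimes> y) \<ominus> q \<otimes> y" by (simp only: qh q(2))
    also have "\<dots> = h" using h y q(1) by algebra
    finally show ?thesis .
  qed
  have "q \<otimes> h = q \<otimes> ((h \<ominus> y) \<otimes> r)" by (simp only: 1)
  also have "\<dots> = h \<otimes> r" using q(1) h y r(1) 2 by (simp add: m_assoc[symmetric])
  finally have "q = r" by (simp only: qh hr)
  then show ?thesis using r hr qh 1 2 by blast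
qed

text \<open>A fixed point \<open>u\<close> of the map sending \<open>u\<close> to
  \<open>(y + u u) / 2\<close> satisfies \<open>u u = 2 u - y\<close>, so \<open>h - u\<close>
  squares to \<open>h - y\<close>. On the selfadjoint elements of the corner of norm at most 1/2 the
  map is a contraction with factor 1/2, and 3/4 is the largest norm of \<open>y\<close> for which
  the estimate keeps this radius: (3/4 + 1/4) / 2 = 1/2.\<close>

lemma corner_sqrt:
  assumes h: "h \<in> carrier A" "h \<otimes> h = h" "star A h = h"
    and y: "y \<in> carrier A" "h \<otimes> y = y" "y \<otimes> h = y" "star A y = y" "nrm A y \<le> 3/4"
  shows "\<exists>t\<in>carrier A. star A t = t \<and> h \<otimes> t = t \<and> t \<otimes> h = t \<and> t \<otimes> t = h \<ominus> y"
proof -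
  let ?S = "{u \<in> carrier A. star A u = u \<and> h \<otimes> u = u \<and> u \<otimes> h = u \<and> nrm A u \<le> 1/2}"
  let ?F = "\<lambda>u. (1/2) \<odot> (y \<oplus> u \<otimes> u)"
  have cl: "cl A ?S \<subseteq> ?S"
  proof
    fix a assume a: "a \<in> cl A ?S"
    then have ac: "a \<in> carrier A" using cl_carrier by auto
    have ap: "\<exists>u\<in>?S. nrm A (a \<ominus> u) < e" if "0 < e" for e using cl_approx[OF a that] .
    \<comment> \<open>Each equation defining \<open>?S\<close> says that a Lipschitz map fixes
      \<open>u\<close>, and such an equation passes to limits.\<close>
    have lin: "f a = a" if f: "\<And>u. u \<in> carrier A \<Longrightarrow> f u \<in> carrier A"
        "\<And>u. u \<in> carrier A \<Longrightarrow> nrm A (f a \<ominus> f u) \<le> k * nrm A (a \<ominus> u)" "0 \<le> k"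
        "\<And>u. u \<in> ?S \<Longrightarrow> f u = u" for f k
    proof (rule eq_if_close)
      fix e :: real assume e: "0 < e"
      then obtain u where u: "u \<in> ?S" "nrm A (a \<ominus> u) < e / (k + 1)" using ap[of "e / (k + 1)"] f(3) by auto
      then have uc: "u \<in> carrier A" by simp
      have "nrm A (f a \<ominus> a) \<le> nrm A (f a \<ominus> f u) + nrm A (f u \<ominus> a)"
        using nrm_triangle ac uc f(1) by blast
      also have "\<dots> \<le> k * nrm A (a \<ominus> u) + nrm A (a \<ominus> u)"
        using f(2)[OF uc] f(4)[OF u(1)] nrm_minus_commute[OF ac uc] by simp
      also have "\<dots> = (k + 1) * nrm A (a \<ominus> u)" by (simp add: algebra_simps)
      also have "\<dots> \<le> e" using u(2) f(3) by (simp add: pos_less_divide_eq mult.commute less_imp_le)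
      finally show "nrm A (f a \<ominus> a) \<le> e" .
    qed (use ac f in auto)
    have "star A a = a" by (rule lin[of _ 1]) (use ac in \<open>auto simp flip: star_minus\<close>)
    moreover have "h \<otimes> a = a"
    proof (rule lin[of _ "nrm A h"])
      fix u assume u: "u \<in> carrier A"
      have "h \<otimes> a \<ominus> h \<otimes> u = h \<otimes> (a \<ominus> u)" using h ac u by algebra
      then show "nrm A (h \<otimes> a \<ominus> h \<otimes> u) \<le> nrm A h * nrm A (a \<ominus> u)" using nrm_mult h ac u by simp
    qed (use h in auto)
    moreover have "a \<otimes> h = a"
    proof (rule lin[of _ "nrm A h"])
      fix u assume u: "u \<in> carrier A"
      have "a \<otimes> h \<ominus> u \<otimes> h = (a \<ominus> u) \<otimes> h" using h ac u by algebra
      then show "nrm A (a \<otimes> h \<ominus> u \<otimes> h) \<le> nrm A h * nrm A (a \<ominus> u)"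
        using nrm_mult[of "a \<ominus> u" h] h ac u by (simp add: mult.commute)
    qed (use h in auto)
    moreover have "nrm A a \<le> 1/2"
    proof (rule field_le_epsilon)
      fix e :: real assume "0 < e"
      then obtain u where "u \<in> ?S" "nrm A (a \<ominus> u) < e" using ap by blast
      then show "nrm A a \<le> 1/2 + e" using nrm_le_minus[OF ac, of u] by simp
    qed
    ultimately show "a \<in> ?S" using ac by simp
  qed
  have "\<exists>u\<in>?S. ?F u = u"
  proof (rule contraction[OF _ _ cl, of _ "1/2"])
    have "\<zero> \<in> ?S" using h by simp
    then show "?S \<noteq> {}" by blast
    fix u assume u: "u \<in> ?S"
    have "nrm A (y \<oplus> u \<otimes> u) \<le> nrm A y + nrm A u * nrm A u"
      using nrm_add[of y "u \<otimes> u"] nrm_mult[of u u] u y by simp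
    also have "\<dots> \<le> 3/4 + 1/2 * (1/2)" using y u by (intro add_mono mult_mono) auto
    finally have "nrm A (?F u) \<le> 1/2" using u y by (simp add: nrm_smult norm_divide)
    moreover have "h \<otimes> ?F u = ?F u" using h y u by (simp add: smult_r r_distr m_assoc[symmetric])
    moreover have "?F u \<otimes> h = ?F u" using h y u by (simp add: smult_l l_distr m_assoc)
    moreover have "star A (?F u) = ?F u" using y u by (simp add: star_smult star_add star_mult)
    ultimately show "?F u \<in> ?S" using u y by simp
    fix v assume v: "v \<in> ?S"
    have uv: "u \<in> carrier A" "v \<in> carrier A" "y \<in> carrier A" using u v y by auto
    have "(y \<oplus> u \<otimes> u) \<ominus> (y \<oplus> v \<otimes> v) = u \<otimes> u \<ominus> v \<otimes> v" using uv by algebra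
    then have "nrm A ((y \<oplus> u \<otimes> u) \<ominus> (y \<oplus> v \<otimes> v)) \<le> nrm A u * nrm A (u \<ominus> v) + nrm A (u \<ominus> v) * nrm A v"
      using nrm_mult_diff[of u u v v] uv by simp
    also have "\<dots> \<le> 1/2 * nrm A (u \<ominus> v) + nrm A (u \<ominus> v) * (1/2)"
      using u v by (intro add_mono mult_mono) auto
    finally have "nrm A ((y \<oplus> u \<otimes> u) \<ominus> (y \<oplus> v \<otimes> v)) \<le> nrm A (u \<ominus> v)" by simp
    then show "nrm A (?F u \<ominus> ?F v) \<le> 1/2 * nrm A (u \<ominus> v)"
      using uv by (simp add: nrm_smult norm_divide flip: smult_minus)
  qed auto
  then obtain u where u: "u \<in> ?S" "?F u = u" by blast
  have uc: "u \<in> carrier A" using u by simp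
  have "2 \<odot> ?F u = 2 \<odot> u" by (simp only: u(2))
  then have e: "y \<oplus> u \<otimes> u = u \<oplus> u" using uc y add_smult[OF uc, of 1 1] by (simp add: smult_smult)
  have "(h \<ominus> u) \<otimes> (h \<ominus> u) = h \<otimes> h \<ominus> (h \<otimes> u \<oplus> u \<otimes> h) \<oplus> u \<otimes> u" using h uc by algebra
  also have "\<dots> = h \<ominus> (u \<oplus> u) \<oplus> u \<otimes> u" using u h by simp
  also have "\<dots> = h \<ominus> (y \<oplus> u \<otimes> u) \<oplus> u \<otimes> u" by (simp only: e)
  also have "\<dots> = h \<ominus> y" using h y uc by algebra
  finally have "(h \<ominus> u) \<otimes> (h \<ominus> u) = h \<ominus> y" .
  moreover have "h \<otimes> (h \<ominus> u) = h \<ominus> u" using h u by (simp add: a_minus_def r_distr r_minus)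
  moreover have "(h \<ominus> u) \<otimes> h = h \<ominus> u" using h u by (simp add: a_minus_def l_distr l_minus)
  ultimately show ?thesis using h u by (intro bexI[of _ "h \<ominus> u"]) (auto simp: star_minus)
qed

text \<open>The element is \<open>t r\<close>, with \<open>t\<close> the square root and
  \<open>r\<close> the inverse of \<open>h - y\<close> in the corner. As \<open>t r\<close> is a
  right and \<open>r t\<close> a left inverse of \<open>t\<close>, the two factors commute, and this
  makes the product selfadjoint.\<close>

lemma corner_inverse_sqrt:
  assumes h: "h \<in> carrier A" "h \<otimes> h = h" "star A h = h"
    and y: "y \<in> carrier A" "h \<otimes> y = y" "y \<otimes> h = y" "star A y = y" "nrm A y \<le> 1/2"
  shows "\<exists>s\<in>carrier A. star A s = s \<and> h \<otimes> s = s \<and> s \<otimes> h = s \<and> s \<otimes> (h \<ominus> y) \<otimes> s = h"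
proof -
  have "nrm A y \<le> 3/4" using y(5) by linarith
  then obtain t where t: "t \<in> carrier A" "star A t = t" "h \<otimes> t = t" "t \<otimes> h = t" "t \<otimes> t = h \<ominus> y"
    using corner_sqrt[OF h y(1-4)] by blast
  obtain r where r: "r \<in> carrier A" "h \<otimes> r = r" "r \<otimes> h = r" "(h \<ominus> y) \<otimes> r = h" "r \<otimes> (h \<ominus> y) = h"
    using corner_inverse[OF h(1,2) y(1,2,3,5)] by blast
  have a: "t \<otimes> (t \<otimes> r) = h" using t(1) r(1) by (simp add: m_assoc[symmetric] t(5) r(4))
  have b: "(r \<otimes> t) \<otimes> t = h" using t(1) r(1) by (simp add: m_assoc t(5) r(5))
  have "r \<otimes> t = (r \<otimes> t) \<otimes> (t \<otimes> (t \<otimes> r))" unfolding a using h(1) t(1,4) r(1) by (simp add: m_assoc)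
  also have "\<dots> = ((r \<otimes> t) \<otimes> t) \<otimes> (t \<otimes> r)" using t(1) r(1) by (simp add: m_assoc)
  also have "\<dots> = t \<otimes> r" unfolding b using h t r by (simp add: m_assoc[symmetric])
  finally have rt: "r \<otimes> t = t \<otimes> r" .
  have hy: "star A (h \<ominus> y) = h \<ominus> y" using h y by (simp add: star_minus)
  have sr: "star A r = r"
  proof -
    have "star A r \<otimes> (h \<ominus> y) = star A ((h \<ominus> y) \<otimes> r)" using h y r(1) hy by (simp add: star_mult)
    then have e: "star A r \<otimes> (h \<ominus> y) = h" using r(4) h by simp
    have "star A r \<otimes> h = star A (h \<otimes> r)" using h(1,3) r(1) by (simp add: star_mult)
    then have "star A r = star A r \<otimes> h" using r(2) by simp
    also have "\<dots> = star A r \<otimes> ((h \<ominus> y) \<otimes> r)" by (simp only: r(4))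
    also have "\<dots> = h \<otimes> r" using h y r(1) e by (simp add: m_assoc[symmetric])
    finally show ?thesis using r(2) by simp
  qed
  define s where "s = t \<otimes> r"
  have s: "s \<in> carrier A" "star A s = s" using t(1,2) r(1) sr rt by (auto simp: s_def star_mult)
  have "s \<otimes> (h \<ominus> y) \<otimes> s = (s \<otimes> t) \<otimes> (t \<otimes> s)" using s(1) t(1) by (simp add: t(5)[symmetric] m_assoc)
  also have "\<dots> = h" using a b rt h by (simp add: s_def)
  finally have "s \<otimes> (h \<ominus> y) \<otimes> s = h" .
  moreover have "h \<otimes> s = s" using h t r by (simp add: s_def m_assoc[symmetric])
  moreover have "s \<otimes> h = s" using h t r by (simp add: s_def m_assoc)
  ultimately show ?thesis using s by blast
qed

end

subsection \<open>Homomorphisms are bounded\<close>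

locale calg_pair = A: calg A + B: calg B for A :: "'a cstar" and B :: "'b cstar"
begin

lemma star_homD:
  assumes "star_hom A B f"
  shows "x \<in> carrier A \<Longrightarrow> f x \<in> carrier B"
    and "x \<in> carrier A \<Longrightarrow> y \<in> carrier A \<Longrightarrow> f (x \<otimes>\<^bsub>A\<^esub> y) = f x \<otimes>\<^bsub>B\<^esub> f y"
    and "x \<in> carrier A \<Longrightarrow> y \<in> carrier A \<Longrightarrow> f (x \<oplus>\<^bsub>A\<^esub> y) = f x \<oplus>\<^bsub>B\<^esub> f y"
    and "f \<one>\<^bsub>A\<^esub> = \<one>\<^bsub>B\<^esub>"
    and "x \<in> carrier A \<Longrightarrow> f (star A x) = star B (f x)"
    and "x \<in> carrier A \<Longrightarrow> f (c \<odot>\<^bsub>A\<^esub> x) = c \<odot>\<^bsub>B\<^esub> f x"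
  using assms by (auto simp: star_hom_def ring_hom_def)

lemma star_hom_zero: "star_hom A B f \<Longrightarrow> f \<zero>\<^bsub>A\<^esub> = \<zero>\<^bsub>B\<^esub>"
  using star_homD(6)[of f "\<zero>\<^bsub>A\<^esub>" 0] star_homD(1)[of f "\<zero>\<^bsub>A\<^esub>"] by simp

lemma star_hom_minus:
  "star_hom A B f \<Longrightarrow> x \<in> carrier A \<Longrightarrow> y \<in> carrier A \<Longrightarrow> f (x \<ominus>\<^bsub>A\<^esub> y) = f x \<ominus>\<^bsub>B\<^esub> f y"
  by (simp add: A.minus_smult B.minus_smult star_homD)

text \<open>The constant 2 is not optimal, but it spares the continuous functional calculus: after scaling,
  \<open>1 - a\<^sup>*a\<close> has a square root given by a contraction.\<close>

lemma star_hom_bounded: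
  assumes f: "star_hom A B f" and a: "a \<in> carrier A"
  shows "nrm B (f a) \<le> 2 * nrm A a"
proof (cases "a = \<zero>\<^bsub>A\<^esub>")
  case True
  then show ?thesis by (simp add: star_hom_zero[OF f])
next
  case False
  note hom = star_homD[OF f]
  define c :: complex where "c = of_real (1 / (2 * nrm A a))"
  define b where "b = c \<odot>\<^bsub>A\<^esub> a"
  have n: "0 < nrm A a" using A.nrm_pos[OF a False] .
  have b: "b \<in> carrier A" "nrm A b = 1/2" using a n by (auto simp: b_def c_def A.nrm_smult norm_divide norm_mult)
  define y where "y = star A b \<otimes>\<^bsub>A\<^esub> b"
  have y: "y \<in> carrier A" "star A y = y" using b(1) by (simp_all add: y_def A.star_mult)
  have "nrm A y = (1/2)\<^sup>2" unfolding y_def A.cstar_identity[OF b(1)] b(2) ..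
  then have y34: "nrm A y \<le> 3/4" by (simp add: power2_eq_square)
  obtain t where t: "t \<in> carrier A" "star A t = t" "t \<otimes>\<^bsub>A\<^esub> t = \<one>\<^bsub>A\<^esub> \<ominus>\<^bsub>A\<^esub> y"
    using A.corner_sqrt[of "\<one>\<^bsub>A\<^esub>" y] y y34 by auto
  have "y \<oplus>\<^bsub>A\<^esub> star A t \<otimes>\<^bsub>A\<^esub> t = \<one>\<^bsub>A\<^esub>" unfolding t(2,3) using y(1) A.one_closed by algebra
  then have "f (star A b \<otimes>\<^bsub>A\<^esub> b \<oplus>\<^bsub>A\<^esub> star A t \<otimes>\<^bsub>A\<^esub> t) = \<one>\<^bsub>B\<^esub>" using hom(4) by (simp add: y_def)
  then have e: "star B (f b) \<otimes>\<^bsub>B\<^esub> f b \<oplus>\<^bsub>B\<^esub> star B (f t) \<otimes>\<^bsub>B\<^esub> f t = \<one>\<^bsub>B\<^esub>" using b t(1) by (simp add: hom)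
  \<comment> \<open>The unit of \<open>B\<close> is the sum in \<open>e\<close> of the terms of
    \<open>f b\<close> and \<open>f t\<close>, so \<open>norm_star_sum\<close> bounds
    \<open>f b\<close> by the norm of the unit.\<close>
  have "(nrm B (f b))\<^sup>2 \<le> 1"
    using B.norm_star_sum[of "f b" "f t"] hom(1) b t(1) e B.nrm_one_le by simp
  then have "nrm B (f b) \<le> 1" using hom(1)[OF b(1)] by (simp add: power2_le_iff_abs_le abs_square_le_1)
  moreover have "nrm B (f b) = nrm B (f a) / (2 * nrm A a)"
    using a n hom(1)[OF a] by (simp add: b_def hom c_def B.nrm_smult norm_divide norm_mult)
  ultimately show ?thesis using n by (simp add: pos_divide_le_eq)
qed

lemma star_hom_cl:
  assumes f: "star_hom A B f" and Y: "Y \<subseteq> carrier A" and a: "a \<in> cl A Y"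
  shows "f a \<in> cl B (f ` Y)"
proof -
  have ac: "a \<in> carrier A" using a A.cl_carrier by auto
  have "\<exists>y\<in>f ` Y. nrm B (f a \<ominus>\<^bsub>B\<^esub> y) < e" if "0 < e" for e
  proof -
    obtain y where y: "y \<in> Y" "nrm A (a \<ominus>\<^bsub>A\<^esub> y) < e / 2" using A.cl_approx[OF a half_gt_zero] \<open>0 < e\<close> by blast
    have yc: "y \<in> carrier A" using y Y by auto
    have "nrm B (f a \<ominus>\<^bsub>B\<^esub> f y) \<le> 2 * nrm A (a \<ominus>\<^bsub>A\<^esub> y)"
      using star_hom_bounded[OF f, of "a \<ominus>\<^bsub>A\<^esub> y"] ac yc by (simp add: star_hom_minus[OF f])
    then show ?thesis using y by (intro bexI[of _ "f y"]) auto
  qed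
  then show ?thesis using star_homD(1)[OF f ac] by (simp add: cl_def)
qed

text \<open>Closed because homomorphisms are bounded. Homomorphisms that agree on generators are
  compared through this subalgebra.\<close>

lemma cstar_sub_equalizer:
  assumes f: "star_hom A B f" and g: "star_hom A B g"
  shows "cstar_sub A {a \<in> carrier A. f a = g a}" (is "cstar_sub A ?E")
proof -
  have "a \<in> ?E" if a: "a \<in> cl A ?E" for a
  proof -
    have ac: "a \<in> carrier A" using a A.cl_carrier by auto
    have "f a = g a"
    proof (rule B.eq_if_close)
      fix e :: real assume e: "0 < e"
      obtain y where y: "y \<in> ?E" "nrm A (a \<ominus>\<^bsub>A\<^esub> y) < e / 4" using A.cl_approx[OF a, of "e/4"] e by auto
      have yc: "y \<in> carrier A" "f y = g y" using y by auto
      have "nrm B (f a \<ominus>\<^bsub>B\<^esub> g a) \<le> nrm B (f a \<ominus>\<^bsub>B\<^esub> f y) + nrm B (g y \<ominus>\<^bsub>B\<^esub> g a)"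
        using B.nrm_triangle[of "f a" "f y" "g a"] yc ac star_homD(1)[OF f] star_homD(1)[OF g] by simp
      also have "\<dots> \<le> 2 * nrm A (a \<ominus>\<^bsub>A\<^esub> y) + 2 * nrm A (y \<ominus>\<^bsub>A\<^esub> a)"
        using star_hom_bounded[OF f, of "a \<ominus>\<^bsub>A\<^esub> y"] star_hom_bounded[OF g, of "y \<ominus>\<^bsub>A\<^esub> a"] ac yc
        by (simp add: star_hom_minus[OF f] star_hom_minus[OF g])
      also have "\<dots> \<le> e" using y A.nrm_minus_commute[OF ac yc(1)] by simp
      finally show "nrm B (f a \<ominus>\<^bsub>B\<^esub> g a) \<le> e" .
    qed (use ac star_homD(1)[OF f] star_homD(1)[OF g] in auto)
    then show ?thesis using ac by simp
  qed
  then have "cl A ?E \<subseteq> ?E" by blast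
  then show ?thesis
    unfolding cstar_sub_def using star_homD[OF f] star_homD[OF g] star_hom_zero[OF f] star_hom_zero[OF g] by auto
qed

lemma star_hom_eqI:
  assumes "star_hom A B f" "star_hom A B g" "\<And>x. x \<in> carrier A \<Longrightarrow> f x = g x"
  shows "f = g"
  using assms unfolding star_hom_def by (metis extensionalityI)

end

subsection \<open>Graphs of bounded linear relations\<close>

text \<open>Its elements are used as pairs of a linear relation: a map prescribed on generators is
  obtained by closing, in this product, the span of its graph.\<close>

definition prod_cstar :: "'a cstar \<Rightarrow> 'b cstar \<Rightarrow> ('a \<times> 'b) cstar" where
  "prod_cstar A B = \<lparr>carrier = carrier A \<times> carrier B,
     mult = (\<lambda>(a, b) (c, d). (a \<otimes>\<^bsub>A\<^esub> c, b \<otimes>\<^bsub>B\<^esub> d)), one = (\<one>\<^bsub>A\<^esub>, \<one>\<^bsub>B\<^esub>), zero = (\<zero>\<^bsub>A\<^esub>, \<zero>\<^bsub>B\<^esub>),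
     add = (\<lambda>(a, b) (c, d). (a \<oplus>\<^bsub>A\<^esub> c, b \<oplus>\<^bsub>B\<^esub> d)), smult = (\<lambda>c (a, b). (c \<odot>\<^bsub>A\<^esub> a, c \<odot>\<^bsub>B\<^esub> b)),
     star = (\<lambda>(a, b). (star A a, star B b)), nrm = (\<lambda>(a, b). max (nrm A a) (nrm B b))\<rparr>"

context calg_pair begin

abbreviation "AB \<equiv> prod_cstar A B"

lemma prod_simps [simp]:
  "carrier AB = carrier A \<times> carrier B" "(a, b) \<otimes>\<^bsub>AB\<^esub> (c, d) = (a \<otimes>\<^bsub>A\<^esub> c, b \<otimes>\<^bsub>B\<^esub> d)"
  "\<one>\<^bsub>AB\<^esub> = (\<one>\<^bsub>A\<^esub>, \<one>\<^bsub>B\<^esub>)" "\<zero>\<^bsub>AB\<^esub> = (\<zero>\<^bsub>A\<^esub>, \<zero>\<^bsub>B\<^esub>)" "(a, b) \<oplus>\<^bsub>AB\<^esub> (c, d) = (a \<oplus>\<^bsub>A\<^esub> c, b \<oplus>\<^bsub>B\<^esub> d)"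
  "z \<odot>\<^bsub>AB\<^esub> (a, b) = (z \<odot>\<^bsub>A\<^esub> a, z \<odot>\<^bsub>B\<^esub> b)" "star AB (a, b) = (star A a, star B b)"
  "nrm AB (a, b) = max (nrm A a) (nrm B b)"
  by (simp_all add: prod_cstar_def)

lemma prod_ring: "ring AB"
proof -
  have "abelian_group AB"
    by (rule abelian_groupI)
      (auto simp: A.a_assoc B.a_assoc intro: A.a_comm B.a_comm intro!: bexI[of _ "(\<ominus>\<^bsub>A\<^esub> _, \<ominus>\<^bsub>B\<^esub> _)"] A.l_neg B.l_neg)
  then show ?thesis
    by (rule ringI) (auto intro!: monoidI simp: A.m_assoc B.m_assoc A.l_distr B.l_distr A.r_distr B.r_distr)
qed

lemma prod_minus:
  assumes "a \<in> carrier A" "b \<in> carrier B" "c \<in> carrier A" "d \<in> carrier B"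
  shows "(a, b) \<ominus>\<^bsub>AB\<^esub> (c, d) = (a \<ominus>\<^bsub>A\<^esub> c, b \<ominus>\<^bsub>B\<^esub> d)"
proof -
  interpret ring AB by (rule prod_ring)
  have "\<ominus>\<^bsub>AB\<^esub> (c, d) = (\<ominus>\<^bsub>A\<^esub> c, \<ominus>\<^bsub>B\<^esub> d)"
    by (rule minus_equality) (use assms in \<open>auto simp: A.l_neg B.l_neg\<close>)
  then show ?thesis by (simp add: a_minus_def)
qed

lemma prod_calg: "calg AB"
proof -
  interpret ring AB by (rule prod_ring)
  show ?thesis
  proof (unfold_locales, goal_cases)
    case (19 x s)
    obtain a b c d where x: "x = (a, b)" "s = (c, d)" by fastforce
    show ?case using 19 x A.norm_star_sum[of a c] B.norm_star_sum[of b d]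
      by (auto simp: max_def)
  next
    case (20 \<sigma>)
    have c: "fst (\<sigma> n) \<in> carrier A" "snd (\<sigma> n) \<in> carrier B" for n using 20(1)[of n] by auto
    have n: "nrm AB (\<sigma> m \<ominus>\<^bsub>AB\<^esub> (a, b)) = max (nrm A (fst (\<sigma> m) \<ominus>\<^bsub>A\<^esub> a)) (nrm B (snd (\<sigma> m) \<ominus>\<^bsub>B\<^esub> b))"
      if "a \<in> carrier A" "b \<in> carrier B" for m a b
      using prod_minus[of "fst (\<sigma> m)" "snd (\<sigma> m)" a b] c that by (simp del: prod_simps(1) add: prod_simps(8))
    have n2: "nrm AB (\<sigma> m \<ominus>\<^bsub>AB\<^esub> \<sigma> k) = max (nrm A (fst (\<sigma> m) \<ominus>\<^bsub>A\<^esub> fst (\<sigma> k))) (nrm B (snd (\<sigma> m) \<ominus>\<^bsub>B\<^esub> snd (\<sigma> k)))" for m k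
      using n[OF c(1)[of k] c(2)[of k], of m] by simp
    have "\<forall>e>0. \<exists>N. \<forall>m\<ge>N. \<forall>n\<ge>N. nrm A (fst (\<sigma> m) \<ominus>\<^bsub>A\<^esub> fst (\<sigma> n)) < e"
      "\<forall>e>0. \<exists>N. \<forall>m\<ge>N. \<forall>n\<ge>N. nrm B (snd (\<sigma> m) \<ominus>\<^bsub>B\<^esub> snd (\<sigma> n)) < e"
      using 20(2) unfolding n2 max_less_iff_conj by blast+
    then obtain a b where a: "a \<in> carrier A" "\<forall>e>0. \<exists>N. \<forall>n\<ge>N. nrm A (fst (\<sigma> n) \<ominus>\<^bsub>A\<^esub> a) < e"
      and b: "b \<in> carrier B" "\<forall>e>0. \<exists>N. \<forall>n\<ge>N. nrm B (snd (\<sigma> n) \<ominus>\<^bsub>B\<^esub> b) < e"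
      using A.complete[of "\<lambda>n. fst (\<sigma> n)"] B.complete[of "\<lambda>n. snd (\<sigma> n)"] c by blast
    have "\<exists>N. \<forall>n\<ge>N. nrm AB (\<sigma> n \<ominus>\<^bsub>AB\<^esub> (a, b)) < e" if e: "0 < e" for e
    proof -
      obtain N M where "\<forall>n\<ge>N. nrm A (fst (\<sigma> n) \<ominus>\<^bsub>A\<^esub> a) < e" "\<forall>n\<ge>M. nrm B (snd (\<sigma> n) \<ominus>\<^bsub>B\<^esub> b) < e"
        using a(2) b(2) e by meson
      then show ?thesis unfolding n[OF a(1) b(1)] by (intro exI[of _ "max N M"]) simp
    qed
    then show ?case using a(1) b(1) by (intro bexI[of _ "(a, b)"]) auto
  next
    case (15 x y) then show ?case using A.nrm_add B.nrm_add by (cases x; cases y) (fastforce simp: max_def)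
  next
    case (17 x y)
    obtain a b c d where x: "x = (a, b)" "y = (c, d)" by fastforce
    have "nrm A a * nrm A c \<le> max (nrm A a) (nrm B b) * max (nrm A c) (nrm B d)"
      "nrm B b * nrm B d \<le> max (nrm A a) (nrm B b) * max (nrm A c) (nrm B d)"
      using 17 x by (auto intro!: mult_mono simp: le_max_iff_disj)
    then show ?case using 17 x A.nrm_mult[of a c] B.nrm_mult[of b d] by auto
  next
    case (14 x)
    obtain a b where x: "x = (a, b)" by fastforce
    have "0 \<le> nrm A a" "0 \<le> nrm B b" using 14 x by auto
    then have "max (nrm A a) (nrm B b) = 0 \<longleftrightarrow> nrm A a = 0 \<and> nrm B b = 0" by (auto simp: max_def)
    then show ?case using 14 x by (auto simp: A.nrm_zero_iff B.nrm_zero_iff)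
  qed (auto simp: A.smult_add B.smult_add A.add_smult B.add_smult A.smult_smult B.smult_smult A.smult_l B.smult_l
      A.smult_r B.smult_r A.star_add B.star_add A.star_mult B.star_mult A.star_smult B.star_smult A.nrm_smult
      B.nrm_smult le_max_iff_disj max_mult_distrib_left)
qed

sublocale AB: calg AB
  by (rule prod_calg)

context
  fixes Y :: "('a \<times> 'b) set" and C :: real
  assumes Y: "Y \<subseteq> carrier AB" and C: "0 \<le> C"
    and bound: "\<And>a b. (a, b) \<in> lin_span AB Y \<Longrightarrow> nrm B b \<le> C * nrm A a"
begin

lemma graph_bound:
  assumes ab: "(a, b) \<in> cl AB (lin_span AB Y)"
  shows "nrm B b \<le> C * nrm A a"
proof (rule field_le_epsilon)
  fix e :: real assume e: "0 < e"
  have abc: "a \<in> carrier A" "b \<in> carrier B" using ab AB.cl_carrier by auto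
  have p: "0 < e / (C + 1)" using e C by simp
  obtain a' b' where y: "(a', b') \<in> lin_span AB Y" "nrm AB ((a, b) \<ominus>\<^bsub>AB\<^esub> (a', b')) < e / (C + 1)"
    using AB.cl_approx[OF ab p] by auto
  then have yc: "a' \<in> carrier A" "b' \<in> carrier B" using AB.lin_span_carrier[OF Y] by fastforce+
  then have d: "nrm A (a \<ominus>\<^bsub>A\<^esub> a') < e / (C + 1)" "nrm B (b \<ominus>\<^bsub>B\<^esub> b') < e / (C + 1)"
    using y(2) abc by (auto simp: prod_minus)
  have "nrm B b \<le> nrm B (b \<ominus>\<^bsub>B\<^esub> b') + nrm B b'" using B.nrm_le_minus abc yc by blast
  also have "\<dots> \<le> e / (C + 1) + C * nrm A a'" using d bound[OF y(1)] by linarith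
  also have "\<dots> \<le> e / (C + 1) + C * (e / (C + 1) + nrm A a)"
    using A.nrm_le_minus[OF yc(1) abc(1)] A.nrm_minus_commute[OF abc(1) yc(1)] d(1) C
    by (intro add_left_mono mult_left_mono) auto
  also have "\<dots> = C * nrm A a + (C + 1) * (e / (C + 1))" unfolding distrib_left distrib_right by simp
  also have "(C + 1) * (e / (C + 1)) = e" using C by simp
  finally show "nrm B b \<le> C * nrm A a + e" .
qed

text \<open>The difference of two values is related to zero, hence bounded by \<open>C\<close> times
  zero.\<close>

lemma graph_unique:
  assumes "(a, b) \<in> cl AB (lin_span AB Y)" "(a, b') \<in> cl AB (lin_span AB Y)"
  shows "b = b'"
proof -
  have s: "lin_span AB Y \<subseteq> carrier AB" using AB.lin_span_carrier[OF Y] by blast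
  have c: "a \<in> carrier A" "b \<in> carrier B" "b' \<in> carrier B" using assms AB.cl_carrier by auto
  have "(-1) \<odot>\<^bsub>AB\<^esub> (a, b') \<in> cl AB (lin_span AB Y)"
    using AB.cl_smult[OF s AB.lin_span_smult[OF Y] assms(2)] .
  from AB.cl_add[OF s AB.lin_span_add[OF Y] assms(1) this]
  have "(a, b) \<oplus>\<^bsub>AB\<^esub> (-1) \<odot>\<^bsub>AB\<^esub> (a, b') \<in> cl AB (lin_span AB Y)" .
  then have "(a \<ominus>\<^bsub>A\<^esub> a, b \<ominus>\<^bsub>B\<^esub> b') \<in> cl AB (lin_span AB Y)"
    using c by (simp add: A.minus_smult B.minus_smult)
  then have "nrm B (b \<ominus>\<^bsub>B\<^esub> b') \<le> 0" using graph_bound c by (fastforce simp: A.minus_eq_zero[THEN iffD2])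
  then have "nrm B (b \<ominus>\<^bsub>B\<^esub> b') = 0" using B.nrm_nonneg[OF B.minus_closed[OF c(2,3)]] by linarith
  then show ?thesis using c B.nrm_zero_iff[of "b \<ominus>\<^bsub>B\<^esub> b'"] B.minus_eq_zero by simp
qed

lemma lin_span_fst: "a \<in> lin_span A (fst ` Y) \<Longrightarrow> \<exists>b. (a, b) \<in> lin_span AB Y"
proof (induct rule: lin_span.induct)
  case zero
  then show ?case using lin_span.zero[of AB Y] by auto
next
  case (step x y c)
  then obtain b where b: "(y, b) \<in> lin_span AB Y" by blast
  obtain z where "(x, z) \<in> Y" using step(1) by auto
  then have "c \<odot>\<^bsub>AB\<^esub> (x, z) \<oplus>\<^bsub>AB\<^esub> (y, b) \<in> lin_span AB Y" using b by (rule lin_span.step)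
  then show ?case by auto
qed

text \<open>Choose related pairs whose first components approach \<open>a\<close> at rate
  \<open>1 / (n + 1)\<close>; by \<open>bound\<close> their second components form a Cauchy
  sequence, whose limit is the value.\<close>

lemma graph_total:
  assumes a: "a \<in> cl A (lin_span A (fst ` Y))"
  shows "\<exists>b. (a, b) \<in> cl AB (lin_span AB Y)"
proof -
  have ac: "a \<in> carrier A" using a A.cl_carrier by auto
  have "\<exists>p \<in> lin_span AB Y. nrm A (a \<ominus>\<^bsub>A\<^esub> fst p) < inverse (real (Suc n))" for n
  proof -
    obtain y where y: "y \<in> lin_span A (fst ` Y)" "nrm A (a \<ominus>\<^bsub>A\<^esub> y) < inverse (real (Suc n))"
      using A.cl_approx[OF a, of "inverse (real (Suc n))"] by auto
    then show ?thesis using lin_span_fst[OF y(1)] by force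
  qed
  then obtain p where p: "\<And>n. p n \<in> lin_span AB Y"
    "\<And>n. nrm A (a \<ominus>\<^bsub>A\<^esub> fst (p n)) < inverse (real (Suc n))" by metis
  have pc: "fst (p n) \<in> carrier A" "snd (p n) \<in> carrier B" for n
    using AB.lin_span_carrier[OF Y p(1)[of n]] by auto
  have conv: "\<exists>N. \<forall>n\<ge>N. C * inverse (real (Suc n)) < e" if e: "0 < e" for e :: real
  proof -
    have "(\<lambda>n. C * inverse (real (Suc n))) \<longlonglongrightarrow> C * 0"
      by (intro tendsto_mult tendsto_const LIMSEQ_inverse_real_of_nat)
    then have "\<forall>\<^sub>F n in sequentially. C * inverse (real (Suc n)) < e" using e by (intro order_tendstoD(2)) auto
    then show ?thesis by (simp add: eventually_sequentially)
  qed
  have diff: "nrm B (snd (p m) \<ominus>\<^bsub>B\<^esub> snd (p n)) \<le> C * inverse (real (Suc m)) + C * inverse (real (Suc n))" for m n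
  proof -
    have "p m \<ominus>\<^bsub>AB\<^esub> p n \<in> lin_span AB Y" using AB.lin_span_minus[OF Y p(1) p(1)] .
    then have "(fst (p m) \<ominus>\<^bsub>A\<^esub> fst (p n), snd (p m) \<ominus>\<^bsub>B\<^esub> snd (p n)) \<in> lin_span AB Y"
      using prod_minus[OF pc[of m] pc[of n]] by simp
    then have "nrm B (snd (p m) \<ominus>\<^bsub>B\<^esub> snd (p n)) \<le> C * nrm A (fst (p m) \<ominus>\<^bsub>A\<^esub> fst (p n))" by (rule bound)
    also have "\<dots> \<le> C * (nrm A (fst (p m) \<ominus>\<^bsub>A\<^esub> a) + nrm A (a \<ominus>\<^bsub>A\<^esub> fst (p n)))"
      using A.nrm_triangle[OF pc(1) ac pc(1)] C by (intro mult_left_mono)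
    also have "\<dots> \<le> C * (inverse (real (Suc m)) + inverse (real (Suc n)))"
      using p(2)[of m] p(2)[of n] A.nrm_minus_commute[OF ac pc(1)] C by (intro mult_left_mono add_mono) auto
    finally show ?thesis by (simp add: algebra_simps)
  qed
  have "\<exists>l\<in>carrier B. \<forall>e>0. \<exists>N. \<forall>n\<ge>N. nrm B (snd (p n) \<ominus>\<^bsub>B\<^esub> l) < e"
  proof (rule B.complete)
    show "\<forall>e>0. \<exists>N. \<forall>m\<ge>N. \<forall>n\<ge>N. nrm B (snd (p m) \<ominus>\<^bsub>B\<^esub> snd (p n)) < e"
    proof (intro allI impI)
      fix e :: real assume "0 < e"
      then obtain N where "\<forall>n\<ge>N. C * inverse (real (Suc n)) < e / 2" using conv[of "e / 2"] by auto
      then have "nrm B (snd (p m) \<ominus>\<^bsub>B\<^esub> snd (p n)) < e" if "m \<ge> N" "n \<ge> N" for m n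
        using diff[of m n] that by (smt (verit) field_sum_of_halves)
      then show "\<exists>N. \<forall>m\<ge>N. \<forall>n\<ge>N. nrm B (snd (p m) \<ominus>\<^bsub>B\<^esub> snd (p n)) < e" by blast
    qed
  qed (rule pc)
  then obtain b where b: "b \<in> carrier B" "\<forall>e>0. \<exists>N. \<forall>n\<ge>N. nrm B (snd (p n) \<ominus>\<^bsub>B\<^esub> b) < e" by blast
  have "\<exists>y\<in>lin_span AB Y. nrm AB ((a, b) \<ominus>\<^bsub>AB\<^esub> y) < e" if e: "0 < e" for e
  proof -
    obtain N where N: "\<forall>n\<ge>N. nrm B (snd (p n) \<ominus>\<^bsub>B\<^esub> b) < e" using b(2) e by blast
    obtain M where M: "inverse (real (Suc M)) < e" using reals_Archimedean[OF e] by blast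
    let ?n = "max M N"
    have "inverse (real (Suc ?n)) \<le> inverse (real (Suc M))" by (simp add: le_imp_inverse_le)
    then have "nrm A (a \<ominus>\<^bsub>A\<^esub> fst (p ?n)) < e" using p(2)[of ?n] M by linarith
    moreover have "nrm B (b \<ominus>\<^bsub>B\<^esub> snd (p ?n)) < e" using N B.nrm_minus_commute[OF b(1) pc(2)] by simp
    ultimately have "nrm AB ((a, b) \<ominus>\<^bsub>AB\<^esub> p ?n) < e"
      using prod_minus[OF ac b(1) pc[of ?n]] by simp
    then show ?thesis using p(1) by blast
  qed
  then show ?thesis using ac b(1) by (auto simp: cl_def)
qed

end
end

section \<open>Operators on square-summable families\<close>

lemma coord_zero [simp]: "coord 0 i = 0"
  by (simp add: zero_ell2.rep_eq)

lemma coord_add [simp]: "coord (x + y) i = coord x i + coord y i"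
  by (simp add: plus_ell2.rep_eq)

lemma coord_uminus [simp]: "coord (- x) i = - coord x i"
  by (simp add: uminus_ell2.rep_eq)

lemma coord_diff [simp]: "coord (x - y) i = coord x i - coord y i"
  unfolding minus_ell2_def coord_add coord_uminus by simp

lemma coord_scaleC [simp]: "coord (scaleC c x) i = c * coord x i"
  by (simp add: scaleC.rep_eq)

lemma coord_scaleR [simp]: "coord (r *\<^sub>R x) i = of_real r * coord x i"
  by (simp add: scaleR_ell2.rep_eq)

lemma coord_sum [simp]: "coord (\<Sum>k\<in>F. f k) i = (\<Sum>k\<in>F. coord (f k) i)"
  by (induct F rule: infinite_finite_induct) auto

lemma ell2_eqI: "(\<And>i. coord x i = coord y i) \<Longrightarrow> x = y"
  by (auto simp flip: coord_inject)

lemma scaleC_of_real: "scaleC (of_real r) x = r *\<^sub>R x"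
  by (rule ell2_eqI) simp

lemma scaleC_add: "scaleC c (x + y) = scaleC c x + scaleC c y"
  and scaleC_add_left: "scaleC (c + d) x = scaleC c x + scaleC d x"
  and scaleC_scaleC: "scaleC c (scaleC d x) = scaleC (c * d) x"
  and scaleC_one [simp]: "scaleC 1 x = x"
  and scaleC_zero [simp]: "scaleC c 0 = 0" "scaleC 0 x = 0"
  by (rule ell2_eqI; simp add: algebra_simps)+

lemma cinner_scaleC_left: "cinner (scaleC c x) y = cnj c * cinner x y"
  unfolding cinner_def by (simp add: mult.assoc infsum_cmult_right')

lemma cinner_scaleC_right: "cinner x (scaleC c y) = c * cinner x y"
  unfolding cinner_commute[of x "scaleC c y"] cinner_commute[of x y] by (simp add: cinner_scaleC_left)

lemma cinner_add_right: "cinner x (y + z) = cinner x y + cinner x z"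
  unfolding cinner_commute[of x "y + z"] cinner_commute[of x y] cinner_commute[of x z]
  by (simp add: cinner_add_left)

lemma cinner_zero [simp]: "cinner 0 x = 0" "cinner x 0 = 0"
  using cinner_scaleC_left[of 0 0 x] cinner_scaleC_right[of x 0 0] by simp_all

lemma cinner_minus: "cinner (- x) y = - cinner x y" "cinner x (- y) = - cinner x y"
  using cinner_add_left[of x "-x" y] cinner_add_right[of x y "-y"] by (auto simp: eq_neg_iff_add_eq_0 add.commute)

lemma cinner_diff: "cinner (x - y) z = cinner x z - cinner y z" "cinner x (y - z) = cinner x y - cinner x z"
  using cinner_add_left[of x "-y" z] cinner_add_right[of x y "-z"] by (simp_all add: cinner_minus)

lemma cinner_sum_left: "cinner (\<Sum>k\<in>F. f k) y = (\<Sum>k\<in>F. cinner (f k) y)"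
  by (induct F rule: infinite_finite_induct) (auto simp: cinner_add_left)

lemma cinner_norm: "cinner x x = of_real ((norm x)\<^sup>2)"
proof -
  have "(norm x)\<^sup>2 = Re (cinner x x)" by (simp add: norm_ell2_def cinner_self infsum_nonneg)
  then show ?thesis by (simp add: cinner_self)
qed

lemma norm_sq_infsum: "(norm x)\<^sup>2 = (\<Sum>\<^sub>\<infinity>i. (cmod (coord x i))\<^sup>2)"
  using cinner_norm[of x] unfolding cinner_self of_real_eq_iff by (rule sym)

lemma cnj_mult_self: "cnj z * z = complex_of_real ((cmod z)\<^sup>2)"
  using complex_norm_square[of z] by (simp add: mult.commute)

lemma norm_scaleC [simp]: "norm (scaleC c x) = cmod c * norm x"
proof -
  have "complex_of_real ((norm (scaleC c x))\<^sup>2) = cnj c * c * of_real ((norm x)\<^sup>2)"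
    unfolding cinner_norm[symmetric] by (simp add: cinner_scaleC_left cinner_scaleC_right)
  also have "\<dots> = complex_of_real ((cmod c * norm x)\<^sup>2)"
    unfolding cnj_mult_self by (simp add: power_mult_distrib)
  finally have "(norm (scaleC c x))\<^sup>2 = (cmod c * norm x)\<^sup>2" using of_real_eq_iff by blast
  then show ?thesis by (rule power2_eq_imp_eq) auto
qed

text \<open>Multiplying \<open>y\<close> by a phase makes the inner product real and nonnegative,
  which reduces the claim to the real inequality.\<close>

lemma cinner_cauchy_schwarz: "cmod (cinner x y) \<le> norm x * norm y"
proof (cases "cinner x y = 0")
  case False
  define u where "u = cnj (cinner x y) / of_real (cmod (cinner x y))"
  have u: "cmod u = 1" using False by (simp add: u_def norm_divide)
  have "cinner x (scaleC u y) = of_real (cmod (cinner x y))"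
    using False complex_norm_square[of "cinner x y"]
    by (simp add: u_def cinner_scaleC_right field_simps power2_eq_square)
  then have "cmod (cinner x y) = inner x (scaleC u y)" by (simp add: inner_ell2_def)
  also have "\<dots> \<le> norm x * norm (scaleC u y)" by (rule norm_cauchy_schwarz)
  finally show ?thesis by (simp add: u)
qed simp

definition ket :: "'i \<Rightarrow> 'i ell2" where
  "ket i = Abs_ell2 (\<lambda>j. of_bool (j = i))"

lemma coord_ket: "coord (ket i) j = of_bool (j = i)"
proof -
  have "(\<lambda>j. (cmod (of_bool (j = i)))\<^sup>2) summable_on {i}" by simp
  then have "(\<lambda>j. (cmod (of_bool (j = i)))\<^sup>2) summable_on UNIV"
    by (rule summable_on_cong_neutral[THEN iffD1, rotated 3]) auto
  then show ?thesis by (simp add: ket_def Abs_ell2_inverse)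
qed

lemma cinner_ket: "cinner (ket i) x = coord x i" "cinner x (ket i) = cnj (coord x i)"
proof -
  have "cinner (ket i) x = (\<Sum>\<^sub>\<infinity>j\<in>{i}. cnj (coord (ket i) j) * coord x j)"
    unfolding cinner_def by (rule infsum_cong_neutral) (auto simp: coord_ket)
  then show 1: "cinner (ket i) x = coord x i" by (simp add: coord_ket)
  show "cinner x (ket i) = cnj (coord x i)" using cinner_commute[of x "ket i"] 1 by simp
qed

lemma norm_ket [simp]: "norm (ket i) = 1"
proof -
  have "complex_of_real ((norm (ket i))\<^sup>2) = 1" unfolding cinner_norm[symmetric] by (simp add: cinner_ket coord_ket)
  then have "(norm (ket i))\<^sup>2 = 1\<^sup>2" by (metis of_real_eq_1_iff one_power2)
  then show ?thesis using norm_ge_zero power2_eq_iff_nonneg zero_le_one by blast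
qed

lemma coord_le_norm: "cmod (coord x i) \<le> norm x"
  using cinner_cauchy_schwarz[of "ket i" x] by (simp add: cinner_ket)

lemma sum_coord_le: "finite F \<Longrightarrow> (\<Sum>i\<in>F. (cmod (coord x i))\<^sup>2) \<le> (norm x)\<^sup>2"
  unfolding norm_sq_infsum by (rule finite_sum_le_infsum[OF summable_coord]) auto

lemma sq_summable_bounded:
  assumes "\<And>F. finite F \<Longrightarrow> (\<Sum>i\<in>F. (cmod (f i))\<^sup>2) \<le> C\<^sup>2" "0 \<le> C"
  shows "(\<lambda>i. (cmod (f i))\<^sup>2) summable_on UNIV"
    and norm_Abs_ell2_le: "norm (Abs_ell2 f) \<le> C"
    and coord_Abs_bounded: "coord (Abs_ell2 f) = f"
proof -
  show s: "(\<lambda>i. (cmod (f i))\<^sup>2) summable_on UNIV"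
    by (rule nonneg_bdd_above_summable_on) (use assms in \<open>auto intro!: bdd_aboveI2\<close>)
  show c: "coord (Abs_ell2 f) = f" using s by (simp add: Abs_ell2_inverse)
  have "(\<Sum>\<^sub>\<infinity>i. (cmod (f i))\<^sup>2) \<le> C\<^sup>2"
    by (rule infsum_le_finite_sums[OF s]) (use assms in auto)
  then have "(norm (Abs_ell2 f))\<^sup>2 \<le> C\<^sup>2" by (simp add: norm_sq_infsum c)
  then show "norm (Abs_ell2 f) \<le> C" using assms(2) by (rule power2_le_imp_le)
qed

text \<open>Pythagoras for the orthogonal projection onto finitely many basis vectors.\<close>

lemma norm_sq_diff_finite:
  assumes "finite F"
  shows "(norm (x - (\<Sum>i\<in>F. scaleC (coord x i) (ket i))))\<^sup>2 = (norm x)\<^sup>2 - (\<Sum>i\<in>F. (cmod (coord x i))\<^sup>2)"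
proof -
  let ?s = "\<Sum>i\<in>F. scaleC (coord x i) (ket i)"
  have xs: "cinner ?s x = of_real (\<Sum>i\<in>F. (cmod (coord x i))\<^sup>2)"
    by (simp add: cinner_sum_left cinner_scaleC_left cinner_ket cnj_mult_self del: of_real_power)
  have "coord ?s i = coord x i" if "i \<in> F" for i
  proof -
    have "coord ?s i = (\<Sum>k\<in>F. if k = i then coord x k else 0)" by (auto simp: coord_ket intro!: sum.cong)
    then show ?thesis using that assms by simp
  qed
  then have ss: "cinner ?s ?s = of_real (\<Sum>i\<in>F. (cmod (coord x i))\<^sup>2)"
    by (subst cinner_sum_left)
      (simp add: cinner_scaleC_left cinner_ket cnj_mult_self del: coord_sum of_real_power)
  have "complex_of_real ((norm (x - ?s))\<^sup>2) = cinner x x - cinner x ?s - cinner ?s x + cinner ?s ?s"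
    unfolding cinner_norm[symmetric] by (simp add: cinner_diff)
  also have "\<dots> = of_real ((norm x)\<^sup>2 - (\<Sum>i\<in>F. (cmod (coord x i))\<^sup>2))"
    unfolding cinner_commute[of x ?s] xs ss unfolding cinner_norm by simp
  finally show ?thesis using of_real_eq_iff by blast
qed

text \<open>This is why complex-linear bounded operators are determined by their values on basis
  vectors. The index set may be uncountable, hence the limit over finite subsets.\<close>

lemma tendsto_finite_kets:
  "((\<lambda>F. \<Sum>i\<in>F. scaleC (coord x i) (ket i)) \<longlongrightarrow> x) (finite_subsets_at_top UNIV)"
proof -
  have "((\<lambda>F. (norm x)\<^sup>2 - (\<Sum>i\<in>F. (cmod (coord x i))\<^sup>2)) \<longlongrightarrow> (norm x)\<^sup>2 - (norm x)\<^sup>2) (finite_subsets_at_top UNIV)"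
    using has_sum_infsum[OF summable_coord[of x]] unfolding has_sum_def norm_sq_infsum
    by (intro tendsto_diff tendsto_const)
  moreover have "\<forall>\<^sub>F F in finite_subsets_at_top UNIV. (norm x)\<^sup>2 - (\<Sum>i\<in>F. (cmod (coord x i))\<^sup>2)
      = (norm (x - (\<Sum>i\<in>F. scaleC (coord x i) (ket i))))\<^sup>2"
    by (intro eventually_finite_subsets_at_top_weakI) (simp add: norm_sq_diff_finite)
  ultimately have "((\<lambda>F. (norm (x - (\<Sum>i\<in>F. scaleC (coord x i) (ket i))))\<^sup>2) \<longlongrightarrow> 0) (finite_subsets_at_top UNIV)"
    using tendsto_cong by fastforce
  then have "((\<lambda>F. sqrt ((norm (x - (\<Sum>i\<in>F. scaleC (coord x i) (ket i))))\<^sup>2)) \<longlongrightarrow> sqrt 0) (finite_subsets_at_top UNIV)"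
    by (rule tendsto_real_sqrt)
  then have "((\<lambda>F. norm ((\<Sum>i\<in>F. scaleC (coord x i) (ket i)) - x)) \<longlongrightarrow> 0) (finite_subsets_at_top UNIV)"
    by (simp add: norm_minus_commute)
  then show ?thesis by (simp add: LIM_zero_iff tendsto_norm_zero_iff)
qed

instance ell2 :: (type) banach
proof
  fix X :: "nat \<Rightarrow> 'a ell2" assume X: "Cauchy X"
  have "Cauchy (\<lambda>n. coord (X n) i)" for i
  proof (rule CauchyI)
    fix e :: real assume "0 < e"
    then obtain M where "\<forall>m\<ge>M. \<forall>n\<ge>M. norm (X m - X n) < e" using CauchyD[OF X] by blast
    then show "\<exists>M. \<forall>m\<ge>M. \<forall>n\<ge>M. norm (coord (X m) i - coord (X n) i) < e"
      using coord_le_norm[of "X _ - X _" i] by (metis coord_diff le_less_trans)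
  qed
  then have cv: "convergent (\<lambda>n. coord (X n) i)" for i by (rule Cauchy_convergent)
  define f where "f i = lim (\<lambda>n. coord (X n) i)" for i
  have f: "(\<lambda>n. coord (X n) i) \<longlonglongrightarrow> f i" for i
    using cv[of i] unfolding f_def convergent_LIMSEQ_iff .
  have close: "\<exists>N. \<forall>n\<ge>N. \<forall>F. finite F \<longrightarrow> (\<Sum>i\<in>F. (cmod (coord (X n) i - f i))\<^sup>2) \<le> e\<^sup>2" if e: "0 < e" for e
  proof -
    obtain M where M: "\<And>m n. m \<ge> M \<Longrightarrow> n \<ge> M \<Longrightarrow> norm (X m - X n) < e" using CauchyD[OF X e] by blast
    have "(\<Sum>i\<in>F. (cmod (coord (X n) i - f i))\<^sup>2) \<le> e\<^sup>2" if n: "n \<ge> M" and F: "finite F" for n F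
    proof (rule LIMSEQ_le_const2)
      show "(\<lambda>m. \<Sum>i\<in>F. (cmod (coord (X n) i - coord (X m) i))\<^sup>2) \<longlonglongrightarrow> (\<Sum>i\<in>F. (cmod (coord (X n) i - f i))\<^sup>2)"
        by (intro tendsto_intros f)
      have "(\<Sum>i\<in>F. (cmod (coord (X n) i - coord (X m) i))\<^sup>2) \<le> e\<^sup>2" if "m \<ge> M" for m
      proof -
        have "(\<Sum>i\<in>F. (cmod (coord (X n) i - coord (X m) i))\<^sup>2) \<le> (norm (X n - X m))\<^sup>2"
          using sum_coord_le[OF F, of "X n - X m"] by simp
        also have "\<dots> \<le> e\<^sup>2" using M[OF n that] by (intro power_mono) auto
        finally show ?thesis .
      qed
      then show "\<exists>N. \<forall>m\<ge>N. (\<Sum>i\<in>F. (cmod (coord (X n) i - coord (X m) i))\<^sup>2) \<le> e\<^sup>2" by blast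
    qed
    then show ?thesis by blast
  qed
  obtain N where N: "\<And>F. finite F \<Longrightarrow> (\<Sum>i\<in>F. (cmod (coord (X N) i - f i))\<^sup>2) \<le> 1\<^sup>2"
    using close[of 1] by (metis order_refl zero_less_one)
  have d: "coord (Abs_ell2 (\<lambda>i. coord (X N) i - f i)) = (\<lambda>i. coord (X N) i - f i)"
    by (rule coord_Abs_bounded[OF N]) auto
  \<comment> \<open>Square summability is known for \<open>X N - f\<close> only, so the limit is
    obtained by subtracting this difference from \<open>X N\<close>.\<close>
  define l where "l = X N - Abs_ell2 (\<lambda>i. coord (X N) i - f i)"
  have l: "coord l i = f i" for i by (simp add: l_def d)
  have "X \<longlonglongrightarrow> l"
  proof (rule LIMSEQ_I)
    fix e :: real assume e: "0 < e"
    then obtain M where M: "\<And>n F. n \<ge> M \<Longrightarrow> finite F \<Longrightarrow> (\<Sum>i\<in>F. (cmod (coord (X n) i - f i))\<^sup>2) \<le> (e/2)\<^sup>2"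
      using close[of "e/2"] by auto
    have "norm (X n - l) < e" if "n \<ge> M" for n
    proof -
      have "(norm (X n - l))\<^sup>2 \<le> (e/2)\<^sup>2"
        unfolding norm_sq_infsum
      proof (rule infsum_le_finite_sums[OF summable_coord])
        fix F :: "'a set" assume "finite F"
        then show "(\<Sum>i\<in>F. (cmod (coord (X n - l) i))\<^sup>2) \<le> (e/2)\<^sup>2"
          using M[OF that, of F] by (simp only: coord_diff l)
      qed
      then have "norm (X n - l) \<le> e/2" by (rule power2_le_imp_le) (use e in simp)
      then show ?thesis using e by simp
    qed
    then show "\<exists>N. \<forall>n\<ge>N. norm (X n - l) < e" by blast
  qed
  then show "convergent X" by (auto simp: convergent_def)
qed

abbreviation (input) app :: "'i op \<Rightarrow> 'i ell2 \<Rightarrow> 'i ell2" where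
  "app \<equiv> blinfun_apply"

lemma carrier_ops: "T \<in> carrier bounded_ops \<longleftrightarrow> (\<forall>c x. app T (scaleC c x) = scaleC c (app T x))"
  by (simp add: bounded_ops_def)

lemma ops_simps:
  "\<one>\<^bsub>bounded_ops\<^esub> = id_blinfun" "\<zero>\<^bsub>bounded_ops\<^esub> = 0" "S \<otimes>\<^bsub>bounded_ops\<^esub> T = S o\<^sub>L T"
  "S \<oplus>\<^bsub>bounded_ops\<^esub> T = S + T" "star bounded_ops T = adj T" "nrm bounded_ops T = norm T"
  by (simp_all add: bounded_ops_def)

lemma op_apply:
  assumes "\<And>x y. f (x + y) = f x + f y" "\<And>c x. f (scaleC c x) = scaleC c (f x)"
    "\<And>x. norm (f x) \<le> C * norm x"
  shows "app (Blinfun f) = f" and op_carrier: "Blinfun f \<in> carrier bounded_ops"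
proof -
  have "bounded_linear f"
    by (rule bounded_linear_intro[of _ C]) (use assms in \<open>auto simp: mult.commute simp flip: scaleC_of_real\<close>)
  then show 1: "app (Blinfun f) = f" by (rule bounded_linear_Blinfun_apply)
  then show "Blinfun f \<in> carrier bounded_ops" using assms(2) by (simp add: carrier_ops)
qed

lemma smult_ops:
  "app (c \<odot>\<^bsub>bounded_ops\<^esub> T) x = scaleC c (app T x)"
proof -
  have "bounded_linear (\<lambda>x. scaleC c (app T x))"
  proof (rule bounded_linear_intro[of _ "cmod c * norm T"])
    show "norm (scaleC c (app T x)) \<le> norm x * (cmod c * norm T)" for x
      using mult_left_mono[OF norm_blinfun[of T x], of "cmod c"] by (simp add: mult_ac)
    show "scaleC c (app T (r *\<^sub>R x)) = r *\<^sub>R scaleC c (app T x)" for r x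
      unfolding blinfun.scaleR_right by (simp add: scaleC_scaleC mult.commute flip: scaleC_of_real)
  qed (simp add: blinfun.add_right scaleC_add)
  then show ?thesis by (simp add: bounded_ops_def bounded_linear_Blinfun_apply)
qed

lemma ops_eqI:
  fixes T S :: "'i op"
  assumes "T \<in> carrier bounded_ops" "S \<in> carrier bounded_ops"
    "\<And>i. app T (ket i) = app S (ket i)"
  shows "T = S"
proof (rule blinfun_eqI)
  fix x :: "'i ell2"
  have e: "app T (\<Sum>i\<in>F. scaleC (coord x i) (ket i)) = app S (\<Sum>i\<in>F. scaleC (coord x i) (ket i))" for F
    using assms by (simp add: blinfun.sum_right carrier_ops)
  have "((\<lambda>F. app T (\<Sum>i\<in>F. scaleC (coord x i) (ket i))) \<longlongrightarrow> app T x) (finite_subsets_at_top UNIV)"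
    "((\<lambda>F. app S (\<Sum>i\<in>F. scaleC (coord x i) (ket i))) \<longlongrightarrow> app S x) (finite_subsets_at_top UNIV)"
    by (intro blinfun.tendsto tendsto_const tendsto_finite_kets)+
  then show "app T x = app S x"
    unfolding e by (rule tendsto_unique[rotated]) simp
qed

lemma cinner_tendsto: "(f \<longlongrightarrow> y) F \<Longrightarrow> ((\<lambda>k. cinner x (f k)) \<longlongrightarrow> cinner x y) F"
proof -
  assume f: "(f \<longlongrightarrow> y) F"
  have "bounded_linear (cinner x)"
    by (rule bounded_linear_intro[of _ "norm x"])
      (use cinner_cauchy_schwarz[of x] in \<open>auto simp: cinner_add_right cinner_scaleC_right mult.commute scaleR_conv_of_real simp flip: scaleC_of_real\<close>)
  from bounded_linear.tendsto[OF this f] show ?thesis .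
qed

lemma cinner_left_eqI: "(\<And>y. cinner x y = cinner x' y) \<Longrightarrow> x = x'"
  by (rule ell2_eqI) (metis cinner_ket(2) complex_cnj_cnj)

text \<open>The adjoint applied to \<open>x\<close> must have the coordinates
  \<open>cinner (app T (ket i)) x\<close>. Their square sum over \<open>F\<close> is the inner
  product of \<open>x\<close> with \<open>T\<close> applied to the finite vector \<open>?v\<close>
  with these coordinates, which gives
  \<open>(norm ?v)\<^sup>2 \<le> norm T * norm ?v * norm x\<close> and so a bound independent of
  \<open>F\<close>.\<close>

lemma adj_exists:
  fixes T :: "'i op"
  assumes T: "T \<in> carrier bounded_ops"
  shows "\<exists>S\<in>carrier bounded_ops. (\<forall>x y. cinner (app S x) y = cinner x (app T y))"
proof -
  define f where "f x i = cinner (app T (ket i)) x" for x i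
  have bd: "(\<Sum>i\<in>F. (cmod (f x i))\<^sup>2) \<le> (norm T * norm x)\<^sup>2" if F: "finite F" for F and x :: "'i ell2"
  proof -
    let ?v = "\<Sum>i\<in>F. scaleC (f x i) (ket i)" and ?s = "\<Sum>i\<in>F. (cmod (f x i))\<^sup>2"
    have "coord ?v i = f x i" if "i \<in> F" for i
    proof -
      have "coord ?v i = (\<Sum>k\<in>F. if k = i then f x k else 0)" by (auto simp: coord_ket intro!: sum.cong)
      then show ?thesis using that F by simp
    qed
    then have "cinner ?v ?v = of_real ?s"
      by (subst cinner_sum_left)
        (simp add: cinner_scaleC_left cinner_ket cnj_mult_self del: coord_sum of_real_power)
    then have v: "(norm ?v)\<^sup>2 = ?s" unfolding cinner_norm using of_real_eq_iff by blast
    have s0: "0 \<le> ?s" by (simp add: sum_nonneg)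
    have "cinner (app T ?v) x = of_real ?s"
      using T by (simp add: blinfun.sum_right carrier_ops cinner_sum_left cinner_scaleC_left cnj_mult_self flip: f_def del: of_real_power)
    then have "?s \<le> norm (app T ?v) * norm x"
      using cinner_cauchy_schwarz[of "app T ?v" x] s0 by (simp add: sum_nonneg del: of_real_sum)
    also have "\<dots> \<le> norm T * norm ?v * norm x" by (intro mult_right_mono norm_blinfun) auto
    finally have "(norm ?v)\<^sup>2 \<le> (norm T * norm x) * norm ?v" by (simp add: v mult_ac)
    then have "norm ?v \<le> norm T * norm x"
      by (cases "norm ?v = 0") (auto simp: power2_eq_square)
    then have "(norm ?v)\<^sup>2 \<le> (norm T * norm x)\<^sup>2" by (intro power_mono) auto
    then show ?thesis by (simp add: v)
  qed
  have nn: "0 \<le> norm T * norm x" for x :: "'i ell2" by simp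
  define g where "g x = Abs_ell2 (f x)" for x
  have g: "coord (g x) i = f x i" for x i
    unfolding g_def by (subst coord_Abs_bounded[OF bd nn]) auto
  note gop = op_apply[of g "norm T"] op_carrier[of g "norm T"]
  have g1: "g (x + y) = g x + g y" for x y by (rule ell2_eqI) (simp add: g f_def cinner_add_right)
  have g2: "g (scaleC c x) = scaleC c (g x)" for c x by (rule ell2_eqI) (simp add: g f_def cinner_scaleC_right)
  have g3: "norm (g x) \<le> norm T * norm x" for x unfolding g_def by (rule norm_Abs_ell2_le[OF bd nn])
  have S: "app (Blinfun g) = g" "Blinfun g \<in> carrier bounded_ops" using gop g1 g2 g3 by blast+
  have "cinner (g x) y = cinner x (app T y)" for x y
  proof -
    have e: "cinner (g x) (\<Sum>i\<in>F. scaleC (coord y i) (ket i)) = cinner x (app T (\<Sum>i\<in>F. scaleC (coord y i) (ket i)))" for F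
    proof -
      have "cinner (g x) (ket i) = cinner x (app T (ket i))" for i
        using cinner_commute[of x "app T (ket i)"] by (simp add: cinner_ket g f_def)
      then show ?thesis using T
        by (induct F rule: infinite_finite_induct)
          (simp_all add: blinfun.add_right cinner_add_right cinner_scaleC_right carrier_ops)
    qed
    have "((\<lambda>F. cinner (g x) (\<Sum>i\<in>F. scaleC (coord y i) (ket i))) \<longlongrightarrow> cinner (g x) y) (finite_subsets_at_top UNIV)"
      by (intro cinner_tendsto tendsto_finite_kets)
    moreover have "((\<lambda>F. cinner x (app T (\<Sum>i\<in>F. scaleC (coord y i) (ket i)))) \<longlongrightarrow> cinner x (app T y)) (finite_subsets_at_top UNIV)"
      by (intro cinner_tendsto blinfun.tendsto tendsto_const tendsto_finite_kets)
    ultimately show ?thesis unfolding e by (rule tendsto_unique[rotated]) simp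
  qed
  then show ?thesis using S by metis
qed

lemma adj_eqI:
  assumes "\<And>x y. cinner (app S x) y = cinner x (app T y)"
  shows "adj T = S"
  unfolding adj_def
proof (rule the_equality)
  fix S' assume "\<forall>x y. cinner (app S' x) y = cinner x (app T y)"
  then have "app S' x = app S x" for x using assms by (intro cinner_left_eqI) simp
  then show "S' = S" by (rule blinfun_eqI)
qed (use assms in blast)

lemma adj_carrier: "T \<in> carrier bounded_ops \<Longrightarrow> adj T \<in> carrier bounded_ops"
  and cinner_adj: "T \<in> carrier bounded_ops \<Longrightarrow> cinner (app (adj T) x) y = cinner x (app T y)"
  using adj_exists[of T] adj_eqI[of _ T] by metis+

lemma cinner_adj2: "T \<in> carrier bounded_ops \<Longrightarrow> cinner x (app (adj T) y) = cinner (app T x) y"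
  using cinner_commute[of x "app (adj T) y"] cinner_commute[of "app T x" y] cinner_adj[of T y x] by simp

lemma ops_ring: "ring (bounded_ops :: 'i op cstar)"
proof -
  have "abelian_group (bounded_ops :: 'i op cstar)"
  proof (rule abelian_groupI)
    fix T :: "'i op" assume "T \<in> carrier bounded_ops"
    then show "\<exists>y\<in>carrier bounded_ops. y \<oplus>\<^bsub>bounded_ops\<^esub> T = \<zero>\<^bsub>bounded_ops\<^esub>"
      by (intro bexI[of _ "- T"]) (auto simp: ops_simps carrier_ops blinfun.minus_left intro!: ell2_eqI)
  qed (auto simp: ops_simps carrier_ops blinfun.add_left scaleC_add)
  then show ?thesis
    by (rule ringI)
      (auto intro!: monoidI blinfun_eqI simp: ops_simps carrier_ops blinfun.add_left blinfun.add_right)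
qed

lemma ops_minus:
  fixes T S :: "'i op"
  assumes "T \<in> carrier bounded_ops"
  shows "S \<ominus>\<^bsub>bounded_ops\<^esub> T = S - T"
proof -
  interpret ring "bounded_ops :: 'i op cstar" by (rule ops_ring)
  have "\<ominus>\<^bsub>bounded_ops\<^esub> T = - T"
    by (rule minus_equality)
      (use assms in \<open>auto simp: ops_simps carrier_ops blinfun.minus_left intro!: ell2_eqI\<close>)
  then show ?thesis by (simp add: a_minus_def ops_simps)
qed

lemma norm_adj_le: "T \<in> carrier bounded_ops \<Longrightarrow> norm (adj T) \<le> norm T"
  for T :: "'i op"
proof (rule norm_blinfun_bound)
  fix x :: "'i ell2" assume T: "T \<in> carrier bounded_ops"
  let ?y = "app (adj T) x"
  have "(norm ?y)\<^sup>2 = cmod (cinner ?y ?y)" by (simp add: cinner_norm flip: of_real_power)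
  also have "\<dots> = cmod (cinner x (app T ?y))" using cinner_adj[OF T] by simp
  also have "\<dots> \<le> norm x * norm (app T ?y)" by (rule cinner_cauchy_schwarz)
  also have "\<dots> \<le> norm x * (norm T * norm ?y)" by (intro mult_left_mono norm_blinfun) simp
  finally have "norm ?y * norm ?y \<le> (norm T * norm x) * norm ?y" by (simp add: power2_eq_square mult_ac)
  then show "norm ?y \<le> norm T * norm x" by (cases "norm ?y = 0") auto
qed simp

lemma adj_adj: "T \<in> carrier bounded_ops \<Longrightarrow> adj (adj T) = T"
  by (rule adj_eqI) (simp add: cinner_adj2)

text \<open>Turns the estimate of the norm of a scalar multiple, applied to the inverse scalar, into
  the converse estimate, so that homogeneity follows from one inequality.\<close>

lemma le_inverse_bound: "c \<noteq> 0 \<Longrightarrow> a \<le> cmod (inverse c) * b \<Longrightarrow> cmod c * a \<le> b"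
  unfolding norm_inverse by (simp add: field_simps)

lemma calg_ops: "calg (bounded_ops :: 'i op cstar)"
proof -
  interpret ring "bounded_ops :: 'i op cstar" by (rule ops_ring)
  show ?thesis
  proof (unfold_locales, goal_cases)
    case (19 x s)
    let ?p = "(adj x o\<^sub>L x) + (adj s o\<^sub>L s)"
    \<comment> \<open>The inner product of \<open>\<xi>\<close> with \<open>?p\<close> applied to
      \<open>\<xi>\<close> is the sum of the squared norms of its images under \<open>x\<close> and
      \<open>s\<close>.\<close>
    have "norm (app x \<xi>) \<le> sqrt (norm ?p) * norm \<xi>" for \<xi>
    proof -
      have "cinner \<xi> (app ?p \<xi>) = of_real ((norm (app x \<xi>))\<^sup>2 + (norm (app s \<xi>))\<^sup>2)"
        using 19 by (simp add: blinfun.add_left cinner_add_right cinner_adj2 cinner_norm)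
      then have "cmod (cinner \<xi> (app ?p \<xi>)) = (norm (app x \<xi>))\<^sup>2 + (norm (app s \<xi>))\<^sup>2"
        by (simp only: norm_of_real) simp
      then have "(norm (app x \<xi>))\<^sup>2 \<le> norm \<xi> * norm (app ?p \<xi>)"
        using cinner_cauchy_schwarz[of \<xi> "app ?p \<xi>"] by (smt (verit) zero_le_power2)
      also have "\<dots> \<le> norm \<xi> * (norm ?p * norm \<xi>)" by (intro mult_left_mono norm_blinfun) simp
      also have "\<dots> = (sqrt (norm ?p) * norm \<xi>)\<^sup>2" by (simp add: power_mult_distrib power2_eq_square)
      finally show ?thesis by (rule power2_le_imp_le) simp
    qed
    then have "norm x \<le> sqrt (norm ?p)" by (intro norm_blinfun_bound) auto
    then have "(norm x)\<^sup>2 \<le> (sqrt (norm ?p))\<^sup>2" by (intro power_mono) auto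
    then show ?case by (simp add: ops_simps)
  next
    case (20 \<sigma>)
    have "Cauchy \<sigma>" by (rule CauchyI) (use 20 in \<open>simp add: ops_simps ops_minus\<close>)
    then obtain l where l: "\<sigma> \<longlonglongrightarrow> l" using Cauchy_convergent_iff convergent_def by blast
    have lc: "l \<in> carrier bounded_ops"
      unfolding carrier_ops
    proof (intro allI)
      fix c x
      have "(\<lambda>n. app (\<sigma> n) (scaleC c x)) \<longlonglongrightarrow> app l (scaleC c x)" by (intro blinfun.tendsto l tendsto_const)
      moreover have "(\<lambda>n. scaleC c (app (\<sigma> n) x)) \<longlonglongrightarrow> scaleC c (app l x)"
      proof (rule bounded_linear.tendsto[of "scaleC c"])
        show "bounded_linear (scaleC c :: 'i ell2 \<Rightarrow> _)"
          by (rule bounded_linear_intro[of _ "cmod c"])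
            (auto simp: scaleC_add scaleC_scaleC mult.commute simp flip: scaleC_of_real)
      qed (intro blinfun.tendsto l tendsto_const)
      ultimately show "app l (scaleC c x) = scaleC c (app l x)"
        using 20(1) LIMSEQ_unique by (simp add: carrier_ops)
    qed
    then show ?case using l LIMSEQ_iff[of \<sigma> l] by (intro bexI[of _ l]) (auto simp: ops_simps ops_minus)
  next
    case (9 x) then show ?case by (simp add: ops_simps adj_adj)
  next
    case (10 x y) then show ?case by (auto simp: ops_simps blinfun.add_left blinfun.add_right cinner_add_left cinner_add_right cinner_adj intro!: adj_eqI)
  next
    case (11 x y) then show ?case by (auto simp: ops_simps cinner_adj intro!: adj_eqI)
  next
    case (12 x c) then show ?case by (auto simp: ops_simps smult_ops cinner_adj cinner_scaleC_left cinner_scaleC_right intro!: adj_eqI)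
  next
    case (16 x c)
    have "norm (c \<odot>\<^bsub>bounded_ops\<^esub> x) \<le> cmod c * norm x" for c and x :: "'i op"
    proof (rule norm_blinfun_bound)
      show "norm (app (c \<odot>\<^bsub>bounded_ops\<^esub> x) y) \<le> cmod c * norm x * norm y" for y
        using mult_left_mono[OF norm_blinfun[of x y], of "cmod c"] by (simp add: smult_ops mult_ac)
    qed simp
    note le = this
    show ?case
    proof (cases "c = 0")
      case True
      then show ?thesis using le[of 0 x] by (simp add: ops_simps)
    next
      case False
      have "inverse c \<odot>\<^bsub>bounded_ops\<^esub> (c \<odot>\<^bsub>bounded_ops\<^esub> x) = x"
        using False by (intro blinfun_eqI) (simp add: smult_ops scaleC_scaleC)
      then have "norm x \<le> cmod (inverse c) * norm (c \<odot>\<^bsub>bounded_ops\<^esub> x)" using le[of "inverse c" "c \<odot>\<^bsub>bounded_ops\<^esub> x"] by simp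
      then have "cmod c * norm x \<le> norm (c \<odot>\<^bsub>bounded_ops\<^esub> x)"
        using False by (rule le_inverse_bound[rotated])
      then show ?thesis using le[of c x] by (simp add: ops_simps)
    qed
  next
    case (17 x y) then show ?case by (simp add: ops_simps norm_blinfun_compose)
  next
    case (18 x) then show ?case using norm_adj_le[of x] norm_adj_le[OF adj_carrier, of x] by (simp add: ops_simps adj_adj)
  next
    case (8 x) then show ?case by (simp add: ops_simps adj_carrier)
  next
    case (15 x y) then show ?case by (simp add: ops_simps norm_triangle_ineq)
  qed (auto simp: smult_ops ops_simps carrier_ops blinfun.add_left blinfun.add_right scaleC_add scaleC_add_left
      scaleC_scaleC mult.commute intro!: blinfun_eqI)
qed

interpretation ops: calg "bounded_ops :: 'i op cstar"
  by (rule calg_ops)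

section \<open>Bounded families and complex numbers\<close>

lemma families_simps:
  "carrier (bounded_families I A) = {f \<in> I \<rightarrow>\<^sub>E carrier A. bdd_above ((\<lambda>i. nrm A (f i)) ` I)}"
  "f \<otimes>\<^bsub>bounded_families I A\<^esub> h = (\<lambda>i\<in>I. f i \<otimes>\<^bsub>A\<^esub> h i)"
  "\<one>\<^bsub>bounded_families I A\<^esub> = (\<lambda>i\<in>I. \<one>\<^bsub>A\<^esub>)" "\<zero>\<^bsub>bounded_families I A\<^esub> = (\<lambda>i\<in>I. \<zero>\<^bsub>A\<^esub>)"
  "f \<oplus>\<^bsub>bounded_families I A\<^esub> h = (\<lambda>i\<in>I. f i \<oplus>\<^bsub>A\<^esub> h i)"
  "c \<odot>\<^bsub>bounded_families I A\<^esub> f = (\<lambda>i\<in>I. c \<odot>\<^bsub>A\<^esub> f i)"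
  "star (bounded_families I A) f = (\<lambda>i\<in>I. star A (f i))"
  by (simp_all add: bounded_families_def)

context calg begin

abbreviation "fam I \<equiv> bounded_families I A"

lemma fam_carrierI:
  assumes "\<And>i. i \<in> I \<Longrightarrow> f i \<in> carrier A" "f \<in> extensional I" "\<And>i. i \<in> I \<Longrightarrow> nrm A (f i) \<le> C"
  shows "f \<in> carrier (fam I)"
  using assms by (auto simp: families_simps PiE_iff intro!: bdd_aboveI2[of _ _ C])

lemma fam_carrier:
  assumes "f \<in> carrier (fam I)"
  shows "i \<in> I \<Longrightarrow> f i \<in> carrier A" "f \<in> extensional I"
  using assms by (auto simp: families_simps PiE_iff)

lemma fam_nrm_nonneg: "f \<in> carrier (fam I) \<Longrightarrow> 0 \<le> nrm (fam I) f"
  unfolding bounded_families_def by (auto intro!: cSup_upper)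

lemma fam_nrm_upper: "f \<in> carrier (fam I) \<Longrightarrow> i \<in> I \<Longrightarrow> nrm A (f i) \<le> nrm (fam I) f"
  unfolding bounded_families_def by (auto intro!: cSup_upper)

lemma fam_nrm_le: "f \<in> carrier (fam I) \<Longrightarrow> 0 \<le> C \<Longrightarrow> (\<And>i. i \<in> I \<Longrightarrow> nrm A (f i) \<le> C) \<Longrightarrow> nrm (fam I) f \<le> C"
  unfolding bounded_families_def by (auto intro!: cSup_least)

lemma fam_closed:
  assumes f: "f \<in> carrier (fam I)" and h: "h \<in> carrier (fam I)"
  shows "(\<lambda>i\<in>I. f i \<otimes> h i) \<in> carrier (fam I)" "(\<lambda>i\<in>I. f i \<oplus> h i) \<in> carrier (fam I)"
    "(\<lambda>i\<in>I. c \<odot> f i) \<in> carrier (fam I)" "(\<lambda>i\<in>I. star A (f i)) \<in> carrier (fam I)"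
proof -
  note c = fam_carrier(1)[OF f] fam_carrier(1)[OF h]
  note u = fam_nrm_upper[OF f] fam_nrm_upper[OF h] fam_nrm_nonneg[OF f] fam_nrm_nonneg[OF h]
  show "(\<lambda>i\<in>I. f i \<otimes> h i) \<in> carrier (fam I)"
    by (rule fam_carrierI[of _ _ "nrm (fam I) f * nrm (fam I) h"])
      (use c u in \<open>auto intro!: order_trans[OF nrm_mult] mult_mono\<close>)
  show "(\<lambda>i\<in>I. f i \<oplus> h i) \<in> carrier (fam I)"
    by (rule fam_carrierI[of _ _ "nrm (fam I) f + nrm (fam I) h"])
      (use c u in \<open>auto intro!: order_trans[OF nrm_add] add_mono\<close>)
  show "(\<lambda>i\<in>I. c \<odot> f i) \<in> carrier (fam I)"
    by (rule fam_carrierI[of _ _ "cmod c * nrm (fam I) f"])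
      (use c u in \<open>auto simp: nrm_smult intro!: mult_left_mono\<close>)
  show "(\<lambda>i\<in>I. star A (f i)) \<in> carrier (fam I)"
    by (rule fam_carrierI[of _ _ "nrm (fam I) f"]) (use c u in auto)
qed

lemma fam_const: "a \<in> carrier A \<Longrightarrow> (\<lambda>i\<in>I. a) \<in> carrier (fam I)"
  by (rule fam_carrierI[of _ _ "nrm A a"]) auto

lemma fam_eqI: "f \<in> carrier (fam I) \<Longrightarrow> h \<in> carrier (fam I) \<Longrightarrow> (\<And>i. i \<in> I \<Longrightarrow> f i = h i) \<Longrightarrow> f = h"
  using fam_carrier(2) by (metis extensionalityI)

lemma fam_ring: "ring (fam I)"
proof -
  have "abelian_group (fam I)"
  proof (rule abelian_groupI, goal_cases)
    case (6 f)
    then show ?case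
      using fam_closed(3)[OF 6 6, of "-1"] fam_carrier(1)[OF 6]
      by (intro bexI[of _ "\<lambda>i\<in>I. (-1) \<odot> f i"])
        (auto simp: families_simps(4,5) l_neg restrict_def simp flip: neg_smult)
  qed (auto simp: families_simps(2-7) fam_closed fam_const a_assoc a_comm a_lcomm fam_carrier restrict_def
      intro!: fam_eqI fam_closed[unfolded restrict_def] fam_const[unfolded restrict_def] dest: fam_carrier(1))
  then show ?thesis
    by (rule ringI)
      (auto simp: families_simps(2-7) fam_closed fam_const m_assoc l_distr r_distr fam_carrier restrict_def
        intro!: monoidI fam_eqI fam_closed[unfolded restrict_def] fam_const[unfolded restrict_def])
qed

lemma fam_minus:
  assumes "f \<in> carrier (fam I)" "h \<in> carrier (fam I)"
  shows "f \<ominus>\<^bsub>fam I\<^esub> h = (\<lambda>i\<in>I. f i \<ominus> h i)"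
proof -
  interpret F: ring "fam I" by (rule fam_ring)
  have m: "(\<lambda>i\<in>I. (-1) \<odot> h i) \<in> carrier (fam I)" using fam_closed(3)[OF assms] fam_closed(3)[OF assms(2,2)] by blast
  have "\<ominus>\<^bsub>fam I\<^esub> h = (\<lambda>i\<in>I. (-1) \<odot> h i)"
    by (rule F.minus_equality)
      (use assms m fam_carrier(1)[OF assms(2)] in \<open>auto simp: families_simps(4,5) l_neg restrict_def simp flip: neg_smult\<close>)
  then show ?thesis using fam_carrier(1)[OF assms(1)] fam_carrier(1)[OF assms(2)]
    by (auto simp: a_minus_def[of "fam I"] families_simps(5) minus_smult)
qed

lemma calg_fam: "calg (fam I)"
proof -
  interpret F: ring "fam I" by (rule fam_ring)
  note c = fam_carrier(1)
  show ?thesis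
  proof (unfold_locales, goal_cases)
    case (13 f) then show ?case by (rule fam_nrm_nonneg)
  next
    case (5 f)
    show ?case unfolding families_simps(6) by (rule fam_eqI[OF fam_closed(3)[OF 5 5] 5]) (simp add: c[OF 5])
  next
    case (9 f)
    show ?case unfolding families_simps(7)
      by (rule fam_eqI[OF fam_closed(4)[OF fam_closed(4)[OF 9 9] 9] 9]) (simp add: c[OF 9])
  next
    case (14 f)
    have "f = (\<lambda>i\<in>I. \<zero>)" if "nrm (fam I) f = 0"
    proof (rule fam_eqI[OF 14 fam_const])
      fix i assume i: "i \<in> I"
      have "nrm A (f i) = 0" using fam_nrm_upper[OF 14 i] nrm_nonneg[OF c[OF 14 i]] that by linarith
      then show "f i = (\<lambda>i\<in>I. \<zero>) i" using nrm_zero_iff[OF c[OF 14 i]] i by simp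
    qed simp
    moreover have "nrm (fam I) (\<lambda>i\<in>I. \<zero>) = 0"
      by (rule order_antisym[OF fam_nrm_le[OF fam_const[OF zero_closed]] fam_nrm_nonneg[OF fam_const[OF zero_closed]]]) auto
    ultimately show ?case by (auto simp: families_simps(4))
  next
    case (15 f h)
    show ?case unfolding families_simps(5)
      using fam_nrm_upper[OF 15(1)] fam_nrm_upper[OF 15(2)] fam_nrm_nonneg[OF 15(1)] fam_nrm_nonneg[OF 15(2)] c[OF 15(1)] c[OF 15(2)]
      by (intro fam_nrm_le fam_closed 15) (auto intro!: order_trans[OF nrm_add] add_mono)
  next
    case (16 f k)
    have le: "nrm (fam I) (\<lambda>i\<in>I. k \<odot> f i) \<le> cmod k * nrm (fam I) f" if "f \<in> carrier (fam I)" for f k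
      using fam_nrm_upper[OF that] fam_nrm_nonneg[OF that] c[OF that]
      by (intro fam_nrm_le fam_closed[OF that that]) (auto simp: nrm_smult intro!: mult_left_mono)
    show ?case
    proof (cases "k = 0")
      case True
      then show ?thesis using le[OF 16, of 0] fam_nrm_nonneg[OF fam_closed(3)[OF 16 16, of 0]]
        by (simp add: families_simps(6) order_antisym)
    next
      case False
      have "(\<lambda>i\<in>I. inverse k \<odot> (\<lambda>i\<in>I. k \<odot> f i) i) = f"
        using False c[OF 16] fam_carrier(2)[OF 16] by (auto simp: smult_smult extensional_def)
      then have "nrm (fam I) f \<le> cmod (inverse k) * nrm (fam I) (\<lambda>i\<in>I. k \<odot> f i)"
        using le[OF fam_closed(3)[OF 16 16, of k], of "inverse k"] by simp
      then have "cmod k * nrm (fam I) f \<le> nrm (fam I) (\<lambda>i\<in>I. k \<odot> f i)"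
        using False by (rule le_inverse_bound[rotated])
      then show ?thesis using le[OF 16, of k] by (simp add: families_simps(6))
    qed
  next
    case (17 f h)
    show ?case unfolding families_simps(2)
      using fam_nrm_upper[OF 17(1)] fam_nrm_upper[OF 17(2)] fam_nrm_nonneg[OF 17(1)] fam_nrm_nonneg[OF 17(2)] c[OF 17(1)] c[OF 17(2)]
      by (intro fam_nrm_le fam_closed 17) (auto intro!: order_trans[OF nrm_mult] mult_mono)
  next
    case (18 f)
    have le: "nrm (fam I) (\<lambda>i\<in>I. star A (f i)) \<le> nrm (fam I) f" if "f \<in> carrier (fam I)" for f
      using fam_nrm_upper[OF that] fam_nrm_nonneg[OF that] c[OF that]
      by (intro fam_nrm_le fam_closed[OF that that]) auto
    have "(\<lambda>i\<in>I. star A ((\<lambda>i\<in>I. star A (f i)) i)) = f"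
      using c[OF 18] fam_carrier(2)[OF 18] by (auto simp: extensional_def)
    then show ?case using le[OF 18] le[OF fam_closed(4)[OF 18 18]] by (simp add: families_simps(7))
  next
    case (19 f s)
    let ?p = "\<lambda>i\<in>I. star A (f i) \<otimes> f i \<oplus> star A (s i) \<otimes> s i"
    have p: "?p \<in> carrier (fam I)"
      using fam_closed(2)[OF fam_closed(1)[OF fam_closed(4)[OF 19(1,1)] 19(1)] fam_closed(1)[OF fam_closed(4)[OF 19(2,2)] 19(2)]]
      by (simp add: restrict_def if_distrib cong: if_cong)
    have "nrm (fam I) f \<le> sqrt (nrm (fam I) ?p)"
    proof (rule fam_nrm_le[OF 19(1)])
      fix i assume i: "i \<in> I"
      have "(nrm A (f i))\<^sup>2 \<le> nrm (fam I) ?p"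
        using norm_star_sum[OF c[OF 19(1) i] c[OF 19(2) i]] fam_nrm_upper[OF p i] i by simp
      then show "nrm A (f i) \<le> sqrt (nrm (fam I) ?p)" by (rule real_le_rsqrt)
    qed (use fam_nrm_nonneg[OF p] in simp)
    then have "(nrm (fam I) f)\<^sup>2 \<le> (sqrt (nrm (fam I) ?p))\<^sup>2" using fam_nrm_nonneg[OF 19(1)] by (intro power_mono)
    also have "\<dots> = nrm (fam I) ?p" using fam_nrm_nonneg[OF p] by simp
    finally show ?case by (simp add: families_simps restrict_def if_distrib cong: if_cong)
  next
    case (20 \<sigma>)
    have ev: "nrm A (\<sigma> m i \<ominus> \<sigma> n i) \<le> nrm (fam I) (\<sigma> m \<ominus>\<^bsub>fam I\<^esub> \<sigma> n)" if "i \<in> I" for i m n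
      using fam_nrm_upper[OF F.minus_closed[OF 20(1)[of m] 20(1)[of n]] that] that
      by (simp add: fam_minus[OF 20(1) 20(1)])
    have "\<exists>l\<in>carrier A. \<forall>e>0. \<exists>N. \<forall>n\<ge>N. nrm A (\<sigma> n i \<ominus> l) < e" if i: "i \<in> I" for i
    proof (rule complete)
      show "\<forall>e>0. \<exists>N. \<forall>m\<ge>N. \<forall>n\<ge>N. nrm A (\<sigma> m i \<ominus> \<sigma> n i) < e"
      proof (intro allI impI)
        fix e :: real assume "0 < e"
        then obtain N where N: "\<And>m n. m \<ge> N \<Longrightarrow> n \<ge> N \<Longrightarrow> nrm (fam I) (\<sigma> m \<ominus>\<^bsub>fam I\<^esub> \<sigma> n) < e"
          using 20(2) by blast
        have "nrm A (\<sigma> m i \<ominus> \<sigma> n i) < e" if "m \<ge> N" "n \<ge> N" for m n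
          using le_less_trans[OF ev[OF i] N[OF that]] .
        then show "\<exists>N. \<forall>m\<ge>N. \<forall>n\<ge>N. nrm A (\<sigma> m i \<ominus> \<sigma> n i) < e" by blast
      qed
    qed (rule c[OF 20(1) i])
    then obtain l0 where l0: "\<And>i. i \<in> I \<Longrightarrow> l0 i \<in> carrier A"
      "\<And>i. i \<in> I \<Longrightarrow> \<forall>e>0. \<exists>N. \<forall>n\<ge>N. nrm A (\<sigma> n i \<ominus> l0 i) < e" by metis
    define l where "l = restrict l0 I"
    \<comment> \<open>The Cauchy estimate passes to the pointwise limit with a bound independent of
      \<open>i\<close>; only the late index \<open>?m\<close> depends on \<open>i\<close> and
      \<open>d\<close>.\<close>
    have unif: "nrm A (\<sigma> n i \<ominus> l i) \<le> e"
      if e: "0 < e" and N: "\<And>m n. m \<ge> N \<Longrightarrow> n \<ge> N \<Longrightarrow> nrm (fam I) (\<sigma> m \<ominus>\<^bsub>fam I\<^esub> \<sigma> n) < e" and i: "i \<in> I" and n: "n \<ge> N" for e N i n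
    proof (rule field_le_epsilon)
      fix d :: real assume "0 < d"
      then obtain M where M: "\<And>n. n \<ge> M \<Longrightarrow> nrm A (\<sigma> n i \<ominus> l0 i) < d" using l0(2)[OF i] by blast
      let ?m = "max M N"
      have "nrm A (\<sigma> n i \<ominus> l0 i) \<le> nrm A (\<sigma> n i \<ominus> \<sigma> ?m i) + nrm A (\<sigma> ?m i \<ominus> l0 i)"
        using nrm_triangle c[OF 20(1) i] l0(1)[OF i] by blast
      also have "\<dots> \<le> e + d" using ev[OF i, of n ?m] N[OF n, of ?m] M[of ?m] by simp
      finally show "nrm A (\<sigma> n i \<ominus> l i) \<le> e + d" using i by (simp add: l_def)
    qed
    have lc: "l i \<in> carrier A" if "i \<in> I" for i using l0(1)[OF that] that by (simp add: l_def)
    obtain N1 where N1: "\<And>m n. m \<ge> N1 \<Longrightarrow> n \<ge> N1 \<Longrightarrow> nrm (fam I) (\<sigma> m \<ominus>\<^bsub>fam I\<^esub> \<sigma> n) < 1"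
      using 20(2)[rule_format, OF zero_less_one] by blast
    have l: "l \<in> carrier (fam I)"
    proof (rule fam_carrierI[of _ _ "1 + nrm (fam I) (\<sigma> N1)"])
      fix i assume i: "i \<in> I"
      have "nrm A (l i) \<le> nrm A (l i \<ominus> \<sigma> N1 i) + nrm A (\<sigma> N1 i)"
        by (rule nrm_le_minus[OF lc[OF i] c[OF 20(1) i]])
      then show "nrm A (l i) \<le> 1 + nrm (fam I) (\<sigma> N1)"
        using unif[OF zero_less_one N1 i order_refl] fam_nrm_upper[OF 20(1) i] nrm_minus_commute[OF lc[OF i] c[OF 20(1) i]]
        by (smt (verit))
    qed (use lc in \<open>auto simp: l_def\<close>)
    show ?case
    proof (intro bexI[OF _ l] allI impI)
      fix e :: real assume e: "0 < e"
      then obtain N where N: "\<And>m n. m \<ge> N \<Longrightarrow> n \<ge> N \<Longrightarrow> nrm (fam I) (\<sigma> m \<ominus>\<^bsub>fam I\<^esub> \<sigma> n) < e/2"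
        using 20(2)[rule_format, OF half_gt_zero[OF e]] by blast
      have "nrm (fam I) (\<sigma> n \<ominus>\<^bsub>fam I\<^esub> l) \<le> e/2" if n: "n \<ge> N" for n
        using unif[OF half_gt_zero[OF e] N _ n] e
        by (intro fam_nrm_le F.minus_closed 20(1) l) (auto simp: fam_minus[OF 20(1) l])
      then show "\<exists>N. \<forall>n\<ge>N. nrm (fam I) (\<sigma> n \<ominus>\<^bsub>fam I\<^esub> l) < e" using e by (intro exI[of _ N]) force
    qed
  qed (auto simp: families_simps(2-7) fam_closed c smult_add add_smult smult_smult smult_l smult_r star_add star_mult
      star_smult extensional_def restrict_def dest: fam_carrier intro!: fam_closed[unfolded restrict_def])
qed

end

lemma calg_complex: "calg complex_cstar"
proof -
  have "abelian_group complex_cstar"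
    by (rule abelian_groupI) (auto simp: complex_cstar_def intro: exI[of _ "- _"])
  then have "ring complex_cstar"
    by (rule ringI) (auto intro!: monoidI simp: complex_cstar_def algebra_simps)
  then interpret ring complex_cstar .
  have m: "x \<ominus>\<^bsub>complex_cstar\<^esub> y = x - y" for x y
  proof -
    have "\<ominus>\<^bsub>complex_cstar\<^esub> y = - y" by (rule minus_equality) (auto simp: complex_cstar_def)
    then show ?thesis by (simp add: a_minus_def) (simp add: complex_cstar_def)
  qed
  show ?thesis
  proof (unfold_locales, goal_cases)
    case (19 x s)
    have "cnj x * x + cnj s * s = of_real ((cmod x)\<^sup>2 + (cmod s)\<^sup>2)" by (simp add: cnj_mult_self del: of_real_power)
    then have "cmod (cnj x * x + cnj s * s) = (cmod x)\<^sup>2 + (cmod s)\<^sup>2" by (simp only: norm_of_real) simp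
    then show ?case by (simp add: complex_cstar_def)
  next
    case (20 \<sigma>)
    have "Cauchy \<sigma>" by (rule CauchyI) (use 20 in \<open>simp add: m, simp add: complex_cstar_def\<close>)
    then obtain l where "\<sigma> \<longlonglongrightarrow> l" using Cauchy_convergent_iff convergent_def by blast
    then show ?case using LIMSEQ_iff[of \<sigma> l] by (intro bexI[of _ l]) (simp_all add: m, simp_all add: complex_cstar_def)
  qed (auto simp: complex_cstar_def algebra_simps norm_mult norm_triangle_ineq)
qed

context group_submonoid begin

section \<open>Continuous functions on the boundary\<close>

abbreviation "fib \<equiv> fibre G X bd"
abbreviation "cpm \<equiv> cp_mult G bd act"
abbreviation "cps \<equiv> cp_star bd act"

text \<open>The image of the indicator function of \<open>S\<close> in the continuous functions on
  the boundary, extended by zero.\<close>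

definition cyl :: "'g set \<Rightarrow> ('g set \<Rightarrow> bool) \<Rightarrow> complex" where
  "cyl S x = of_bool (x \<in> X \<and> x S)"

text \<open>Combinations of cylinders inside the range of \<open>g\<close>, uniformly dense in
  \<open>fib g\<close>. The index \<open>inv g\<close> occurs because this range is the domain of
  \<open>inv g\<close>.\<close>

inductive_set simp_fun :: "'g \<Rightarrow> (('g set \<Rightarrow> bool) \<Rightarrow> complex) set" for g where
  zero: "(\<lambda>_. 0) \<in> simp_fun g"
| step: "S \<in> jd (inv g) \<Longrightarrow> s \<in> simp_fun g \<Longrightarrow> (\<lambda>x. c * cyl S x + s x) \<in> simp_fun g"

lemma cyl_mult: "S \<in> J \<Longrightarrow> T \<in> J \<Longrightarrow> cyl S x * cyl T x = cyl (S \<inter> T) x"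
  using X_Int[of x S T] by (cases "x \<in> X") (simp_all add: cyl_def)

lemma simp_fun_add: "s \<in> simp_fun g \<Longrightarrow> t \<in> simp_fun g \<Longrightarrow> (\<lambda>x. s x + t x) \<in> simp_fun g"
proof (induct rule: simp_fun.induct)
  case (step S s c)
  then have "(\<lambda>x. c * cyl S x + (s x + t x)) \<in> simp_fun g" by (intro simp_fun.step) auto
  then show ?case by (simp add: add.assoc)
qed simp

lemma simp_fun_smult: "s \<in> simp_fun g \<Longrightarrow> (\<lambda>x. c * s x) \<in> simp_fun g"
proof (induct rule: simp_fun.induct)
  case (step S s d)
  then have "(\<lambda>x. (c * d) * cyl S x + c * s x) \<in> simp_fun g" by (intro simp_fun.step) auto
  then show ?case by (simp add: algebra_simps)
qed (simp add: simp_fun.zero)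

lemma simp_fun_cyl: "S \<in> jd (inv g) \<Longrightarrow> cyl S \<in> simp_fun g"
  using simp_fun.step[OF _ simp_fun.zero, of S g 1] by simp

lemma simp_fun_module:
  assumes "a \<in> simp_fun \<one>" "s \<in> simp_fun g"
  shows "(\<lambda>x. a x * s x) \<in> simp_fun g"
  using assms(1)
proof (induct rule: simp_fun.induct)
  case zero
  then show ?case by (simp add: simp_fun.zero)
next
  case (step T a c)
  have "(\<lambda>x. cyl T x * s x) \<in> simp_fun g"
    using assms(2)
  proof (induct rule: simp_fun.induct)
    case zero
    then show ?case by (simp add: simp_fun.zero)
  next
    case st: (step S s d)
    have TJ: "T \<in> J" using step(1) jd_J by blast
    have "S \<inter> T \<in> jd (inv g)" using jd_Int[OF st(1) TJ] .
    then have "(\<lambda>x. d * cyl (S \<inter> T) x + cyl T x * s x) \<in> simp_fun g" using st by (intro simp_fun.step)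
    moreover have "cyl T x * (d * cyl S x + s x) = d * cyl (S \<inter> T) x + cyl T x * s x" for x
      using cyl_mult[OF jd_J[OF st(1)] TJ, of x] by (simp add: algebra_simps)
    ultimately show ?case by simp
  qed
  then have "(\<lambda>x. c * (cyl T x * s x) + a x * s x) \<in> simp_fun g"
    using step(3) by (intro simp_fun_add simp_fun_smult)
  then show ?case by (simp add: algebra_simps)
qed

lemma cyl_P: "cyl P x = of_bool (x \<in> X)"
  using X_P by (auto simp: cyl_def)

lemma simp_fun_one: "(\<lambda>x. of_bool (x \<in> X)) \<in> simp_fun \<one>"
proof -
  have "cyl P \<in> simp_fun \<one>" using simp_fun_cyl[of P \<one>] P_jd[of \<one>] by simp
  moreover have "cyl P = (\<lambda>x. of_bool (x \<in> X))" by (rule ext) (rule cyl_P)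
  ultimately show ?thesis by simp
qed

lemma simp_fun_off: "s \<in> simp_fun g \<Longrightarrow> x \<notin> bd (inv g) \<Longrightarrow> s x = 0"
proof (induct rule: simp_fun.induct)
  case (step S s c)
  then have "cyl S x = 0" by (auto simp: cyl_def bd_iff)
  then show ?case using step by simp
qed simp

lemma continuous_cyl: "continuous_on A (cyl S)" if "A \<subseteq> X"
proof -
  have "continuous_on A (\<lambda>x. x S)"
    by (rule continuous_on_subset[OF continuous_on_product_coordinates]) simp
  then have "continuous_on A ((\<lambda>b. of_bool b :: complex) \<circ> (\<lambda>x. x S))"
    by (rule continuous_on_compose) simp
  then show ?thesis
    by (rule continuous_on_eq) (use that in \<open>auto simp: cyl_def\<close>)
qed

lemma continuous_simp_fun: "s \<in> simp_fun g \<Longrightarrow> continuous_on X s"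
  by (induct rule: simp_fun.induct) (auto intro!: continuous_intros continuous_cyl)

lemma compact_X: "compact X"
proof -
  have "compact_space (product_topology (\<lambda>_ :: 'g set. euclidean :: bool topology) UNIV)"
    by (rule compact_space_product_topology[THEN iffD2]) (auto simp: compact_space_def intro: finite_imp_compact)
  then have "compact (UNIV :: ('g set \<Rightarrow> bool) set)"
    unfolding euclidean_product_topology by (simp add: compact_space_def)
  then have "compact (UNIV \<inter> X)" by (rule compact_Int_closed) (simp add: boundary_closure)
  then show ?thesis by simp
qed

text \<open>The indicator of a basic clopen set is a product of functions \<open>cyl S\<close> and
  \<open>1 - cyl S\<close>.\<close>

lemma simp_fun_nbhd:
  assumes "finite F" "F \<subseteq> J"
  shows "\<exists>v\<in>simp_fun \<one>. \<forall>y\<in>X. v y = of_bool (\<forall>S\<in>F. y S = z S)"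
  using assms
proof (induct F)
  case empty
  then show ?case using simp_fun_one by (intro bexI[of _ "\<lambda>x. of_bool (x \<in> X)"]) auto
next
  case (insert S F)
  then obtain v where v: "v \<in> simp_fun \<one>" "\<forall>y\<in>X. v y = of_bool (\<forall>S\<in>F. y S = z S)" by auto
  have S: "S \<in> jd (inv \<one>)" using insert J_jd by simp
  define w where "w = (if z S then cyl S else (\<lambda>x. of_bool (x \<in> X) + (-1) * cyl S x))"
  have "w \<in> simp_fun \<one>"
    unfolding w_def using simp_fun_cyl[OF S] simp_fun_add[OF simp_fun_one simp_fun_smult[OF simp_fun_cyl[OF S], of "-1"]]
    by simp
  then have "(\<lambda>x. w x * v x) \<in> simp_fun \<one>" by (rule simp_fun_module[OF _ v(1)])
  moreover have "w y * v y = of_bool (\<forall>R\<in>insert S F. y R = z R)" if "y \<in> X" for y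
    using v(2) that by (auto simp: w_def cyl_def)
  ultimately show ?case by (intro bexI[of _ "\<lambda>x. w x * v x"]) auto
qed

text \<open>By compactness finitely many basic clopen sets cover the boundary, on each of which
  \<open>f\<close> stays within \<open>e\<close> of its value at the centre. If that value is
  nonzero, the describing family includes an ideal of \<open>jd (inv g)\<close>, so the indicator of
  the set times this cylinder is in \<open>simp_fun g\<close>; if it is zero, so is the
  approximation.\<close>

lemma fib_approx:
  assumes f: "f \<in> fib g" and e: "0 < e"
  shows "\<exists>s\<in>simp_fun g. \<forall>x\<in>X. cmod (f x - s x) < e"
proof -
  have fc: "continuous_on X f" and f0: "\<And>x. x \<notin> bd (inv g) \<Longrightarrow> f x = 0" using f by (auto simp: fibre_def)
  have "\<exists>F. finite F \<and> F \<subseteq> J \<and> (\<forall>y\<in>X. (\<forall>S\<in>F. y S = z S) \<longrightarrow> cmod (f y - f z) < e) \<and>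
    (f z \<noteq> 0 \<longrightarrow> (\<exists>S\<in>F. S \<in> jd (inv g) \<and> z S))" if z: "z \<in> X" for z
  proof -
    obtain U where U: "open U" "z \<in> U" "\<forall>y\<in>X. y \<in> U \<longrightarrow> f y \<in> ball (f z) e"
      using fc[unfolded continuous_on_topological, rule_format, OF z, of "ball (f z) e"] e by auto
    obtain F where F: "finite F" "F \<subseteq> J" "\<forall>y\<in>X. (\<forall>S\<in>F. y S = z S) \<longrightarrow> y \<in> U"
      using basic_nbhd[OF z U(1,2)] by blast
    have near: "cmod (f y - f z) < e" if "y \<in> X" "\<forall>S\<in>F. y S = z S" for y
      using U(3) F(3) that by (auto simp: dist_norm norm_minus_commute)
    show ?thesis
    proof (cases "f z = 0")
      case True
      then show ?thesis using F near by blast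
    next
      case False
      then obtain S where S: "S \<in> jd (inv g)" "z S" using f0[of z] by (auto simp: bd_iff)
      have "finite (insert S F)" "insert S F \<subseteq> J" using F jd_J[OF S(1)] by auto
      then show ?thesis using near S by (intro exI[of _ "insert S F"]) auto
    qed
  qed
  then have "\<forall>z\<in>X. \<exists>F. finite F \<and> F \<subseteq> J \<and> (\<forall>y\<in>X. (\<forall>S\<in>F. y S = z S) \<longrightarrow> cmod (f y - f z) < e) \<and>
    (f z \<noteq> 0 \<longrightarrow> (\<exists>S\<in>F. S \<in> jd (inv g) \<and> z S))" by (intro ballI)
  then obtain F where F0: "\<forall>z\<in>X. finite (F z) \<and> F z \<subseteq> J \<and>
    (\<forall>y\<in>X. (\<forall>S\<in>F z. y S = z S) \<longrightarrow> cmod (f y - f z) < e) \<and>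
    (f z \<noteq> 0 \<longrightarrow> (\<exists>S\<in>F z. S \<in> jd (inv g) \<and> z S))" by (rule bchoice[THEN exE])
  then have F: "\<And>z. z \<in> X \<Longrightarrow> finite (F z)" "\<And>z. z \<in> X \<Longrightarrow> F z \<subseteq> J"
    "\<And>z y. z \<in> X \<Longrightarrow> y \<in> X \<Longrightarrow> (\<forall>S\<in>F z. y S = z S) \<Longrightarrow> cmod (f y - f z) < e"
    "\<And>z. z \<in> X \<Longrightarrow> f z \<noteq> 0 \<Longrightarrow> (\<exists>S\<in>F z. S \<in> jd (inv g) \<and> z S)" by simp_all
  let ?N = "\<lambda>z. {y. \<forall>S\<in>F z. y S = z S}"
  have Nopen: "open (?N z)" if "z \<in> X" for z
  proof -
    have "?N z = (\<Inter>S\<in>F z. {y. y S = z S})" by auto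
    then show ?thesis using F(1)[OF that] by (auto intro!: open_INT open_cylinder)
  qed
  have cover: "X \<subseteq> (\<Union>z\<in>X. ?N z)" by auto
  obtain Z where Z: "Z \<subseteq> X" "finite Z" "X \<subseteq> (\<Union>z\<in>Z. ?N z)"
    by (rule compactE_image[OF compact_X Nopen cover])
  \<comment> \<open>Induction over the cover: \<open>u\<close> is the indicator of the union so far,
    and \<open>s\<close> approximates \<open>f\<close> there and vanishes on the rest. A new set
    contributes only through the part outside this union, whose indicator is
    \<open>w\<close>.\<close>
  have "\<exists>s\<in>simp_fun g. \<exists>u\<in>simp_fun \<one>. \<forall>y\<in>X. u y = of_bool (y \<in> (\<Union>z\<in>Z. ?N z)) \<and>
    (y \<in> (\<Union>z\<in>Z. ?N z) \<longrightarrow> cmod (f y - s y) < e) \<and> (y \<notin> (\<Union>z\<in>Z. ?N z) \<longrightarrow> s y = 0)"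
    using Z(2,1)
  proof (induct Z)
    case empty
    then show ?case using simp_fun.zero[of g] simp_fun.zero[of \<one>] by (intro bexI[of _ "\<lambda>_. 0"]) auto
  next
    case (insert z Z)
    then have zX: "z \<in> X" and ZX: "Z \<subseteq> X" by simp_all
    from insert(3)[OF ZX] obtain s u where su: "s \<in> simp_fun g" "u \<in> simp_fun \<one>"
      and su0: "\<forall>y\<in>X. u y = of_bool (y \<in> (\<Union>z\<in>Z. ?N z)) \<and>
        (y \<in> (\<Union>z\<in>Z. ?N z) \<longrightarrow> cmod (f y - s y) < e) \<and> (y \<notin> (\<Union>z\<in>Z. ?N z) \<longrightarrow> s y = 0)"
      by (elim bexE)
    have uZ: "u y = of_bool (y \<in> (\<Union>z\<in>Z. ?N z))" if "y \<in> X" for y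
      using su0[rule_format, OF that] by (rule conjunct1)
    have sZ: "y \<in> (\<Union>z\<in>Z. ?N z) \<longrightarrow> cmod (f y - s y) < e" "y \<notin> (\<Union>z\<in>Z. ?N z) \<longrightarrow> s y = 0" if "y \<in> X" for y
      using su0[rule_format, OF that] by (rule conjunct2[THEN conjunct1], rule conjunct2[THEN conjunct2])
    obtain v where v: "v \<in> simp_fun \<one>" "\<And>y. y \<in> X \<Longrightarrow> v y = of_bool (y \<in> ?N z)"
      using simp_fun_nbhd[OF F(1,2)[OF zX], of z] by auto
    have comp: "(\<lambda>x. of_bool (x \<in> X) + (-1) * u x) \<in> simp_fun \<one>"
      by (intro simp_fun_add simp_fun_one simp_fun_smult su)
    define w where "w x = (of_bool (x \<in> X) + (-1) * u x) * v x" for x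
    have w: "w \<in> simp_fun \<one>" unfolding w_def using simp_fun_module[OF comp v(1)] .
    have wy: "w y = of_bool (y \<in> ?N z \<and> y \<notin> (\<Union>z\<in>Z. ?N z))" if "y \<in> X" for y
      unfolding w_def uZ[OF that] v(2)[OF that] using that by simp
    have u': "(\<lambda>x. u x + w x) \<in> simp_fun \<one>" by (intro simp_fun_add su w)
    have "\<exists>t\<in>simp_fun g. \<forall>y\<in>X. t y = f z * w y"
    proof (cases "f z = 0")
      case True
      then show ?thesis using simp_fun.zero by auto
    next
      case False
      then obtain S where S: "S \<in> F z" "S \<in> jd (inv g)" "z S" using F(4)[OF zX] by blast
      have "(\<lambda>x. w x * cyl S x) \<in> simp_fun g" by (rule simp_fun_module[OF w simp_fun_cyl[OF S(2)]])
      moreover have "w y * cyl S y = w y" if "y \<in> X" for y using wy[OF that] S that by (auto simp: cyl_def)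
      ultimately show ?thesis
        by (intro bexI[of _ "\<lambda>x. f z * (w x * cyl S x)"] simp_fun_smult) auto
    qed
    then obtain t where t: "t \<in> simp_fun g" "\<And>y. y \<in> X \<Longrightarrow> t y = f z * w y" by blast
    have "u y + w y = of_bool (y \<in> (\<Union>z\<in>insert z Z. ?N z)) \<and>
      (y \<in> (\<Union>z\<in>insert z Z. ?N z) \<longrightarrow> cmod (f y - (s y + t y)) < e) \<and>
      (y \<notin> (\<Union>z\<in>insert z Z. ?N z) \<longrightarrow> s y + t y = 0)" if y: "y \<in> X" for y
    proof (cases "y \<in> (\<Union>z\<in>Z. ?N z)")
      case True
      then have e: "w y = 0" "u y = 1" "cmod (f y - s y) < e" using wy[OF y] uZ[OF y] sZ(1)[OF y] by simp_all
      have "t y = 0" using t(2)[OF y] e(1) by simp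
      moreover have "y \<in> (\<Union>z\<in>insert z Z. ?N z)" using True by blast
      ultimately show ?thesis using e by simp
    next
      case False
      then have e: "u y = 0" "s y = 0" "w y = of_bool (y \<in> ?N z)" using wy[OF y] uZ[OF y] sZ(2)[OF y] by simp_all
      have i: "y \<in> (\<Union>z\<in>insert z Z. ?N z) \<longleftrightarrow> y \<in> ?N z" using False by blast
      have "t y = f z * of_bool (y \<in> ?N z)" using t(2)[OF y] e(3) by simp
      then show ?thesis unfolding i e using F(3)[OF zX y] by simp
    qed
    then show ?case using u' simp_fun_add[OF su(1) t(1)]
      by (intro bexI[of _ "\<lambda>x. s x + t x"] bexI[of _ "\<lambda>x. u x + w x"] ballI)
  qed
  then obtain s where s: "s \<in> simp_fun g"
    "\<forall>y\<in>X. y \<in> (\<Union>z\<in>Z. ?N z) \<longrightarrow> cmod (f y - s y) < e" by blast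
  have "cmod (f y - s y) < e" if "y \<in> X" for y
    using s(2)[rule_format, OF that subsetD[OF Z(3) that]] .
  then show ?thesis using s(1) by blast
qed

text \<open>A uniform limit of simple functions is in the fibre. Products and adjoints are placed in
  their fibres this way, so that only the effect of the action on cylinders has to be
  computed.\<close>

lemma fibI:
  assumes f0: "\<And>x. x \<notin> X \<Longrightarrow> f x = 0"
    and ap: "\<And>e. 0 < e \<Longrightarrow> \<exists>s\<in>simp_fun g. \<forall>x\<in>X. cmod (f x - s x) \<le> e"
  shows "f \<in> fib g"
proof -
  have "\<exists>s\<in>simp_fun g. \<forall>x\<in>X. cmod (s x - f x) \<le> inverse (real (Suc n))" for n
    using ap[of "inverse (real (Suc n))"] by (simp add: norm_minus_commute)
  then obtain s where s: "\<And>n. s n \<in> simp_fun g" "\<And>n x. x \<in> X \<Longrightarrow> cmod (s n x - f x) \<le> inverse (real (Suc n))" by metis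
  have "uniform_limit X s f sequentially"
  proof (rule uniform_limitI)
    fix e :: real assume "0 < e"
    then obtain N where N: "inverse (real (Suc N)) < e" using reals_Archimedean by blast
    have "\<forall>x\<in>X. dist (s n x) (f x) < e" if "n \<ge> N" for n
    proof
      fix x assume "x \<in> X"
      have "inverse (real (Suc n)) \<le> inverse (real (Suc N))" using that by (simp add: le_imp_inverse_le)
      then show "dist (s n x) (f x) < e" 
        using s(2)[OF \<open>x \<in> X\<close>, of n] N unfolding dist_norm by linarith
    qed
    then show "\<forall>\<^sub>F n in sequentially. \<forall>x\<in>X. dist (s n x) (f x) < e" by (auto simp: eventually_sequentially)
  qed
  then have c: "continuous_on X f"
    by (rule uniform_limit_theorem[rotated]) (auto intro: always_eventually continuous_simp_fun s)
  have "f x = 0" if x: "x \<notin> bd (inv g)" for x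
  proof (cases "x \<in> X")
    case True
    have "cmod (f x) \<le> e" if e: "0 < e" for e
    proof -
      obtain s where s: "s \<in> simp_fun g" "cmod (f x - s x) \<le> e" using ap[OF e] True by blast
      show ?thesis using s(2) simp_fun_off[OF s(1) x] by simp
    qed
    then have "cmod (f x) \<le> 0" by (rule field_le_epsilon) simp
    then show ?thesis by simp
  qed (rule f0)
  then show ?thesis using c by (simp add: fibre_def)
qed

lemma fib_off: "f \<in> fib g \<Longrightarrow> x \<notin> bd (inv g) \<Longrightarrow> f x = 0"
  by (simp add: fibre_def)

lemma fib_off_X: "f \<in> fib g \<Longrightarrow> x \<notin> X \<Longrightarrow> f x = 0"
  using fib_off bd_X by blast

lemma simp_fun_fib: "s \<in> simp_fun g \<Longrightarrow> s \<in> fib g"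
  using simp_fun_off continuous_simp_fun by (auto simp: fibre_def)

lemma cyl_fib: "S \<in> jd (inv g) \<Longrightarrow> cyl S \<in> fib g"
  by (intro simp_fun_fib simp_fun_cyl)

lemma fib_bounded: "f \<in> fib g \<Longrightarrow> \<exists>M\<ge>0. \<forall>x. cmod (f x) \<le> M"
proof -
  assume f: "f \<in> fib g"
  then have "compact (f ` X)" by (intro compact_continuous_image compact_X) (simp add: fibre_def)
  from compact_imp_bounded[OF this] obtain M where M: "\<forall>y\<in>f ` X. cmod y \<le> M" unfolding bounded_iff by blast
  have "cmod (f x) \<le> max M 0" for x
    using M fib_off_X[OF f, of x] by (cases "x \<in> X") (auto simp: le_max_iff_disj)
  then have "\<forall>x. cmod (f x) \<le> max M 0" ..
  then show ?thesis by (intro exI[of _ "max M 0"]) auto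
qed

lemma fib_add: "f \<in> fib g \<Longrightarrow> h \<in> fib g \<Longrightarrow> (\<lambda>x. f x + h x) \<in> fib g"
  and fib_smult: "f \<in> fib g \<Longrightarrow> (\<lambda>x. c * f x) \<in> fib g"
  by (auto simp: fibre_def intro!: continuous_intros)

lemma fib_diff: "f \<in> fib g \<Longrightarrow> h \<in> fib g \<Longrightarrow> (\<lambda>x. f x - h x) \<in> fib g"
  by (auto simp: fibre_def intro!: continuous_intros)

text \<open>Composing with \<open>act (inv g)\<close> pulls \<open>T\<close> back along translation
  by \<open>inv g\<close>, by \<open>act_iff\<close>; at points not containing \<open>S\<close> both
  sides vanish.\<close>

lemma cpm_cyl:
  assumes "S \<in> jd (inv g)" and that: "T \<in> J"
  shows "cpm g (cyl S) (cyl T) = cyl {p \<in> S. inv g \<otimes> p \<in> T}"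
proof
  fix x
  show "cpm g (cyl S) (cyl T) x = cyl {p \<in> S. inv g \<otimes> p \<in> T} x"
  proof (cases "x \<in> X \<and> x S")
    case True
    then have "x \<in> bd (inv g)" using assms(1) unfolding bd_iff by blast
    moreover have "act (inv g) x T \<longleftrightarrow> x {p \<in> S. inv g \<otimes> p \<in> T}" using act_iff[OF _ assms(1) _ that] True by blast
    moreover have "act (inv g) x \<in> X" using act_X[OF calculation(1)] .
    ultimately show ?thesis using True by (simp add: cp_mult_def cyl_def)
  next
    case False
    then have "\<not> (x \<in> X \<and> x {p \<in> S. inv g \<otimes> p \<in> T})" using X_mono[OF _ _ _ jd_J[OF assms(1)]] by blast
    then show ?thesis using False by (auto simp: cp_mult_def cyl_def)
  qed
qed

text \<open>The adjoint moves the function from the range of \<open>g\<close> to its domain, which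
  translates the ideal by \<open>inv g\<close>.\<close>

lemma cps_cyl:
  assumes g: "g \<in> carrier G" and S: "S \<in> jd (inv g)"
  shows "cps g (cyl S) = cyl (inv g <# S)"
proof
  fix x
  have R: "inv g <# S \<in> jd g" using jd_inv[OF S] g by simp
  have SP: "S \<subseteq> carrier G" using J_sub[OF jd_J[OF S]] by auto
  have e: "{p \<in> inv g <# S. g \<otimes> p \<in> S} = inv g <# S" using g SP by (auto simp: mem_lcoset_iff)
  show "cps g (cyl S) x = cyl (inv g <# S) x"
  proof (cases "x \<in> X \<and> x (inv g <# S)")
    case True
    then have "x \<in> bd g" using R by (auto simp: bd_iff)
    moreover have "act g x S" using act_iff[OF _ R _ jd_J[OF S], of x] True e by simp
    ultimately show ?thesis using True act_X by (simp add: cp_star_def cyl_def)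
  next
    case False
    have "\<not> act g x S" if x: "x \<in> bd g"
    proof
      assume a: "act g x S"
      obtain T where T: "x \<in> X" "T \<in> jd g" "x T" using x by (auto simp: bd_iff)
      have "x {p \<in> T. g \<otimes> p \<in> S}" using a act_iff[OF T jd_J[OF S]] by simp
      moreover have "{p \<in> T. g \<otimes> p \<in> S} \<subseteq> inv g <# S"
        using g SP J_sub[OF jd_J[OF T(2)]] by (auto simp: mem_lcoset_iff)
      ultimately show False using False X_mono[OF T(1) _ _ jd_J[OF R]] T(1) by blast
    qed
    then show ?thesis using False by (simp add: cp_star_def cyl_def)
  qed
qed

lemma cpm_simp_fun:
  assumes g: "g \<in> carrier G" "h \<in> carrier G" and s: "s \<in> simp_fun g" and t: "t \<in> simp_fun h"
  shows "cpm g s t \<in> simp_fun (g \<otimes> h)"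
  using s
proof (induct rule: simp_fun.induct)
  case zero
  have "cpm g (\<lambda>_. 0) t = (\<lambda>_. 0)" by (auto simp: cp_mult_def)
  then show ?case by (simp add: simp_fun.zero)
next
  case (step S s c)
  have 1: "cpm g (cyl S) t \<in> simp_fun (g \<otimes> h)"
    using t
  proof (induct rule: simp_fun.induct)
    case zero
    have "cpm g (cyl S) (\<lambda>_. 0) = (\<lambda>_. 0)" by (auto simp: cp_mult_def)
    then show ?case by (simp add: simp_fun.zero)
  next
    case st: (step T t d)
    have "cpm g (cyl S) (\<lambda>x. d * cyl T x + t x) = (\<lambda>x. d * cpm g (cyl S) (cyl T) x + cpm g (cyl S) t x)"
      by (auto simp: cp_mult_def algebra_simps)
    moreover have "{p \<in> S. inv g \<otimes> p \<in> T} \<in> jd (inv (g \<otimes> h))"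
      using jd_comp[OF step(1) st(1)] g by (simp add: inv_mult_group)
    ultimately show ?case using st cpm_cyl[OF step(1) jd_J[OF st(1)]] by (simp add: simp_fun.step)
  qed
  have "cpm g (\<lambda>x. c * cyl S x + s x) t = (\<lambda>x. c * cpm g (cyl S) t x + cpm g s t x)"
    by (auto simp: cp_mult_def algebra_simps)
  then show ?case using simp_fun_add[OF simp_fun_smult[OF 1] step(3)] by simp
qed

lemma fib_mult:
  assumes g: "g \<in> carrier G" "h \<in> carrier G" and f: "f \<in> fib g" and f': "f' \<in> fib h"
  shows "cpm g f f' \<in> fib (g \<otimes> h)"
proof (rule fibI)
  show "cpm g f f' x = 0" if "x \<notin> X" for x using that bd_X by (auto simp: cp_mult_def)
  fix e :: real assume e: "0 < e"
  obtain M where M: "M \<ge> 0" "\<And>x. cmod (f x) \<le> M" using fib_bounded[OF f] by blast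
  obtain M' where M': "M' \<ge> 0" "\<And>x. cmod (f' x) \<le> M'" using fib_bounded[OF f'] by blast
  \<comment> \<open>The bound 1 keeps \<open>t\<close> below \<open>M' + 1\<close> in absolute
    value, and the error is then at most \<open>M * d + d * (M' + 1)\<close>, which is at most
    \<open>e\<close>.\<close>
  define d where "d = min 1 (e / (M + M' + 1))"
  have d: "0 < d" "d \<le> 1" "d \<le> e / (M + M' + 1)" using e M(1) M'(1) by (auto simp: d_def)
  then have d': "d * (M + M' + 1) \<le> e" using M(1) M'(1) by (simp add: pos_le_divide_eq)
  obtain s where s: "s \<in> simp_fun g" "\<And>x. x \<in> X \<Longrightarrow> cmod (f x - s x) < d" using fib_approx[OF f d(1)] by blast
  obtain t where t: "t \<in> simp_fun h" "\<And>x. x \<in> X \<Longrightarrow> cmod (f' x - t x) < d" using fib_approx[OF f' d(1)] by blast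
  have "cmod (cpm g f f' x - cpm g s t x) \<le> e" for x
  proof (cases "x \<in> bd (inv g)")
    case True
    let ?y = "act (inv g) x"
    have x: "x \<in> X" "?y \<in> X" using True bd_X act_X by auto
    have tt: "cmod (t ?y) \<le> cmod (f' ?y) + cmod (f' ?y - t ?y)"
      using norm_triangle_ineq4[of "f' ?y" "f' ?y - t ?y"] by simp
    have eq: "f x * f' ?y - s x * t ?y = f x * (f' ?y - t ?y) + (f x - s x) * (f' ?y - (f' ?y - t ?y))"
      by (simp add: algebra_simps)
    have "cmod (f x * f' ?y - s x * t ?y) \<le> cmod (f x) * cmod (f' ?y - t ?y) + cmod (f x - s x) * (cmod (f' ?y) + cmod (f' ?y - t ?y))"
      unfolding eq by (rule order_trans[OF norm_triangle_ineq]) (simp add: norm_mult mult_left_mono tt)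
    also have "\<dots> \<le> M * d + d * (M' + 1)"
    proof (rule add_mono)
      show "cmod (f x) * cmod (f' ?y - t ?y) \<le> M * d"
        by (rule mult_mono[OF M(2) less_imp_le[OF t(2)[OF x(2)]] M(1) norm_ge_zero])
      have "cmod (f' ?y) + cmod (f' ?y - t ?y) \<le> M' + 1" using M'(2)[of ?y] t(2)[OF x(2)] d(2) by linarith
      then show "cmod (f x - s x) * (cmod (f' ?y) + cmod (f' ?y - t ?y)) \<le> d * (M' + 1)"
        using s(2)[OF x(1)] d(1) by (intro mult_mono) auto
    qed
    also have "\<dots> \<le> e" using d' by (simp add: algebra_simps)
    finally show ?thesis using True by (simp add: cp_mult_def)
  next
    case False
    then show ?thesis using e by (simp add: cp_mult_def)
  qed
  then show "\<exists>s\<in>simp_fun (g \<otimes> h). \<forall>x\<in>X. cmod (cpm g f f' x - s x) \<le> e"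
    using cpm_simp_fun[OF g s(1) t(1)] by blast
qed

lemma cps_simp_fun:
  assumes g: "g \<in> carrier G" and s: "s \<in> simp_fun g"
  shows "cps g s \<in> simp_fun (inv g)"
  using s
proof (induct rule: simp_fun.induct)
  case zero
  have "cps g (\<lambda>_. 0) = (\<lambda>_. 0)" by (auto simp: cp_star_def)
  then show ?case by (simp add: simp_fun.zero)
next
  case (step S s c)
  have "cps g (\<lambda>x. c * cyl S x + s x) = (\<lambda>x. cnj c * cps g (cyl S) x + cps g s x)"
    by (auto simp: cp_star_def)
  moreover have "inv g <# S \<in> jd (inv (inv g))" using jd_inv[OF step(1)] .
  ultimately show ?case using step(3) cps_cyl[OF g step(1)] by (simp add: simp_fun.step)
qed

lemma fib_star:
  assumes g: "g \<in> carrier G" and f: "f \<in> fib g"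
  shows "cps g f \<in> fib (inv g)"
proof (rule fibI)
  show "cps g f x = 0" if "x \<notin> X" for x using that bd_X by (auto simp: cp_star_def)
  fix e :: real assume e: "0 < e"
  obtain s where s: "s \<in> simp_fun g" "\<And>x. x \<in> X \<Longrightarrow> cmod (f x - s x) < e" using fib_approx[OF f e] by blast
  have "cmod (cps g f x - cps g s x) \<le> e" for x
  proof (cases "x \<in> bd g")
    case True
    then have "act g x \<in> X" by (rule act_X)
    then have "cmod (cnj (f (act g x) - s (act g x))) < e" unfolding complex_mod_cnj by (rule s(2))
    then show ?thesis using True by (simp add: cp_star_def)
  next
    case False
    then show ?thesis using e by (simp add: cp_star_def)
  qed
  then show "\<exists>s\<in>simp_fun (inv g). \<forall>x\<in>X. cmod (cps g f x - s x) \<le> e"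
    using cps_simp_fun[OF g s(1)] by blast
qed

end

section \<open>Homomorphisms from bounded relations between generators\<close>

context calg_pair begin

text \<open>The closed span of \<open>Y\<close> is the graph of \<open>\<phi>\<close>:
  \<open>bound\<close> makes it single-valued and total over the closed span of the first
  components, and stability under products and adjoints makes the map a homomorphism. The units
  \<open>uA\<close> and \<open>uB\<close> are given separately because the subalgebras need not
  contain the ambient units.\<close>

lemma graph_star_hom:
  assumes Y: "Y \<subseteq> carrier AB" and C: "0 \<le> C"
    and bound: "\<And>a b. (a, b) \<in> lin_span AB Y \<Longrightarrow> nrm B b \<le> C * nrm A a"
    and mult: "\<And>y z. y \<in> Y \<Longrightarrow> z \<in> Y \<Longrightarrow> y \<otimes>\<^bsub>AB\<^esub> z \<in> lin_span AB Y"
    and star: "\<And>y. y \<in> Y \<Longrightarrow> star AB y \<in> lin_span AB Y"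
    and one: "(uA, uB) \<in> Y"
    and E: "cl B (lin_span B (snd ` Y)) \<subseteq> E"
  shows "\<exists>\<phi>. star_hom (A\<lparr>carrier := cl A (lin_span A (fst ` Y)), one := uA\<rparr>) (B\<lparr>carrier := E, one := uB\<rparr>) \<phi> \<and>
    (\<forall>a b. (a, b) \<in> Y \<longrightarrow> \<phi> a = b) \<and>
    (\<forall>a\<in>cl A (lin_span A (fst ` Y)). (a, \<phi> a) \<in> cl AB (lin_span AB Y))"
proof -
  let ?L = "lin_span AB Y" and ?D = "cl A (lin_span A (fst ` Y))"
  let ?\<Gamma> = "cl AB ?L"
  have Ytot: "\<And>a. a \<in> ?D \<Longrightarrow> \<exists>b. (a, b) \<in> ?\<Gamma>" by (rule graph_total[OF Y C]) (rule bound)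
  have Yun: "\<And>a b b'. (a, b) \<in> ?\<Gamma> \<Longrightarrow> (a, b') \<in> ?\<Gamma> \<Longrightarrow> b = b'" by (rule graph_unique[OF Y C]) (rule bound)
  have s: "?L \<subseteq> carrier AB" using AB.lin_span_carrier[OF Y] by blast
  have fY: "fst ` Y \<subseteq> carrier A" and sY: "snd ` Y \<subseteq> carrier B" using Y by auto
  define \<phi> where "\<phi> = (\<lambda>a\<in>?D. THE b. (a, b) \<in> ?\<Gamma>)"
  have \<phi>: "(a, \<phi> a) \<in> ?\<Gamma>" if a: "a \<in> ?D" for a
  proof -
    obtain b where b: "(a, b) \<in> ?\<Gamma>" using Ytot[OF a] by blast
    then have "(THE b. (a, b) \<in> ?\<Gamma>) = b" by (rule the_equality) (use Yun[OF _ b] in blast)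
    then show ?thesis using b a by (simp add: \<phi>_def)
  qed
  have eq: "\<phi> a = b" if "a \<in> ?D" "(a, b) \<in> ?\<Gamma>" for a b using Yun[OF \<phi>[OF that(1)] that(2)] .
  have fstD: "a \<in> ?D" if ab: "(a, b) \<in> ?\<Gamma>" for a b
  proof -
    have "\<exists>y\<in>lin_span A (fst ` Y). nrm A (a \<ominus>\<^bsub>A\<^esub> y) < e" if e: "0 < e" for e
    proof -
      have c: "a \<in> carrier A" "b \<in> carrier B" using ab AB.cl_carrier by auto
      obtain a' b' where y: "(a', b') \<in> ?L" "nrm AB ((a, b) \<ominus>\<^bsub>AB\<^esub> (a', b')) < e" using AB.cl_approx[OF ab e] by auto
      then have "a' \<in> carrier A" "b' \<in> carrier B" using s by auto
      then have "nrm A (a \<ominus>\<^bsub>A\<^esub> a') < e" using y(2) c by (simp add: prod_minus)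
      moreover have "fst y \<in> lin_span A (fst ` Y)" if "y \<in> ?L" for y
        using that
      proof induct
        case zero
        show ?case by (simp add: lin_span.zero)
      next
        case (step x y c)
        then have "c \<odot>\<^bsub>A\<^esub> fst x \<oplus>\<^bsub>A\<^esub> fst y \<in> lin_span A (fst ` Y)" by (intro lin_span.step) auto
        then show ?case by (cases x; cases y) simp
      qed
      ultimately show ?thesis using y(1) by force
    qed
    moreover have "a \<in> carrier A" using ab AB.cl_carrier by auto
    ultimately show ?thesis by (simp add: cl_def)
  qed
  have base: "(a, b) \<in> ?\<Gamma>" if "(a, b) \<in> Y" for a b
    using AB.cl_subset[OF s] AB.lin_span_base[OF Y that] by blast
  have sndE: "b \<in> E" if ab: "(a, b) \<in> ?\<Gamma>" for a b
  proof -
    have "\<exists>y\<in>lin_span B (snd ` Y). nrm B (b \<ominus>\<^bsub>B\<^esub> y) < e" if e: "0 < e" for e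
    proof -
      have c: "a \<in> carrier A" "b \<in> carrier B" using ab AB.cl_carrier by auto
      obtain a' b' where y: "(a', b') \<in> ?L" "nrm AB ((a, b) \<ominus>\<^bsub>AB\<^esub> (a', b')) < e" using AB.cl_approx[OF ab e] by auto
      then have "a' \<in> carrier A" "b' \<in> carrier B" using s by auto
      then have "nrm B (b \<ominus>\<^bsub>B\<^esub> b') < e" using y(2) c by (simp add: prod_minus)
      moreover have "snd y \<in> lin_span B (snd ` Y)" if "y \<in> ?L" for y
        using that
      proof induct
        case zero
        show ?case by (simp add: lin_span.zero)
      next
        case (step x y c)
        then have "c \<odot>\<^bsub>B\<^esub> snd x \<oplus>\<^bsub>B\<^esub> snd y \<in> lin_span B (snd ` Y)" by (intro lin_span.step) auto
        then show ?case by (cases x; cases y) simp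
      qed
      ultimately show ?thesis using y(1) by force
    qed
    moreover have "b \<in> carrier B" using ab AB.cl_carrier by auto
    ultimately show ?thesis using E by (auto simp: cl_def)
  qed
  have hom: "a \<otimes>\<^bsub>A\<^esub> a' \<in> ?D \<and> \<phi> (a \<otimes>\<^bsub>A\<^esub> a') = \<phi> a \<otimes>\<^bsub>B\<^esub> \<phi> a'"
    "a \<oplus>\<^bsub>A\<^esub> a' \<in> ?D \<and> \<phi> (a \<oplus>\<^bsub>A\<^esub> a') = \<phi> a \<oplus>\<^bsub>B\<^esub> \<phi> a'"
    "c \<odot>\<^bsub>A\<^esub> a \<in> ?D \<and> \<phi> (c \<odot>\<^bsub>A\<^esub> a) = c \<odot>\<^bsub>B\<^esub> \<phi> a"
    "star A a \<in> ?D \<and> \<phi> (star A a) = star B (\<phi> a)" if a: "a \<in> ?D" "a' \<in> ?D" for a a' c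
  proof -
    have "(a \<otimes>\<^bsub>A\<^esub> a', \<phi> a \<otimes>\<^bsub>B\<^esub> \<phi> a') \<in> ?\<Gamma>"
      using AB.cl_mult[OF s s AB.lin_span_mult[OF Y Y Y mult] \<phi>[OF a(1)] \<phi>[OF a(2)]] by simp
    then show "a \<otimes>\<^bsub>A\<^esub> a' \<in> ?D \<and> \<phi> (a \<otimes>\<^bsub>A\<^esub> a') = \<phi> a \<otimes>\<^bsub>B\<^esub> \<phi> a'" using fstD eq by blast
    have "(a \<oplus>\<^bsub>A\<^esub> a', \<phi> a \<oplus>\<^bsub>B\<^esub> \<phi> a') \<in> ?\<Gamma>"
      using AB.cl_add[OF s AB.lin_span_add[OF Y] \<phi>[OF a(1)] \<phi>[OF a(2)]] by simp
    then show "a \<oplus>\<^bsub>A\<^esub> a' \<in> ?D \<and> \<phi> (a \<oplus>\<^bsub>A\<^esub> a') = \<phi> a \<oplus>\<^bsub>B\<^esub> \<phi> a'" using fstD eq by blast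
    have "(c \<odot>\<^bsub>A\<^esub> a, c \<odot>\<^bsub>B\<^esub> \<phi> a) \<in> ?\<Gamma>"
      using AB.cl_smult[OF s AB.lin_span_smult[OF Y] \<phi>[OF a(1)], of c] by simp
    then show "c \<odot>\<^bsub>A\<^esub> a \<in> ?D \<and> \<phi> (c \<odot>\<^bsub>A\<^esub> a) = c \<odot>\<^bsub>B\<^esub> \<phi> a" using fstD eq by blast
    have "(star A a, star B (\<phi> a)) \<in> ?\<Gamma>"
      using AB.cl_star[OF s AB.lin_span_star[OF Y Y star] \<phi>[OF a(1)]] by simp
    then show "star A a \<in> ?D \<and> \<phi> (star A a) = star B (\<phi> a)" using fstD eq by blast
  qed
  have "\<phi> \<in> extensional ?D" by (simp add: \<phi>_def)
  moreover have "\<phi> uA = uB" using eq[OF fstD] base[OF one] by blast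
  moreover have "\<phi> a \<in> E" if "a \<in> ?D" for a using sndE[OF \<phi>[OF that]] .
  ultimately have "star_hom (A\<lparr>carrier := ?D, one := uA\<rparr>) (B\<lparr>carrier := E, one := uB\<rparr>) \<phi>"
    using hom by (simp add: star_hom_def ring_hom_def)
  moreover have "\<phi> a = b" if "(a, b) \<in> Y" for a b using eq[OF fstD] base[OF that] by blast
  ultimately show ?thesis using \<phi> by blast
qed

end

section \<open>The relations of the crossed product\<close>

context group_submonoid begin

text \<open>The relations of \<open>cp_rep\<close> in an arbitrary algebra, so that the same results
  apply to single representations and to the full and the reduced crossed product.\<close>

definition cprel :: "'a cstar \<Rightarrow> ('g \<Rightarrow> (('g set \<Rightarrow> bool) \<Rightarrow> complex) \<Rightarrow> 'a) \<Rightarrow> bool" where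
  "cprel A u \<longleftrightarrow>
     (\<forall>g\<in>carrier G. \<forall>f\<in>fib g.
        u g f \<in> carrier A \<and>
        (\<forall>f'\<in>fib g. u g (\<lambda>x. f x + f' x) = u g f \<oplus>\<^bsub>A\<^esub> u g f') \<and>
        (\<forall>c. u g (\<lambda>x. c * f x) = c \<odot>\<^bsub>A\<^esub> u g f) \<and>
        (\<forall>h\<in>carrier G. \<forall>f'\<in>fib h. u (g \<otimes> h) (cpm g f f') = u g f \<otimes>\<^bsub>A\<^esub> u h f') \<and>
        u (inv g) (cps g f) = star A (u g f)) \<and>
     u \<one> (\<lambda>x. of_bool (x \<in> X)) = \<one>\<^bsub>A\<^esub>"

lemma cp_rep_iff: "cp_rep G X bd act \<rho> \<longleftrightarrow> cprel bounded_ops \<rho>"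
  unfolding cp_rep_def cprel_def ..

text \<open>Treat the elements of \<open>E\<close> one by one: whenever \<open>pP\<close> meets
  \<open>gP\<close>, replace \<open>p\<close> by a point of the intersection, which still decides
  \<open>F\<close>. Smallness on \<open>Delta G P E\<close>, as in \<open>D_r_o\<close>, thereby
  becomes smallness at the points of the boundary.\<close>

lemma Delta_decides:
  assumes x: "x \<in> X" and F: "finite F" "F \<subseteq> J" and E: "finite E" "E \<subseteq> carrier G"
  shows "\<exists>p\<in>Delta G P E. decides p x F"
  using E
proof (induct E)
  case empty
  obtain p where p: "decides p x F" using X_decides[OF x F] by blast
  then have "p \<in> Delta G P {}" by (simp add: Delta_def decides_def)
  then show ?case using p by blast
next
  case (insert g E)
  then obtain p where p: "p \<in> Delta G P E" "decides p x F" by auto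
  have pP: "p \<in> P" using p(2) by (simp add: decides_def)
  show ?case
  proof (cases "(p <# P) \<inter> (g <# P) = {}")
    case True
    then have "p \<in> Delta G P (insert g E)" using p(1) by (simp add: Delta_def)
    then show ?thesis using p(2) by blast
  next
    case False
    then obtain q where q: "q \<in> p <# P" "q \<in> g <# P" by blast
    have qP: "q \<in> P" using pr_P[OF pP q(1)] .
    have sub: "q <# P \<subseteq> p <# P" using pr_trans[OF pP q(1)] .
    obtain a where a: "a \<in> P" "q = g \<otimes> a" using q(2) unfolding pr_iff by blast
    have "q <# P \<subseteq> g <# P" unfolding a(2) using lcoset_mult_sub[OF _ a(1)] insert by simp
    moreover have "(q <# P) \<inter> (h <# P) = {} \<or> (q <# P) \<inter> (h <# P) = q <# P" if "h \<in> E" for h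
    proof -
      have "(p <# P) \<inter> (h <# P) = {} \<or> (p <# P) \<inter> (h <# P) = p <# P" using p(1) that by (simp add: Delta_def)
      then show ?thesis using sub by blast
    qed
    ultimately have "q \<in> Delta G P (insert g E)" using qP by (auto simp: Delta_def)
    then show ?thesis using decides_ext[OF F(2) p(2) q(1)] by blast
  qed
qed

text \<open>A constructible ideal is the intersection of \<open>P\<close> with finitely many
  translates \<open>gP\<close>. Once these \<open>g\<close> belong to \<open>E'\<close>, the
  principal ideal of a point of \<open>Delta G P E'\<close> is contained in or disjoint from each
  translate, hence the point decides the intersection.\<close>

lemma Delta_decides_all:
  assumes "finite F" "F \<subseteq> J"
  shows "\<exists>E. finite E \<and> E \<subseteq> carrier G \<and> (\<forall>E'. E \<subseteq> E' \<longrightarrow> (\<forall>p\<in>Delta G P E'. \<forall>S\<in>F. p \<in> S \<or> (p <# P) \<inter> S = {}))"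
  using assms
proof (induct F)
  case empty
  show ?case by (intro exI[of _ "{}"]) simp
next
  case (insert S F)
  then obtain E where E: "finite E" "E \<subseteq> carrier G"
    "\<And>E' p T. E \<subseteq> E' \<Longrightarrow> p \<in> Delta G P E' \<Longrightarrow> T \<in> F \<Longrightarrow> p \<in> T \<or> (p <# P) \<inter> T = {}" by auto
  obtain \<alpha> where \<alpha>: "is_word P \<alpha>" "S = K G P \<alpha>" using insert by (auto simp: constructible_def)
  have "\<exists>D. finite D \<and> D \<subseteq> carrier G \<and>
    (\<forall>E'. D \<subseteq> E' \<longrightarrow> (\<forall>p\<in>Delta G P E'. p \<in> K G P \<alpha> \<or> (p <# P) \<inter> K G P \<alpha> = {}))"
    using \<alpha>(1)
  proof (induct rule: word_induct)
    case Nil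
    show ?case by (intro exI[of _ "{}"]) (simp add: Delta_def)
  next
    case (step a b \<alpha>)
    from step(4) obtain D where D: "finite D" "D \<subseteq> carrier G"
      and D3: "\<forall>E'. D \<subseteq> E' \<longrightarrow> (\<forall>p\<in>Delta G P E'. p \<in> K G P \<alpha> \<or> (p <# P) \<inter> K G P \<alpha> = {})"
      by (elim exE conjE)
    let ?g = "inv (wdot G (a # b # \<alpha>))"
    have g: "?g \<in> carrier G" using step wdot_closed[of "a # b # \<alpha>"] by (intro inv_closed) simp
    have "p \<in> K G P (a # b # \<alpha>) \<or> (p <# P) \<inter> K G P (a # b # \<alpha>) = {}"
      if E': "insert ?g D \<subseteq> E'" and p: "p \<in> Delta G P E'" for E' p
    proof -
      have pP: "p \<in> P" using p by (simp add: Delta_def)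
      have "(p <# P) \<inter> (?g <# P) = {} \<or> (p <# P) \<inter> (?g <# P) = p <# P" using p E' by (simp add: Delta_def)
      moreover have "p \<in> K G P \<alpha> \<or> (p <# P) \<inter> K G P \<alpha> = {}" by (rule D3[rule_format, OF _ p]) (use E' in simp)
      moreover have "p \<in> p <# P" using pP by simp
      ultimately show ?thesis unfolding K.simps(1) by blast
    qed
    then show ?case using D(1,2) g by (intro exI[of _ "insert ?g D"]) auto
  qed
  then obtain D where D: "finite D" "D \<subseteq> carrier G"
    "\<And>E' p. D \<subseteq> E' \<Longrightarrow> p \<in> Delta G P E' \<Longrightarrow> p \<in> S \<or> (p <# P) \<inter> S = {}" unfolding \<alpha>(2) by auto
  have "\<forall>E'. E \<union> D \<subseteq> E' \<longrightarrow> (\<forall>p\<in>Delta G P E'. \<forall>T\<in>insert S F. p \<in> T \<or> (p <# P) \<inter> T = {})"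
  proof (intro allI impI ballI)
    fix E' p T assume "E \<union> D \<subseteq> E'" "p \<in> Delta G P E'" "T \<in> insert S F"
    then show "p \<in> T \<or> (p <# P) \<inter> T = {}" using E(3)[of E' p T] D(3)[of E' p] by blast
  qed
  then show ?case using E(1,2) D(1,2) by (intro exI[of _ "E \<union> D"]) simp
qed

abbreviation "lP \<equiv> bounded_families P complex_cstar"

lemma calg_lP: "calg lP"
  using calg.calg_fam[OF calg_complex] .

lemma ind_carrier: "ind P S \<in> carrier lP"
  by (rule calg.fam_carrierI[OF calg_complex, of _ _ 1]) (auto simp: ind_def complex_cstar_def)

lemma ind_simps:
  "ind P S \<otimes>\<^bsub>lP\<^esub> ind P T = ind P (S \<inter> T)" "star lP (ind P S) = ind P S" "\<one>\<^bsub>lP\<^esub> = ind P P"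
  by (auto simp: ind_def families_simps complex_cstar_def restrict_def)

lemma lP_nrm_upper: "b \<in> carrier lP \<Longrightarrow> p \<in> P \<Longrightarrow> cmod (b p) \<le> nrm lP b"
  using calg.fam_nrm_upper[OF calg_complex, of b P p] by (simp add: complex_cstar_def)

lemma lP_minus: "b \<in> carrier lP \<Longrightarrow> c \<in> carrier lP \<Longrightarrow> p \<in> P \<Longrightarrow> (b \<ominus>\<^bsub>lP\<^esub> c) p = b p - c p"
proof -
  assume "b \<in> carrier lP" "c \<in> carrier lP" "p \<in> P"
  moreover have "x \<ominus>\<^bsub>complex_cstar\<^esub> y = x - y" for x y
    by (subst calg.minus_smult[OF calg_complex]) (simp_all add: complex_cstar_def)
  ultimately show ?thesis using calg.fam_minus[OF calg_complex, of b P c] by simp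
qed

lemma D_r_simps:
  "D_r G P = lP\<lparr>carrier := cl lP (lin_span lP (ind P ` J)), one := \<one>\<^bsub>lP\<^esub>\<rparr>"
  by (simp add: D_r_def Let_def)

end

locale crossed = group_submonoid G P + A: calg A
  for G :: "'g monoid" (structure) and P :: "'g set" and A :: "'a cstar" +
  fixes u :: "'g \<Rightarrow> (('g set \<Rightarrow> bool) \<Rightarrow> complex) \<Rightarrow> 'a"
  assumes rel: "cprel A u"
begin

lemma u_closed [simp]: "g \<in> carrier G \<Longrightarrow> f \<in> fib g \<Longrightarrow> u g f \<in> carrier A"
  and u_add: "g \<in> carrier G \<Longrightarrow> f \<in> fib g \<Longrightarrow> f' \<in> fib g \<Longrightarrow> u g (\<lambda>x. f x + f' x) = u g f \<oplus>\<^bsub>A\<^esub> u g f'"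
  and u_smult: "g \<in> carrier G \<Longrightarrow> f \<in> fib g \<Longrightarrow> u g (\<lambda>x. c * f x) = c \<odot>\<^bsub>A\<^esub> u g f"
  and u_mult: "g \<in> carrier G \<Longrightarrow> f \<in> fib g \<Longrightarrow> h \<in> carrier G \<Longrightarrow> f' \<in> fib h \<Longrightarrow>
    u g f \<otimes>\<^bsub>A\<^esub> u h f' = u (g \<otimes> h) (cpm g f f')"
  and u_star: "g \<in> carrier G \<Longrightarrow> f \<in> fib g \<Longrightarrow> star A (u g f) = u (inv g) (cps g f)"
  and u_one: "u \<one> (\<lambda>x. of_bool (x \<in> X)) = \<one>\<^bsub>A\<^esub>"
  using rel unfolding cprel_def by simp_all

lemma u_diff: "g \<in> carrier G \<Longrightarrow> f \<in> fib g \<Longrightarrow> f' \<in> fib g \<Longrightarrow> u g (\<lambda>x. f x - f' x) = u g f \<ominus>\<^bsub>A\<^esub> u g f'"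
  using u_add[of g f "\<lambda>x. (-1) * f' x"] u_smult[of g f' "-1"] fib_smult[of f' g "-1"]
  by (simp add: A.minus_smult)

lemma u_zero: "g \<in> carrier G \<Longrightarrow> u g (\<lambda>_. 0) = \<zero>\<^bsub>A\<^esub>"
  using u_smult[of g "\<lambda>_. 0" 0] simp_fun_fib[OF simp_fun.zero, of g] by simp

lemma fib_one_iff: "f \<in> fib \<one> \<longleftrightarrow> continuous_on X f \<and> (\<forall>x. x \<notin> X \<longrightarrow> f x = 0)"
  using X_bd_one bd_X[of _ \<one>] by (auto simp: fibre_def)

text \<open>Let \<open>k\<close> be the square root of \<open>M^2 - |f|^2\<close>. In degree one,
  \<open>f \<delta>_g\<close> times its adjoint is \<open>|f|^2\<close>, and adding
  \<open>k k\<close> gives \<open>M^2\<close> times the unit; \<open>norm_star_sum\<close> then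
  yields the bound in every algebra satisfying the relations.\<close>

lemma u_bound:
  assumes g: "g \<in> carrier G" and f: "f \<in> fib g" and M: "0 \<le> M" "\<And>x. x \<in> X \<Longrightarrow> cmod (f x) \<le> M"
  shows "nrm A (u g f) \<le> M"
proof -
  define q where "q x = complex_of_real ((cmod (f x))\<^sup>2)" for x
  define k where "k x = (if x \<in> X then complex_of_real (sqrt (M\<^sup>2 - (cmod (f x))\<^sup>2)) else 0)" for x
  define o1 where "o1 x = (of_bool (x \<in> X) :: complex)" for x :: "'g set \<Rightarrow> bool"
  have fc: "continuous_on X f" and foff: "\<And>x. x \<notin> bd (inv g) \<Longrightarrow> f x = 0" using f by (auto simp: fibre_def)
  have o1f: "o1 \<in> fib \<one>" unfolding o1_def using simp_fun_fib[OF simp_fun_one] .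
  have qf: "q \<in> fib \<one>"
    unfolding fib_one_iff q_def using fib_off_X[OF f] by (auto intro!: continuous_intros fc)
  have kc: "continuous_on X k"
  proof (rule continuous_on_eq)
    show "continuous_on X (\<lambda>x. complex_of_real (sqrt (M\<^sup>2 - (cmod (f x))\<^sup>2)))" by (intro continuous_intros fc)
  qed (simp add: k_def)
  have kf: "k \<in> fib \<one>" unfolding fib_one_iff using kc by (simp add: k_def)
  have act1: "act (inv \<one>) x = x" if "x \<in> X" for x using act_one[OF that] by simp
  have b1: "x \<in> bd (inv \<one>) \<longleftrightarrow> x \<in> X" for x using X_bd_one bd_X[of x \<one>] by auto
  have kk: "cpm \<one> k k = (\<lambda>x. M\<^sup>2 * o1 x - q x)"
  proof
    fix x
    show "cpm \<one> k k x = M\<^sup>2 * o1 x - q x"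
    proof (cases "x \<in> X")
      case True
      have "0 \<le> M\<^sup>2 - (cmod (f x))\<^sup>2" using power_mono[OF M(2)[OF True], of 2] by simp
      then have "sqrt (M\<^sup>2 - (cmod (f x))\<^sup>2) * sqrt (M\<^sup>2 - (cmod (f x))\<^sup>2) = M\<^sup>2 - (cmod (f x))\<^sup>2" by simp
      then have "k x * k x = complex_of_real (M\<^sup>2 - (cmod (f x))\<^sup>2)"
        using True unfolding k_def by (simp only: if_True of_real_mult[symmetric])
      then show ?thesis using True act1[OF True] b1[of x] by (simp add: cp_mult_def q_def o1_def)
    next
      case False
      then show ?thesis using b1[of x] fib_off_X[OF f False] by (simp add: cp_mult_def q_def o1_def)
    qed
  qed
  have "x \<in> bd \<one> \<longleftrightarrow> x \<in> X" for x using b1[of x] by simp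
  then have "cps \<one> k x = k x" for x
    by (cases "x \<in> X") (simp_all only: cp_star_def act_one, simp_all add: k_def)
  then have ks: "cps \<one> k = k" by (rule ext)
  have fq: "cpm g f (cps g f) = q"
  proof
    fix x
    show "cpm g f (cps g f) x = q x"
    proof (cases "x \<in> bd (inv g)")
      case True
      have "act (inv g) x \<in> bd g" using act_bd[OF True] g by simp
      moreover have "act g (act (inv g) x) = x" using act_inv[OF True] g by simp
      ultimately show ?thesis using True cnj_mult_self[of "f x"]
        by (simp add: cp_mult_def cp_star_def q_def mult.commute)
    next
      case False
      then show ?thesis using foff[OF False] by (simp add: cp_mult_def q_def)
    qed
  qed
  \<comment> \<open>\<open>norm_star_sum\<close> has the adjoint as left factor, so it is applied to
    the adjoint of \<open>u g f\<close>.\<close>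
  let ?a = "star A (u g f)" and ?k = "u \<one> k"
  have ac: "?a \<in> carrier A" "?k \<in> carrier A" using g f kf by auto
  have "star A ?a = u g f" using g f by simp
  then have 1: "star A ?a \<otimes>\<^bsub>A\<^esub> ?a = u \<one> q"
    using u_mult[OF g f inv_closed[OF g] fib_star[OF g f]] g f by (simp only: u_star[OF g f] fq r_inv)
  have 2: "star A ?k \<otimes>\<^bsub>A\<^esub> ?k = u \<one> (\<lambda>x. M\<^sup>2 * o1 x - q x)"
    using u_mult[OF one_closed kf one_closed kf] kk u_star[OF one_closed kf] ks by simp
  have Mo: "(\<lambda>x. complex_of_real (M\<^sup>2) * o1 x) \<in> fib \<one>" using fib_smult[OF o1f] .
  have "u \<one> q \<oplus>\<^bsub>A\<^esub> u \<one> (\<lambda>x. M\<^sup>2 * o1 x - q x) = u \<one> (\<lambda>x. complex_of_real (M\<^sup>2) * o1 x)"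
    using u_add[OF one_closed qf fib_diff[OF Mo qf]] by simp
  also have "\<dots> = of_real (M\<^sup>2) \<odot>\<^bsub>A\<^esub> \<one>\<^bsub>A\<^esub>"
    using u_smult[OF one_closed o1f, of "of_real (M\<^sup>2)"] u_one by (simp add: o1_def[abs_def])
  finally have "(nrm A ?a)\<^sup>2 \<le> nrm A (of_real (M\<^sup>2) \<odot>\<^bsub>A\<^esub> \<one>\<^bsub>A\<^esub>)"
    using A.norm_star_sum[OF ac] unfolding 1 2 by simp
  also have "\<dots> = M\<^sup>2 * nrm A \<one>\<^bsub>A\<^esub>" by (simp add: A.nrm_smult norm_power)
  also have "\<dots> \<le> M\<^sup>2" using A.nrm_one_le mult_left_mono[of "nrm A \<one>\<^bsub>A\<^esub>" 1 "M\<^sup>2"] by simp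
  finally have "nrm A ?a \<le> M" using M(1) by (rule power2_le_imp_le)
  then show ?thesis using g f by simp
qed

definition t :: "'g \<Rightarrow> 'g set \<Rightarrow> 'a" where
  "t g S = u g (cyl S)"

lemma t_closed [simp]: "g \<in> carrier G \<Longrightarrow> S \<in> jd (inv g) \<Longrightarrow> t g S \<in> carrier A"
  by (simp add: t_def cyl_fib)

lemma t_mult:
  assumes "g \<in> carrier G" "h \<in> carrier G" "S \<in> jd (inv g)" "T \<in> jd (inv h)"
  shows "t g S \<otimes>\<^bsub>A\<^esub> t h T = t (g \<otimes> h) {p \<in> S. inv g \<otimes> p \<in> T}"
  unfolding t_def u_mult[OF assms(1) cyl_fib[OF assms(3)] assms(2) cyl_fib[OF assms(4)]]
    cpm_cyl[OF assms(3) jd_J[OF assms(4)]] ..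

lemma t_star: "g \<in> carrier G \<Longrightarrow> S \<in> jd (inv g) \<Longrightarrow> star A (t g S) = t (inv g) (inv g <# S)"
  by (simp add: t_def u_star cyl_fib cps_cyl)

lemma t_one: "t \<one> P = \<one>\<^bsub>A\<^esub>"
proof -
  have "cyl P = (\<lambda>x. of_bool (x \<in> X))" by (rule ext) (rule cyl_P)
  then show ?thesis by (simp add: t_def u_one)
qed

text \<open>The canonical isometry of \<open>p\<close>, namely \<open>1_{pP} \<delta>_p\<close>, the
  counterpart of the generator of the covariance algebra.\<close>

definition v :: "'g \<Rightarrow> 'a" where
  "v = (\<lambda>p\<in>P. t p (p <# P))"

lemma v_closed [simp]: "p \<in> P \<Longrightarrow> v p \<in> carrier A"
  by (simp add: v_def pr_jd)

lemma star_v: "p \<in> P \<Longrightarrow> star A (v p) = t (inv p) P"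
proof -
  assume p: "p \<in> P"
  have "inv p <# (p <# P) = P" using p P_sub by (auto simp: mem_lcoset_iff l_coset_subset_G pr_iff m_assoc[symmetric])
  then show ?thesis using p by (simp add: v_def t_star pr_jd)
qed

lemma rep_dot_closed: "is_word P \<alpha> \<Longrightarrow> rep_dot A v \<alpha> \<in> carrier A"
  by (induct \<alpha> rule: word_induct) auto

text \<open>A word in the isometries acts as partial translation by its dot. The function sits on
  the range of this translation, which is \<open>K\<close> of the reversed word, whereas
  \<open>K G P \<alpha>\<close> is its domain.\<close>

lemma rep_dot_v:
  assumes "is_word P \<alpha>"
  shows "rep_dot A v \<alpha> = t (wdot G \<alpha>) (K G P (rev \<alpha>))"
  using assms
proof (induct \<alpha> rule: word_induct)
  case Nil
  then show ?case by (simp add: t_one)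
next
  case (step p q \<alpha>)
  have c: "p \<in> carrier G" "q \<in> carrier G" "wdot G \<alpha> \<in> carrier G" using step by auto
  have P1: "P \<in> jd (inv (inv p))" using P_jd[OF step(1)] c by simp
  have Kr: "K G P (rev \<alpha>) \<in> jd (inv (wdot G \<alpha>))" using step(3) by (intro jdI) (auto simp: wdot_rev)
  have w: "is_word P [q, p]" "is_word P (rev \<alpha>)" using step by auto
  have K2: "{x \<in> P. inv (inv p) \<otimes> x \<in> q <# P} = K G P [q, p]"
  proof -
    have "x \<in> K G P [q, p] \<longleftrightarrow> x \<in> P \<and> inv q \<otimes> (p \<otimes> x) \<in> P" for x
      using K_step[OF step(2,1), of "[]" x] c by (auto simp: m_assoc simp del: K.simps(1))
    then show ?thesis using c P_sub by (auto simp: mem_lcoset_iff simp del: K.simps(1))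
  qed
  have S2: "K G P [q, p] \<in> jd (inv (inv p \<otimes> q))"
    using w(1) c by (intro jdI) (auto simp: inv_mult_group)
  have "rep_dot A v (p # q # \<alpha>) = t (inv p) P \<otimes>\<^bsub>A\<^esub> t q (q <# P) \<otimes>\<^bsub>A\<^esub> t (wdot G \<alpha>) (K G P (rev \<alpha>))"
    using step by (simp add: star_v) (simp add: v_def)
  also have "t (inv p) P \<otimes>\<^bsub>A\<^esub> t q (q <# P) = t (inv p \<otimes> q) (K G P [q, p])"
    using t_mult[of "inv p" q P "q <# P"] c P1 pr_jd[OF step(2)] K2 by simp
  also have "t (inv p \<otimes> q) (K G P [q, p]) \<otimes>\<^bsub>A\<^esub> t (wdot G \<alpha>) (K G P (rev \<alpha>))
      = t (inv p \<otimes> q \<otimes> wdot G \<alpha>) {x \<in> K G P [q, p]. inv (inv p \<otimes> q) \<otimes> x \<in> K G P (rev \<alpha>)}"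
    using t_mult[of "inv p \<otimes> q" "wdot G \<alpha>"] c S2 Kr by simp
  also have "{x \<in> K G P [q, p]. inv (inv p \<otimes> q) \<otimes> x \<in> K G P (rev \<alpha>)} = K G P (rev (p # q # \<alpha>))"
    using K_append[OF w(2,1)] c by (auto simp: inv_mult_group simp del: K.simps(1))
  finally show ?case by simp
qed

lemma t_rep_dot:
  assumes "g \<in> carrier G" "S \<in> jd (inv g)"
  shows "\<exists>\<alpha>. is_word P \<alpha> \<and> wdot G \<alpha> = g \<and> t g S = rep_dot A v \<alpha>"
proof -
  obtain \<beta> where b: "is_word P \<beta>" "wdot G \<beta> = inv g" "S = K G P \<beta>" using assms(2) by (auto simp: jd_def)
  then show ?thesis using assms(1) rep_dot_v[of "rev \<beta>"] by (intro exI[of _ "rev \<beta>"]) (simp add: wdot_rev)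
qed

definition words :: "'a set" where
  "words = {rep_dot A v \<alpha> | \<alpha>. is_word P \<alpha>}"

lemma words_carrier: "words \<subseteq> carrier A"
  using rep_dot_closed by (auto simp: words_def)

lemma u_simp_fun: "g \<in> carrier G \<Longrightarrow> s \<in> simp_fun g \<Longrightarrow> u g s \<in> lin_span A words"
proof (rotate_tac 1, induct s rule: simp_fun.induct)
  case zero
  then show ?case using u_zero lin_span.zero by metis
next
  case (step S s c)
  have "u g (\<lambda>x. c * cyl S x + s x) = c \<odot>\<^bsub>A\<^esub> t g S \<oplus>\<^bsub>A\<^esub> u g s"
    using u_add[OF step(4) fib_smult[OF cyl_fib[OF step(1)]] simp_fun_fib[OF step(2)]]
      u_smult[OF step(4) cyl_fib[OF step(1)]] by (simp add: t_def)
  moreover have "t g S \<in> words" using t_rep_dot[OF step(4,1)] by (auto simp: words_def)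
  ultimately show ?case using step by (auto intro: lin_span.step)
qed

lemma u_cl_words:
  assumes "g \<in> carrier G" "f \<in> fib g"
  shows "u g f \<in> cl A (lin_span A words)"
proof -
  have "\<exists>y\<in>lin_span A words. nrm A (u g f \<ominus>\<^bsub>A\<^esub> y) < e" if e: "0 < e" for e
  proof -
    obtain s where s: "s \<in> simp_fun g" "\<And>x. x \<in> X \<Longrightarrow> cmod (f x - s x) < e / 2"
      using fib_approx[OF assms(2) half_gt_zero[OF e]] by blast
    have sf: "s \<in> fib g" by (rule simp_fun_fib[OF s(1)])
    have "nrm A (u g (\<lambda>x. f x - s x)) \<le> e / 2"
      by (rule u_bound[OF assms(1) fib_diff[OF assms(2) sf]]) (use e s(2) in \<open>auto intro: less_imp_le\<close>)
    then have "nrm A (u g f \<ominus>\<^bsub>A\<^esub> u g s) < e" using u_diff[OF assms sf] e by simp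
    then show ?thesis using u_simp_fun[OF assms(1) s(1)] by blast
  qed
  then show ?thesis using assms by (simp add: cl_def)
qed

lemma words_u: "words \<subseteq> {u g f | g f. g \<in> carrier G \<and> f \<in> fib g}"
proof
  fix a assume "a \<in> words"
  then obtain \<alpha> where \<alpha>: "is_word P \<alpha>" "a = rep_dot A v \<alpha>" by (auto simp: words_def)
  have "K G P (rev \<alpha>) \<in> jd (inv (wdot G \<alpha>))" using \<alpha>(1) by (intro jdI) (auto simp: wdot_rev)
  then have "cyl (K G P (rev \<alpha>)) \<in> fib (wdot G \<alpha>)" by (rule cyl_fib)
  moreover have "wdot G \<alpha> \<in> carrier G" using \<alpha>(1) by simp
  ultimately show "a \<in> {u g f | g f. g \<in> carrier G \<and> f \<in> fib g}"
    unfolding \<alpha>(2) rep_dot_v[OF \<alpha>(1)] t_def by blast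
qed

text \<open>The generated algebra is thus already generated by the isometries, on which
  homomorphisms can then be compared.\<close>

lemma cl_span_u: "cl A (lin_span A {u g f | g f. g \<in> carrier G \<and> f \<in> fib g}) = cl A (lin_span A words)"
proof
  let ?U = "{u g f | g f. g \<in> carrier G \<and> f \<in> fib g}"
  have U: "?U \<subseteq> carrier A" by auto
  have w: "lin_span A words \<subseteq> carrier A" using A.lin_span_carrier[OF words_carrier] by blast
  have lu: "x \<in> cl A (lin_span A words)" if "x \<in> lin_span A ?U" for x
    using that
  proof induct
    case zero
    then show ?case using A.cl_subset[OF w] lin_span.zero by blast
  next
    case (step x y c)
    then have "x \<in> cl A (lin_span A words)" using u_cl_words by blast
    then show ?case
      using A.cl_add[OF w A.lin_span_add[OF words_carrier]] A.cl_smult[OF w A.lin_span_smult[OF words_carrier]] step(3)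
      by blast
  qed
  have "cl A (lin_span A ?U) \<subseteq> cl A (cl A (lin_span A words))" by (rule A.cl_mono) (use lu in blast)
  also have "\<dots> \<subseteq> cl A (lin_span A words)" by (rule A.cl_cl[OF w])
  finally show "cl A (lin_span A ?U) \<subseteq> cl A (lin_span A words)" .
  show "cl A (lin_span A words) \<subseteq> cl A (lin_span A ?U)"
  proof (rule A.cl_mono, rule A.lin_span_sub[OF U])
    show "words \<subseteq> lin_span A ?U" using words_u A.lin_span_base[OF U] by blast
  qed
qed

end

section \<open>Strongly covariant representations\<close>

locale cov = group_submonoid G P + A: calg A
  for G :: "'g monoid" (structure) and P :: "'g set" and A :: "'a cstar" +
  fixes w :: "'g \<Rightarrow> 'a"
  assumes sc: "strongly_covariant G P A w"
begin

lemma w_closed [simp]: "p \<in> P \<Longrightarrow> w p \<in> carrier A"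
  and w_one: "w \<one> = \<one>\<^bsub>A\<^esub>"
  and w_isometry: "p \<in> P \<Longrightarrow> star A (w p) \<otimes>\<^bsub>A\<^esub> w p = \<one>\<^bsub>A\<^esub>"
  and w_ext: "w \<in> extensional P"
  using sc by (auto simp: strongly_covariant_def isometric_rep_def PiE_iff)

lemma dot_closed [simp]: "is_word P \<alpha> \<Longrightarrow> rep_dot A w \<alpha> \<in> carrier A"
  by (induct \<alpha> rule: word_induct) auto

lemma dot_append: "is_word P \<alpha> \<Longrightarrow> is_word P \<beta> \<Longrightarrow> rep_dot A w (\<alpha> @ \<beta>) = rep_dot A w \<alpha> \<otimes>\<^bsub>A\<^esub> rep_dot A w \<beta>"
  by (induct \<alpha> rule: word_induct) (auto simp: A.m_assoc)

lemma dot_rev: "is_word P \<alpha> \<Longrightarrow> rep_dot A w (rev \<alpha>) = star A (rep_dot A w \<alpha>)"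
  by (induct \<alpha> rule: word_induct) (auto simp: dot_append A.star_mult A.m_assoc)

lemma dot_pair: "p \<in> P \<Longrightarrow> rep_dot A w [\<one>, p] = w p"
  by (simp add: w_one)

lemma dot_neutral:
  assumes "is_word P \<alpha>" "is_word P \<beta>" "wdot G \<alpha> = \<one>" "wdot G \<beta> = \<one>" "K G P \<alpha> = K G P \<beta>"
  shows "rep_dot A w \<alpha> = rep_dot A w \<beta>"
proof -
  obtain \<phi> where "\<forall>\<alpha>. is_word P \<alpha> \<and> wdot G \<alpha> = \<one> \<longrightarrow> \<phi> (ind P (K G P \<alpha>)) = rep_dot A w \<alpha>"
    using sc by (auto simp: strongly_covariant_def)
  then show ?thesis using assms by metis
qed

lemma D_r_sub: "cstar_sub lP (cl lP (lin_span lP (ind P ` J)))"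
proof -
  interpret L: calg lP by (rule calg_lP)
  have Y: "ind P ` J \<subseteq> carrier lP" using ind_carrier by auto
  show ?thesis
    by (rule L.cstar_sub_cl_lin_span[OF Y]) (auto simp: ind_simps intro!: L.lin_span_base[OF Y])
qed

lemma D_r_mem: "S \<in> J \<Longrightarrow> ind P S \<in> carrier (D_r G P)"
proof -
  assume S: "S \<in> J"
  interpret L: calg lP by (rule calg_lP)
  have Y: "ind P ` J \<subseteq> carrier lP" using ind_carrier by auto
  have "lin_span lP (ind P ` J) \<subseteq> carrier lP" using L.lin_span_carrier[OF Y] by blast
  moreover have "ind P S \<in> lin_span lP (ind P ` J)" by (rule L.lin_span_base[OF Y]) (use S in blast)
  ultimately show ?thesis using L.cl_subset by (auto simp: D_r_simps)
qed

lemma calg_D_r: "calg (D_r G P)"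
proof -
  interpret L: calg lP by (rule calg_lP)
  show ?thesis unfolding D_r_simps
  proof (rule L.calg_sub[OF D_r_sub])
    show "\<one>\<^bsub>lP\<^esub> \<in> cl lP (lin_span lP (ind P ` J))"
      using D_r_mem[OF P_J] by (simp add: D_r_simps ind_simps(3))
    show "\<one>\<^bsub>lP\<^esub> \<otimes>\<^bsub>lP\<^esub> x = x \<and> x \<otimes>\<^bsub>lP\<^esub> \<one>\<^bsub>lP\<^esub> = x" if "x \<in> cl lP (lin_span lP (ind P ` J))" for x
      using that L.cl_carrier L.l_one L.r_one by blast
  qed
qed

text \<open>Let \<open>?c\<close> be the difference of the two products. Multiplied by its adjoint
  it expands into four products along neutral words with ideal \<open>S\<close>; these agree by
  strong covariance and cancel, so \<open>?c\<close> vanishes.\<close>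

lemma dot_eq:
  assumes a: "is_word P \<alpha>" "wdot G \<alpha> = g" "K G P (rev \<alpha>) = S"
    and b: "is_word P \<beta>" "wdot G \<beta> = g" "K G P (rev \<beta>) = S"
  shows "rep_dot A w \<alpha> = rep_dot A w \<beta>"
proof -
  have g: "g \<in> carrier G" using a by auto
  have K: "K G P (\<gamma> @ rev \<delta>) = S \<and> wdot G (\<gamma> @ rev \<delta>) = \<one>"
    if "is_word P \<gamma>" "wdot G \<gamma> = g" "K G P (rev \<gamma>) = S" "is_word P \<delta>" "wdot G \<delta> = g" "K G P (rev \<delta>) = S" for \<gamma> \<delta>
  proof -
    have "x \<in> K G P (\<gamma> @ rev \<delta>) \<longleftrightarrow> x \<in> S" for x
    proof -
      have "x \<in> K G P (\<gamma> @ rev \<delta>) \<longleftrightarrow> x \<in> S \<and> inv g \<otimes> x \<in> K G P \<gamma>"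
        using K_append[of \<gamma> "rev \<delta>" x] that by (simp add: wdot_rev)
      moreover have "x \<in> S \<Longrightarrow> x \<in> carrier G" using K_sub_P[of "rev \<delta>"] that by auto
      ultimately show ?thesis using K_rev[of \<gamma> x] that by auto
    qed
    then show ?thesis using that g by (auto simp: wdot_append wdot_rev)
  qed
  let ?a = "rep_dot A w \<alpha>" and ?b = "rep_dot A w \<beta>"
  have c: "?a \<in> carrier A" "?b \<in> carrier A" using a b by auto
  have prod: "rep_dot A w \<gamma> \<otimes>\<^bsub>A\<^esub> star A (rep_dot A w \<delta>) = rep_dot A w (\<gamma> @ rev \<delta>)"
    if "is_word P \<gamma>" "is_word P \<delta>" for \<gamma> \<delta> using that by (simp add: dot_append dot_rev)
  have ab: "rep_dot A w (\<alpha> @ rev \<beta>) = rep_dot A w (\<alpha> @ rev \<alpha>)"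
    "rep_dot A w (\<beta> @ rev \<alpha>) = rep_dot A w (\<alpha> @ rev \<alpha>)"
    "rep_dot A w (\<beta> @ rev \<beta>) = rep_dot A w (\<alpha> @ rev \<alpha>)"
    using K[OF a a] K[OF a b] K[OF b a] K[OF b b] a b by (auto intro!: dot_neutral)
  let ?c = "?a \<ominus>\<^bsub>A\<^esub> ?b"
  have "?c \<otimes>\<^bsub>A\<^esub> star A ?c = ?c \<otimes>\<^bsub>A\<^esub> (star A ?a \<ominus>\<^bsub>A\<^esub> star A ?b)" using c by (simp add: A.star_minus)
  also have "\<dots> = (?a \<otimes>\<^bsub>A\<^esub> star A ?a \<ominus>\<^bsub>A\<^esub> ?a \<otimes>\<^bsub>A\<^esub> star A ?b) \<oplus>\<^bsub>A\<^esub> (?b \<otimes>\<^bsub>A\<^esub> star A ?b \<ominus>\<^bsub>A\<^esub> ?b \<otimes>\<^bsub>A\<^esub> star A ?a)"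
    using c A.star_closed[OF c(1)] A.star_closed[OF c(2)] by algebra
  also have "\<dots> = \<zero>\<^bsub>A\<^esub>" using prod a b ab c by (simp add: A.minus_eq_zero[THEN iffD2])
  finally have "star A (star A ?c) \<otimes>\<^bsub>A\<^esub> star A ?c = \<zero>\<^bsub>A\<^esub>" using c by simp
  then have "star A ?c = \<zero>\<^bsub>A\<^esub>" by (rule A.star_mult_zero[rotated]) (simp add: c)
  then have "star A (star A ?c) = \<zero>\<^bsub>A\<^esub>" by simp
  then have "?c = \<zero>\<^bsub>A\<^esub>" using c by simp
  then show ?thesis using c by (simp add: A.minus_eq_zero)
qed

end

section \<open>The isometries of a crossed product are strongly covariant\<close>

context crossed begin

lemma t_one_mult: "S \<in> J \<Longrightarrow> T \<in> J \<Longrightarrow> t \<one> S \<otimes>\<^bsub>A\<^esub> t \<one> T = t \<one> (S \<inter> T)"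
proof -
  assume S: "S \<in> J" "T \<in> J"
  have "{p \<in> S. inv \<one> \<otimes> p \<in> T} = S \<inter> T" using J_sub[OF S(1)] by auto
  then show ?thesis using t_mult[of \<one> \<one> S T] S J_jd by simp
qed

lemma t_one_star: "S \<in> J \<Longrightarrow> star A (t \<one> S) = t \<one> S"
proof -
  assume S: "S \<in> J"
  have "inv \<one> <# S = S" using J_sub[OF S] P_sub by (auto simp: mem_lcoset_iff subset_eq)
  then show ?thesis using t_star[of \<one> S] S J_jd by simp
qed

lemma isometric_v: "isometric_rep G P A v"
  unfolding isometric_rep_def
proof (intro conjI ballI)
  show "v \<in> P \<rightarrow>\<^sub>E carrier A" using v_closed by (auto simp: v_def)
  have "\<one> <# P = P" using P_sub by (auto simp: mem_lcoset_iff subset_eq)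
  then show "v \<one> = \<one>\<^bsub>A\<^esub>" by (simp add: v_def t_one)
  fix p assume p: "p \<in> P"
  have P1: "P \<in> jd (inv (inv p))" using P_jd[OF p] p by simp
  have "{x \<in> P. inv (inv p) \<otimes> x \<in> p <# P} = P" using p by (auto simp: pr_iff)
  then show "star A (v p) \<otimes>\<^bsub>A\<^esub> v p = \<one>\<^bsub>A\<^esub>"
    using p t_mult[of "inv p" p P "p <# P"] P1 pr_jd[OF p] by (simp add: star_v t_one) (simp add: v_def t_one)
  fix q assume q: "q \<in> P"
  have "{x \<in> p <# P. inv p \<otimes> x \<in> q <# P} = (p \<otimes> q) <# P"
    using p q P_sub by (auto simp: mem_lcoset_iff inv_mult_group m_assoc subset_eq)
      (metis (no_types, lifting) P_carrier P_mult inv_closed inv_solve_left m_closed)+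
  then show "v (p \<otimes> q) = v p \<otimes>\<^bsub>A\<^esub> v q"
    using p q t_mult[of p q "p <# P" "q <# P"] pr_jd by (simp add: v_def)
qed

lemma rep_dot_neutral:
  assumes "is_word P \<alpha>" "wdot G \<alpha> = \<one>"
  shows "rep_dot A v \<alpha> = t \<one> (K G P \<alpha>)"
proof -
  have "K G P (rev \<alpha>) = K G P \<alpha>"
    using lcoset_K[OF assms(1)] assms(2) lcos_mult_one[of "K G P \<alpha>"] K_sub_P[OF assms(1)] P_sub by simp
  then show ?thesis using rep_dot_v[OF assms(1)] assms(2) by simp
qed

sublocale LA: calg_pair lP A
  by (intro calg_pair.intro calg_lP A.calg_axioms)

definition "indt = {(ind P S, t \<one> S) | S. S \<in> J}"

lemma indt_carrier: "indt \<subseteq> carrier LA.AB"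
  using ind_carrier J_jd by (auto simp: indt_def)

text \<open>In a pair of the span, \<open>s\<close> is the boundary value of the function on
  \<open>P\<close>: for \<open>F\<close> large enough this function takes the value
  \<open>s x\<close> at every point that decides \<open>F\<close> for \<open>x\<close>. Estimates on
  \<open>P\<close> and on the boundary are compared through this relation.\<close>

lemma indt_span:
  assumes "y \<in> lin_span LA.AB indt"
  shows "\<exists>s\<in>simp_fun \<one>. snd y = u \<one> s \<and>
    (\<exists>F. finite F \<and> F \<subseteq> J \<and> (\<forall>x\<in>X. \<forall>p. decides p x F \<longrightarrow> fst y p = s x))"
  using assms
proof induct
  case zero
  have "fst \<zero>\<^bsub>LA.AB\<^esub> p = 0" if "p \<in> P" for p using that by (simp add: LA.prod_simps families_simps) (simp add: complex_cstar_def)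
  then have "\<forall>x\<in>X. \<forall>p. decides p x {} \<longrightarrow> fst \<zero>\<^bsub>LA.AB\<^esub> p = 0" by (simp add: decides_def)
  then show ?case using u_zero[OF one_closed] simp_fun.zero[of \<one>]
    by (intro bexI[of _ "\<lambda>_. 0"] conjI exI[of _ "{}"]) auto
next
  case (step x y c)
  then obtain s F where s: "s \<in> simp_fun \<one>" "snd y = u \<one> s" "finite F" "F \<subseteq> J"
    and sF: "\<forall>x\<in>X. \<forall>p. decides p x F \<longrightarrow> fst y p = s x" by blast
  obtain S where S: "S \<in> J" "x = (ind P S, t \<one> S)" using step(1) by (auto simp: indt_def)
  have Sj: "S \<in> jd (inv \<one>)" using S(1) J_jd by simp
  have "y \<in> carrier LA.AB" using LA.AB.lin_span_carrier[OF indt_carrier step(2)] .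
  then obtain b a where y: "y = (b, a)" by (cases y)
  let ?s = "\<lambda>z. c * cyl S z + s z"
  have 1: "?s \<in> simp_fun \<one>" using simp_fun.step[OF Sj s(1)] .
  have 2: "snd (c \<odot>\<^bsub>LA.AB\<^esub> x \<oplus>\<^bsub>LA.AB\<^esub> y) = u \<one> ?s"
    using u_add[OF one_closed fib_smult[OF cyl_fib[OF Sj]] simp_fun_fib[OF s(1)], of c]
      u_smult[OF one_closed cyl_fib[OF Sj], of c] s(2) by (simp add: S(2) y t_def)
  have 3: "fst (c \<odot>\<^bsub>LA.AB\<^esub> x \<oplus>\<^bsub>LA.AB\<^esub> y) p = ?s z" if z: "z \<in> X" and p: "decides p z (insert S F)" for z p
  proof -
    have pP: "p \<in> P" using p by (simp add: decides_def)
    have "fst y p = s z" using sF z decides_mono[OF p subset_insertI] by blast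
    moreover have "of_bool (p \<in> S) = (cyl S z :: complex)"
    proof -
      have "p \<in> S \<longleftrightarrow> z S"
      proof (cases "z S")
        case False
        then have "(p <# P) \<inter> S = {}" using p by (simp add: decides_def)
        then show ?thesis using pr_self[OF pP] False by blast
      qed (use p in \<open>simp add: decides_def\<close>)
      then show ?thesis using z by (simp add: cyl_def)
    qed
    ultimately show ?thesis using pP by (simp add: S(2) y LA.prod_simps families_simps ind_def) (simp add: complex_cstar_def)
  qed
  have "finite (insert S F)" "insert S F \<subseteq> J" using s S by auto
  then show ?case using 1 2 3 by blast
qed

lemma indt_bound:
  assumes "(b, a) \<in> lin_span LA.AB indt"
  shows "nrm A a \<le> 1 * nrm lP b"
proof -
  obtain s F where s: "s \<in> simp_fun \<one>" "a = u \<one> s" "finite F" "F \<subseteq> J"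
    and sF: "\<forall>x\<in>X. \<forall>p. decides p x F \<longrightarrow> b p = s x" using indt_span[OF assms] by auto
  have bc: "b \<in> carrier lP" using LA.AB.lin_span_carrier[OF indt_carrier assms] by simp
  have "nrm A (u \<one> s) \<le> nrm lP b"
  proof (rule u_bound[OF one_closed simp_fun_fib[OF s(1)]])
    show "0 \<le> nrm lP b" using LA.A.nrm_nonneg[OF bc] .
    fix x assume x: "x \<in> X"
    obtain p where p: "decides p x F" using X_decides[OF x s(3,4)] by blast
    then have "p \<in> P" "b p = s x" using sF x by (auto simp: decides_def)
    then show "cmod (s x) \<le> nrm lP b" using lP_nrm_upper[OF bc] by metis
  qed
  then show ?thesis by (simp add: s(2))
qed

text \<open>The homomorphism on \<open>D_r\<close> has the closed span of \<open>indt\<close> as its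
  graph. For \<open>b\<close> in \<open>D_r_o\<close> approximate \<open>(b, \<phi> b)\<close> by a
  pair \<open>(b', u \<one> s)\<close>: each \<open>x\<close> has a deciding \<open>p\<close> in
  \<open>Delta G P E\<close>, where \<open>b\<close> and \<open>b - b'\<close> are both small, so
  \<open>s\<close> is small, and with it \<open>\<phi> b\<close>.\<close>

theorem strongly_covariant_v: "strongly_covariant G P A v"
proof -
  have fst: "fst ` indt = ind P ` J" by (force simp: indt_def)
  have AA: "A\<lparr>carrier := carrier A, one := \<one>\<^bsub>A\<^esub>\<rparr> = A" by simp
  have "\<exists>\<phi>. star_hom (lP\<lparr>carrier := cl lP (lin_span lP (fst ` indt)), one := \<one>\<^bsub>lP\<^esub>\<rparr>)
      (A\<lparr>carrier := carrier A, one := \<one>\<^bsub>A\<^esub>\<rparr>) \<phi> \<and> (\<forall>b a. (b, a) \<in> indt \<longrightarrow> \<phi> b = a) \<and>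
      (\<forall>b\<in>cl lP (lin_span lP (fst ` indt)). (b, \<phi> b) \<in> cl LA.AB (lin_span LA.AB indt))"
  proof (rule LA.graph_star_hom[OF indt_carrier _ indt_bound])
    fix y z assume yz: "y \<in> indt" "z \<in> indt"
    obtain S T where S: "S \<in> J" "T \<in> J" "y = (ind P S, t \<one> S)" "z = (ind P T, t \<one> T)"
      using yz by (auto simp: indt_def)
    then have "y \<otimes>\<^bsub>LA.AB\<^esub> z = (ind P (S \<inter> T), t \<one> (S \<inter> T))" by (simp add: ind_simps t_one_mult)
    then have "y \<otimes>\<^bsub>LA.AB\<^esub> z \<in> indt" using J_Int[OF S(1,2)] unfolding indt_def by blast
    then show "y \<otimes>\<^bsub>LA.AB\<^esub> z \<in> lin_span LA.AB indt" by (rule LA.AB.lin_span_base[OF indt_carrier])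
    have "star LA.AB y = y" using S by (simp add: ind_simps t_one_star)
    then show "star LA.AB y \<in> lin_span LA.AB indt" using LA.AB.lin_span_base[OF indt_carrier yz(1)] by simp
  next
    show "(\<one>\<^bsub>lP\<^esub>, \<one>\<^bsub>A\<^esub>) \<in> indt" unfolding ind_simps(3) t_one[symmetric] indt_def using P_J by blast
    show "cl A (lin_span A (snd ` indt)) \<subseteq> carrier A" by (rule A.cl_carrier)
  qed simp
  then obtain \<phi> where \<phi>: "star_hom (D_r G P) A \<phi>" "\<And>S. S \<in> J \<Longrightarrow> \<phi> (ind P S) = t \<one> S"
    "\<And>b. b \<in> carrier (D_r G P) \<Longrightarrow> (b, \<phi> b) \<in> cl LA.AB (lin_span LA.AB indt)"
    unfolding fst AA by (auto simp: D_r_simps indt_def[symmetric]) (use indt_def in blast)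
  have "\<phi> b = \<zero>\<^bsub>A\<^esub>" if b: "b \<in> D_r_o G P" for b
  proof -
    have bD: "b \<in> carrier (D_r G P)"
      and lim: "((\<lambda>F. Sup (insert 0 ((\<lambda>p. cmod (b p)) ` Delta G P F))) \<longlongrightarrow> 0) (finite_subsets_at_top (carrier G))"
      using b by (auto simp: D_r_o_def)
    note gr = \<phi>(3)[OF bD]
    have c: "b \<in> carrier lP" "\<phi> b \<in> carrier A" using gr LA.AB.cl_carrier by auto
    have "nrm A (\<phi> b) \<le> e" if e: "0 < e" for e
    proof -
      have e3: "0 < e / 3" using e by simp
      obtain b' a' where y: "(b', a') \<in> lin_span LA.AB indt" "nrm LA.AB ((b, \<phi> b) \<ominus>\<^bsub>LA.AB\<^esub> (b', a')) < e / 3"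
        using LA.AB.cl_approx[OF gr e3] by auto
      have c': "b' \<in> carrier lP" "a' \<in> carrier A" using LA.AB.lin_span_carrier[OF indt_carrier y(1)] by auto
      have d: "nrm lP (b \<ominus>\<^bsub>lP\<^esub> b') < e / 3" "nrm A (\<phi> b \<ominus>\<^bsub>A\<^esub> a') < e / 3"
        using y(2) LA.prod_minus[OF c c'] by simp_all
      obtain s F where s: "s \<in> simp_fun \<one>" "a' = u \<one> s" "finite F" "F \<subseteq> J"
        and sF: "\<forall>x\<in>X. \<forall>p. decides p x F \<longrightarrow> b' p = s x" using indt_span[OF y(1)] by auto
      have "\<forall>\<^sub>F F in finite_subsets_at_top (carrier G). Sup (insert 0 ((\<lambda>p. cmod (b p)) ` Delta G P F)) < e / 3"
        using order_tendstoD(2)[OF lim e3] .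
      then obtain E where E: "finite E" "E \<subseteq> carrier G"
        "Sup (insert 0 ((\<lambda>p. cmod (b p)) ` Delta G P E)) < e / 3"
        unfolding eventually_finite_subsets_at_top by blast
      have bdd: "bdd_above (insert 0 ((\<lambda>p. cmod (b p)) ` Delta G P E))"
        unfolding bdd_above_insert using lP_nrm_upper[OF c(1)] by (auto simp: Delta_def intro!: bdd_aboveI2)
      have "nrm A a' \<le> 2 * (e / 3)"
        unfolding s(2)
      proof (rule u_bound[OF one_closed simp_fun_fib[OF s(1)]])
        fix x assume x: "x \<in> X"
        obtain p where p: "p \<in> Delta G P E" "decides p x F" using Delta_decides[OF x s(3,4) E(1,2)] by blast
        have pP: "p \<in> P" using p by (simp add: decides_def)
        have "cmod (b p) \<le> Sup (insert 0 ((\<lambda>p. cmod (b p)) ` Delta G P E))"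
          by (rule cSup_upper[OF _ bdd]) (use p in blast)
        then have 1: "cmod (b p) < e / 3" using E(3) by linarith
        have "cmod (b p - b' p) \<le> nrm lP (b \<ominus>\<^bsub>lP\<^esub> b')"
          using lP_nrm_upper[OF LA.A.minus_closed[OF c(1) c'(1)] pP] lP_minus[OF c(1) c'(1) pP] by simp
        then have "cmod (b' p) \<le> e / 3 + e / 3"
          using 1 d(1) norm_triangle_ineq4[of "b p" "b p - b' p"] by simp
        then show "cmod (s x) \<le> 2 * (e / 3)" using sF x p(2) by simp
      qed (use e in simp)
      then show ?thesis using A.nrm_le_minus[OF c(2) c'(2)] d(2) by linarith
    qed
    then have "nrm A (\<phi> b) \<le> 0" using field_le_epsilon[of "nrm A (\<phi> b)" 0] by simp
    then have "nrm A (\<phi> b) = 0" using A.nrm_nonneg[OF c(2)] by linarith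
    then show ?thesis using A.nrm_zero_iff[OF c(2)] by simp
  qed
  moreover have "\<phi> (ind P (K G P \<alpha>)) = rep_dot A v \<alpha>" if "is_word P \<alpha>" "wdot G \<alpha> = \<one>" for \<alpha>
    using \<phi>(2)[of "K G P \<alpha>"] rep_dot_neutral[OF that] that by (auto simp: constructible_def)
  ultimately show ?thesis unfolding strongly_covariant_def using isometric_v \<phi>(1) by blast
qed

sublocale cov G P A v
  by unfold_locales (rule strongly_covariant_v)

end

section \<open>Representations by partial bijections\<close>

lemma weighted_shift:
  assumes inj: "inj_on \<tau> D" and C: "0 \<le> C" "\<And>k. k \<in> D \<Longrightarrow> cmod (m k) \<le> C"
  defines "f \<equiv> \<lambda>\<xi>. Abs_ell2 (\<lambda>k. if k \<in> D then m k * coord \<xi> (\<tau> k) else 0)"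
  shows "coord (app (Blinfun f) \<xi>) k = (if k \<in> D then m k * coord \<xi> (\<tau> k) else 0)"
    and "Blinfun f \<in> carrier bounded_ops"
proof -
  have bd: "(\<Sum>k\<in>F. (cmod (if k \<in> D then m k * coord \<xi> (\<tau> k) else 0))\<^sup>2) \<le> (C * norm \<xi>)\<^sup>2" if F: "finite F" for F and \<xi>
  proof -
    have "(\<Sum>k\<in>F. (cmod (if k \<in> D then m k * coord \<xi> (\<tau> k) else 0))\<^sup>2) = (\<Sum>k\<in>F \<inter> D. (cmod (m k * coord \<xi> (\<tau> k)))\<^sup>2)"
      by (rule sum.mono_neutral_cong_right) (use F in auto)
    also have "\<dots> \<le> (\<Sum>k\<in>F \<inter> D. C\<^sup>2 * (cmod (coord \<xi> (\<tau> k)))\<^sup>2)"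
      by (intro sum_mono) (use C in \<open>auto simp: norm_mult power_mult_distrib intro!: mult_right_mono power_mono\<close>)
    also have "\<dots> = C\<^sup>2 * (\<Sum>k\<in>\<tau> ` (F \<inter> D). (cmod (coord \<xi> k))\<^sup>2)"
      by (subst sum.reindex) (use inj in \<open>auto simp: sum_distrib_left inj_on_def\<close>)
    also have "\<dots> \<le> C\<^sup>2 * (norm \<xi>)\<^sup>2" by (intro mult_left_mono sum_coord_le) (use F in auto)
    finally show ?thesis by (simp add: power_mult_distrib)
  qed
  have cf: "coord (f \<xi>) = (\<lambda>k. if k \<in> D then m k * coord \<xi> (\<tau> k) else 0)" for \<xi>
    unfolding f_def by (rule coord_Abs_bounded[OF bd]) (use C in simp_all)
  have nf: "norm (f \<xi>) \<le> C * norm \<xi>" for \<xi>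
    unfolding f_def by (rule norm_Abs_ell2_le[OF bd]) (use C in simp_all)
  have add: "f (x + y) = f x + f y" and sc: "f (scaleC c x) = scaleC c (f x)" for x y c
    by (rule ell2_eqI, simp add: cf algebra_simps)+
  show "coord (app (Blinfun f) \<xi>) k = (if k \<in> D then m k * coord \<xi> (\<tau> k) else 0)"
    unfolding op_apply[of f, OF add sc nf] cf ..
  show "Blinfun f \<in> carrier bounded_ops" by (rule op_carrier[of f, OF add sc nf])
qed

lemma coord_adj_ket:
  "T \<in> carrier bounded_ops \<Longrightarrow> coord (app (adj T) (ket j)) i = cnj (coord (app T (ket i)) j)"
  using cinner_adj2[of T "ket i" "ket j"] by (simp add: cinner_ket)

context group_submonoid begin

text \<open>Given by coordinates; on basis vectors \<open>f \<delta>_g\<close> sends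
  \<open>ket j\<close> to \<open>f (act g (\<kappa> j))\<close> times \<open>ket (a g j)\<close>.
  The regular representation, its slices over points and the permutation representation on an orbit
  are of this form.\<close>

definition prep :: "'i set \<Rightarrow> ('i \<Rightarrow> ('g set \<Rightarrow> bool)) \<Rightarrow> ('g \<Rightarrow> 'i \<Rightarrow> 'i) \<Rightarrow> 'g \<Rightarrow>
    (('g set \<Rightarrow> bool) \<Rightarrow> complex) \<Rightarrow> 'i op" where
  "prep Y \<kappa> a g f = Blinfun (\<lambda>\<xi>. Abs_ell2 (\<lambda>k.
     if k \<in> {k \<in> Y. \<kappa> k \<in> bd (inv g)} then f (\<kappa> k) * coord \<xi> (a (inv g) k) else 0))"

end

text \<open>A partial action on the index set \<open>Y\<close> for which \<open>\<kappa> : Y \<rightarrow> X\<close> is equivariant and the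
  domains are pulled back.\<close>

locale pact = group_submonoid G P
  for G :: "'g monoid" (structure) and P :: "'g set" +
  fixes Y :: "'i set" and \<kappa> :: "'i \<Rightarrow> ('g set \<Rightarrow> bool)" and a :: "'g \<Rightarrow> 'i \<Rightarrow> 'i"
  assumes kX: "i \<in> Y \<Longrightarrow> \<kappa> i \<in> X"
    and aY: "i \<in> Y \<Longrightarrow> \<kappa> i \<in> bd g \<Longrightarrow> a g i \<in> Y"
    and ka: "i \<in> Y \<Longrightarrow> \<kappa> i \<in> bd g \<Longrightarrow> \<kappa> (a g i) = act g (\<kappa> i)"
    and a_one: "i \<in> Y \<Longrightarrow> a \<one> i = i"
    and a_comp: "i \<in> Y \<Longrightarrow> \<kappa> i \<in> bd h \<Longrightarrow> act h (\<kappa> i) \<in> bd g \<Longrightarrow> a g (a h i) = a (g \<otimes> h) i"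
begin

lemma bd_carrier: "x \<in> bd g \<Longrightarrow> g \<in> carrier G"
  using jd_carrier by (auto simp: bd_iff)

lemma a_inv: "i \<in> Y \<Longrightarrow> \<kappa> i \<in> bd g \<Longrightarrow> a (inv g) (a g i) = i"
  using a_comp[of i g "inv g"] act_bd[of "\<kappa> i" g] bd_carrier[of "\<kappa> i" g] a_one by simp

lemma coord_prep:
  assumes g: "g \<in> carrier G" and f: "f \<in> fib g"
  shows "coord (app (prep Y \<kappa> a g f) \<xi>) k =
      (if k \<in> Y \<and> \<kappa> k \<in> bd (inv g) then f (\<kappa> k) * coord \<xi> (a (inv g) k) else 0)"
    and prep_carrier: "prep Y \<kappa> a g f \<in> carrier bounded_ops"
proof -
  obtain M where M: "0 \<le> M" "\<And>x. cmod (f x) \<le> M" using fib_bounded[OF f] by blast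
  have inj: "inj_on (a (inv g)) {k \<in> Y. \<kappa> k \<in> bd (inv g)}"
    by (rule inj_on_inverseI[of _ "a g"]) (use a_inv[of _ "inv g"] g in auto)
  note w = weighted_shift[OF inj M(1), of "\<lambda>k. f (\<kappa> k)"]
  show "coord (app (prep Y \<kappa> a g f) \<xi>) k =
      (if k \<in> Y \<and> \<kappa> k \<in> bd (inv g) then f (\<kappa> k) * coord \<xi> (a (inv g) k) else 0)"
    unfolding prep_def by (subst w(1)) (use M in simp_all)
  show "prep Y \<kappa> a g f \<in> carrier bounded_ops" unfolding prep_def by (rule w(2)) (use M in simp_all)
qed

lemma prep_ket:
  assumes g: "g \<in> carrier G" and f: "f \<in> fib g"
  shows "app (prep Y \<kappa> a g f) (ket j) =
    (if j \<in> Y \<and> \<kappa> j \<in> bd g then scaleC (f (act g (\<kappa> j))) (ket (a g j)) else 0)"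
proof (rule ell2_eqI)
  fix k
  show "coord (app (prep Y \<kappa> a g f) (ket j)) k =
    coord (if j \<in> Y \<and> \<kappa> j \<in> bd g then scaleC (f (act g (\<kappa> j))) (ket (a g j)) else 0) k"
  proof (cases "j \<in> Y \<and> \<kappa> j \<in> bd g \<and> k = a g j")
    case True
    then have "a g j \<in> Y" "\<kappa> (a g j) = act g (\<kappa> j)" "act g (\<kappa> j) \<in> bd (inv g)" "a (inv g) (a g j) = j"
      using aY[of j g] ka[of j g] act_bd[of "\<kappa> j" g] a_inv[of j g] by auto
    then show ?thesis using True by (simp add: coord_prep[OF g f] coord_ket)
  next
    case False
    have "\<not> (k \<in> Y \<and> \<kappa> k \<in> bd (inv g) \<and> a (inv g) k = j)"
    proof
      assume k: "k \<in> Y \<and> \<kappa> k \<in> bd (inv g) \<and> a (inv g) k = j"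
      then have "j \<in> Y" "\<kappa> j \<in> bd g" "a g j = k"
        using aY[of k "inv g"] ka[of k "inv g"] act_bd[of "\<kappa> k" "inv g"] a_inv[of k "inv g"] g by auto
      then show False using False by simp
    qed
    then have "coord (app (prep Y \<kappa> a g f) (ket j)) k = 0" by (auto simp: coord_prep[OF g f] coord_ket)
    then show ?thesis using False by (auto simp: coord_ket)
  qed
qed

text \<open>The left side describes where the product in degree \<open>gh\<close> can be nonzero,
  the right side where the two partial maps can be applied in turn.\<close>

lemma act_comp_iff:
  assumes "g \<in> carrier G" "h \<in> carrier G" "x \<in> X"
  shows "x \<in> bd (g \<otimes> h) \<and> act (g \<otimes> h) x \<in> bd (inv g) \<longleftrightarrow> x \<in> bd h \<and> act h x \<in> bd g"
proof
  assume l: "x \<in> bd (g \<otimes> h) \<and> act (g \<otimes> h) x \<in> bd (inv g)"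
  then have "x \<in> bd (inv g \<otimes> (g \<otimes> h))" "act (inv g \<otimes> (g \<otimes> h)) x = act (inv g) (act (g \<otimes> h) x)"
    using act_comp[of x "g \<otimes> h" "inv g"] by auto
  moreover have "inv g \<otimes> (g \<otimes> h) = h" using assms by (simp add: m_assoc[symmetric])
  ultimately show "x \<in> bd h \<and> act h x \<in> bd g" using act_bd[of "act (g \<otimes> h) x" "inv g"] l assms by simp
next
  assume "x \<in> bd h \<and> act h x \<in> bd g"
  then show "x \<in> bd (g \<otimes> h) \<and> act (g \<otimes> h) x \<in> bd (inv g)"
    using act_comp[of x h g] act_bd[of "act h x" g] by simp
qed

text \<open>The unit is the projection onto the basis vectors indexed by \<open>Y\<close>, so it
  replaces the identity operator in the record.\<close>

lemma cprel_prep: "cprel (bounded_ops\<lparr>one := prep Y \<kappa> a \<one> (\<lambda>x. of_bool (x \<in> X))\<rparr>) (prep Y \<kappa> a)"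
proof -
  let ?r = "prep Y \<kappa> a"
  have add: "?r g (\<lambda>x. f x + f' x) = ?r g f + ?r g f'" if "g \<in> carrier G" "f \<in> fib g" "f' \<in> fib g" for g f f'
    by (rule blinfun_eqI, rule ell2_eqI) (use that in \<open>simp add: coord_prep fib_add blinfun.add_left algebra_simps\<close>)
  have sm: "?r g (\<lambda>x. c * f x) = c \<odot>\<^bsub>bounded_ops\<^esub> ?r g f" if "g \<in> carrier G" "f \<in> fib g" for g f c
    by (rule blinfun_eqI, rule ell2_eqI) (use that in \<open>simp add: coord_prep fib_smult smult_ops\<close>)
  have mult: "?r (g \<otimes> h) (cpm g f f') = ?r g f o\<^sub>L ?r h f'"
    if g: "g \<in> carrier G" "h \<in> carrier G" and f: "f \<in> fib g" "f' \<in> fib h" for g h f f'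
  proof (rule ops_eqI)
    have gh: "g \<otimes> h \<in> carrier G" using g by simp
    note fm = fib_mult[OF g f]
    show "?r (g \<otimes> h) (cpm g f f') \<in> carrier bounded_ops" by (rule prep_carrier[OF gh fm])
    show "?r g f o\<^sub>L ?r h f' \<in> carrier bounded_ops"
      using ops.m_closed[OF prep_carrier[OF g(1) f(1)] prep_carrier[OF g(2) f(2)]] by (simp add: ops_simps)
    fix j
    have sc: "app (?r g f) (scaleC c x) = scaleC c (app (?r g f) x)" for c x
      using prep_carrier[OF g(1) f(1)] by (simp add: carrier_ops)
    show "app (?r (g \<otimes> h) (cpm g f f')) (ket j) = app (?r g f o\<^sub>L ?r h f') (ket j)"
    proof (cases "j \<in> Y \<and> \<kappa> j \<in> bd h \<and> act h (\<kappa> j) \<in> bd g")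
      case True
      then have jX: "\<kappa> j \<in> X" using kX by blast
      have 1: "\<kappa> j \<in> bd (g \<otimes> h)" "act (g \<otimes> h) (\<kappa> j) \<in> bd (inv g)" using act_comp_iff[OF g jX] True by auto
      have 2: "act (g \<otimes> h) (\<kappa> j) = act g (act h (\<kappa> j))" "a g (a h j) = a (g \<otimes> h) j"
        using act_comp(2)[of "\<kappa> j" h g] a_comp[of j h g] True by auto
      have 3: "act (inv g) (act g (act h (\<kappa> j))) = act h (\<kappa> j)" using act_inv True by blast
      show ?thesis unfolding prep_ket[OF gh fm] using True 1 2 3 aY[of j h] ka[of j h]
        by (simp add: prep_ket[OF g(2) f(2)] sc prep_ket[OF g(1) f(1)] cp_mult_def
            scaleC_scaleC mult.commute)
    next
      case False
      have "app (?r (g \<otimes> h) (cpm g f f')) (ket j) = 0"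
        unfolding prep_ket[OF gh fm] using act_comp_iff[OF g kX, of j] False by (auto simp: cp_mult_def)
      moreover have "app (?r g f) (app (?r h f') (ket j)) = 0"
        using False aY[of j h] ka[of j h]
        by (auto simp: prep_ket[OF g(2) f(2)] sc prep_ket[OF g(1) f(1)])
      ultimately show ?thesis by simp
    qed
  qed
  have star: "?r (inv g) (cps g f) = adj (?r g f)" if g: "g \<in> carrier G" and f: "f \<in> fib g" for g f
  proof (rule ops_eqI)
    have gi: "inv g \<in> carrier G" using g by simp
    note fs = fib_star[OF g f] and pc = prep_carrier[OF g f]
    show "?r (inv g) (cps g f) \<in> carrier bounded_ops" by (rule prep_carrier[OF gi fs])
    show "adj (?r g f) \<in> carrier bounded_ops" by (rule adj_carrier[OF pc])
    fix j
    show "app (?r (inv g) (cps g f)) (ket j) = app (adj (?r g f)) (ket j)"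
    proof (rule ell2_eqI)
      fix i
      show "coord (app (?r (inv g) (cps g f)) (ket j)) i = coord (app (adj (?r g f)) (ket j)) i"
        unfolding coord_adj_ket[OF pc] prep_ket[OF g f] coord_prep(1)[OF gi fs]
        using g ka[of i g] by (auto simp: coord_ket cp_star_def)
    qed
  qed
  show ?thesis
    unfolding cprel_def using add sm mult star prep_carrier by (simp add: bounded_ops_def)
qed

end

section \<open>The crossed products\<close>

context group_submonoid begin

abbreviation gens :: "('g \<Rightarrow> (('g set \<Rightarrow> bool) \<Rightarrow> complex) \<Rightarrow> 'a) \<Rightarrow> 'a set" where
  "gens u \<equiv> {u g f | g f. g \<in> carrier G \<and> f \<in> fib g}"

text \<open>The relations make \<open>e\<close> a unit for the generators, hence for their span and
  by continuity for the closure, even where it differs from the unit of \<open>B\<close>.\<close>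

lemma crossed_sub:
  fixes B :: "'a cstar"
  assumes B: "calg B" and u: "cprel (B\<lparr>one := e\<rparr>) u"
  shows "crossed G P (B\<lparr>carrier := cl B (lin_span B (gens u)), one := e\<rparr>) u"
    and "cstar_sub B (cl B (lin_span B (gens u)))"
proof -
  interpret B: calg B by (rule B)
  let ?U = "gens u" and ?A = "B\<lparr>carrier := cl B (lin_span B (gens u)), one := e\<rparr>"
  let ?o = "\<lambda>x. of_bool (x \<in> X)"
  have o1: "?o \<in> fib \<one>" using simp_fun_fib[OF simp_fun_one] .
  have uc: "\<And>g f. g \<in> carrier G \<Longrightarrow> f \<in> fib g \<Longrightarrow> u g f \<in> carrier B"
    and um: "\<And>g f h f'. g \<in> carrier G \<Longrightarrow> f \<in> fib g \<Longrightarrow> h \<in> carrier G \<Longrightarrow> f' \<in> fib h \<Longrightarrow>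
      u (g \<otimes> h) (cpm g f f') = u g f \<otimes>\<^bsub>B\<^esub> u h f'"
    and us: "\<And>g f. g \<in> carrier G \<Longrightarrow> f \<in> fib g \<Longrightarrow> u (inv g) (cps g f) = star B (u g f)"
    and ue: "u \<one> ?o = e"
    using u unfolding cprel_def by simp_all
  have U: "?U \<subseteq> carrier B" using uc by blast
  have Um: "x \<otimes>\<^bsub>B\<^esub> y \<in> ?U" if xy: "x \<in> ?U" "y \<in> ?U" for x y
  proof -
    obtain g f h f' where "x = u g f" "y = u h f'" "g \<in> carrier G" "f \<in> fib g" "h \<in> carrier G" "f' \<in> fib h"
      using xy by blast
    then have "x \<otimes>\<^bsub>B\<^esub> y = u (g \<otimes> h) (cpm g f f')" "g \<otimes> h \<in> carrier G" "cpm g f f' \<in> fib (g \<otimes> h)"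
      by (simp_all add: um fib_mult)
    then show ?thesis by blast
  qed
  have Us: "star B x \<in> ?U" if x: "x \<in> ?U" for x
  proof -
    obtain g f where "x = u g f" "g \<in> carrier G" "f \<in> fib g" using x by blast
    then have "star B x = u (inv g) (cps g f)" "inv g \<in> carrier G" "cps g f \<in> fib (inv g)" by (simp_all add: us fib_star)
    then show ?thesis by blast
  qed
  show sub: "cstar_sub B (cl B (lin_span B ?U))"
    by (rule B.cstar_sub_cl_lin_span[OF U B.lin_span_base[OF U Um] B.lin_span_base[OF U Us]])
  have base: "x \<in> ?U \<Longrightarrow> x \<in> cl B (lin_span B ?U)" for x
    using B.cl_subset[of "lin_span B ?U"] B.lin_span_carrier[OF U] B.lin_span_base[OF U, of x] by blast
  have eU: "e \<in> ?U" using ue[symmetric] o1 one_closed by blast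
  have ec: "e \<in> carrier B" using eU U by blast
  have e1: "e \<otimes>\<^bsub>B\<^esub> x = x \<and> x \<otimes>\<^bsub>B\<^esub> e = x" if xU: "x \<in> ?U" for x
  proof -
    obtain g f where x: "x = u g f" and g: "g \<in> carrier G" and f: "f \<in> fib g" using xU by blast
    have b1: "x \<in> bd (inv \<one>) \<longleftrightarrow> x \<in> X" for x using X_bd_one bd_X[of x \<one>] by auto
    have "cpm \<one> ?o f x = f x" for x
      using b1[of x] act_one[of x] fib_off_X[OF f, of x] by (cases "x \<in> X") (simp_all add: cp_mult_def)
    then have 1: "cpm \<one> ?o f = f" by (rule ext)
    have "cpm g f ?o x = f x" for x
      using fib_off[OF f, of x] act_X[of x "inv g"] by (auto simp: cp_mult_def)
    then have 2: "cpm g f ?o = f" by (rule ext)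
    show ?thesis using um[OF one_closed o1 g f] um[OF g f one_closed o1] 1 2 g by (simp add: x ue)
  qed
  have e2: "e \<otimes>\<^bsub>B\<^esub> x = x \<and> x \<otimes>\<^bsub>B\<^esub> e = x" if "x \<in> lin_span B ?U" for x
    using that
  proof induct
    case (step x y c)
    then have "x \<in> carrier B" "y \<in> carrier B" using U B.lin_span_carrier[OF U] by blast+
    then show ?case using step(3) e1[OF step(1)] ec by (simp add: B.r_distr B.l_distr B.smult_l B.smult_r)
  qed (use ec in simp)
  have e3: "e \<otimes>\<^bsub>B\<^esub> a = a \<and> a \<otimes>\<^bsub>B\<^esub> e = a" if a: "a \<in> cl B (lin_span B ?U)" for a
  proof -
    have ac: "a \<in> carrier B" using a B.cl_carrier by blast
    have "nrm B (e \<otimes>\<^bsub>B\<^esub> a \<ominus>\<^bsub>B\<^esub> a) \<le> d \<and> nrm B (a \<otimes>\<^bsub>B\<^esub> e \<ominus>\<^bsub>B\<^esub> a) \<le> d" if d: "0 < d" for d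
    proof -
      let ?n = "nrm B e + 1"
      have n: "0 < ?n" using B.nrm_nonneg[OF ec] by simp
      obtain y where y: "y \<in> lin_span B ?U" "nrm B (a \<ominus>\<^bsub>B\<^esub> y) < d / ?n"
        using B.cl_approx[OF a divide_pos_pos[OF d n]] by blast
      have yc: "y \<in> carrier B" using B.lin_span_carrier[OF U y(1)] .
      have le: "(nrm B e + 1) * nrm B (a \<ominus>\<^bsub>B\<^esub> y) \<le> d" using y(2) n by (simp add: field_simps)
      have "e \<otimes>\<^bsub>B\<^esub> a \<ominus>\<^bsub>B\<^esub> a = e \<otimes>\<^bsub>B\<^esub> (a \<ominus>\<^bsub>B\<^esub> y) \<ominus>\<^bsub>B\<^esub> (a \<ominus>\<^bsub>B\<^esub> y) \<oplus>\<^bsub>B\<^esub> (e \<otimes>\<^bsub>B\<^esub> y \<ominus>\<^bsub>B\<^esub> y)"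
        using ac yc ec by algebra
      then have 1: "e \<otimes>\<^bsub>B\<^esub> a \<ominus>\<^bsub>B\<^esub> a = e \<otimes>\<^bsub>B\<^esub> (a \<ominus>\<^bsub>B\<^esub> y) \<ominus>\<^bsub>B\<^esub> (a \<ominus>\<^bsub>B\<^esub> y)"
        using e2[OF y(1)] ac yc ec by (simp add: B.minus_eq_zero[THEN iffD2])
      have "a \<otimes>\<^bsub>B\<^esub> e \<ominus>\<^bsub>B\<^esub> a = (a \<ominus>\<^bsub>B\<^esub> y) \<otimes>\<^bsub>B\<^esub> e \<ominus>\<^bsub>B\<^esub> (a \<ominus>\<^bsub>B\<^esub> y) \<oplus>\<^bsub>B\<^esub> (y \<otimes>\<^bsub>B\<^esub> e \<ominus>\<^bsub>B\<^esub> y)"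
        using ac yc ec by algebra
      then have 2: "a \<otimes>\<^bsub>B\<^esub> e \<ominus>\<^bsub>B\<^esub> a = (a \<ominus>\<^bsub>B\<^esub> y) \<otimes>\<^bsub>B\<^esub> e \<ominus>\<^bsub>B\<^esub> (a \<ominus>\<^bsub>B\<^esub> y)"
        using e2[OF y(1)] ac yc ec by (simp add: B.minus_eq_zero[THEN iffD2])
      have dc: "a \<ominus>\<^bsub>B\<^esub> y \<in> carrier B" using ac yc by simp
      have "nrm B (e \<otimes>\<^bsub>B\<^esub> a \<ominus>\<^bsub>B\<^esub> a) \<le> (nrm B e + 1) * nrm B (a \<ominus>\<^bsub>B\<^esub> y)"
        unfolding 1 using B.nrm_minus_le[of "e \<otimes>\<^bsub>B\<^esub> (a \<ominus>\<^bsub>B\<^esub> y)" "a \<ominus>\<^bsub>B\<^esub> y"] B.nrm_mult[OF ec dc] ec dc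
        by (simp add: distrib_right)
      moreover have "nrm B (a \<otimes>\<^bsub>B\<^esub> e \<ominus>\<^bsub>B\<^esub> a) \<le> (nrm B e + 1) * nrm B (a \<ominus>\<^bsub>B\<^esub> y)"
        unfolding 2 using B.nrm_minus_le[of "(a \<ominus>\<^bsub>B\<^esub> y) \<otimes>\<^bsub>B\<^esub> e" "a \<ominus>\<^bsub>B\<^esub> y"] B.nrm_mult[OF dc ec] ec dc
        by (simp add: distrib_right mult.commute)
      ultimately show ?thesis using le by linarith
    qed
    then show ?thesis using ac ec
      by (intro conjI B.eq_if_close[of "e \<otimes>\<^bsub>B\<^esub> a" a] B.eq_if_close[of "a \<otimes>\<^bsub>B\<^esub> e" a]) simp_all
  qed
  have A: "calg ?A" by (rule B.calg_sub[OF sub e3 base[OF eU]])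
  have "cprel ?A u"
    using u unfolding cprel_def by (simp add: base) (use base in blast)
  then show "crossed G P ?A u" by (intro crossed.intro crossed_axioms.intro group_submonoid_axioms A)
qed

abbreviation "Red \<equiv> reduced_cp G X bd act"
abbreviation "rg \<equiv> reg_gen G X bd act"

lemma pact_reg: "pact G P {(k, x). k \<in> carrier G \<and> x \<in> bd k} (\<lambda>(k, x). act k x) (\<lambda>g (k, x). (g \<otimes> k, x))"
proof (unfold_locales, goal_cases)
  case (5 i h g)
  then obtain k x where i: "i = (k, x)" "k \<in> carrier G" "x \<in> bd k" by auto
  have "h \<in> carrier G" "g \<in> carrier G" using 5 jd_carrier by (auto simp: bd_iff)
  then show ?case using i by (simp add: m_assoc)
qed (use act_X act_comp jd_carrier in \<open>auto simp: bd_iff[of _ g for g] split: prod.splits\<close>)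

interpretation reg: pact G P "{(k, x). k \<in> carrier G \<and> x \<in> bd k}" "\<lambda>(k, x). act k x" "\<lambda>g (k, x). (g \<otimes> k, x)"
  by (rule pact_reg)

text \<open>\<open>reg_gen\<close> tests whether \<open>x\<close> is in
  \<open>bd (inv g \<otimes> k)\<close>, the general construction whether \<open>act k x\<close> is
  in \<open>bd (inv g)\<close>; for \<open>x\<close> in \<open>bd k\<close> these agree.\<close>

lemma rg_prep:
  assumes g: "g \<in> carrier G"
  shows "rg g f = prep {(k, x). k \<in> carrier G \<and> x \<in> bd k} (\<lambda>(k, x). act k x) (\<lambda>g (k, x). (g \<otimes> k, x)) g f"
proof -
  have "x \<in> bd (inv g \<otimes> k) \<longleftrightarrow> act k x \<in> bd (inv g)" if k: "k \<in> carrier G" "x \<in> bd k" for k x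
  proof
    assume "act k x \<in> bd (inv g)" then show "x \<in> bd (inv g \<otimes> k)" using act_comp[OF k(2)] by simp
  next
    assume "x \<in> bd (inv g \<otimes> k)"
    then show "act k x \<in> bd (inv g)"
      using act_comp(1)[OF act_bd[OF k(2)], of "inv g \<otimes> k"] act_inv[OF k(2)] g k by (simp add: m_assoc)
  qed
  then have "(if i \<in> {i \<in> {(k, x). k \<in> carrier G \<and> x \<in> bd k}. (case i of (k, x) \<Rightarrow> act k x) \<in> bd (inv g)}
      then f (case i of (k, x) \<Rightarrow> act k x) * coord \<xi> (case i of (k, x) \<Rightarrow> (inv g \<otimes> k, x)) else 0) =
    (case i of (k, x) \<Rightarrow> if k \<in> carrier G \<and> x \<in> bd k \<and> x \<in> bd (inv g \<otimes> k)
      then f (act k x) * coord \<xi> (inv g \<otimes> k, x) else 0)" for i \<xi>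
    by (cases i; cases "fst i \<in> carrier G \<and> snd i \<in> bd (fst i)") auto
  then show ?thesis unfolding reg_gen_def prep_def by simp
qed

lemma rg_ket:
  assumes g: "g \<in> carrier G" and f: "f \<in> fib g"
  shows "app (rg g f) (ket (k, x)) =
    (if k \<in> carrier G \<and> x \<in> bd k \<and> act k x \<in> bd g then scaleC (f (act g (act k x))) (ket (g \<otimes> k, x)) else 0)"
  unfolding rg_prep[OF g] reg.prep_ket[OF g f] by simp

lemma rg_cprel: "cprel (bounded_ops\<lparr>one := rg \<one> (\<lambda>x. of_bool (x \<in> X))\<rparr>) rg"
proof -
  have "cprel A u \<Longrightarrow> (\<And>g f. g \<in> carrier G \<Longrightarrow> u' g f = u g f) \<Longrightarrow> cprel A u'" for A :: "'z cstar" and u u'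
    unfolding cprel_def by simp
  from this[OF reg.cprel_prep rg_prep] show ?thesis by (simp add: rg_prep[OF one_closed])
qed

lemma crossed_Red: "crossed G P Red rg"
  and Red_sub: "cstar_sub bounded_ops (carrier Red)"
  using crossed_sub[OF calg_ops rg_cprel] by (simp_all add: reduced_cp_def)

abbreviation "Full \<equiv> full_cp G X bd act :: (('g \<Rightarrow> (('g set \<Rightarrow> bool) \<Rightarrow> complex) \<Rightarrow> ('g \<times> nat) op) \<Rightarrow> ('g \<times> nat) op) cstar"
abbreviation "fg \<equiv> full_gen G X bd act :: 'g \<Rightarrow> _ \<Rightarrow> (('g \<Rightarrow> (('g set \<Rightarrow> bool) \<Rightarrow> complex) \<Rightarrow> ('g \<times> nat) op) \<Rightarrow> ('g \<times> nat) op)"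
abbreviation "reps \<equiv> Collect (cp_rep G X bd act) :: ('g \<Rightarrow> (('g set \<Rightarrow> bool) \<Rightarrow> complex) \<Rightarrow> ('g \<times> nat) op) set"

lemma crossed_rep: "\<rho> \<in> reps \<Longrightarrow> crossed G P bounded_ops \<rho>"
  by (intro crossed.intro crossed_axioms.intro group_submonoid_axioms calg_ops) (simp add: cp_rep_iff)

text \<open>\<open>u_bound\<close> bounds \<open>\<rho> g f\<close> uniformly over all
  representations, so the family belongs to the direct sum.\<close>

lemma fg_cprel: "cprel (bounded_families reps bounded_ops) fg"
proof -
  have "fg g f \<in> carrier (bounded_families reps bounded_ops)" if g: "g \<in> carrier G" and f: "f \<in> fib g" for g f
  proof -
    obtain M where M: "0 \<le> M" "\<And>x. cmod (f x) \<le> M" using fib_bounded[OF f] by blast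
    have "\<rho> g f \<in> carrier bounded_ops \<and> nrm bounded_ops (\<rho> g f) \<le> M" if "\<rho> \<in> reps" for \<rho> :: "'g \<Rightarrow> _ \<Rightarrow> ('g \<times> nat) op"
      using crossed.u_closed[OF crossed_rep[OF that] g f] crossed.u_bound[OF crossed_rep[OF that] g f M(1)] M(2) by blast
    then show ?thesis by (intro ops.fam_carrierI[of _ _ M]) (auto simp: full_gen_def)
  qed
  moreover have "\<rho> \<in> reps \<Longrightarrow> cprel bounded_ops \<rho>" for \<rho> by (simp add: cp_rep_iff)
  ultimately show ?thesis
    unfolding cprel_def by (auto simp: families_simps full_gen_def intro!: restrict_ext)
qed

lemma crossed_Full: "crossed G P Full fg"
  and Full_sub: "cstar_sub (bounded_families reps bounded_ops) (carrier Full)"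
proof -
  have e: "fg \<one> (\<lambda>x. of_bool (x \<in> X)) = \<one>\<^bsub>bounded_families reps bounded_ops\<^esub>"
    using fg_cprel unfolding cprel_def by (rule conjunct2)
  then show "crossed G P Full fg" "cstar_sub (bounded_families reps bounded_ops) (carrier Full)"
    using crossed_sub[OF ops.calg_fam, of "\<one>\<^bsub>bounded_families reps bounded_ops\<^esub>" reps fg] fg_cprel
    by (simp_all add: full_cp_def Let_def)
qed

end

section \<open>Strongly covariant representations come from the crossed product\<close>

context group_submonoid begin

definition same_type :: "'g set set \<Rightarrow> 'g \<Rightarrow> 'g \<Rightarrow> bool" where
  "same_type F p q \<longleftrightarrow> (\<forall>S\<in>F. p \<in> S \<longleftrightarrow> q \<in> S)"

text \<open>Induction on \<open>F\<close>, splitting along one more ideal \<open>S\<close>: on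
  \<open>S\<close> and on its complement \<open>h\<close> agrees with functions
  \<open>k True\<close> and \<open>k False\<close> that depend on the type for the smaller family
  only.\<close>

lemma ind_lin_span:
  assumes F: "finite F" "F \<subseteq> J"
    and h: "h \<in> extensional P" "\<And>p q. p \<in> P \<Longrightarrow> q \<in> P \<Longrightarrow> same_type F p q \<Longrightarrow> h p = h q"
  shows "h \<in> lin_span lP (ind P ` J)"
  using F h
proof (induct F arbitrary: h)
  case empty
  interpret L: calg lP by (rule calg_lP)
  have Y: "ind P ` J \<subseteq> carrier lP" using ind_carrier by auto
  have "h = h \<one> \<odot>\<^bsub>lP\<^esub> ind P P"
  proof (rule extensionalityI[OF empty(2)])
    fix p assume p: "p \<in> P"
    have "h p = h \<one>" by (rule empty(3)[OF p]) (simp_all add: same_type_def)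
    then show "h p = (h \<one> \<odot>\<^bsub>lP\<^esub> ind P P) p" using p by (simp add: families_simps complex_cstar_def ind_def)
  qed (simp add: families_simps)
  moreover have "h \<one> \<odot>\<^bsub>lP\<^esub> ind P P \<in> lin_span lP (ind P ` J)"
    using L.lin_span_smult[OF Y L.lin_span_base[OF Y]] P_J by blast
  ultimately show ?case by simp
next
  case (insert S F)
  interpret L: calg lP by (rule calg_lP)
  have Y: "ind P ` J \<subseteq> carrier lP" using ind_carrier by auto
  \<comment> \<open>\<open>k b\<close> reads \<open>h\<close> off at some point of the same
    \<open>F\<close>-type on the side \<open>b\<close> of \<open>S\<close>. Where that side has no
    such point, the value does not matter and is set to 0.\<close>
  define k where "k b = (\<lambda>p\<in>P. if \<exists>q\<in>P. (q \<in> S \<longleftrightarrow> b) \<and> same_type F p q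
    then h (SOME q. q \<in> P \<and> (q \<in> S \<longleftrightarrow> b) \<and> same_type F p q) else 0)" for b
  have ks: "k b \<in> lin_span lP (ind P ` J)" for b
  proof (rule insert(3))
    show "F \<subseteq> J" "k b \<in> extensional P" using insert by (simp_all add: k_def)
    fix p q assume p: "p \<in> P" "q \<in> P" and "same_type F p q"
    then have "same_type F p = same_type F q" by (intro ext) (auto simp: same_type_def)
    then show "k b p = k b q" using p unfolding k_def by (simp only: restrict_apply')
  qed
  have kh: "k b p = h p" if p: "p \<in> P" "p \<in> S \<longleftrightarrow> b" for b p
  proof -
    let ?Q = "\<lambda>q. q \<in> P \<and> (q \<in> S \<longleftrightarrow> b) \<and> same_type F p q"
    have Qp: "?Q p" using p by (simp add: same_type_def)
    define r where "r = (SOME q. ?Q q)"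
    have Q: "?Q r" unfolding r_def by (rule someI[of ?Q, OF Qp])
    have "same_type (insert S F) p r" using p(2) Q by (simp add: same_type_def)
    then have "h r = h p" using insert(6)[OF p(1), of r] Q by simp
    moreover have "\<exists>q\<in>P. (q \<in> S \<longleftrightarrow> b) \<and> same_type F p q" using Qp by blast
    ultimately show ?thesis using p unfolding k_def by (simp only: restrict_apply' if_True r_def)
  qed
  have m: "ind P S \<otimes>\<^bsub>lP\<^esub> k b \<in> lin_span lP (ind P ` J)" for b
  proof (rule L.lin_span_mult[OF Y Y Y _ _ ks])
    show "ind P S \<in> lin_span lP (ind P ` J)" using insert by (intro L.lin_span_base[OF Y]) auto
  qed (auto simp: ind_simps intro!: L.lin_span_base[OF Y])
  have "ind P S \<otimes>\<^bsub>lP\<^esub> k True \<oplus>\<^bsub>lP\<^esub> (k False \<oplus>\<^bsub>lP\<^esub> (-1) \<odot>\<^bsub>lP\<^esub> (ind P S \<otimes>\<^bsub>lP\<^esub> k False))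
      \<in> lin_span lP (ind P ` J)"
    by (intro L.lin_span_add[OF Y] L.lin_span_smult[OF Y] m ks)
  also have "ind P S \<otimes>\<^bsub>lP\<^esub> k True \<oplus>\<^bsub>lP\<^esub> (k False \<oplus>\<^bsub>lP\<^esub> (-1) \<odot>\<^bsub>lP\<^esub> (ind P S \<otimes>\<^bsub>lP\<^esub> k False)) = h"
  proof (rule extensionalityI[OF _ insert(5)])
    fix p assume p: "p \<in> P"
    show "(ind P S \<otimes>\<^bsub>lP\<^esub> k True \<oplus>\<^bsub>lP\<^esub> (k False \<oplus>\<^bsub>lP\<^esub> (-1) \<odot>\<^bsub>lP\<^esub> (ind P S \<otimes>\<^bsub>lP\<^esub> k False))) p = h p"
      using p kh[OF p, of True] kh[OF p, of False]
      by (cases "p \<in> S") (simp_all add: families_simps complex_cstar_def ind_def)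
  qed (simp add: families_simps)
  finally show ?case .
qed

text \<open>Test on the basis vector at \<open>(\<one>, act (inv g) x)\<close>, which is sent to
  \<open>f x\<close> times a basis vector.\<close>

lemma rg_lower:
  assumes g: "g \<in> carrier G" and f: "f \<in> fib g" and x: "x \<in> X"
  shows "cmod (f x) \<le> nrm Red (rg g f)"
proof (cases "x \<in> bd (inv g)")
  case True
  then have y: "act (inv g) x \<in> bd g" "act g (act (inv g) x) = x" using act_bd[OF True] act_inv[OF True] g by simp_all
  have "app (rg g f) (ket (\<one>, act (inv g) x)) = scaleC (f x) (ket (g, act (inv g) x))"
    using y X_bd_one[OF bd_X] act_one[OF bd_X] g by (simp add: rg_ket[OF g f])
  then have "cmod (f x) = norm (app (rg g f) (ket (\<one>, act (inv g) x)))" by simp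
  also have "\<dots> \<le> norm (rg g f) * norm (ket (\<one>, act (inv g) x))" by (rule norm_blinfun)
  finally show ?thesis by (simp add: reduced_cp_def ops_simps)
next
  case False
  interpret R: crossed G P Red rg by (rule crossed_Red)
  show ?thesis using fib_off[OF f False] R.A.nrm_nonneg[OF R.u_closed[OF g f]] by simp
qed

end

context cov begin

text \<open>The counterpart of \<open>1_S \<delta>_g\<close> in an algebra carrying a strongly
  covariant representation; independent of the word by \<open>dot_eq\<close>.\<close>

definition d :: "'g \<Rightarrow> 'g set \<Rightarrow> 'a" where
  "d g S = (SOME a. \<exists>\<alpha>. is_word P \<alpha> \<and> wdot G \<alpha> = g \<and> K G P (rev \<alpha>) = S \<and> a = rep_dot A w \<alpha>)"

lemma d_eq: "is_word P \<alpha> \<Longrightarrow> wdot G \<alpha> = g \<Longrightarrow> K G P (rev \<alpha>) = S \<Longrightarrow> d g S = rep_dot A w \<alpha>"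
  unfolding d_def by (rule some1_equality) (use dot_eq in blast)+

lemma d_word:
  assumes "g \<in> carrier G" "S \<in> jd (inv g)"
  obtains \<alpha> where "is_word P \<alpha>" "wdot G \<alpha> = g" "K G P (rev \<alpha>) = S" "d g S = rep_dot A w \<alpha>"
proof -
  obtain \<beta> where b: "is_word P \<beta>" "wdot G \<beta> = inv g" "S = K G P \<beta>" using assms(2) by (auto simp: jd_def)
  then show thesis using that[of "rev \<beta>"] d_eq[of "rev \<beta>" g S] assms(1) by (simp add: wdot_rev)
qed

lemma d_closed: "g \<in> carrier G \<Longrightarrow> S \<in> jd (inv g) \<Longrightarrow> d g S \<in> carrier A"
  by (rule d_word) auto

lemma d_mult:
  assumes "g \<in> carrier G" "h \<in> carrier G" "S \<in> jd (inv g)" "T \<in> jd (inv h)"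
  shows "d g S \<otimes>\<^bsub>A\<^esub> d h T = d (g \<otimes> h) {p \<in> S. inv g \<otimes> p \<in> T}"
proof -
  obtain \<alpha> where a: "is_word P \<alpha>" "wdot G \<alpha> = g" "K G P (rev \<alpha>) = S" "d g S = rep_dot A w \<alpha>"
    using d_word[OF assms(1,3)] .
  obtain \<beta> where b: "is_word P \<beta>" "wdot G \<beta> = h" "K G P (rev \<beta>) = T" "d h T = rep_dot A w \<beta>"
    using d_word[OF assms(2,4)] .
  have "K G P (rev (\<alpha> @ \<beta>)) = {p \<in> S. inv g \<otimes> p \<in> T}"
    using a b K_append[of "rev \<beta>" "rev \<alpha>"] by (auto simp: wdot_rev)
  then have "d (g \<otimes> h) {p \<in> S. inv g \<otimes> p \<in> T} = rep_dot A w (\<alpha> @ \<beta>)"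
    using a b by (intro d_eq) (auto simp: wdot_append)
  then show ?thesis using a b by (simp add: dot_append)
qed

lemma d_star:
  assumes "g \<in> carrier G" "S \<in> jd (inv g)"
  shows "star A (d g S) = d (inv g) (inv g <# S)"
proof -
  obtain \<alpha> where a: "is_word P \<alpha>" "wdot G \<alpha> = g" "K G P (rev \<alpha>) = S" "d g S = rep_dot A w \<alpha>"
    using d_word[OF assms] .
  have "d (inv g) (inv g <# S) = rep_dot A w (rev \<alpha>)"
    using a lcoset_K[of "rev \<alpha>"] by (intro d_eq) (auto simp: wdot_rev)
  then show ?thesis using a by (simp add: dot_rev)
qed

lemma d_one: "d \<one> P = \<one>\<^bsub>A\<^esub>"
  using d_eq[of "[]" \<one> P] by simp

lemma d_P: "p \<in> P \<Longrightarrow> d p (p <# P) = w p"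
proof -
  assume p: "p \<in> P"
  have "K G P [p, \<one>] = p <# P" using p pr_P by (auto simp: inv_mult_group)
  then have "d p (p <# P) = rep_dot A w [\<one>, p]" using p by (intro d_eq) auto
  then show ?thesis using p dot_pair by simp
qed

text \<open>The part of \<open>b\<close> carried by points whose type is not that of a point deciding some character of
  the boundary lies in \<open>D_r_o\<close>, so it does not contribute to \<open>\<phi> b\<close>.\<close>

lemma d_bound:
  assumes F: "finite F" "F \<subseteq> J" and M: "0 \<le> M"
    and b: "b \<in> lin_span lP (ind P ` J)"
    and type: "\<And>p q. p \<in> P \<Longrightarrow> q \<in> P \<Longrightarrow> same_type F p q \<Longrightarrow> b p = b q"
    and bM: "\<And>x p. x \<in> X \<Longrightarrow> decides p x F \<Longrightarrow> cmod (b p) \<le> M"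
    and \<phi>: "star_hom (D_r G P) A \<phi>" "\<forall>b\<in>D_r_o G P. \<phi> b = \<zero>\<^bsub>A\<^esub>"
  shows "nrm A (\<phi> b) \<le> 2 * M"
proof -
  interpret L: calg lP by (rule calg_lP)
  interpret DA: calg_pair "D_r G P" A by (intro calg_pair.intro calg_D_r A.calg_axioms)
  have Y: "ind P ` J \<subseteq> carrier lP" using ind_carrier by auto
  have spanD: "x \<in> carrier (D_r G P)" if "x \<in> lin_span lP (ind P ` J)" for x
    using L.cl_subset[of "lin_span lP (ind P ` J)"] L.lin_span_carrier[OF Y] that by (auto simp: D_r_simps)
  define good where "good p \<longleftrightarrow> (\<exists>x\<in>X. \<exists>q. decides q x F \<and> same_type F p q)" for p
  define b' where "b' = (\<lambda>p\<in>P. if good p then b p else 0)"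
  have same: "good p \<longleftrightarrow> good q" if "same_type F p q" for p q
    unfolding good_def using that by (auto simp: same_type_def)
  have b's: "b' \<in> lin_span lP (ind P ` J)"
    by (rule ind_lin_span[OF F]) (use type same in \<open>auto simp: b'_def\<close>)
  note c = L.lin_span_carrier[OF Y b] L.lin_span_carrier[OF Y b's]
  \<comment> \<open>There is a boundary point containing \<open>pP\<close>, and \<open>p\<close>
    decides \<open>F\<close> for it.\<close>
  have decide: "good p" if p: "p \<in> P" and dec: "\<forall>S\<in>F. p \<in> S \<or> (p <# P) \<inter> S = {}" for p
  proof -
    obtain x where x: "x \<in> X" "x (p <# P)" using X_exists[OF p] by blast
    have "if x S then p \<in> S else (p <# P) \<inter> S = {}" if S: "S \<in> F" for S
    proof (cases "p \<in> S")
      case True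
      then have "p <# P \<subseteq> S" using pr_sub[of S p] S F by blast
      then have "x S" using X_mono[OF x] S F by blast
      then show ?thesis using True by simp
    next
      case False
      then have e: "(p <# P) \<inter> S = {}" using dec S by blast
      then show ?thesis using X_disjoint[OF x, of S] by auto
    qed
    then have "decides p x F" using p x by (simp add: decides_def)
    then show ?thesis using x by (auto simp: good_def same_type_def)
  qed
  obtain E where E: "finite E" "E \<subseteq> carrier G"
    "\<forall>E'. E \<subseteq> E' \<longrightarrow> (\<forall>p\<in>Delta G P E'. \<forall>S\<in>F. p \<in> S \<or> (p <# P) \<inter> S = {})"
    using Delta_decides_all[OF F] by blast
  let ?k = "b \<ominus>\<^bsub>lP\<^esub> b'"
  have ks: "?k \<in> lin_span lP (ind P ` J)" by (rule L.lin_span_minus[OF Y b b's])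
  have z: "?k p = 0" if "p \<in> P" "good p" for p using lP_minus[OF c, of p] that by (simp add: b'_def)
  \<comment> \<open>Beyond \<open>E\<close> all points of \<open>Delta G P E'\<close> decide the
    members of \<open>F\<close>, so they are good and \<open>?k\<close> vanishes on them; the net is
    eventually zero.\<close>
  have "Sup (insert 0 ((\<lambda>p. cmod (?k p)) ` Delta G P E')) = 0" if E': "E \<subseteq> E'" for E'
  proof -
    have "cmod (?k p) = 0" if p: "p \<in> Delta G P E'" for p
    proof -
      have pP: "p \<in> P" using p by (simp add: Delta_def)
      show ?thesis using z[OF pP decide[OF pP]] E(3)[rule_format, OF E' p] by simp
    qed
    then have "(\<lambda>p. cmod (?k p)) ` Delta G P E' \<subseteq> {0}" by (intro image_subsetI) simp
    then have "insert 0 ((\<lambda>p. cmod (?k p)) ` Delta G P E') = {0}" by (metis insert_absorb2 subset_singletonD)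
    then show ?thesis by (simp only: cSup_singleton)
  qed
  then have "\<forall>\<^sub>F E' in finite_subsets_at_top (carrier G). Sup (insert 0 ((\<lambda>p. cmod (?k p)) ` Delta G P E')) = 0"
    unfolding eventually_finite_subsets_at_top using E(1,2) by blast
  then have "?k \<in> D_r_o G P" unfolding D_r_o_def using spanD[OF ks] by (simp add: tendsto_eventually)
  then have "\<phi> ?k = \<zero>\<^bsub>A\<^esub>" using \<phi>(2) by blast
  moreover have "?k = b \<ominus>\<^bsub>D_r G P\<^esub> b'"
    using L.sub_minus(1)[OF D_r_sub, of b b' "\<one>\<^bsub>lP\<^esub>"] spanD[OF b] spanD[OF b's] by (simp add: D_r_simps)
  ultimately have "\<phi> b \<ominus>\<^bsub>A\<^esub> \<phi> b' = \<zero>\<^bsub>A\<^esub>" using DA.star_hom_minus[OF \<phi>(1) spanD[OF b] spanD[OF b's]] by simp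
  then have eq: "\<phi> b = \<phi> b'" using DA.star_homD(1)[OF \<phi>(1)] spanD b b's by (simp add: A.minus_eq_zero)
  have "nrm lP b' \<le> M"
  proof (rule calg.fam_nrm_le[OF calg_complex c(2) M])
    fix p assume p: "p \<in> P"
    show "nrm complex_cstar (b' p) \<le> M"
    proof (cases "good p")
      case True
      then obtain x q where q: "x \<in> X" "decides q x F" "same_type F p q" by (auto simp: good_def)
      then have "b p = b q" using type[OF p _ q(3)] by (simp add: decides_def)
      then show ?thesis using bM[OF q(1,2)] True p by (simp add: b'_def complex_cstar_def)
    qed (use p M in \<open>simp add: b'_def complex_cstar_def\<close>)
  qed
  then show ?thesis using DA.star_hom_bounded[OF \<phi>(1) spanD[OF b's]] unfolding eq by (simp add: D_r_simps)
qed

end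

section \<open>Extending a strongly covariant representation to the crossed product\<close>

context cov begin

interpretation R: crossed G P Red rg
  by (rule crossed_Red)

interpretation RA: calg_pair Red A
  by (intro calg_pair.intro R.A.calg_axioms A.calg_axioms)

text \<open>The degree \<open>g\<close> part of a relation between the regular representation and
  \<open>A\<close>. It is formed for one degree at a time because only there the reduced norm bounds
  the second component; the covariant representation need not factor through the reduced crossed
  product.\<close>

definition Yd :: "'g \<Rightarrow> (('g \<times> ('g set \<Rightarrow> bool)) op \<times> 'a) set" where
  "Yd g = {(rg g (cyl S), d g S) | S. S \<in> jd (inv g)}"

lemma Yd_carrier: "g \<in> carrier G \<Longrightarrow> Yd g \<subseteq> carrier RA.AB"
  using cyl_fib d_closed by (auto simp: Yd_def)

lemma Yd_mult:
  assumes g: "g \<in> carrier G" "h \<in> carrier G" and "y \<in> Yd g" "z \<in> Yd h"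
  shows "y \<otimes>\<^bsub>RA.AB\<^esub> z \<in> Yd (g \<otimes> h)"
proof -
  obtain S T where S: "S \<in> jd (inv g)" "T \<in> jd (inv h)" "y = (rg g (cyl S), d g S)" "z = (rg h (cyl T), d h T)"
    using assms(3,4) by (auto simp: Yd_def)
  have "{p \<in> S. inv g \<otimes> p \<in> T} \<in> jd (inv h \<otimes> inv g)" using jd_comp[OF S(1,2)] .
  then have "{p \<in> S. inv g \<otimes> p \<in> T} \<in> jd (inv (g \<otimes> h))" using g by (simp add: inv_mult_group)
  moreover have "y \<otimes>\<^bsub>RA.AB\<^esub> z = (rg (g \<otimes> h) (cyl {p \<in> S. inv g \<otimes> p \<in> T}), d (g \<otimes> h) {p \<in> S. inv g \<otimes> p \<in> T})"
    using R.t_mult[OF g S(1,2)] d_mult[OF g S(1,2)] by (simp add: S(3,4) R.t_def)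
  ultimately show ?thesis by (auto simp: Yd_def)
qed

lemma Yd_star:
  assumes g: "g \<in> carrier G" and "y \<in> Yd g"
  shows "star RA.AB y \<in> Yd (inv g)"
proof -
  obtain S where S: "S \<in> jd (inv g)" "y = (rg g (cyl S), d g S)" using assms(2) by (auto simp: Yd_def)
  have "inv g <# S \<in> jd (inv (inv g))" using jd_inv[OF S(1)] by simp
  moreover have "star RA.AB y = (rg (inv g) (cyl (inv g <# S)), d (inv g) (inv g <# S))"
    using R.t_star[OF g S(1)] d_star[OF g S(1)] by (simp add: S(2) R.t_def)
  ultimately show ?thesis by (auto simp: Yd_def)
qed

text \<open>The analogue of \<open>indt_span\<close>, with the element of \<open>A\<close> written
  as \<open>\<phi> b\<close>; the condition on types is the one that \<open>d_bound\<close> asks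
  for.\<close>

lemma Yd_span_one:
  assumes \<phi>: "star_hom (D_r G P) A \<phi>" "\<forall>\<alpha>. is_word P \<alpha> \<and> wdot G \<alpha> = \<one> \<longrightarrow> \<phi> (ind P (K G P \<alpha>)) = rep_dot A w \<alpha>"
    and y: "y \<in> lin_span RA.AB (Yd \<one>)"
  shows "\<exists>s\<in>simp_fun \<one>. fst y = rg \<one> s \<and> (\<exists>b\<in>lin_span lP (ind P ` J). snd y = \<phi> b \<and>
    (\<exists>F. finite F \<and> F \<subseteq> J \<and> (\<forall>x\<in>X. \<forall>p. decides p x F \<longrightarrow> b p = s x) \<and>
      (\<forall>p\<in>P. \<forall>q\<in>P. same_type F p q \<longrightarrow> b p = b q)))"
  using y
proof induct
  case zero
  interpret DA: calg_pair "D_r G P" A by (intro calg_pair.intro calg_D_r A.calg_axioms)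
  have "\<zero>\<^bsub>A\<^esub> = \<phi> \<zero>\<^bsub>lP\<^esub>" using DA.star_hom_zero[OF \<phi>(1)] by (simp add: D_r_simps)
  moreover have "\<zero>\<^bsub>lP\<^esub> p = 0" if "p \<in> P" for p using that by (simp add: families_simps complex_cstar_def)
  ultimately show ?case using R.u_zero[OF one_closed] simp_fun.zero[of \<one>] lin_span.zero[of lP "ind P ` J"]
    by (intro bexI[of _ "\<lambda>_. 0"] conjI bexI[of _ "\<zero>\<^bsub>lP\<^esub>"] exI[of _ "{}"]) (auto simp: decides_def)
next
  case (step x y c)
  interpret DA: calg_pair "D_r G P" A by (intro calg_pair.intro calg_D_r A.calg_axioms)
  have Y: "ind P ` J \<subseteq> carrier lP" using ind_carrier by auto
  from step(3) obtain s b F where s: "s \<in> simp_fun \<one>" "fst y = rg \<one> s" "b \<in> lin_span lP (ind P ` J)" "snd y = \<phi> b"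
    "finite F" "F \<subseteq> J" and bs: "\<forall>x\<in>X. \<forall>p. decides p x F \<longrightarrow> b p = s x"
    and bt: "\<forall>p\<in>P. \<forall>q\<in>P. same_type F p q \<longrightarrow> b p = b q" by (elim bexE exE conjE)
  obtain S where Sj: "S \<in> jd (inv \<one>)" and x: "x = (rg \<one> (cyl S), d \<one> S)" using step(1) by (auto simp: Yd_def)
  have SJ: "S \<in> J" by (rule jd_J[OF Sj])
  have dS: "d \<one> S = \<phi> (ind P S)"
  proof -
    obtain \<alpha> where a: "is_word P \<alpha>" "wdot G \<alpha> = \<one>" "K G P (rev \<alpha>) = S" "d \<one> S = rep_dot A w \<alpha>"
      using d_word[OF one_closed Sj] .
    have "K G P \<alpha> = S" using lcoset_K[OF a(1)] a lcos_mult_one[of "K G P \<alpha>"] K_sub_P[OF a(1)] P_sub by simp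
    then show ?thesis using \<phi>(2) a by auto
  qed
  let ?b = "c \<odot>\<^bsub>lP\<^esub> ind P S \<oplus>\<^bsub>lP\<^esub> b" and ?s = "\<lambda>z. c * cyl S z + s z"
  have bp: "?b p = c * of_bool (p \<in> S) + b p" if "p \<in> P" for p
    using that by (simp add: families_simps complex_cstar_def ind_def)
  have bc: "b \<in> carrier (D_r G P)"
    using calg.cl_subset[OF calg_lP, of "lin_span lP (ind P ` J)"] calg.lin_span_carrier[OF calg_lP Y] s(3) by (auto simp: D_r_simps)
  have 1: "?s \<in> simp_fun \<one>" using simp_fun.step[OF Sj s(1)] .
  have "rg \<one> ?s = c \<odot>\<^bsub>Red\<^esub> rg \<one> (cyl S) \<oplus>\<^bsub>Red\<^esub> rg \<one> s"
    using R.u_add[OF one_closed fib_smult[OF cyl_fib[OF Sj]] simp_fun_fib[OF s(1)], of c]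
      R.u_smult[OF one_closed cyl_fib[OF Sj], of c] by simp
  then have 2: "fst (c \<odot>\<^bsub>RA.AB\<^esub> x \<oplus>\<^bsub>RA.AB\<^esub> y) = rg \<one> ?s"
    using s(2) by (cases y) (simp add: x)
  have "\<phi> ?b = c \<odot>\<^bsub>A\<^esub> \<phi> (ind P S) \<oplus>\<^bsub>A\<^esub> \<phi> b"
    using DA.star_homD(3,6)[OF \<phi>(1)] D_r_mem[OF SJ] bc DA.A.smult_closed by (simp add: D_r_simps)
  then have 3: "snd (c \<odot>\<^bsub>RA.AB\<^esub> x \<oplus>\<^bsub>RA.AB\<^esub> y) = \<phi> ?b"
    using s(4) dS by (cases y) (simp add: x)
  have 4: "?b \<in> lin_span lP (ind P ` J)" using SJ s(3) by (intro lin_span.step) auto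
  have 5: "?b p = ?s z" if z: "z \<in> X" and p: "decides p z (insert S F)" for z p
  proof -
    have pP: "p \<in> P" using p by (simp add: decides_def)
    have "b p = s z" using bs z decides_mono[OF p subset_insertI] by blast
    moreover have "p \<in> S \<longleftrightarrow> z S"
    proof (cases "z S")
      case False
      then have "(p <# P) \<inter> S = {}" using p by (simp add: decides_def)
      then show ?thesis using pr_self[OF pP] False by blast
    qed (use p in \<open>simp add: decides_def\<close>)
    ultimately show ?thesis using z by (simp add: bp[OF pP] cyl_def)
  qed
  have 6: "?b p = ?b q" if "p \<in> P" "q \<in> P" "same_type (insert S F) p q" for p q
    using bt[rule_format, OF that(1,2)] that by (simp add: bp same_type_def)
  show ?case
    using 1 2 3 4 5 6 s(5,6) SJ
    by (intro bexI[of _ ?s] conjI bexI[of _ ?b] exI[of _ "insert S F"]) auto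
qed

text \<open>At deciding points the function on \<open>P\<close> takes its boundary values, which the
  reduced norm dominates by \<open>rg_lower\<close>; the factor 2 is that of
  \<open>d_bound\<close>.\<close>

lemma Yd_bound_one: "(a, b) \<in> lin_span RA.AB (Yd \<one>) \<Longrightarrow> nrm A b \<le> 2 * nrm Red a"
proof -
  assume ab: "(a, b) \<in> lin_span RA.AB (Yd \<one>)"
  obtain \<phi> where \<phi>: "star_hom (D_r G P) A \<phi>"
    "\<forall>\<alpha>. is_word P \<alpha> \<and> wdot G \<alpha> = \<one> \<longrightarrow> \<phi> (ind P (K G P \<alpha>)) = rep_dot A w \<alpha>"
    "\<forall>b\<in>D_r_o G P. \<phi> b = \<zero>\<^bsub>A\<^esub>"
    using sc unfolding strongly_covariant_def by (elim conjE exE)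
  from Yd_span_one[OF \<phi>(1,2) ab] obtain s b' F where s: "s \<in> simp_fun \<one>" "a = rg \<one> s"
    "b' \<in> lin_span lP (ind P ` J)" "b = \<phi> b'" "finite F" "F \<subseteq> J"
    and bs: "\<forall>x\<in>X. \<forall>p. decides p x F \<longrightarrow> b' p = s x"
    and bt: "\<forall>p\<in>P. \<forall>q\<in>P. same_type F p q \<longrightarrow> b' p = b' q" unfolding fst_conv snd_conv by (elim bexE exE conjE)
  have f: "s \<in> fib \<one>" by (rule simp_fun_fib[OF s(1)])
  show ?thesis unfolding s(2,4)
  proof (rule d_bound[OF s(5,6) _ s(3) bt[rule_format] _ \<phi>(1,3)])
    show "0 \<le> nrm Red (rg \<one> s)" using R.u_closed[OF one_closed f] by (rule R.A.nrm_nonneg)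
    fix x p assume x: "x \<in> X" and p: "decides p x F"
    have "b' p = s x" using bs x p by blast
    then show "cmod (b' p) \<le> nrm Red (rg \<one> s)" using rg_lower[OF one_closed f x] by simp
  qed
qed

text \<open>The adjoint of the pair times the pair has degree one, so the C*-identity reduces the
  claim to \<open>Yd_bound_one\<close>, and \<open>2 n^2 \<le> (2 n)^2\<close> keeps the
  constant.\<close>

lemma Yd_bound:
  assumes g: "g \<in> carrier G" and ab: "(a, b) \<in> lin_span RA.AB (Yd g)"
  shows "nrm A b \<le> 2 * nrm Red a"
proof -
  have gi: "inv g \<in> carrier G" using g by simp
  note Y = Yd_carrier[OF g] and Yi = Yd_carrier[OF gi] and Y1 = Yd_carrier[OF one_closed]
  have c: "a \<in> carrier Red" "b \<in> carrier A" using RA.AB.lin_span_carrier[OF Y ab] by auto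
  have st: "star RA.AB (a, b) \<in> lin_span RA.AB (Yd (inv g))"
    by (rule RA.AB.lin_span_star[OF Y Yi RA.AB.lin_span_base[OF Yi Yd_star[OF g]] ab])
  have m: "star RA.AB (a, b) \<otimes>\<^bsub>RA.AB\<^esub> (a, b) \<in> lin_span RA.AB (Yd \<one>)"
  proof (rule RA.AB.lin_span_mult_gen[OF Yi Y Y1 _ st ab])
    fix x y assume "x \<in> Yd (inv g)" "y \<in> Yd g"
    then show "x \<otimes>\<^bsub>RA.AB\<^esub> y \<in> lin_span RA.AB (Yd \<one>)"
      using Yd_mult[OF gi g] g RA.AB.lin_span_base[OF Y1] by simp
  qed
  have "(nrm A b)\<^sup>2 = nrm A (star A b \<otimes>\<^bsub>A\<^esub> b)" using A.cstar_identity[OF c(2)] by simp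
  also have "\<dots> \<le> 2 * nrm Red (star Red a \<otimes>\<^bsub>Red\<^esub> a)" by (rule Yd_bound_one) (use m in simp)
  also have "\<dots> = 2 * (nrm Red a)\<^sup>2" using R.A.cstar_identity[OF c(1)] by simp
  also have "\<dots> \<le> (2 * nrm Red a)\<^sup>2" by (simp add: power_mult_distrib)
  finally show ?thesis by (rule power2_le_imp_le) (use R.A.nrm_nonneg[OF c(1)] in simp)
qed

lemma rg_simp_fun: "g \<in> carrier G \<Longrightarrow> s \<in> simp_fun g \<Longrightarrow> rg g s \<in> lin_span Red (fst ` Yd g)"
proof (rotate_tac 1, induct s rule: simp_fun.induct)
  case zero
  then show ?case using R.u_zero lin_span.zero by metis
next
  case (step S s c)
  have "rg g (\<lambda>x. c * cyl S x + s x) = c \<odot>\<^bsub>Red\<^esub> rg g (cyl S) \<oplus>\<^bsub>Red\<^esub> rg g s"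
    using R.u_add[OF step(4) fib_smult[OF cyl_fib[OF step(1)]] simp_fun_fib[OF step(2)], of c]
      R.u_smult[OF step(4) cyl_fib[OF step(1)], of c] by simp
  moreover have "rg g (cyl S) \<in> fst ` Yd g" using step(1) by (force simp: Yd_def)
  ultimately show ?case using step by (auto intro: lin_span.step)
qed

definition \<Gamma> :: "'g \<Rightarrow> (('g \<times> ('g set \<Rightarrow> bool)) op \<times> 'a) set" where
  "\<Gamma> g = cl RA.AB (lin_span RA.AB (Yd g))"

lemma \<Gamma>_unique: "g \<in> carrier G \<Longrightarrow> (a, b) \<in> \<Gamma> g \<Longrightarrow> (a, b') \<in> \<Gamma> g \<Longrightarrow> b = b'"
  unfolding \<Gamma>_def by (rule RA.graph_unique[OF Yd_carrier, of g 2]) (use Yd_bound in auto)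

lemma \<Gamma>_total:
  assumes g: "g \<in> carrier G" and f: "f \<in> fib g"
  shows "\<exists>b. (rg g f, b) \<in> \<Gamma> g"
  unfolding \<Gamma>_def
proof (rule RA.graph_total[OF Yd_carrier[OF g], of 2])
  have "\<exists>y\<in>lin_span Red (fst ` Yd g). nrm Red (rg g f \<ominus>\<^bsub>Red\<^esub> y) < e" if e: "0 < e" for e
  proof -
    obtain s where s: "s \<in> simp_fun g" "\<And>x. x \<in> X \<Longrightarrow> cmod (f x - s x) < e / 2"
      using fib_approx[OF f half_gt_zero[OF e]] by blast
    have sf: "s \<in> fib g" by (rule simp_fun_fib[OF s(1)])
    have "nrm Red (rg g (\<lambda>x. f x - s x)) \<le> e / 2"
      by (rule R.u_bound[OF g fib_diff[OF f sf]]) (use e s(2) in \<open>auto intro: less_imp_le\<close>)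
    then have "nrm Red (rg g f \<ominus>\<^bsub>Red\<^esub> rg g s) < e" using R.u_diff[OF g f sf] e by simp
    then show ?thesis using rg_simp_fun[OF g s(1)] by blast
  qed
  then show "rg g f \<in> cl Red (lin_span Red (fst ` Yd g))" using R.u_closed[OF g f] by (simp add: cl_def)
qed (use Yd_bound[OF g] in auto)

definition crep :: "'g \<Rightarrow> (('g set \<Rightarrow> bool) \<Rightarrow> complex) \<Rightarrow> 'a" where
  "crep g f = (SOME b. (rg g f, b) \<in> \<Gamma> g)"

lemma crep: "g \<in> carrier G \<Longrightarrow> f \<in> fib g \<Longrightarrow> (rg g f, crep g f) \<in> \<Gamma> g"
  unfolding crep_def by (rule someI_ex[OF \<Gamma>_total])

lemma crep_eqI: "g \<in> carrier G \<Longrightarrow> f \<in> fib g \<Longrightarrow> (rg g f, b) \<in> \<Gamma> g \<Longrightarrow> crep g f = b"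
  using \<Gamma>_unique[OF _ crep] by blast

text \<open>The relations hold for the spanning pairs and pass to the closures
  \<open>\<Gamma> g\<close>. Each of these is single-valued, so the value of \<open>crep\<close> is
  identified by showing that the expected pair belongs to it.\<close>

theorem crossed_crep: "crossed G P A crep"
  and crep_cyl: "p \<in> P \<Longrightarrow> crep p (cyl (p <# P)) = w p"
proof -
  have s: "lin_span RA.AB (Yd g) \<subseteq> carrier RA.AB" if "g \<in> carrier G" for g
    using RA.AB.lin_span_carrier[OF Yd_carrier[OF that]] by blast
  have base: "(rg g (cyl S), d g S) \<in> \<Gamma> g" if "g \<in> carrier G" "S \<in> jd (inv g)" for g S
    using RA.AB.cl_subset[OF s[OF that(1)]] RA.AB.lin_span_base[OF Yd_carrier[OF that(1)]] that(2)
    unfolding \<Gamma>_def Yd_def by blast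
  show "crep p (cyl (p <# P)) = w p" if "p \<in> P"
    using crep_eqI[OF _ cyl_fib base, of p "p <# P"] that pr_jd[OF that] d_P by simp
  have c1: "crep g f \<in> carrier A" if "g \<in> carrier G" "f \<in> fib g" for g f
    using crep[OF that] RA.AB.cl_carrier by (auto simp: \<Gamma>_def)
  have c2: "crep g (\<lambda>x. f x + f' x) = crep g f \<oplus>\<^bsub>A\<^esub> crep g f'"
    if g: "g \<in> carrier G" and f: "f \<in> fib g" "f' \<in> fib g" for g f f'
    using RA.AB.cl_add[OF s[OF g] RA.AB.lin_span_add[OF Yd_carrier[OF g]], folded \<Gamma>_def, OF _ _ crep[OF g f(1)] crep[OF g f(2)]]
    by (intro crep_eqI g fib_add f) (simp add: R.u_add g f)
  have c3: "crep g (\<lambda>x. c * f x) = c \<odot>\<^bsub>A\<^esub> crep g f" if g: "g \<in> carrier G" and f: "f \<in> fib g" for g f c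
    using RA.AB.cl_smult[OF s[OF g] RA.AB.lin_span_smult[OF Yd_carrier[OF g]], folded \<Gamma>_def, OF _ crep[OF g f], of c]
    by (intro crep_eqI g fib_smult f) (simp add: R.u_smult g f)
  have c4: "crep (g \<otimes> h) (cpm g f f') = crep g f \<otimes>\<^bsub>A\<^esub> crep h f'"
    if g: "g \<in> carrier G" "h \<in> carrier G" and f: "f \<in> fib g" "f' \<in> fib h" for g h f f'
  proof (rule crep_eqI)
    have gh: "g \<otimes> h \<in> carrier G" using g by simp
    have "(rg g f, crep g f) \<otimes>\<^bsub>RA.AB\<^esub> (rg h f', crep h f') \<in> \<Gamma> (g \<otimes> h)"
      unfolding \<Gamma>_def
    proof (rule RA.AB.cl_mult_gen[OF s[OF g(1)] s[OF g(2)] _ crep[OF g(1) f(1), unfolded \<Gamma>_def] crep[OF g(2) f(2), unfolded \<Gamma>_def]])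
      fix x y assume xy: "x \<in> lin_span RA.AB (Yd g)" "y \<in> lin_span RA.AB (Yd h)"
      show "x \<otimes>\<^bsub>RA.AB\<^esub> y \<in> lin_span RA.AB (Yd (g \<otimes> h))"
        by (rule RA.AB.lin_span_mult_gen[OF Yd_carrier[OF g(1)] Yd_carrier[OF g(2)] Yd_carrier[OF gh] _ xy])
          (rule RA.AB.lin_span_base[OF Yd_carrier[OF gh] Yd_mult[OF g]])
    qed
    then show "(rg (g \<otimes> h) (cpm g f f'), crep g f \<otimes>\<^bsub>A\<^esub> crep h f') \<in> \<Gamma> (g \<otimes> h)"
      by (simp add: R.u_mult g f)
  qed (use g f fib_mult in auto)
  have c5: "crep (inv g) (cps g f) = star A (crep g f)" if g: "g \<in> carrier G" and f: "f \<in> fib g" for g f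
  proof (rule crep_eqI)
    have gi: "inv g \<in> carrier G" using g by simp
    have "star RA.AB (rg g f, crep g f) \<in> \<Gamma> (inv g)"
      unfolding \<Gamma>_def
      by (rule RA.AB.cl_star[OF s[OF g] RA.AB.lin_span_star[OF Yd_carrier[OF g] Yd_carrier[OF gi]
          RA.AB.lin_span_base[OF Yd_carrier[OF gi] Yd_star[OF g]]] crep[OF g f, unfolded \<Gamma>_def]])
    then show "(rg (inv g) (cps g f), star A (crep g f)) \<in> \<Gamma> (inv g)" by (simp add: R.u_star g f)
  qed (use g f fib_star in auto)
  have c6: "crep \<one> (\<lambda>x. of_bool (x \<in> X)) = \<one>\<^bsub>A\<^esub>"
  proof -
    have "cyl P = (\<lambda>x. of_bool (x \<in> X))" by (rule ext) (rule cyl_P)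
    then show ?thesis
      using crep_eqI[OF one_closed cyl_fib base[OF one_closed], of P] P_jd[OF P_one] d_one by simp
  qed
  have "cprel A crep"
    unfolding cprel_def by (intro conjI ballI allI c6) (rule c1 c2 c3 c4 c5; assumption)+
  then show "crossed G P A crep"
    by (intro crossed.intro crossed_axioms.intro group_submonoid_axioms A.calg_axioms)
qed

end

section \<open>The covariance algebra as a crossed product\<close>

context calg begin

lemma cstar_sub_sub_iff:
  assumes B: "cstar_sub A B" and T: "T \<subseteq> B"
  shows "cstar_sub (A\<lparr>carrier := B, one := u\<rparr>) T \<longleftrightarrow> cstar_sub A T"
proof -
  have "cl (A\<lparr>carrier := B, one := u\<rparr>) T = cl A T" by (rule cl_sub[OF B T])
  moreover have "B \<subseteq> carrier A" using B by (simp add: cstar_sub_def)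
  ultimately show ?thesis using T by (auto simp: cstar_sub_def)
qed

end

context calg_pair begin

lemma cstar_sub_preimage:
  assumes f: "star_hom A B f" and D: "cstar_sub B D"
  shows "cstar_sub A {a \<in> carrier A. f a \<in> D}" (is "cstar_sub A ?E")
proof -
  have "a \<in> ?E" if a: "a \<in> cl A ?E" for a
  proof -
    have "f a \<in> cl B (f ` ?E)" by (rule star_hom_cl[OF f _ a]) blast
    moreover have "cl B (f ` ?E) \<subseteq> cl B D" by (rule B.cl_mono) blast
    ultimately show ?thesis using a A.cl_carrier D by (auto simp: cstar_sub_def)
  qed
  then have "cl A ?E \<subseteq> ?E" by blast
  then show ?thesis
    using D star_hom_zero[OF f] unfolding cstar_sub_def by (simp add: star_homD[OF f])
qed

end

lemma star_hom_restrict: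
  assumes f: "star_hom A B f" and C: "cstar_sub A C" "\<one>\<^bsub>A\<^esub> \<in> C" and D: "\<And>x. x \<in> C \<Longrightarrow> f x \<in> D"
  shows "star_hom (A\<lparr>carrier := C\<rparr>) (B\<lparr>carrier := D\<rparr>) (restrict f C)"
proof -
  have m: "\<And>x. x \<in> C \<Longrightarrow> x \<in> carrier A"
    and c: "\<And>x y. x \<in> C \<Longrightarrow> y \<in> C \<Longrightarrow> x \<otimes>\<^bsub>A\<^esub> y \<in> C" "\<And>x y. x \<in> C \<Longrightarrow> y \<in> C \<Longrightarrow> x \<oplus>\<^bsub>A\<^esub> y \<in> C"
      "\<And>x. x \<in> C \<Longrightarrow> star A x \<in> C" "\<And>x z. x \<in> C \<Longrightarrow> z \<odot>\<^bsub>A\<^esub> x \<in> C"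
    using C(1) by (auto simp: cstar_sub_def)
  show ?thesis
    using f C(2) D m c unfolding star_hom_def ring_hom_def by (simp add: Pi_iff)
qed

locale crossed_gen = crossed +
  assumes gen: "carrier A \<subseteq> cl A (lin_span A (gens u))"
begin

lemma carrier_words: "carrier A = cl A (lin_span A words)"
  using gen cl_span_u A.cl_carrier[of "lin_span A words"] by blast

lemma carrier_sub:
  assumes T: "cstar_sub A T" and vT: "\<And>p. p \<in> P \<Longrightarrow> v p \<in> T"
  shows "carrier A \<subseteq> T"
proof -
  have one: "\<one>\<^bsub>A\<^esub> \<in> T" using vT[OF P_one] w_one by simp
  have "rep_dot A v \<alpha> \<in> T" if "is_word P \<alpha>" for \<alpha>
    using that by (induct \<alpha> rule: word_induct) (use T one vT in \<open>auto simp: cstar_sub_def\<close>)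
  then have "words \<subseteq> T" by (auto simp: words_def)
  then show ?thesis unfolding carrier_words by (rule A.cstar_sub_cl_lin_span_subset[OF T])
qed

end

context group_submonoid begin

lemma crossed_sub_gen:
  fixes B :: "'a cstar"
  assumes B: "calg B" and u: "cprel (B\<lparr>one := e\<rparr>) u"
  shows "crossed_gen G P (B\<lparr>carrier := cl B (lin_span B (gens u)), one := e\<rparr>) u"
proof -
  interpret B: calg B by (rule B)
  interpret C: crossed G P "B\<lparr>carrier := cl B (lin_span B (gens u)), one := e\<rparr>" u by (rule crossed_sub[OF assms])
  have U: "gens u \<subseteq> carrier B" using u unfolding cprel_def by auto
  have "gens u \<subseteq> cl B (lin_span B (gens u))" using C.u_closed by auto
  then have l: "lin_span B (gens u) \<subseteq> cl B (lin_span B (gens u))"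
    using B.cl_subset[of "lin_span B (gens u)"] B.lin_span_carrier[OF U] by blast
  show ?thesis
    by unfold_locales (simp add: B.lin_span_sub_eq B.cl_sub[OF crossed_sub(2)[OF assms] l])
qed

lemma crossed_gen_Red: "crossed_gen G P Red rg"
  using crossed_sub_gen[OF calg_ops rg_cprel] by (simp add: reduced_cp_def)

abbreviation "Full_prod \<equiv> bounded_families reps bounded_ops ::
  (('g \<Rightarrow> (('g set \<Rightarrow> bool) \<Rightarrow> complex) \<Rightarrow> ('g \<times> nat) op) \<Rightarrow> ('g \<times> nat) op) cstar"

lemma Full_eq: "Full = Full_prod\<lparr>carrier := carrier Full\<rparr>" "\<one>\<^bsub>Full\<^esub> = \<one>\<^bsub>Full_prod\<^esub>"
  by (simp_all add: full_cp_def Let_def)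

lemma Full_one_eq: "Full_prod\<lparr>carrier := carrier Full, one := \<one>\<^bsub>Full_prod\<^esub>\<rparr> = Full"
  by (simp add: full_cp_def Let_def)

lemma crossed_gen_Full: "crossed_gen G P Full fg"
proof -
  have e: "fg \<one> (\<lambda>x. of_bool (x \<in> X)) = \<one>\<^bsub>Full_prod\<^esub>"
    using fg_cprel unfolding cprel_def by (rule conjunct2)
  then show ?thesis
    using crossed_sub_gen[OF ops.calg_fam, of "\<one>\<^bsub>Full_prod\<^esub>" reps fg] fg_cprel
    by (simp add: full_cp_def Let_def)
qed

abbreviation "Cov \<equiv> covariance_algebra G P"
abbreviation "Cov_prod \<equiv> bounded_families (cov_reps G P) bounded_ops"
abbreviation "cg \<equiv> cov_gen G P"

lemma cg_carrier: "p \<in> P \<Longrightarrow> cg p \<in> carrier Cov_prod"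
proof (rule ops.fam_carrierI[of _ _ 1])
  fix w assume p: "p \<in> P" and w: "w \<in> cov_reps G P"
  interpret w: cov G P bounded_ops w
    by (intro cov.intro cov_axioms.intro group_submonoid_axioms calg_ops) (use w in \<open>simp add: cov_reps_def\<close>)
  show c: "cg p w \<in> carrier bounded_ops" using p w by (simp add: cov_gen_def)
  have e: "(nrm bounded_ops (w p))\<^sup>2 = nrm bounded_ops (\<one>\<^bsub>bounded_ops\<^esub> :: ('g \<times> nat) op)"
    by (rule ops.cstar_identity[OF w.w_closed[OF p], unfolded w.w_isometry[OF p], symmetric])
  have "(nrm bounded_ops (w p))\<^sup>2 \<le> 1\<^sup>2" unfolding e power_one by (rule ops.nrm_one_le)
  then have "nrm bounded_ops (w p) \<le> 1" by (rule power2_le_imp_le) simp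
  then show "nrm bounded_ops (cg p w) \<le> 1" using w by (simp add: cov_gen_def)
qed (simp add: cov_gen_def)

lemma Cov_sub: "cstar_sub Cov_prod (carrier Cov)"
  and Cov_eq: "Cov = Cov_prod\<lparr>carrier := carrier Cov\<rparr>" "\<one>\<^bsub>Cov\<^esub> = \<one>\<^bsub>Cov_prod\<^esub>"
  and cg_Cov: "p \<in> P \<Longrightarrow> cg p \<in> carrier Cov"
  and Cov_least: "cstar_sub Cov_prod T \<Longrightarrow> cg ` P \<subseteq> T \<Longrightarrow> carrier Cov \<subseteq> T"
proof -
  interpret B: calg Cov_prod by (rule ops.calg_fam)
  have Y: "cg ` P \<subseteq> carrier Cov_prod" using cg_carrier by blast
  show "cstar_sub Cov_prod (carrier Cov)" using B.cstar_gen_sub[OF Y] by (simp add: covariance_algebra_def Let_def)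
  show "Cov = Cov_prod\<lparr>carrier := carrier Cov\<rparr>" "\<one>\<^bsub>Cov\<^esub> = \<one>\<^bsub>Cov_prod\<^esub>" by (simp_all add: covariance_algebra_def Let_def)
  show "p \<in> P \<Longrightarrow> cg p \<in> carrier Cov" using B.cstar_gen_base[of "cg ` P"] by (auto simp: covariance_algebra_def Let_def)
  show "cstar_sub Cov_prod T \<Longrightarrow> cg ` P \<subseteq> T \<Longrightarrow> carrier Cov \<subseteq> T"
    using B.cstar_gen_least by (simp add: covariance_algebra_def Let_def)
qed

lemma cg_one: "cg \<one> = \<one>\<^bsub>Cov_prod\<^esub>"
  unfolding cov_gen_def families_simps
  by (rule restrict_ext) (simp add: cov_reps_def strongly_covariant_def isometric_rep_def)

lemma Cov_one_eq: "Cov_prod\<lparr>carrier := carrier Cov, one := \<one>\<^bsub>Cov_prod\<^esub>\<rparr> = Cov"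
  by (simp add: covariance_algebra_def Let_def)

lemma calg_Cov: "calg Cov"
proof -
  interpret B: calg Cov_prod by (rule ops.calg_fam)
  have "carrier Cov \<subseteq> carrier Cov_prod" using Cov_sub by (simp add: cstar_sub_def)
  then have "calg (Cov_prod\<lparr>carrier := carrier Cov, one := \<one>\<^bsub>Cov_prod\<^esub>\<rparr>)"
    using cg_Cov[OF P_one] cg_one by (intro B.calg_sub[OF Cov_sub]) auto
  then show ?thesis unfolding Cov_one_eq .
qed

abbreviation "isom \<rho> \<equiv> crossed.v G P \<rho>"

lemma isom_cov: "\<rho> \<in> reps \<Longrightarrow> isom \<rho> \<in> cov_reps G P"
  using crossed.strongly_covariant_v[OF crossed_rep] by (simp add: cov_reps_def)

lemma isom_apply:
  assumes "\<rho> \<in> reps" "p \<in> P"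
  shows "isom \<rho> p = \<rho> p (cyl (p <# P))"
proof -
  interpret c: crossed G P bounded_ops \<rho> by (rule crossed_rep[OF assms(1)])
  show ?thesis using assms(2) by (simp add: c.v_def c.t_def)
qed

text \<open>Each strongly covariant \<open>w\<close> extends to the representation
  \<open>crep\<close>, whose isometries are those of \<open>w\<close>. Together with
  \<open>isom_cov\<close> this makes \<open>isom\<close> a surjection between the index sets of the
  two direct sums.\<close>

lemma isom_onto:
  assumes "w \<in> cov_reps G P"
  shows "\<exists>\<rho>\<in>reps. isom \<rho> = w"
proof -
  interpret w: cov G P bounded_ops w
    by (intro cov.intro cov_axioms.intro group_submonoid_axioms calg_ops) (use assms in \<open>simp add: cov_reps_def\<close>)
  have r: "w.crep \<in> reps" using crossed.rel[OF w.crossed_crep] by (simp add: cp_rep_iff)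
  have "isom w.crep \<in> extensional P" using isom_cov[OF r] by (simp add: cov_reps_def strongly_covariant_def isometric_rep_def PiE_iff)
  then have "isom w.crep = w" by (rule extensionalityI[OF _ w.w_ext]) (simp add: isom_apply[OF r] w.crep_cyl)
  then show ?thesis using r by blast
qed

definition \<Phi>0 where
  "\<Phi>0 = (\<lambda>a\<in>carrier Cov_prod. \<lambda>\<rho>\<in>reps. a (isom \<rho>))"

text \<open>Reindexing along a chosen right inverse of \<open>isom\<close>, whereas
  \<open>\<Phi>0\<close> reindexes along \<open>isom\<close> itself; on the generated subalgebras
  the two are mutually inverse.\<close>

definition \<Psi>0 where
  "\<Psi>0 = (\<lambda>b\<in>carrier Full_prod. \<lambda>w\<in>cov_reps G P. b (SOME \<rho>. \<rho> \<in> reps \<and> isom \<rho> = w))"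

lemma lift_isom:
  assumes "w \<in> cov_reps G P"
  defines "\<rho> \<equiv> SOME \<rho>. \<rho> \<in> reps \<and> isom \<rho> = w"
  shows "\<rho> \<in> reps" "isom \<rho> = w"
  unfolding \<rho>_def using someI_ex[of "\<lambda>\<rho>. \<rho> \<in> reps \<and> isom \<rho> = w"] isom_onto[OF assms(1)] by blast+

end

lemma (in calg) star_hom_reindex:
  assumes h: "\<And>j. j \<in> J \<Longrightarrow> h j \<in> I"
  shows "star_hom (fam I) (fam J) (\<lambda>a\<in>carrier (fam I). \<lambda>j\<in>J. a (h j))"
proof -
  interpret I: calg "fam I" by (rule calg_fam)
  have c: "(\<lambda>j\<in>J. a (h j)) \<in> carrier (fam J)" if "a \<in> carrier (fam I)" for a
    by (rule fam_carrierI[of _ _ "nrm (fam I) a"]) (simp_all add: fam_carrier(1)[OF that h] fam_nrm_upper[OF that h])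
  show ?thesis
    unfolding star_hom_def ring_hom_def
    using h c I.one_closed I.m_closed I.a_closed I.star_closed I.smult_closed
    by (auto simp: families_simps(2-) intro!: restrict_ext)
qed

context group_submonoid begin

lemma star_hom_\<Phi>0: "star_hom Cov_prod Full_prod \<Phi>0"
  unfolding \<Phi>0_def by (rule ops.star_hom_reindex) (rule isom_cov)

lemma star_hom_\<Psi>0: "star_hom Full_prod Cov_prod \<Psi>0"
  unfolding \<Psi>0_def by (rule ops.star_hom_reindex) (rule lift_isom)

lemma fg_carrier: "g \<in> carrier G \<Longrightarrow> f \<in> fib g \<Longrightarrow> fg g f \<in> carrier Full_prod"
  using crossed.u_closed[OF crossed_Full] Full_sub by (auto simp: cstar_sub_def)

lemma \<Phi>0_cg: "p \<in> P \<Longrightarrow> \<Phi>0 (cg p) = fg p (cyl (p <# P))"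
  using cg_carrier isom_cov isom_apply by (auto simp: \<Phi>0_def cov_gen_def full_gen_def intro!: restrict_ext)

lemma \<Psi>0_fg: "p \<in> P \<Longrightarrow> \<Psi>0 (fg p (cyl (p <# P))) = cg p"
proof -
  assume p: "p \<in> P"
  have c: "fg p (cyl (p <# P)) \<in> carrier Full_prod" using p cyl_fib pr_jd by (intro fg_carrier) auto
  show ?thesis
    unfolding \<Psi>0_def cov_gen_def restrict_apply'[OF c]
  proof (rule restrict_ext)
    fix w assume w: "w \<in> cov_reps G P"
    show "fg p (cyl (p <# P)) (SOME \<rho>. \<rho> \<in> reps \<and> isom \<rho> = w) = w p"
      using isom_apply[OF lift_isom(1)[OF w] p] lift_isom[OF w] by (simp add: full_gen_def)
  qed
qed

lemma fam_pair: "calg_pair Cov_prod Full_prod" "calg_pair Full_prod Cov_prod" "calg_pair Full_prod Full_prod"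
  by (intro calg_pair.intro ops.calg_fam)+

lemma \<Phi>0_Full: "a \<in> carrier Cov \<Longrightarrow> \<Phi>0 a \<in> carrier Full"
proof -
  interpret F: crossed G P Full fg by (rule crossed_Full)
  have "carrier Cov \<subseteq> {a \<in> carrier Cov_prod. \<Phi>0 a \<in> carrier Full}"
    by (rule Cov_least[OF calg_pair.cstar_sub_preimage[OF fam_pair(1) star_hom_\<Phi>0 Full_sub]])
      (use cg_carrier \<Phi>0_cg F.u_closed cyl_fib pr_jd in auto)
  then show "a \<in> carrier Cov \<Longrightarrow> \<Phi>0 a \<in> carrier Full" by blast
qed

lemma Full_subset:
  assumes T: "cstar_sub Full_prod T" and vT: "\<And>p. p \<in> P \<Longrightarrow> fg p (cyl (p <# P)) \<in> T"
  shows "carrier Full \<subseteq> T"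
proof -
  interpret F: crossed_gen G P Full fg by (rule crossed_gen_Full)
  interpret B: calg Full_prod by (rule ops.calg_fam)
  have T': "T \<inter> carrier Full \<subseteq> carrier Full" by blast
  have "cl Full_prod (T \<inter> carrier Full) \<subseteq> cl Full_prod T \<inter> cl Full_prod (carrier Full)"
    using B.cl_mono by (meson Int_greatest inf_le1 inf_le2)
  then have "cstar_sub Full_prod (T \<inter> carrier Full)" using T Full_sub unfolding cstar_sub_def by blast
  then have "cstar_sub Full (T \<inter> carrier Full)"
    by (rule B.cstar_sub_sub_iff[OF Full_sub T', of "\<one>\<^bsub>Full_prod\<^esub>", unfolded Full_one_eq, THEN iffD2])
  then have "carrier Full \<subseteq> T \<inter> carrier Full"
  proof (rule F.carrier_sub)
    fix p assume "p \<in> P"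
    then show "F.v p \<in> T \<inter> carrier Full" using vT[of p] F.v_closed[of p] by (simp add: F.v_def F.t_def)
  qed
  then show ?thesis by blast
qed

lemma \<Psi>0_Cov: "b \<in> carrier Full \<Longrightarrow> \<Psi>0 b \<in> carrier Cov"
proof -
  have "carrier Full \<subseteq> {b \<in> carrier Full_prod. \<Psi>0 b \<in> carrier Cov}"
    by (rule Full_subset[OF calg_pair.cstar_sub_preimage[OF fam_pair(2) star_hom_\<Psi>0 Cov_sub]])
      (simp add: cg_Cov \<Psi>0_fg fg_carrier cyl_fib pr_jd)
  then show "b \<in> carrier Full \<Longrightarrow> \<Psi>0 b \<in> carrier Cov" by blast
qed

lemma \<Psi>0_\<Phi>0: "a \<in> carrier Cov_prod \<Longrightarrow> \<Psi>0 (\<Phi>0 a) = a"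
proof -
  assume a: "a \<in> carrier Cov_prod"
  have b: "\<Phi>0 a \<in> carrier Full_prod" by (rule calg_pair.star_homD(1)[OF fam_pair(1) star_hom_\<Phi>0 a])
  show ?thesis
  proof (rule ops.fam_eqI[OF calg_pair.star_homD(1)[OF fam_pair(2) star_hom_\<Psi>0 b] a])
    fix w assume w: "w \<in> cov_reps G P"
    show "\<Psi>0 (\<Phi>0 a) w = a w"
      unfolding \<Psi>0_def restrict_apply'[OF b] restrict_apply'[OF w]
      unfolding \<Phi>0_def restrict_apply'[OF a] restrict_apply'[OF lift_isom(1)[OF w]] lift_isom(2)[OF w] ..
  qed
qed

text \<open>The composite replaces each representation by the chosen one with the same isometries.
  It fixes the families of isometries, and these generate \<open>Full\<close>.\<close>

lemma \<Phi>0_\<Psi>0: "b \<in> carrier Full \<Longrightarrow> \<Phi>0 (\<Psi>0 b) = b"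
proof -
  interpret B: calg Full_prod by (rule ops.calg_fam)
  note \<Psi> = calg_pair.star_homD[OF fam_pair(2) star_hom_\<Psi>0]
    and \<Phi> = calg_pair.star_homD[OF fam_pair(1) star_hom_\<Phi>0]
  have 1: "star_hom Full_prod Full_prod (\<lambda>b\<in>carrier Full_prod. \<Phi>0 (\<Psi>0 b))"
    by (simp add: star_hom_def ring_hom_def \<Psi> \<Phi> Pi_iff)
  have 2: "star_hom Full_prod Full_prod (\<lambda>b\<in>carrier Full_prod. b)"
    by (simp add: star_hom_def ring_hom_def Pi_iff)
  have "carrier Full \<subseteq> {b \<in> carrier Full_prod. (\<lambda>b\<in>carrier Full_prod. \<Phi>0 (\<Psi>0 b)) b = (\<lambda>b\<in>carrier Full_prod. b) b}"
    by (rule Full_subset[OF calg_pair.cstar_sub_equalizer[OF fam_pair(3) 1 2]])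
      (simp add: fg_carrier cyl_fib pr_jd \<Psi>0_fg \<Phi>0_cg)
  then show "b \<in> carrier Full \<Longrightarrow> \<Phi>0 (\<Psi>0 b) = b" by auto
qed

text \<open>For uniqueness, another candidate agrees with this one on the generators
  \<open>cg p\<close>, hence on the closed subalgebra they generate.\<close>

theorem covariance_iso_eq: "covariance_iso G P = restrict \<Phi>0 (carrier Cov)"
  and star_iso_\<Phi>0: "star_iso Cov Full (restrict \<Phi>0 (carrier Cov))"
proof -
  interpret C: calg Cov_prod by (rule ops.calg_fam)
  interpret F: crossed G P Full fg by (rule crossed_Full)
  interpret CF: calg_pair Cov Full by (intro calg_pair.intro calg_Cov F.A.calg_axioms)
  have sub: "carrier Cov \<subseteq> carrier Cov_prod" "carrier Full \<subseteq> carrier Full_prod"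
    using Cov_sub Full_sub unfolding cstar_sub_def by blast+
  have "\<one>\<^bsub>Cov_prod\<^esub> \<in> carrier Cov" using cg_Cov[OF P_one] cg_one by simp
  from star_hom_restrict[OF star_hom_\<Phi>0 Cov_sub this \<Phi>0_Full]
  have h: "star_hom Cov Full (restrict \<Phi>0 (carrier Cov))"
    using Cov_eq(1)[symmetric] Full_eq(1)[symmetric] by simp
  have "bij_betw (restrict \<Phi>0 (carrier Cov)) (carrier Cov) (carrier Full)"
    by (rule bij_betw_byWitness[where f' = \<Psi>0])
      (use \<Psi>0_\<Phi>0 \<Phi>0_\<Psi>0 \<Phi>0_Full \<Psi>0_Cov sub in auto)
  with h show iso: "star_iso Cov Full (restrict \<Phi>0 (carrier Cov))" by (simp add: star_iso_def)
  have cyl: "(\<lambda>\<omega>. of_bool (\<omega> \<in> X \<and> \<omega> (p <# P))) = cyl (p <# P)" for p by (auto simp: cyl_def)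
  have g: "restrict \<Phi>0 (carrier Cov) (cg p) = fg p (cyl (p <# P))" if "p \<in> P" for p
    using that by (simp add: cg_Cov \<Phi>0_cg)
  show "covariance_iso G P = restrict \<Phi>0 (carrier Cov)"
    unfolding covariance_iso_def full_boundary_cp_def cyl
  proof (rule the_equality)
    show "star_iso Cov Full (restrict \<Phi>0 (carrier Cov)) \<and>
      (\<forall>p\<in>P. restrict \<Phi>0 (carrier Cov) (cg p) = fg p (cyl (p <# P)))" using iso g by simp
    fix f assume f: "star_iso Cov Full f \<and> (\<forall>p\<in>P. f (cg p) = fg p (cyl (p <# P)))"
    then have fh: "star_hom Cov Full f" by (simp add: star_iso_def)
    let ?E = "{a \<in> carrier Cov. f a = restrict \<Phi>0 (carrier Cov) a}"
    have "?E \<subseteq> carrier Cov" by blast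
    then have "cstar_sub Cov_prod ?E"
      by (rule C.cstar_sub_sub_iff[OF Cov_sub, of _ "\<one>\<^bsub>Cov_prod\<^esub>", unfolded Cov_one_eq, THEN iffD1])
        (rule CF.cstar_sub_equalizer[OF fh h])
    then have "carrier Cov \<subseteq> ?E" by (rule Cov_least) (use f g cg_Cov in auto)
    then show "f = restrict \<Phi>0 (carrier Cov)" by (intro CF.star_hom_eqI[OF fh h]) blast
  qed
qed

end

section \<open>From the full to the reduced crossed product\<close>

text \<open>Relabelling the coordinates of \<open>\<xi>\<close> with second component
  \<open>x\<close> gives a vector for each \<open>x\<close>. The pieces use disjoint sets of
  coordinates, so their squared norms add up to at most that of \<open>\<xi>\<close>.\<close>

lemma slice:
  fixes \<xi> :: "('b \<times> 'c) ell2" and m :: "'c \<Rightarrow> 'a \<Rightarrow> 'b"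
  assumes inj: "\<And>x. x \<in> X' \<Longrightarrow> inj_on (m x) {i. D x i}" and X': "finite X'"
  defines "z \<equiv> \<lambda>x i. if D x i then coord \<xi> (m x i, x) else 0"
  shows "x \<in> X' \<Longrightarrow> coord (Abs_ell2 (z x)) = z x"
    and "(\<Sum>x\<in>X'. (norm (Abs_ell2 (z x)))\<^sup>2) \<le> (norm \<xi>)\<^sup>2"
proof -
  have bd: "(\<Sum>x\<in>S. \<Sum>i\<in>I. (cmod (z x i))\<^sup>2) \<le> (norm \<xi>)\<^sup>2" if I: "finite I" and S: "S \<subseteq> X'" for I S
  proof -
    have fS: "finite S" using S X' by (rule finite_subset)
    let ?T = "{(x, i) \<in> S \<times> I. D x i}"
    have fT: "finite ?T" by (rule finite_subset[of _ "S \<times> I"]) (use fS I in auto)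
    have injT: "inj_on (\<lambda>(x, i). (m x i, x)) ?T" using inj S by (auto simp: inj_on_def)
    have "(\<Sum>x\<in>S. \<Sum>i\<in>I. (cmod (z x i))\<^sup>2) = (\<Sum>(x, i)\<in>S \<times> I. (cmod (z x i))\<^sup>2)" by (rule sum.cartesian_product)
    also have "\<dots> = (\<Sum>(x, i)\<in>?T. (cmod (coord \<xi> (m x i, x)))\<^sup>2)"
      by (rule sum.mono_neutral_cong_right) (use fS I in \<open>auto simp: z_def split: if_split_asm\<close>)
    also have "\<dots> = (\<Sum>y\<in>(\<lambda>(x, i). (m x i, x)) ` ?T. (cmod (coord \<xi> y))\<^sup>2)"
      by (subst sum.reindex[OF injT]) (simp add: case_prod_unfold)
    also have "\<dots> \<le> (norm \<xi>)\<^sup>2" by (rule sum_coord_le) (use fT in simp)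
    finally show ?thesis .
  qed
  have bd1: "(\<Sum>i\<in>I. (cmod (z x i))\<^sup>2) \<le> (norm \<xi>)\<^sup>2" if "finite I" "x \<in> X'" for I x
    using bd[OF that(1), of "{x}"] that(2) by simp
  have c: "coord (Abs_ell2 (z x)) = z x" if x: "x \<in> X'" for x
    by (rule coord_Abs_bounded[OF bd1[OF _ x]]) simp_all
  then show "x \<in> X' \<Longrightarrow> coord (Abs_ell2 (z x)) = z x" .
  have "((\<lambda>I. \<Sum>x\<in>X'. \<Sum>i\<in>I. (cmod (z x i))\<^sup>2) \<longlongrightarrow> (\<Sum>x\<in>X'. (norm (Abs_ell2 (z x)))\<^sup>2)) (finite_subsets_at_top UNIV)"
  proof (rule tendsto_sum)
    fix x assume x: "x \<in> X'"
    show "((\<lambda>I. \<Sum>i\<in>I. (cmod (z x i))\<^sup>2) \<longlongrightarrow> (norm (Abs_ell2 (z x)))\<^sup>2) (finite_subsets_at_top UNIV)"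
      using infsum_tendsto[OF summable_coord[of "Abs_ell2 (z x)"]] unfolding norm_sq_infsum c[OF x] .
  qed
  then show "(\<Sum>x\<in>X'. (norm (Abs_ell2 (z x)))\<^sup>2) \<le> (norm \<xi>)\<^sup>2"
    by (rule tendsto_upperbound) (auto simp: bd intro: eventually_finite_subsets_at_top_weakI)
qed

lemma (in pact) reps_prep:
  assumes "Y = UNIV"
  shows "cprel bounded_ops (prep Y \<kappa> a)"
proof -
  have o1: "(\<lambda>x. of_bool (x \<in> X)) \<in> fib \<one>" using simp_fun_fib[OF simp_fun_one] .
  have "prep Y \<kappa> a \<one> (\<lambda>x. of_bool (x \<in> X)) = \<one>\<^bsub>bounded_ops\<^esub>"
  proof (rule ops_eqI[OF prep_carrier[OF one_closed o1] ops.one_closed])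
    fix j :: 'i
    have j: "j \<in> Y" "\<kappa> j \<in> X" using kX[of j] assms by auto
    then show "app (prep Y \<kappa> a \<one> (\<lambda>x. of_bool (x \<in> X))) (ket j) = app \<one>\<^bsub>bounded_ops\<^esub> (ket j)"
      using X_bd_one[OF j(2)] act_one[OF j(2)] a_one[OF j(1)] by (simp add: prep_ket[OF one_closed o1] ops_simps)
  qed
  then show ?thesis using cprel_prep by (simp add: bounded_ops_def)
qed

text \<open>Since \<open>Y\<close> injects into \<open>'g\<close>, the product of \<open>Y\<close>
  with \<open>'g \<times> nat\<close> has the cardinality of \<open>'g \<times> nat\<close>. So a
  multiple of the representation on \<open>Y\<close> acts on the prescribed Hilbert space, with all
  basis vectors in use and hence unitally.\<close>

lemma (in pact) amplify:
  fixes e :: "'i \<Rightarrow> 'g"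
  assumes ne: "Y \<noteq> {}" and e: "inj_on e Y"
  shows "\<exists>\<beta> :: 'g \<times> nat \<Rightarrow> 'i \<times> ('g \<times> nat). bij_betw \<beta> UNIV (Y \<times> UNIV) \<and>
    pact G P UNIV (\<lambda>i. \<kappa> (fst (\<beta> i))) (\<lambda>g i. inv_into UNIV \<beta> (a g (fst (\<beta> i)), snd (\<beta> i)))"
proof -
  include cardinal_syntax
  have inf: "infinite (UNIV :: ('g \<times> nat) set)" by (simp add: finite_prod)
  have "|Y| \<le>o |UNIV :: 'g set|" using e by (intro card_of_ordLeqI) auto
  also have "|UNIV :: 'g set| \<le>o |UNIV :: ('g \<times> nat) set|" by (rule card_of_ordLeqI[of "\<lambda>g. (g, 0)"]) (auto simp: inj_on_def)
  finally have "|Y \<times> (UNIV :: ('g \<times> nat) set)| =o |UNIV :: ('g \<times> nat) set|"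
    using card_of_Times_infinite[OF inf ne] by blast
  then obtain \<beta>' where "bij_betw \<beta>' (Y \<times> (UNIV :: ('g \<times> nat) set)) (UNIV :: ('g \<times> nat) set)"
    using card_of_ordIso by blast
  then obtain \<beta> where \<beta>: "bij_betw \<beta> (UNIV :: ('g \<times> nat) set) (Y \<times> (UNIV :: ('g \<times> nat) set))"
    using bij_betw_inv by blast
  have bY: "fst (\<beta> i) \<in> Y" for i using bij_betwE[OF \<beta>, rule_format, of i] by (cases "\<beta> i") auto
  have b1: "inv_into UNIV \<beta> (\<beta> i) = i" for i using \<beta> by (simp add: bij_betw_def)
  have b2: "\<beta> (inv_into UNIV \<beta> (y, n)) = (y, n)" if "y \<in> Y" for y n
    using \<beta> that by (intro f_inv_into_f) (simp add: bij_betw_def)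
  have "pact G P UNIV (\<lambda>i. \<kappa> (fst (\<beta> i))) (\<lambda>g i. inv_into UNIV \<beta> (a g (fst (\<beta> i)), snd (\<beta> i)))"
    by unfold_locales (simp_all add: kX bY b1 b2 aY ka a_one a_comp)
  then show ?thesis using \<beta> by blast
qed

section \<open>Slices of the regular representation\<close>

context group_submonoid begin

interpretation reg: pact G P "{(k, x). k \<in> carrier G \<and> x \<in> bd k}" "\<lambda>(k, x). act k x" "\<lambda>g (k, x). (g \<otimes> k, x)"
  by (rule pact_reg)

text \<open>The summand of the regular representation over the single point \<open>x\<close>; its
  indices are group elements, so \<open>amplify\<close> applies.\<close>

lemma pact_point: "pact G P {k \<in> carrier G. x \<in> bd k} (\<lambda>k. act k x) (\<otimes>)"
  by unfold_locales (use act_X act_comp jd_carrier in \<open>auto simp: m_assoc bd_iff[of _ g for g]\<close>)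

definition "point_bij x = (SOME \<beta> :: 'g \<times> nat \<Rightarrow> 'g \<times> ('g \<times> nat).
  bij_betw \<beta> UNIV ({k \<in> carrier G. x \<in> bd k} \<times> UNIV) \<and>
  pact G P UNIV (\<lambda>i. act (fst (\<beta> i)) x) (\<lambda>g i. inv_into UNIV \<beta> (g \<otimes> fst (\<beta> i), snd (\<beta> i))))"

definition "point_rep x = prep UNIV (\<lambda>i. act (fst (point_bij x i)) x)
  (\<lambda>g i. inv_into UNIV (point_bij x) (g \<otimes> fst (point_bij x i), snd (point_bij x i)))"

definition "point_slice x n \<xi> = Abs_ell2 (\<lambda>i. if snd (point_bij x i) = n then coord \<xi> (fst (point_bij x i), x) else 0)"

lemma point_bij:
  assumes "x \<in> X"
  shows "bij_betw (point_bij x) UNIV ({k \<in> carrier G. x \<in> bd k} \<times> UNIV)"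
    and "pact G P UNIV (\<lambda>i. act (fst (point_bij x i)) x)
      (\<lambda>g i. inv_into UNIV (point_bij x) (g \<otimes> fst (point_bij x i), snd (point_bij x i)))"
proof -
  have "{k \<in> carrier G. x \<in> bd k} \<noteq> {}" using X_bd_one[OF assms] by auto
  from someI_ex[OF pact.amplify[OF pact_point this inj_on_id]]
  show "bij_betw (point_bij x) UNIV ({k \<in> carrier G. x \<in> bd k} \<times> UNIV)"
    "pact G P UNIV (\<lambda>i. act (fst (point_bij x i)) x)
      (\<lambda>g i. inv_into UNIV (point_bij x) (g \<otimes> fst (point_bij x i), snd (point_bij x i)))"
    by (simp_all add: point_bij_def)
qed

lemma point_bij_inj:
  assumes x: "x \<in> X"
  shows "inj_on (\<lambda>i. fst (point_bij x i)) {i. snd (point_bij x i) = n}"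
proof (rule inj_onI)
  fix i j assume "i \<in> {i. snd (point_bij x i) = n}" "j \<in> {i. snd (point_bij x i) = n}"
    "fst (point_bij x i) = fst (point_bij x j)"
  then have "point_bij x i = point_bij x j" by (simp add: prod_eq_iff)
  then show "i = j" using point_bij(1)[OF x] by (auto simp: bij_betw_def dest: injD)
qed

lemma point_rep: "x \<in> X \<Longrightarrow> point_rep x \<in> reps"
  using pact.reps_prep[OF point_bij(2)] by (simp add: cp_rep_iff point_rep_def)

abbreviation "fr_gens \<equiv> {(fg g f, rg g f) | g f. g \<in> carrier G \<and> f \<in> fib g}"

interpretation FR: calg_pair Full_prod "bounded_ops :: ('g \<times> ('g set \<Rightarrow> bool)) op cstar"
  by (intro calg_pair.intro ops.calg_fam calg_ops)

lemma rg_carrier: "g \<in> carrier G \<Longrightarrow> f \<in> fib g \<Longrightarrow> rg g f \<in> carrier bounded_ops"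
  using rg_cprel unfolding cprel_def by simp

lemma fr_gens_carrier: "fr_gens \<subseteq> carrier FR.AB"
  using fg_carrier rg_carrier by auto

text \<open>The restriction of the regular representation to the slice at \<open>x\<close> is contained in \<open>point_rep x\<close>,
  where the auxiliary index \<open>n\<close> selects one of the copies made by the amplification.\<close>

lemma fr_slice:
  assumes y: "y \<in> lin_span FR.AB fr_gens" and x: "x \<in> X"
  shows "snd (point_bij x i) = n \<Longrightarrow>
      coord (app (fst y (point_rep x)) (point_slice x n \<xi>)) i = coord (app (snd y) \<xi>) (fst (point_bij x i), x)"
    and "\<not> (k \<in> carrier G \<and> x' \<in> bd k) \<Longrightarrow> coord (app (snd y) \<xi>) (k, x') = 0"
proof -
  let ?\<beta> = "point_bij x"
  interpret p: pact G P UNIV "\<lambda>i. act (fst (?\<beta> i)) x" "\<lambda>g i. inv_into UNIV ?\<beta> (g \<otimes> fst (?\<beta> i), snd (?\<beta> i))"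
    by (rule point_bij(2)[OF x])
  note \<beta> = point_bij(1)[OF x]
  have bY: "fst (?\<beta> i) \<in> carrier G \<and> x \<in> bd (fst (?\<beta> i))" for i
    using bij_betwE[OF \<beta>, rule_format, of i] by (cases "?\<beta> i") auto
  have cs: "coord (point_slice x n \<xi>) = (\<lambda>i. if snd (?\<beta> i) = n then coord \<xi> (fst (?\<beta> i), x) else 0)"
    unfolding point_slice_def
    by (rule slice(1)[of "{x}" "\<lambda>x i. fst (point_bij x i)" "\<lambda>x i. snd (point_bij x i) = n"]) (use point_bij_inj[OF x] in simp_all)
  have base: "coord (app (point_rep x g f) (point_slice x n \<xi>)) i = coord (app (rg g f) \<xi>) (fst (?\<beta> i), x)"
    if g: "g \<in> carrier G" and f: "f \<in> fib g" and i: "snd (?\<beta> i) = n" for g f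
  proof -
    have "?\<beta> (inv_into UNIV ?\<beta> (inv g \<otimes> fst (?\<beta> i), n)) = (inv g \<otimes> fst (?\<beta> i), n)"
      if "act (fst (?\<beta> i)) x \<in> bd (inv g)"
    proof (rule f_inv_into_f)
      have "x \<in> bd (inv g \<otimes> fst (?\<beta> i))" using act_comp(1)[of x "fst (?\<beta> i)" "inv g"] bY[of i] that by simp
      then show "(inv g \<otimes> fst (?\<beta> i), n) \<in> range ?\<beta>" using \<beta> bY[of i] g by (simp add: bij_betw_def)
    qed
    then show ?thesis
      unfolding point_rep_def p.coord_prep(1)[OF g f] rg_prep[OF g] reg.coord_prep(1)[OF g f] cs
      using bY[of i] i by simp
  qed
  have r: "point_rep x \<in> reps" by (rule point_rep[OF x])
  show "coord (app (fst y (point_rep x)) (point_slice x n \<xi>)) i = coord (app (snd y) \<xi>) (fst (?\<beta> i), x)"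
    if i: "snd (?\<beta> i) = n"
    using y
  proof induct
    case zero
    then show ?case using r by (simp add: families_simps ops_simps)
  next
    case (step z y c)
    obtain g f where z: "z = (fg g f, rg g f)" "g \<in> carrier G" "f \<in> fib g" using step(1) by blast
    then show ?case using step(3) base[OF z(2,3) i] r
      by (cases y) (simp add: families_simps ops_simps smult_ops full_gen_def blinfun.add_left)
  qed
  show "coord (app (snd y) \<xi>) (k, x') = 0" if "\<not> (k \<in> carrier G \<and> x' \<in> bd k)"
    using y
  proof induct
    case zero
    then show ?case by (simp add: ops_simps)
  next
    case (step z y c)
    obtain g f where z: "z = (fg g f, rg g f)" "g \<in> carrier G" "f \<in> fib g" using step(1) by blast
    have "coord (app (rg g f) \<xi>) (k, x') = 0" using that by (auto simp: rg_prep z(2) reg.coord_prep(1)[OF z(2,3)])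
    then show ?case using step(3) by (cases y) (simp add: z(1) ops_simps smult_ops blinfun.add_left)
  qed
qed

text \<open>Split the coordinates of the image of \<open>\<xi>\<close> under \<open>b\<close>
  according to the point \<open>x\<close>. By \<open>fr_slice\<close> each part is read off from
  \<open>a (point_rep x)\<close> applied to the slice of \<open>\<xi>\<close>, hence bounded by the
  full norm; the squared norms of the slices of \<open>\<xi>\<close> are summed by
  \<open>slice\<close>.\<close>

lemma fr_bound:
  assumes ab: "(a, b) \<in> lin_span FR.AB fr_gens"
  shows "nrm bounded_ops b \<le> 1 * nrm Full_prod a"
proof -
  have c: "a \<in> carrier Full_prod" using FR.AB.lin_span_carrier[OF fr_gens_carrier ab] by simp
  have a0: "0 \<le> nrm Full_prod a" by (rule ops.fam_nrm_nonneg[OF c])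
  have "norm (app b \<xi>) \<le> nrm Full_prod a * norm \<xi>" for \<xi>
  proof -
    \<comment> \<open>Any copy made by the amplification serves; one is fixed arbitrarily.\<close>
    obtain n :: "'g \<times> nat" where True by blast
    have "(\<Sum>z\<in>F. (cmod (coord (app b \<xi>) z))\<^sup>2) \<le> (nrm Full_prod a * norm \<xi>)\<^sup>2" if F: "finite F" for F
    proof -
      let ?F = "{z \<in> F. fst z \<in> carrier G \<and> snd z \<in> bd (fst z)}"
      let ?X = "snd ` ?F" and ?\<zeta> = "\<lambda>x. point_slice x n \<xi>"
      have XX: "x \<in> X" if "x \<in> ?X" for x using that bd_X by auto
      have fX: "finite ?X" using F by simp
      have z0: "coord (app b \<xi>) z = 0" if "z \<in> F - ?F" for z
        using fr_slice(2)[OF ab, of _ "fst z" "snd z"] that X_exists[OF P_one] by auto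
      have "(\<Sum>z\<in>F. (cmod (coord (app b \<xi>) z))\<^sup>2) = (\<Sum>z\<in>?F. (cmod (coord (app b \<xi>) z))\<^sup>2)"
        by (rule sum.mono_neutral_right) (use F z0 in auto)
      also have "\<dots> = (\<Sum>x\<in>?X. \<Sum>z\<in>{z \<in> ?F. snd z = x}. (cmod (coord (app b \<xi>) z))\<^sup>2)"
        by (rule sum.image_gen) (use F in simp)
      also have "\<dots> \<le> (\<Sum>x\<in>?X. (nrm Full_prod a)\<^sup>2 * (norm (?\<zeta> x))\<^sup>2)"
      proof (rule sum_mono)
        fix x assume "x \<in> ?X"
        then have x: "x \<in> X" by (rule XX)
        let ?\<beta> = "point_bij x"
        let ?i = "\<lambda>z. inv_into UNIV ?\<beta> (fst z, n)"
        note \<beta> = point_bij(1)[OF x]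
        have \<beta>i: "?\<beta> (?i z) = (fst z, n)" if "z \<in> ?F" "snd z = x" for z
          using \<beta> that by (intro f_inv_into_f) (auto simp: bij_betw_def)
        have inj: "inj_on ?i {z \<in> ?F. snd z = x}"
        proof (rule inj_onI)
          fix z z' assume z: "z \<in> {z \<in> ?F. snd z = x}" "z' \<in> {z \<in> ?F. snd z = x}" and e: "?i z = ?i z'"
          then have 1: "?\<beta> (?i z) = (fst z, n)" and 2: "?\<beta> (?i z') = (fst z', n)" using \<beta>i by blast+
          have "(fst z, n) = (fst z', n)" by (rule trans[OF 1[symmetric] trans[OF arg_cong[OF e, of ?\<beta>] 2]])
          then have "fst z = fst z'" by (rule Pair_inject)
          then show "z = z'" using z by (simp add: prod_eq_iff)
        qed
        have r: "point_rep x \<in> reps" by (rule point_rep[OF x])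
        have "(\<Sum>z\<in>{z \<in> ?F. snd z = x}. (cmod (coord (app b \<xi>) z))\<^sup>2) =
          (\<Sum>z\<in>{z \<in> ?F. snd z = x}. (cmod (coord (app (a (point_rep x)) (?\<zeta> x)) (?i z)))\<^sup>2)"
        proof (rule sum.cong[OF refl])
          fix z assume z: "z \<in> {z \<in> ?F. snd z = x}"
          then have "?\<beta> (?i z) = (fst z, n)" using \<beta>i by blast
          then show "(cmod (coord (app b \<xi>) z))\<^sup>2 = (cmod (coord (app (a (point_rep x)) (?\<zeta> x)) (?i z)))\<^sup>2"
            using fr_slice(1)[OF ab x, of "?i z" n \<xi>] z by auto
        qed
        also have "\<dots> = (\<Sum>i\<in>?i ` {z \<in> ?F. snd z = x}. (cmod (coord (app (a (point_rep x)) (?\<zeta> x)) i))\<^sup>2)"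
          by (subst sum.reindex[OF inj]) simp
        also have "\<dots> \<le> (norm (app (a (point_rep x)) (?\<zeta> x)))\<^sup>2" by (rule sum_coord_le) (use F in simp)
        also have "\<dots> \<le> (norm (a (point_rep x)) * norm (?\<zeta> x))\<^sup>2" by (rule power_mono[OF norm_blinfun]) simp
        also have "\<dots> \<le> (nrm Full_prod a * norm (?\<zeta> x))\<^sup>2"
          by (intro power_mono mult_right_mono) (use ops.fam_nrm_upper[OF c r] in \<open>simp_all add: ops_simps\<close>)
        finally show "(\<Sum>z\<in>{z \<in> ?F. snd z = x}. (cmod (coord (app b \<xi>) z))\<^sup>2) \<le> (nrm Full_prod a)\<^sup>2 * (norm (?\<zeta> x))\<^sup>2"
          by (simp add: power_mult_distrib)
      qed
      also have "\<dots> = (nrm Full_prod a)\<^sup>2 * (\<Sum>x\<in>?X. (norm (?\<zeta> x))\<^sup>2)" by (simp add: sum_distrib_left)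
      also have "\<dots> \<le> (nrm Full_prod a)\<^sup>2 * (norm \<xi>)\<^sup>2"
      proof (rule mult_left_mono)
        show "(\<Sum>x\<in>?X. (norm (?\<zeta> x))\<^sup>2) \<le> (norm \<xi>)\<^sup>2"
          unfolding point_slice_def
        proof (rule slice(2)[OF _ fX])
          fix x assume "x \<in> ?X"
          then show "inj_on (\<lambda>i. fst (point_bij x i)) {i. snd (point_bij x i) = n}"
            by (intro point_bij_inj XX)
        qed
      qed simp
      finally show ?thesis by (simp add: power_mult_distrib)
    qed
    then have "norm (Abs_ell2 (coord (app b \<xi>))) \<le> nrm Full_prod a * norm \<xi>"
      by (rule norm_Abs_ell2_le) (assumption, rule mult_nonneg_nonneg[OF a0 norm_ge_zero])
    then show ?thesis by (simp add: coord_inverse)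
  qed
  then have "norm b \<le> nrm Full_prod a" using a0 by (intro norm_blinfun_bound) auto
  then show ?thesis by (simp add: ops_simps)
qed

abbreviation "\<Lambda>0 \<equiv> full_to_reduced G X bd act ::
  (('g \<Rightarrow> (('g set \<Rightarrow> bool) \<Rightarrow> complex) \<Rightarrow> ('g \<times> nat) op) \<Rightarrow> ('g \<times> nat) op) \<Rightarrow> ('g \<times> ('g set \<Rightarrow> bool)) op"

text \<open>Existence comes from the bounded relation between the two families of generators,
  uniqueness from the fact that the isometries generate \<open>Full\<close>.\<close>

theorem star_hom_full_to_reduced: "star_hom Full Red \<Lambda>0"
  and full_to_reduced_gen: "g \<in> carrier G \<Longrightarrow> f \<in> fib g \<Longrightarrow> \<Lambda>0 (fg g f) = rg g f"
proof -
  interpret F: crossed_gen G P Full fg by (rule crossed_gen_Full)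
  interpret R: crossed_gen G P Red rg by (rule crossed_gen_Red)
  interpret C: calg_pair Full Red by (intro calg_pair.intro F.A.calg_axioms R.A.calg_axioms)
  let ?o = "\<lambda>x. of_bool (x \<in> X)"
  have o1: "?o \<in> fib \<one>" using simp_fun_fib[OF simp_fun_one] .
  have fst: "fst ` fr_gens = gens fg" and snd: "snd ` fr_gens = gens rg" by force+
  have ex: "\<exists>\<phi>. star_hom (Full_prod\<lparr>carrier := cl Full_prod (lin_span Full_prod (fst ` fr_gens)), one := fg \<one> ?o\<rparr>)
      (bounded_ops\<lparr>carrier := carrier Red, one := rg \<one> ?o\<rparr>) \<phi> \<and> (\<forall>a b. (a, b) \<in> fr_gens \<longrightarrow> \<phi> a = b) \<and>
      (\<forall>b\<in>cl Full_prod (lin_span Full_prod (fst ` fr_gens)). (b, \<phi> b) \<in> cl FR.AB (lin_span FR.AB fr_gens))"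
  proof (rule FR.graph_star_hom[OF fr_gens_carrier _ fr_bound])
    fix y z assume yz: "y \<in> fr_gens" "z \<in> fr_gens"
    obtain g f h f' where y: "y = (fg g f, rg g f)" "g \<in> carrier G" "f \<in> fib g"
      and z: "z = (fg h f', rg h f')" "h \<in> carrier G" "f' \<in> fib h" using yz by blast
    have "fg (g \<otimes> h) (cpm g f f') = fg g f \<otimes>\<^bsub>Full_prod\<^esub> fg h f'"
      "rg (g \<otimes> h) (cpm g f f') = rg g f \<otimes>\<^bsub>bounded_ops\<^esub> rg h f'"
      using fg_cprel rg_cprel y z unfolding cprel_def by simp_all
    then have "y \<otimes>\<^bsub>FR.AB\<^esub> z = (fg (g \<otimes> h) (cpm g f f'), rg (g \<otimes> h) (cpm g f f'))" by (simp add: y z)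
    then have "y \<otimes>\<^bsub>FR.AB\<^esub> z \<in> fr_gens" using fib_mult[OF y(2) z(2) y(3) z(3)] m_closed[OF y(2) z(2)] by blast
    then show "y \<otimes>\<^bsub>FR.AB\<^esub> z \<in> lin_span FR.AB fr_gens" by (rule FR.AB.lin_span_base[OF fr_gens_carrier])
    have "fg (inv g) (cps g f) = star Full_prod (fg g f)" "rg (inv g) (cps g f) = star bounded_ops (rg g f)"
      using fg_cprel rg_cprel y unfolding cprel_def by simp_all
    then have "star FR.AB y = (fg (inv g) (cps g f), rg (inv g) (cps g f))" by (simp add: y)
    then have "star FR.AB y \<in> fr_gens" using fib_star[OF y(2,3)] inv_closed[OF y(2)] by blast
    then show "star FR.AB y \<in> lin_span FR.AB fr_gens" by (rule FR.AB.lin_span_base[OF fr_gens_carrier])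
  next
    show "(fg \<one> ?o, rg \<one> ?o) \<in> fr_gens" using o1 one_closed by blast
    show "cl bounded_ops (lin_span bounded_ops (snd ` fr_gens)) \<subseteq> carrier Red"
      unfolding snd by (simp add: reduced_cp_def)
  qed simp
  have e: "Full_prod\<lparr>carrier := cl Full_prod (lin_span Full_prod (gens fg)), one := fg \<one> ?o\<rparr> = Full"
    "bounded_ops\<lparr>carrier := carrier Red, one := rg \<one> ?o\<rparr> = Red"
    using fg_cprel unfolding cprel_def by (simp_all add: full_cp_def reduced_cp_def Let_def)
  from ex obtain \<phi> where \<phi>: "star_hom Full Red \<phi>" "\<And>a b. (a, b) \<in> fr_gens \<Longrightarrow> \<phi> a = b"
    unfolding fst e by blast
  have \<phi>g: "\<phi> (fg g f) = rg g f" if "g \<in> carrier G" "f \<in> fib g" for g f using that by (intro \<phi>(2)) blast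
  have "\<Lambda>0 = \<phi>" unfolding full_to_reduced_def
  proof (rule the_equality)
    show "star_hom Full Red \<phi> \<and> (\<forall>g\<in>carrier G. \<forall>f\<in>fib g. \<phi> (fg g f) = rg g f)" using \<phi>(1) \<phi>g by simp
    fix \<psi> assume \<psi>: "star_hom Full Red \<psi> \<and> (\<forall>g\<in>carrier G. \<forall>f\<in>fib g. \<psi> (fg g f) = rg g f)"
    have "carrier Full \<subseteq> {a \<in> carrier Full. \<psi> a = \<phi> a}"
    proof (rule F.carrier_sub[OF C.cstar_sub_equalizer])
      fix p assume p: "p \<in> P"
      then show "F.v p \<in> {a \<in> carrier Full. \<psi> a = \<phi> a}"
        using \<psi> \<phi>g cyl_fib[OF pr_jd[OF p]] F.v_closed[OF p] by (simp add: F.v_def F.t_def)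
    qed (use \<psi> \<phi> in blast)+
    then show "\<psi> = \<phi>" using \<psi> \<phi>(1) by (intro C.star_hom_eqI) blast+
  qed
  then show "star_hom Full Red \<Lambda>0" "g \<in> carrier G \<Longrightarrow> f \<in> fib g \<Longrightarrow> \<Lambda>0 (fg g f) = rg g f"
    using \<phi>(1) \<phi>g by simp_all
qed

end

section \<open>Simplicity and pure infiniteness\<close>

context calg begin

text \<open>The element is dominated by \<open>M\<close> times \<open>b\<close> with its adjoint,
  which is in \<open>B\<close>. With \<open>t\<close> the square root of \<open>1 - y\<close>, where
  \<open>y = ?k / M\<close>, the difference of the two is the adjoint of \<open>?d\<close> times
  \<open>?d\<close>, hence positive.\<close>

lemma hereditary_conj:
  assumes B: "hereditary_sub A B" and b: "b \<in> B" and c: "c \<in> carrier A"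
  shows "(b \<otimes> c) \<otimes> star A (b \<otimes> c) \<in> B"
proof -
  have Bs: "cstar_sub A B" using B by (simp add: hereditary_sub_def)
  have bc: "b \<in> carrier A" using b Bs by (auto simp: cstar_sub_def)
  let ?k = "c \<otimes> star A c"
  \<comment> \<open>Large enough for \<open>?k / M\<close> to have norm at most 1/2, within the
    range of \<open>corner_sqrt\<close>.\<close>
  define M where "M = 2 * (nrm A ?k + 1)"
  have kc: "?k \<in> carrier A" using c by simp
  have M: "0 < M" using nrm_nonneg[OF kc] by (simp add: M_def)
  define y where "y = of_real (1 / M) \<odot> ?k"
  have yc: "y \<in> carrier A" using c by (simp add: y_def)
  have ys: "star A y = y" using c by (simp add: y_def star_smult star_mult)
  have "nrm A y = nrm A ?k / M" using kc M by (simp add: y_def nrm_smult norm_divide)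
  also have "\<dots> \<le> 3/4" using M nrm_nonneg[OF kc] by (simp add: M_def field_simps)
  finally have yn: "nrm A y \<le> 3/4" .
  have "\<exists>t\<in>carrier A. star A t = t \<and> \<one> \<otimes> t = t \<and> t \<otimes> \<one> = t \<and> t \<otimes> t = \<one> \<ominus> y"
    by (rule corner_sqrt) (use yc ys yn in simp_all)
  then obtain t where t: "t \<in> carrier A" "star A t = t" "t \<otimes> t = \<one> \<ominus> y" by blast
  have Mk: "of_real M \<odot> y = ?k" using M kc by (simp add: y_def smult_smult)
  let ?d = "of_real (sqrt M) \<odot> (t \<otimes> star A b)"
  have sM: "complex_of_real (sqrt M) * complex_of_real (sqrt M) = of_real M" using M by (simp flip: of_real_mult)
  have "star A ?d \<otimes> ?d = of_real M \<odot> (b \<otimes> t \<otimes> (t \<otimes> star A b))"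
    using t bc by (simp add: star_smult star_mult smult_l smult_r smult_smult sM)
  also have "b \<otimes> t \<otimes> (t \<otimes> star A b) = b \<otimes> (t \<otimes> t) \<otimes> star A b" using t(1) bc by (simp add: m_assoc)
  also have "\<dots> = b \<otimes> star A b \<ominus> b \<otimes> y \<otimes> star A b"
  proof -
    have bs: "star A b \<in> carrier A" using bc by simp
    show ?thesis unfolding t(3) using bc bs yc by algebra
  qed
  also have "of_real M \<odot> (b \<otimes> star A b \<ominus> b \<otimes> y \<otimes> star A b) = of_real M \<odot> (b \<otimes> star A b) \<ominus> b \<otimes> ?k \<otimes> star A b"
    using M bc yc by (simp add: smult_minus Mk[symmetric] smult_l smult_r)
  also have "b \<otimes> ?k \<otimes> star A b = (b \<otimes> c) \<otimes> star A (b \<otimes> c)" using bc c by (simp add: star_mult m_assoc)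
  finally have p3: "positive A (of_real M \<odot> (b \<otimes> star A b) \<ominus> (b \<otimes> c) \<otimes> star A (b \<otimes> c))"
    unfolding positive_def using t bc by (intro bexI[of _ ?d]) simp_all
  have p1: "positive A ((b \<otimes> c) \<otimes> star A (b \<otimes> c))"
    unfolding positive_def using bc c by (intro bexI[of _ "star A (b \<otimes> c)"]) simp_all
  have "of_real M \<odot> (b \<otimes> star A b) = star A (of_real (sqrt M) \<odot> star A b) \<otimes> (of_real (sqrt M) \<odot> star A b)"
    using M bc by (simp add: star_smult smult_l smult_r smult_smult sM)
  then have p2: "positive A (of_real M \<odot> (b \<otimes> star A b))"
    unfolding positive_def using bc by (intro bexI[of _ "of_real (sqrt M) \<odot> star A b"]) simp_all
  have "of_real M \<odot> (b \<otimes> star A b) \<in> B" using Bs b by (simp add: cstar_sub_def)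
  then show ?thesis using B p1 p2 p3 unfolding hereditary_sub_def by blast
qed

text \<open>Conjugation by \<open>z\<close> identifies the corner of \<open>h\<close> with that of
  the range projection of \<open>z\<close>, and carries the proper isometry \<open>r\<close> of the
  first corner to one of the second.\<close>

lemma infinite_projection_conj:
  assumes h: "h \<in> carrier A" "h \<otimes> h = h" "star A h = h"
    and r: "r \<in> carrier A" "star A r \<otimes> r = h" "h \<otimes> r = r" "r \<otimes> h = r" "r \<otimes> star A r \<noteq> h"
    and z: "z \<in> carrier A" "star A z \<otimes> z = h" "z \<otimes> h = z"
  shows "infinite_projection A (z \<otimes> star A z)"
proof -
  let ?p = "z \<otimes> star A z" and ?v = "z \<otimes> r \<otimes> star A z" and ?q = "z \<otimes> (r \<otimes> star A r) \<otimes> star A z"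
  have sr: "star A r \<otimes> h = star A r" "h \<otimes> star A r = star A r" "h \<otimes> star A z = star A z"
    using star_mult[OF h(1) r(1)] star_mult[OF r(1) h(1)] star_mult[OF z(1) h(1)] h(3) r(3,4) z(3) by simp_all
  have sc: "star A z \<in> carrier A" "star A r \<in> carrier A" using z r by simp_all
  note a = m_assoc[symmetric]
  have l: "star A z \<otimes> (z \<otimes> x) = h \<otimes> x" "star A r \<otimes> (r \<otimes> x) = h \<otimes> x" "h \<otimes> (r \<otimes> x) = r \<otimes> x"
    "r \<otimes> (h \<otimes> x) = r \<otimes> x" "z \<otimes> (h \<otimes> x) = z \<otimes> x" "star A r \<otimes> (h \<otimes> x) = star A r \<otimes> x"
    "h \<otimes> (star A r \<otimes> x) = star A r \<otimes> x" "h \<otimes> (star A z \<otimes> x) = star A z \<otimes> x" if "x \<in> carrier A" for x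
    using that h r z sr sc
    by (simp_all only: a[OF sc(1) z(1) that] a[OF sc(2) r(1) that] a[OF h(1) r(1) that] a[OF r(1) h(1) that]
      a[OF z(1) h(1) that] a[OF sc(2) h(1) that] a[OF h(1) sc(2) that] a[OF h(1) sc(1) that])
  have p: "projection A ?p" unfolding projection_def using z h by (simp add: star_mult m_assoc l sr)
  have q: "projection A ?q" unfolding projection_def using z h r by (simp add: star_mult m_assoc l sr)
  have pq: "?p \<otimes> ?q = ?q" using z h r by (simp add: star_mult m_assoc l sr)
  have "?q \<noteq> ?p"
  proof
    assume e: "?q = ?p"
    have "r \<otimes> star A r = star A z \<otimes> ?q \<otimes> z" using z h r by (simp add: m_assoc l sr)
    also have "\<dots> = h" unfolding e using z h by (simp add: m_assoc l)
    finally show False using r(5) by simp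
  qed
  moreover have "star A ?v \<otimes> ?v = ?p" using z h r by (simp add: star_mult m_assoc l sr)
  moreover have "?v \<otimes> star A ?v = ?q" using z h r by (simp add: star_mult m_assoc l sr)
  moreover have "?v \<in> carrier A" using z r by simp
  ultimately show ?thesis unfolding infinite_projection_def using p q pq by blast
qed

end

text \<open>In both instances \<open>E\<close> is contractive; the weaker bound suffices and follows from
  \<open>star_hom_bounded\<close>.\<close>

locale cond_exp = crossed_gen G P A u
  for G :: "'g monoid" (structure) and P :: "'g set" and A :: "'a cstar" and u +
  fixes E :: "'a \<Rightarrow> ('g set \<Rightarrow> bool) \<Rightarrow> complex"
  assumes E_bound: "a \<in> carrier A \<Longrightarrow> x \<in> X \<Longrightarrow> cmod (E a x) \<le> 2 * nrm A a"
    and E_add: "a \<in> carrier A \<Longrightarrow> b \<in> carrier A \<Longrightarrow> x \<in> X \<Longrightarrow> E (a \<oplus>\<^bsub>A\<^esub> b) x = E a x + E b x"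
    and E_smult: "a \<in> carrier A \<Longrightarrow> x \<in> X \<Longrightarrow> E (c \<odot>\<^bsub>A\<^esub> a) x = c * E a x"
    and E_t: "g \<in> carrier G \<Longrightarrow> S \<in> jd (inv g) \<Longrightarrow> x \<in> X \<Longrightarrow> E (t g S) x = of_bool (g = \<one> \<and> x S)"
begin

text \<open>The range projection of the isometry \<open>v r\<close>, see \<open>h_v\<close>.\<close>

definition h :: "'g \<Rightarrow> 'a" where
  "h r = t \<one> (r <# P)"

lemma t_empty: "t g {} = \<zero>\<^bsub>A\<^esub>" if "g \<in> carrier G"
proof -
  have "cyl {} = (\<lambda>_. 0)" by (rule ext) (use X_empty in \<open>auto simp: cyl_def\<close>)
  then show ?thesis using u_zero[OF that] by (simp add: t_def)
qed

lemma t_bound: "g \<in> carrier G \<Longrightarrow> S \<in> jd (inv g) \<Longrightarrow> nrm A (t g S) \<le> 1"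
  unfolding t_def by (rule u_bound) (auto simp: cyl_fib cyl_def)

lemma pr_jd_one: "r \<in> P \<Longrightarrow> r <# P \<in> jd \<one>"
  using J_jd pr_J by blast

lemma h_closed [simp]: "r \<in> P \<Longrightarrow> h r \<in> carrier A"
  and h_proj: "r \<in> P \<Longrightarrow> h r \<otimes>\<^bsub>A\<^esub> h r = h r" "r \<in> P \<Longrightarrow> star A (h r) = h r"
  and h_bound: "r \<in> P \<Longrightarrow> nrm A (h r) \<le> 1"
  using t_closed[of \<one>] t_bound[of \<one>] by (simp_all add: h_def t_one_mult t_one_star pr_jd_one)

lemma h_v: "r \<in> P \<Longrightarrow> v r \<otimes>\<^bsub>A\<^esub> star A (v r) = h r"
proof -
  assume r: "r \<in> P"
  have "{p \<in> r <# P. inv r \<otimes> p \<in> P} = r <# P" using r P_sub by (auto simp: mem_lcoset_iff)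
  then show ?thesis
    using r t_mult[of r "inv r" "r <# P" P] pr_jd[OF r] P_jd[OF r] by (simp add: star_v h_def) (simp add: v_def)
qed

lemma v_h_v: "r \<in> P \<Longrightarrow> star A (v r) \<otimes>\<^bsub>A\<^esub> h r \<otimes>\<^bsub>A\<^esub> v r = \<one>\<^bsub>A\<^esub>"
  using w_isometry[of r] by (simp add: h_v[symmetric] A.m_assoc flip: A.m_assoc)

text \<open>For \<open>g = \<one>\<close> the ideal \<open>rP\<close> is inside \<open>S\<close> or
  disjoint from it, so the compression is \<open>h r\<close> or zero. For other \<open>g\<close>,
  \<open>cond4_refine\<close> provides \<open>q\<close> with \<open>qP\<close> and
  \<open>gqP\<close> disjoint, and the compression vanishes below \<open>q\<close>. The claim covers
  all \<open>r'\<close> below \<open>r\<close>, so that it survives further refinement.\<close>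

lemma pinch_word:
  assumes c4: cond4 and x: "x \<in> X" and g: "g \<in> carrier G" and S: "S \<in> jd (inv g)" and r0: "decides r0 x {S}"
  shows "\<exists>r\<in>r0 <# P. \<forall>r'\<in>r <# P. h r' \<otimes>\<^bsub>A\<^esub> t g S \<otimes>\<^bsub>A\<^esub> h r' = E (t g S) x \<odot>\<^bsub>A\<^esub> h r'"
proof -
  have r0P: "r0 \<in> P" using r0 by (simp add: decides_def)
  have SJ: "S \<in> J" by (rule jd_J[OF S])
  have hth: "h r \<otimes>\<^bsub>A\<^esub> t g S \<otimes>\<^bsub>A\<^esub> h r = t g {p \<in> (r <# P) \<inter> S. inv g \<otimes> p \<in> r <# P}" if r: "r \<in> P" for r
  proof -
    have "{p \<in> r <# P. inv \<one> \<otimes> p \<in> S} = (r <# P) \<inter> S" using J_sub[OF SJ] r P_sub pr_P[OF r] by auto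
    then have "h r \<otimes>\<^bsub>A\<^esub> t g S = t g ((r <# P) \<inter> S)"
      using t_mult[of \<one> g "r <# P" S] g S r pr_jd_one by (simp add: h_def)
    moreover have "(r <# P) \<inter> S \<in> jd (inv g)" using jd_Int[OF S pr_J[OF r]] by (simp add: Int_commute)
    ultimately show ?thesis using t_mult[of g \<one> "(r <# P) \<inter> S" "r <# P"] g r pr_jd_one by (simp add: h_def)
  qed
  show ?thesis
  proof (cases "g = \<one>")
    case True
    have "h r \<otimes>\<^bsub>A\<^esub> t g S \<otimes>\<^bsub>A\<^esub> h r = E (t g S) x \<odot>\<^bsub>A\<^esub> h r" if r: "r \<in> r0 <# P" for r
    proof -
      have rP: "r \<in> P" using pr_P[OF r0P r] .
      have sub: "r <# P \<subseteq> r0 <# P" using pr_trans[OF r0P r] .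
      have e: "{p \<in> (r <# P) \<inter> S. inv g \<otimes> p \<in> r <# P} = (r <# P) \<inter> S"
        using True J_sub[OF SJ] P_sub by auto
      show ?thesis
      proof (cases "x S")
        case True
        then have "r0 <# P \<subseteq> S" using r0 pr_sub[OF SJ] by (simp add: decides_def)
        then have "(r <# P) \<inter> S = r <# P" using sub by blast
        then show ?thesis using hth[OF rP] E_t[OF g S x] e \<open>g = \<one>\<close> True rP by (simp add: h_def[symmetric])
      next
        case False
        then have "(r <# P) \<inter> S = {}" using r0 sub by (auto simp: decides_def)
        then show ?thesis using hth[OF rP] E_t[OF g S x] e False rP t_empty[OF g] by simp
      qed
    qed
    then show ?thesis using pr_self[OF r0P] by blast
  next
    case False
    obtain q where q: "q \<in> r0 <# P" "(q <# P) \<inter> ((g \<otimes> q) <# P) = {}" using cond4_refine[OF c4 g False r0P] by blast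
    have qP: "q \<in> P" using pr_P[OF r0P q(1)] .
    have "h r \<otimes>\<^bsub>A\<^esub> t g S \<otimes>\<^bsub>A\<^esub> h r = E (t g S) x \<odot>\<^bsub>A\<^esub> h r" if r: "r \<in> q <# P" for r
    proof -
      have rP: "r \<in> P" using pr_P[OF qP r] .
      have sub: "r <# P \<subseteq> q <# P" using pr_trans[OF qP r] .
      have "p \<in> (g \<otimes> q) <# P" if p: "p \<in> S" "inv g \<otimes> p \<in> r <# P" for p
      proof -
        have pc: "p \<in> carrier G" using p(1) J_sub[OF SJ] P_sub by blast
        have "inv g \<otimes> p \<in> q <# P" using p(2) sub by blast
        then have "inv q \<otimes> (inv g \<otimes> p) \<in> P" using qP g pc P_sub by (simp add: mem_lcoset_iff)
        then show ?thesis using qP g pc P_sub by (simp add: mem_lcoset_iff inv_mult_group m_assoc)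
      qed
      then have e: "{p \<in> (r <# P) \<inter> S. inv g \<otimes> p \<in> r <# P} = {}" using q(2) sub by blast
      show ?thesis unfolding hth[OF rP] e using E_t[OF g S x] False rP t_empty[OF g] by simp
    qed
    then show ?thesis using q(1) by blast
  qed
qed

text \<open>Induction over the linear combination: the words are treated in turn, each passing to a
  smaller principal ideal without spoiling the earlier ones. The finite family \<open>F\<close>
  collects the ideals that the initial element has to decide.\<close>

lemma pinch:
  assumes c4: cond4 and x: "x \<in> X" and a: "a \<in> lin_span A words"
  shows "\<exists>r\<in>P. h r \<otimes>\<^bsub>A\<^esub> a \<otimes>\<^bsub>A\<^esub> h r = E a x \<odot>\<^bsub>A\<^esub> h r"
proof -
  have "\<exists>F. finite F \<and> F \<subseteq> J \<and> (\<forall>r0. decides r0 x F \<longrightarrow>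
    (\<exists>r\<in>r0 <# P. \<forall>r'\<in>r <# P. h r' \<otimes>\<^bsub>A\<^esub> a \<otimes>\<^bsub>A\<^esub> h r' = E a x \<odot>\<^bsub>A\<^esub> h r'))"
    using a
  proof induct
    case zero
    have "h r' \<otimes>\<^bsub>A\<^esub> \<zero>\<^bsub>A\<^esub> \<otimes>\<^bsub>A\<^esub> h r' = E \<zero>\<^bsub>A\<^esub> x \<odot>\<^bsub>A\<^esub> h r'" if "r' \<in> P" for r'
      using that E_smult[OF A.zero_closed x, of 0] by simp
    then have "\<exists>r\<in>r0 <# P. \<forall>r'\<in>r <# P. h r' \<otimes>\<^bsub>A\<^esub> \<zero>\<^bsub>A\<^esub> \<otimes>\<^bsub>A\<^esub> h r' = E \<zero>\<^bsub>A\<^esub> x \<odot>\<^bsub>A\<^esub> h r'"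
      if "decides r0 x {}" for r0
      using pr_self[of r0] pr_P[of r0] that by (intro bexI[of _ r0]) (auto simp: decides_def)
    then show ?case by (intro exI[of _ "{}"]) simp
  next
    case (step z y c)
    then obtain F where F: "finite F" "F \<subseteq> J"
      and Fy: "\<And>r0. decides r0 x F \<Longrightarrow> \<exists>r\<in>r0 <# P. \<forall>r'\<in>r <# P. h r' \<otimes>\<^bsub>A\<^esub> y \<otimes>\<^bsub>A\<^esub> h r' = E y x \<odot>\<^bsub>A\<^esub> h r'"
      by (elim exE conjE) blast
    obtain \<alpha> where \<alpha>: "is_word P \<alpha>" "z = rep_dot A v \<alpha>" using step(1) by (auto simp: words_def)
    let ?g = "wdot G \<alpha>" and ?S = "K G P (rev \<alpha>)"
    have g: "?g \<in> carrier G" and S: "?S \<in> jd (inv ?g)"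
      using \<alpha>(1) by (auto intro!: jdI simp: wdot_rev)
    have z: "z = t ?g ?S" using rep_dot_v[OF \<alpha>(1)] \<alpha>(2) by simp
    have zc: "z \<in> carrier A" and yc: "y \<in> carrier A"
      using z g S A.lin_span_carrier[OF words_carrier step(2)] by simp_all
    have "\<exists>r\<in>r0 <# P. \<forall>r'\<in>r <# P. h r' \<otimes>\<^bsub>A\<^esub> (c \<odot>\<^bsub>A\<^esub> z \<oplus>\<^bsub>A\<^esub> y) \<otimes>\<^bsub>A\<^esub> h r' = E (c \<odot>\<^bsub>A\<^esub> z \<oplus>\<^bsub>A\<^esub> y) x \<odot>\<^bsub>A\<^esub> h r'"
      if r0: "decides r0 x (insert ?S F)" for r0
    proof -
      have r0P: "r0 \<in> P" using r0 by (simp add: decides_def)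
      obtain q where q: "q \<in> r0 <# P" and qz: "\<And>r'. r' \<in> q <# P \<Longrightarrow> h r' \<otimes>\<^bsub>A\<^esub> z \<otimes>\<^bsub>A\<^esub> h r' = E z x \<odot>\<^bsub>A\<^esub> h r'"
        using pinch_word[OF c4 x g S decides_mono[OF r0, of "{?S}"]] unfolding z by blast
      have qP: "q \<in> P" using pr_P[OF r0P q] .
      have "decides q x F" using decides_ext[OF F(2) decides_mono[OF r0 subset_insertI] q] .
      then obtain r where r: "r \<in> q <# P" and ry: "\<And>r'. r' \<in> r <# P \<Longrightarrow> h r' \<otimes>\<^bsub>A\<^esub> y \<otimes>\<^bsub>A\<^esub> h r' = E y x \<odot>\<^bsub>A\<^esub> h r'"
        using Fy by blast
      have "h r' \<otimes>\<^bsub>A\<^esub> (c \<odot>\<^bsub>A\<^esub> z \<oplus>\<^bsub>A\<^esub> y) \<otimes>\<^bsub>A\<^esub> h r' = E (c \<odot>\<^bsub>A\<^esub> z \<oplus>\<^bsub>A\<^esub> y) x \<odot>\<^bsub>A\<^esub> h r'"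
        if r': "r' \<in> r <# P" for r'
      proof -
        have r'P: "r' \<in> P" using pr_P[OF pr_P[OF qP r] r'] .
        have r'q: "r' \<in> q <# P" using pr_trans[OF qP r] r' by blast
        have "h r' \<otimes>\<^bsub>A\<^esub> (c \<odot>\<^bsub>A\<^esub> z \<oplus>\<^bsub>A\<^esub> y) \<otimes>\<^bsub>A\<^esub> h r' = c \<odot>\<^bsub>A\<^esub> (h r' \<otimes>\<^bsub>A\<^esub> z \<otimes>\<^bsub>A\<^esub> h r') \<oplus>\<^bsub>A\<^esub> h r' \<otimes>\<^bsub>A\<^esub> y \<otimes>\<^bsub>A\<^esub> h r'"
          using r'P zc yc by (simp add: A.r_distr A.l_distr A.smult_l A.smult_r)
        also have "\<dots> = E (c \<odot>\<^bsub>A\<^esub> z \<oplus>\<^bsub>A\<^esub> y) x \<odot>\<^bsub>A\<^esub> h r'"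
          unfolding qz[OF r'q] ry[OF r'] using r'P zc yc x by (simp add: E_add E_smult A.add_smult A.smult_smult)
        finally show ?thesis .
      qed
      moreover have "r \<in> r0 <# P" using pr_trans[OF r0P q] r by blast
      ultimately show ?thesis by blast
    qed
    then show ?case using F jd_J[OF S] by (intro exI[of _ "insert ?S F"]) simp
  qed
  then obtain F where F: "finite F" "F \<subseteq> J" and Fa: "\<forall>r0. decides r0 x F \<longrightarrow>
    (\<exists>r\<in>r0 <# P. \<forall>r'\<in>r <# P. h r' \<otimes>\<^bsub>A\<^esub> a \<otimes>\<^bsub>A\<^esub> h r' = E a x \<odot>\<^bsub>A\<^esub> h r')" by (elim exE conjE)
  obtain r0 where r0: "decides r0 x F" using X_decides[OF x F] by blast
  then have r0P: "r0 \<in> P" by (simp add: decides_def)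
  obtain r where r: "r \<in> r0 <# P" "\<forall>r'\<in>r <# P. h r' \<otimes>\<^bsub>A\<^esub> a \<otimes>\<^bsub>A\<^esub> h r' = E a x \<odot>\<^bsub>A\<^esub> h r'"
    using Fa r0 by blast
  have "r \<in> P" using pr_P[OF r0P r(1)] .
  then show ?thesis using r(2) pr_self[of r] by blast
qed

lemma approx_words:
  assumes "a \<in> carrier A" "0 < e"
  shows "\<exists>y\<in>lin_span A words. nrm A (a \<ominus>\<^bsub>A\<^esub> y) < e"
  using A.cl_approx[of a "lin_span A words" e] assms carrier_words by simp

lemma E_diff: "a \<in> carrier A \<Longrightarrow> b \<in> carrier A \<Longrightarrow> x \<in> X \<Longrightarrow> E (a \<ominus>\<^bsub>A\<^esub> b) x = E a x - E b x"
  by (simp add: A.minus_smult E_add E_smult)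

lemma pinch_close:
  assumes c4: cond4 and x: "x \<in> X" and a: "a \<in> carrier A" and e: "0 < e"
  shows "\<exists>r\<in>P. nrm A (h r \<otimes>\<^bsub>A\<^esub> a \<otimes>\<^bsub>A\<^esub> h r \<ominus>\<^bsub>A\<^esub> E a x \<odot>\<^bsub>A\<^esub> h r) < e"
proof -
  \<comment> \<open>One third covers the compression of the error \<open>a - y\<close>, the other
    two the factor 2 in \<open>E_bound\<close>.\<close>
  obtain y where y: "y \<in> lin_span A words" "nrm A (a \<ominus>\<^bsub>A\<^esub> y) < e / 3" using approx_words[OF a, of "e / 3"] e by auto
  have yc: "y \<in> carrier A" using A.lin_span_carrier[OF words_carrier y(1)] .
  obtain r where r: "r \<in> P" "h r \<otimes>\<^bsub>A\<^esub> y \<otimes>\<^bsub>A\<^esub> h r = E y x \<odot>\<^bsub>A\<^esub> h r" using pinch[OF c4 x y(1)] by blast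
  let ?h = "h r" and ?d = "a \<ominus>\<^bsub>A\<^esub> y"
  have hc: "?h \<in> carrier A" and dc: "?d \<in> carrier A" using r a yc by simp_all
  have "?h \<otimes>\<^bsub>A\<^esub> a \<otimes>\<^bsub>A\<^esub> ?h \<ominus>\<^bsub>A\<^esub> E a x \<odot>\<^bsub>A\<^esub> ?h =
      (?h \<otimes>\<^bsub>A\<^esub> a \<otimes>\<^bsub>A\<^esub> ?h \<ominus>\<^bsub>A\<^esub> ?h \<otimes>\<^bsub>A\<^esub> y \<otimes>\<^bsub>A\<^esub> ?h) \<ominus>\<^bsub>A\<^esub> (E a x \<odot>\<^bsub>A\<^esub> ?h \<ominus>\<^bsub>A\<^esub> E y x \<odot>\<^bsub>A\<^esub> ?h)"
    unfolding r(2) using A.smult_closed[OF hc, of "E a x"] A.smult_closed[OF hc, of "E y x"]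
      A.m_closed[OF A.m_closed[OF hc a] hc] by algebra
  also have "?h \<otimes>\<^bsub>A\<^esub> a \<otimes>\<^bsub>A\<^esub> ?h \<ominus>\<^bsub>A\<^esub> ?h \<otimes>\<^bsub>A\<^esub> y \<otimes>\<^bsub>A\<^esub> ?h = ?h \<otimes>\<^bsub>A\<^esub> ?d \<otimes>\<^bsub>A\<^esub> ?h"
    using hc a yc by algebra
  also have "E a x \<odot>\<^bsub>A\<^esub> ?h \<ominus>\<^bsub>A\<^esub> E y x \<odot>\<^bsub>A\<^esub> ?h = E ?d x \<odot>\<^bsub>A\<^esub> ?h"
    unfolding E_diff[OF a yc x] using hc by (simp add: A.minus_smult A.smult_smult flip: A.add_smult)
  finally have "nrm A (?h \<otimes>\<^bsub>A\<^esub> a \<otimes>\<^bsub>A\<^esub> ?h \<ominus>\<^bsub>A\<^esub> E a x \<odot>\<^bsub>A\<^esub> ?h) \<le> nrm A (?h \<otimes>\<^bsub>A\<^esub> ?d \<otimes>\<^bsub>A\<^esub> ?h) + nrm A (E ?d x \<odot>\<^bsub>A\<^esub> ?h)"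
    using hc dc by (simp add: A.nrm_minus_le)
  also have "nrm A (?h \<otimes>\<^bsub>A\<^esub> ?d \<otimes>\<^bsub>A\<^esub> ?h) \<le> nrm A (?h \<otimes>\<^bsub>A\<^esub> ?d) * nrm A ?h" using hc dc by (simp add: A.nrm_mult)
  also have "\<dots> \<le> nrm A (?h \<otimes>\<^bsub>A\<^esub> ?d) * 1" using h_bound[OF r(1)] hc dc by (intro mult_left_mono) simp_all
  also have "\<dots> \<le> nrm A ?h * nrm A ?d" using hc dc by (simp add: A.nrm_mult)
  also have "\<dots> \<le> 1 * nrm A ?d" using h_bound[OF r(1)] dc by (intro mult_right_mono) simp_all
  also have "nrm A (E ?d x \<odot>\<^bsub>A\<^esub> ?h) = cmod (E ?d x) * nrm A ?h" using hc by (simp add: A.nrm_smult)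
  also have "\<dots> \<le> (2 * nrm A ?d) * 1" using h_bound[OF r(1)] E_bound[OF dc x] hc dc by (intro mult_mono) simp_all
  finally show ?thesis using y(2) r(1) by (intro bexI[of _ r]) simp_all
qed

text \<open>If the value were nonzero, a compression of \<open>a\<close> divided by it would lie in
  the ideal at distance less than 1 from \<open>h r\<close>. By \<open>ideal_near_unit\<close> the
  ideal contains \<open>h r\<close>, and conjugating by the isometry \<open>v r\<close> it contains
  the unit.\<close>

lemma ideal_E_zero:
  assumes c4: cond4 and I: "cstar_ideal A I" "I \<noteq> carrier A" and a: "a \<in> I" and x: "x \<in> X"
  shows "E a x = 0"
proof (rule ccontr)
  assume n: "E a x \<noteq> 0"
  interpret I: ideal I A using I by (simp add: cstar_ideal_def)
  have ac: "a \<in> carrier A" using I.a_Hcarr[OF a] .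
  let ?l = "E a x"
  obtain r where r: "r \<in> P" "nrm A (h r \<otimes>\<^bsub>A\<^esub> a \<otimes>\<^bsub>A\<^esub> h r \<ominus>\<^bsub>A\<^esub> ?l \<odot>\<^bsub>A\<^esub> h r) < cmod ?l"
    using pinch_close[OF c4 x ac, of "cmod ?l"] n by auto
  let ?h = "h r" and ?k = "h r \<otimes>\<^bsub>A\<^esub> a \<otimes>\<^bsub>A\<^esub> h r"
  have hc: "?h \<in> carrier A" and kc: "?k \<in> carrier A" using r ac by simp_all
  have kI: "?k \<in> I" using hc a by (intro I.I_r_closed I.I_l_closed)
  let ?c = "inverse ?l \<odot>\<^bsub>A\<^esub> ?k"
  have "?c = (inverse ?l \<odot>\<^bsub>A\<^esub> \<one>\<^bsub>A\<^esub>) \<otimes>\<^bsub>A\<^esub> ?k" using kc by (simp add: A.smult_l)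
  then have cI: "?c \<in> I" using kI by (simp add: I.I_l_closed)
  have hk: "?h \<otimes>\<^bsub>A\<^esub> ?k = ?k" using hc ac h_proj(1)[OF r(1)] by (simp flip: A.m_assoc)
  have "?h \<in> I"
  proof (rule A.ideal_near_unit[OF I(1) hc h_proj(1)[OF r(1)] cI])
    show "?h \<otimes>\<^bsub>A\<^esub> ?c = ?c" using hc kc hk by (simp add: A.smult_r)
    have "?h \<ominus>\<^bsub>A\<^esub> ?c = inverse ?l \<odot>\<^bsub>A\<^esub> (?l \<odot>\<^bsub>A\<^esub> ?h \<ominus>\<^bsub>A\<^esub> ?k)" using n hc kc by (simp add: A.smult_minus A.smult_smult)
    then have "nrm A (?h \<ominus>\<^bsub>A\<^esub> ?c) = nrm A (?k \<ominus>\<^bsub>A\<^esub> ?l \<odot>\<^bsub>A\<^esub> ?h) / cmod ?l"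
      using hc kc A.nrm_minus_commute[of ?k "?l \<odot>\<^bsub>A\<^esub> ?h"]
      by (simp add: A.nrm_smult norm_inverse divide_inverse mult.commute)
    then show "nrm A (?h \<ominus>\<^bsub>A\<^esub> ?c) < 1" using r(2) n by simp
  qed
  then have "star A (v r) \<otimes>\<^bsub>A\<^esub> ?h \<otimes>\<^bsub>A\<^esub> v r \<in> I" using r(1) by (intro I.I_r_closed I.I_l_closed) simp_all
  then have "\<one>\<^bsub>A\<^esub> \<in> I" using v_h_v[OF r(1)] by simp
  then show False using I.one_imp_carrier I(2) by blast
qed

end

locale faithful_cond_exp = cond_exp +
  assumes E_pos: "a \<in> carrier A \<Longrightarrow> x \<in> X \<Longrightarrow> \<exists>r\<ge>0. E (star A a \<otimes>\<^bsub>A\<^esub> a) x = complex_of_real r"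
    and E_faithful: "a \<in> carrier A \<Longrightarrow> (\<And>x. x \<in> X \<Longrightarrow> E (star A a \<otimes>\<^bsub>A\<^esub> a) x = 0) \<Longrightarrow> a = \<zero>\<^bsub>A\<^esub>"
begin

lemma simple:
  assumes c4: cond4
  shows "simple_cstar A"
proof -
  obtain x where x: "x \<in> X" using X_exists[OF P_one] by blast
  have "E \<one>\<^bsub>A\<^esub> x = 1" using E_t[of \<one> P x] x P_jd[OF P_one] X_P[OF x] by (simp add: t_one)
  moreover have "E \<zero>\<^bsub>A\<^esub> x = 0" using E_smult[OF A.zero_closed x, of 0] by simp
  ultimately have "\<one>\<^bsub>A\<^esub> \<noteq> \<zero>\<^bsub>A\<^esub>" by auto
  moreover have "I = {\<zero>\<^bsub>A\<^esub>}" if I: "cstar_ideal A I" "I \<noteq> carrier A" for I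
  proof -
    interpret I: ideal I A using I by (simp add: cstar_ideal_def)
    have "a = \<zero>\<^bsub>A\<^esub>" if a: "a \<in> I" for a
    proof (rule E_faithful)
      show ac: "a \<in> carrier A" using I.a_Hcarr[OF a] .
      fix x assume "x \<in> X"
      then show "E (star A a \<otimes>\<^bsub>A\<^esub> a) x = 0" using ac a by (intro ideal_E_zero[OF c4 I] I.I_l_closed) simp_all
    qed
    then show ?thesis using I.zero_closed by blast
  qed
  ultimately show ?thesis unfolding simple_cstar_def using A.one_closed by blast
qed

text \<open>Condition \<open>cond4\<close> for some \<open>p \<noteq> \<one>\<close> and
  \<open>\<one>\<close> gives \<open>s\<close> with \<open>psP\<close> and \<open>sP\<close>
  disjoint. With \<open>q = r \<otimes> (p \<otimes> s)\<close> the isometry from \<open>h r\<close>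
  onto \<open>h q\<close> has smaller range: a boundary point containing \<open>rsP\<close> does not
  contain \<open>qP\<close>, so the expectation distinguishes \<open>h q\<close> from
  \<open>h r\<close>.\<close>

lemma h_infinite:
  assumes c4: cond4 and P1: "P \<noteq> {\<one>}" and r: "r \<in> P"
  shows "\<exists>s\<in>carrier A. star A s \<otimes>\<^bsub>A\<^esub> s = h r \<and> h r \<otimes>\<^bsub>A\<^esub> s = s \<and> s \<otimes>\<^bsub>A\<^esub> h r = s \<and> s \<otimes>\<^bsub>A\<^esub> star A s \<noteq> h r"
proof -
  obtain p where p: "p \<in> P" "p \<noteq> \<one>" using P1 P_one by blast
  obtain s where s: "s \<in> P" "((p \<otimes> s) <# P) \<inter> ((\<one> \<otimes> s) <# P) = {}" using c4 p P_one unfolding cond4_def by blast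
  define q where "q = r \<otimes> (p \<otimes> s)"
  have qP: "q \<in> P" "q \<in> r <# P" using r p s by (auto simp: q_def pr_iff)
  have disj: "(q <# P) \<inter> ((r \<otimes> s) <# P) = {}"
    using s(2) p(1) s(1) r lcoset_translate[of r "p \<otimes> s" s] by (simp add: q_def)
  have rs: "r \<otimes> s \<in> P" "(r \<otimes> s) <# P \<subseteq> r <# P" using r s lcoset_mult_sub[of r s] by simp_all
  obtain x where x: "x \<in> X" "x ((r \<otimes> s) <# P)" using X_exists[OF rs(1)] by blast
  have xr: "x (r <# P)" using X_mono[OF x rs(2)] r by simp
  have xq: "\<not> x (q <# P)" using X_disjoint[OF x, of "q <# P"] disj by blast
  have hr: "E (h r) x = 1" and hq: "E (h q) x = 0"
    using E_t[of \<one> _ x] x xr xq r qP pr_jd_one by (simp_all add: h_def)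
  let ?s = "v q \<otimes>\<^bsub>A\<^esub> star A (v r)"
  have hh: "h r \<otimes>\<^bsub>A\<^esub> h q = h q"
  proof -
    have "(r <# P) \<inter> (q <# P) = q <# P" using pr_trans[OF r qP(2)] by blast
    then show ?thesis using r qP by (simp add: h_def t_one_mult)
  qed
  have vv: "star A (v q) \<otimes>\<^bsub>A\<^esub> (v q \<otimes>\<^bsub>A\<^esub> y) = y" "star A (v r) \<otimes>\<^bsub>A\<^esub> (v r \<otimes>\<^bsub>A\<^esub> y) = y" if "y \<in> carrier A" for y
    using that r qP w_isometry[of q] w_isometry[of r] by (simp_all flip: A.m_assoc)
  have ss: "star A ?s = v r \<otimes>\<^bsub>A\<^esub> star A (v q)" using r qP by (simp add: A.star_mult)
  have 1: "star A ?s \<otimes>\<^bsub>A\<^esub> ?s = h r" unfolding ss using r qP by (simp add: A.m_assoc vv h_v)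
  have 2: "?s \<otimes>\<^bsub>A\<^esub> star A ?s = h q" unfolding ss using r qP by (simp add: A.m_assoc vv h_v)
  have 3: "?s \<otimes>\<^bsub>A\<^esub> h r = ?s" using r qP by (simp add: h_v[symmetric] A.m_assoc vv)
  have "h q \<otimes>\<^bsub>A\<^esub> v q = v q" using qP w_isometry[of q] by (simp add: h_v[symmetric] A.m_assoc)
  then have 4: "h r \<otimes>\<^bsub>A\<^esub> ?s = ?s" using hh r qP by (metis A.m_assoc A.star_closed h_closed v_closed)
  have "h q \<noteq> h r" using hr hq by auto
  then show ?thesis using 1 2 3 4 r qP by (intro bexI[of _ ?s]) simp_all
qed

text \<open>Take a nonzero \<open>b\<close> in the hereditary subalgebra. A compression of the
  square of \<open>b\<close> is close to a positive multiple of some \<open>h r\<close>, and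
  correcting it by an inverse square root gives \<open>?z\<close>, a right multiple of
  \<open>b\<close> whose adjoint times itself is \<open>h r\<close>. Its range projection is in
  \<open>B\<close> by \<open>hereditary_conj\<close> and is infinite because \<open>h r\<close>
  is.\<close>

theorem purely_infinite:
  assumes c4: cond4 and P1: "P \<noteq> {\<one>}"
  shows "purely_infinite_simple A"
proof -
  have "\<exists>p\<in>B. infinite_projection A p" if B: "hereditary_sub A B" and B0: "B \<noteq> {\<zero>\<^bsub>A\<^esub>}" for B
  proof -
    have Bs: "cstar_sub A B" using B by (simp add: hereditary_sub_def)
    obtain b where b: "b \<in> B" "b \<noteq> \<zero>\<^bsub>A\<^esub>" using Bs B0 by (auto simp: cstar_sub_def)
    have bc: "b \<in> carrier A" using b Bs by (auto simp: cstar_sub_def)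
    let ?k = "star A b \<otimes>\<^bsub>A\<^esub> b"
    have kc: "?k \<in> carrier A" and ks: "star A ?k = ?k" using bc by (simp_all add: A.star_mult)
    obtain x where x: "x \<in> X" "E ?k x \<noteq> 0" using E_faithful[OF bc] b(2) by blast
    obtain l where l0: "0 \<le> l" "E ?k x = complex_of_real l" using E_pos[OF bc x(1)] by blast
    have l: "0 < l" using l0 x(2) by (cases "l = 0") auto
    obtain r where r: "r \<in> P" "nrm A (h r \<otimes>\<^bsub>A\<^esub> ?k \<otimes>\<^bsub>A\<^esub> h r \<ominus>\<^bsub>A\<^esub> of_real l \<odot>\<^bsub>A\<^esub> h r) < l / 2"
      using pinch_close[OF c4 x(1) kc half_gt_zero[OF l]] l0(2) by auto
    let ?h = "h r" and ?m = "h r \<otimes>\<^bsub>A\<^esub> ?k \<otimes>\<^bsub>A\<^esub> h r"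
    note h = h_closed[OF r(1)] h_proj[OF r(1)]
    have mc: "?m \<in> carrier A" using h kc by simp
    have hm: "?h \<otimes>\<^bsub>A\<^esub> ?m = ?m" "?m \<otimes>\<^bsub>A\<^esub> ?h = ?m" "star A ?m = ?m"
    proof -
      have "?h \<otimes>\<^bsub>A\<^esub> (?h \<otimes>\<^bsub>A\<^esub> y) = ?h \<otimes>\<^bsub>A\<^esub> y" if "y \<in> carrier A" for y
        using that h(1) by (simp add: h(2) flip: A.m_assoc)
      then show "?h \<otimes>\<^bsub>A\<^esub> ?m = ?m" "?m \<otimes>\<^bsub>A\<^esub> ?h = ?m" "star A ?m = ?m"
        using h bc by (simp_all add: A.m_assoc A.star_mult)
    qed
    \<comment> \<open>Thus \<open>?m\<close> is \<open>l\<close> times \<open>?h - y\<close>, with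
      \<open>y\<close> of norm at most 1/2, so that \<open>corner_inverse_sqrt\<close>
      applies.\<close>
    define y where "y = ?h \<ominus>\<^bsub>A\<^esub> of_real (1 / l) \<odot>\<^bsub>A\<^esub> ?m"
    have y: "y \<in> carrier A" "?h \<otimes>\<^bsub>A\<^esub> y = y" "y \<otimes>\<^bsub>A\<^esub> ?h = y" "star A y = y"
      using h mc hm
      by (simp_all add: y_def A.minus_smult A.r_distr A.l_distr A.smult_l A.smult_r A.star_add A.star_smult)
    have "y = of_real (1 / l) \<odot>\<^bsub>A\<^esub> (of_real l \<odot>\<^bsub>A\<^esub> ?h \<ominus>\<^bsub>A\<^esub> ?m)"
      using l h(1) mc by (simp add: y_def A.smult_minus A.smult_smult)
    then have "nrm A y = nrm A (?m \<ominus>\<^bsub>A\<^esub> of_real l \<odot>\<^bsub>A\<^esub> ?h) / l"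
      using l h(1) mc A.nrm_minus_commute[of ?m "of_real l \<odot>\<^bsub>A\<^esub> ?h"] by (simp add: A.nrm_smult norm_divide)
    then have yn: "nrm A y \<le> 1/2" using r(2) l by (simp add: pos_divide_le_eq)
    obtain s where s: "s \<in> carrier A" "star A s = s" "?h \<otimes>\<^bsub>A\<^esub> s = s" "s \<otimes>\<^bsub>A\<^esub> ?h = s"
      "s \<otimes>\<^bsub>A\<^esub> (?h \<ominus>\<^bsub>A\<^esub> y) \<otimes>\<^bsub>A\<^esub> s = ?h"
      using A.corner_inverse_sqrt[OF h y yn] by blast
    have hy: "?h \<ominus>\<^bsub>A\<^esub> y = of_real (1 / l) \<odot>\<^bsub>A\<^esub> ?m"
    proof -
      have "of_real (1 / l) \<odot>\<^bsub>A\<^esub> ?m \<in> carrier A" using mc by simp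
      then show ?thesis using h(1) unfolding y_def by algebra
    qed
    \<comment> \<open>The scalar accounts for the factor \<open>l\<close> between \<open>?m\<close>
      and \<open>?h - y\<close>.\<close>
    let ?c = "of_real (sqrt (1 / l)) \<odot>\<^bsub>A\<^esub> s"
    have cc: "?c \<in> carrier A" using s by simp
    let ?z = "b \<otimes>\<^bsub>A\<^esub> ?c"
    have sl: "complex_of_real (sqrt (1 / l)) * complex_of_real (sqrt (1 / l)) = of_real (1 / l)"
      unfolding of_real_mult[symmetric] using l by simp
    have zc: "?z \<in> carrier A" using bc cc by simp
    have "star A ?z \<otimes>\<^bsub>A\<^esub> ?z = of_real (1 / l) \<odot>\<^bsub>A\<^esub> (s \<otimes>\<^bsub>A\<^esub> ?k \<otimes>\<^bsub>A\<^esub> s)"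
      using bc s(1) by (simp only: A.star_mult A.star_smult A.smult_l A.smult_r A.smult_smult s(2) cc sl
          complex_cnj_complex_of_real A.m_closed A.star_closed A.smult_closed A.m_assoc)
    also have "s \<otimes>\<^bsub>A\<^esub> ?k \<otimes>\<^bsub>A\<^esub> s = s \<otimes>\<^bsub>A\<^esub> ?m \<otimes>\<^bsub>A\<^esub> s"
    proof -
      have "s \<otimes>\<^bsub>A\<^esub> ?m \<otimes>\<^bsub>A\<^esub> s = (s \<otimes>\<^bsub>A\<^esub> ?h) \<otimes>\<^bsub>A\<^esub> ?k \<otimes>\<^bsub>A\<^esub> (?h \<otimes>\<^bsub>A\<^esub> s)"
        using h(1) s(1) bc by (simp add: A.m_assoc)
      then show ?thesis by (simp only: s(3,4))
    qed
    also have "of_real (1 / l) \<odot>\<^bsub>A\<^esub> (s \<otimes>\<^bsub>A\<^esub> ?m \<otimes>\<^bsub>A\<^esub> s) = s \<otimes>\<^bsub>A\<^esub> (?h \<ominus>\<^bsub>A\<^esub> y) \<otimes>\<^bsub>A\<^esub> s"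
      unfolding hy using s(1) mc by (simp add: A.smult_l A.smult_r)
    finally have zz: "star A ?z \<otimes>\<^bsub>A\<^esub> ?z = ?h" unfolding s(5) .
    have zh: "?z \<otimes>\<^bsub>A\<^esub> ?h = ?z" using bc s h(1) by (simp add: A.m_assoc A.smult_l A.smult_r)
    obtain w where w: "w \<in> carrier A" "star A w \<otimes>\<^bsub>A\<^esub> w = ?h" "?h \<otimes>\<^bsub>A\<^esub> w = w" "w \<otimes>\<^bsub>A\<^esub> ?h = w" "w \<otimes>\<^bsub>A\<^esub> star A w \<noteq> ?h"
      using h_infinite[OF c4 P1 r(1)] by blast
    have "infinite_projection A (?z \<otimes>\<^bsub>A\<^esub> star A ?z)" by (rule A.infinite_projection_conj[OF h w zc zz zh])
    moreover have "?z \<otimes>\<^bsub>A\<^esub> star A ?z \<in> B" by (rule A.hereditary_conj[OF B b(1) cc])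
    ultimately show ?thesis by blast
  qed
  then show ?thesis unfolding purely_infinite_simple_def using simple[OF c4] by blast
qed

end

section \<open>The conditional expectation of the boundary quotient\<close>

context calg_pair begin

lemma ideal_preimage:
  assumes f: "star_hom A B f" and I: "cstar_ideal B I"
  shows "cstar_ideal A {a \<in> carrier A. f a \<in> I}" (is "cstar_ideal A ?K")
proof -
  interpret I: ideal I B using I by (simp add: cstar_ideal_def)
  note h = star_homD[OF f]
  have neg: "f (\<ominus>\<^bsub>A\<^esub> x) = \<ominus>\<^bsub>B\<^esub> f x" if "x \<in> carrier A" for x
    unfolding A.neg_smult[OF that] B.neg_smult[OF h(1)[OF that]] by (rule h(6)[OF that])
  have "ideal ?K A"
  proof (rule idealI)
    show "ring A" by (rule A.ring_axioms)
    show "subgroup ?K (add_monoid A)"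
    proof (rule A.add.subgroupI)
      show "?K \<noteq> {}" using star_hom_zero[OF f] I.zero_closed A.zero_closed by auto
    qed (auto simp: h neg I.a_closed simp flip: a_inv_def)
  qed (simp_all add: h I.I_l_closed I.I_r_closed)
  moreover have "cl A ?K \<subseteq> ?K"
  proof
    fix a assume a: "a \<in> cl A ?K"
    have "f a \<in> cl B (f ` ?K)" by (rule star_hom_cl[OF f _ a]) blast
    moreover have "cl B (f ` ?K) \<subseteq> cl B I" by (rule B.cl_mono) blast
    ultimately show "a \<in> ?K" using a A.cl_carrier I by (auto simp: cstar_ideal_def)
  qed
  ultimately show ?thesis by (simp add: cstar_ideal_def)
qed

lemma ideal_zero: "cstar_ideal B {\<zero>\<^bsub>B\<^esub>}"
  unfolding cstar_ideal_def
proof (intro conjI subsetI)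
  fix b assume b: "b \<in> cl B {\<zero>\<^bsub>B\<^esub>}"
  have bc: "b \<in> carrier B" using b B.cl_carrier by blast
  have "b = \<zero>\<^bsub>B\<^esub>"
    by (rule B.eq_if_close[OF bc B.zero_closed]) (use B.cl_approx[OF b] in \<open>force intro: less_imp_le\<close>)
  then show "b \<in> {\<zero>\<^bsub>B\<^esub>}" by simp
qed (rule B.zeroideal)

end

text \<open>The image of \<open>I\<close> is its preimage under the inverse map; the inverse is a
  homomorphism, hence bounded, so the image is closed.\<close>

lemma star_iso_ideal:
  assumes AB: "calg_pair A B" "calg_pair B A" and f: "star_iso A B f" and I: "cstar_ideal A I"
  shows "cstar_ideal B (f ` I)" and "f ` I = carrier B \<Longrightarrow> I = carrier A"
proof -
  interpret AB: calg_pair A B by (rule AB)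
  interpret I: ideal I A using I by (simp add: cstar_ideal_def)
  have fh: "star_hom A B f" and bij: "bij_betw f (carrier A) (carrier B)" using f by (simp_all add: star_iso_def)
  note h = AB.star_homD[OF fh]
  define g where "g = restrict (inv_into (carrier A) f) (carrier B)"
  have gc: "g b \<in> carrier A" and fg: "f (g b) = b" if "b \<in> carrier B" for b
    using that bij by (auto simp: g_def bij_betw_def inv_into_into f_inv_into_f)
  have gf: "g (f a) = a" if "a \<in> carrier A" for a
    using that bij h(1)[OF that] by (auto simp: g_def bij_betw_def inv_into_f_f)
  have g: "g b = a" if "a \<in> carrier A" "f a = b" for a b using gf that by blast
  have "g \<in> extensional (carrier B)" by (simp add: g_def)
  then have "star_hom B A g"
    unfolding star_hom_def ring_hom_def by (auto intro!: g simp: gc fg h)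
  then have "cstar_ideal B {b \<in> carrier B. g b \<in> I}" by (rule calg_pair.ideal_preimage[OF AB(2) _ I])
  moreover have "{b \<in> carrier B. g b \<in> I} = f ` I"
  proof (intro equalityI subsetI)
    fix b assume "b \<in> {b \<in> carrier B. g b \<in> I}"
    then show "b \<in> f ` I" using fg[of b] by (metis (mono_tags, lifting) image_eqI mem_Collect_eq)
  next
    fix b assume "b \<in> f ` I"
    then obtain a where a: "a \<in> I" "b = f a" by blast
    then show "b \<in> {b \<in> carrier B. g b \<in> I}" using gf[of a] h(1)[of a] I.a_Hcarr[of a] by simp
  qed
  ultimately show "cstar_ideal B (f ` I)" by simp
  assume e: "f ` I = carrier B"
  have "a \<in> I" if a: "a \<in> carrier A" for a
  proof -
    obtain a' where a': "a' \<in> I" "f a = f a'" using e h(1)[OF a] by (metis image_iff)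
    have "inj_on f (carrier A)" using bij by (simp add: bij_betw_def)
    then have "a = a'" using a'(2) a I.a_Hcarr[OF a'(1)] by (rule inj_onD)
    then show ?thesis using a'(1) by simp
  qed
  then show "I = carrier A" using I.a_Hcarr by blast
qed

context group_submonoid begin

text \<open>The conditional expectation onto the functions on the boundary appears as a diagonal
  matrix coefficient of the regular representation.\<close>

abbreviation "Er \<equiv> (\<lambda>a x. coord (app a (ket (\<one>, x))) (\<one>, x)) ::
  ('g \<times> ('g set \<Rightarrow> bool)) op \<Rightarrow> ('g set \<Rightarrow> bool) \<Rightarrow> complex"

lemma Red_simps:
  "S \<otimes>\<^bsub>Red\<^esub> T = S o\<^sub>L T" "S \<oplus>\<^bsub>Red\<^esub> T = S + T" "\<zero>\<^bsub>Red\<^esub> = 0" "star Red T = adj T" "nrm Red T = norm T"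
  "c \<odot>\<^bsub>Red\<^esub> T = c \<odot>\<^bsub>bounded_ops\<^esub> T"
  by (simp_all add: reduced_cp_def ops_simps)

lemma Red_carrier: "a \<in> carrier Red \<Longrightarrow> a \<in> carrier bounded_ops"
  using Red_sub by (auto simp: cstar_sub_def)

text \<open>Coefficients are bounded by the operator norm, so an identity between them extends from
  the generators to the closure of their span.\<close>

lemma Red_coord_eq:
  assumes a: "a \<in> carrier Red"
    and gens: "\<And>g f. g \<in> carrier G \<Longrightarrow> f \<in> fib g \<Longrightarrow> coord (app (rg g f) \<xi>) i = coord (app (rg g f) \<eta>) j"
  shows "coord (app a \<xi>) i = coord (app a \<eta>) j"
proof -
  have U: "gens rg \<subseteq> carrier bounded_ops" using rg_carrier by blast
  have l: "coord (app y \<xi>) i = coord (app y \<eta>) j" if "y \<in> lin_span bounded_ops (gens rg)" for y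
    using that
  proof induct
    case (step x y c)
    then obtain g f where "x = rg g f" "g \<in> carrier G" "f \<in> fib g" by blast
    then show ?case using step(3) gens by (simp add: ops_simps smult_ops blinfun.add_left)
  qed (simp add: ops_simps)
  have "cmod (coord (app a \<xi>) i - coord (app a \<eta>) j) \<le> 0 + e" if e: "0 < e" for e
  proof -
    let ?n = "norm \<xi> + norm \<eta> + 1"
    have n: "0 < ?n" using norm_ge_zero[of \<xi>] norm_ge_zero[of \<eta>] by linarith
    have "a \<in> cl bounded_ops (lin_span bounded_ops (gens rg))" using a by (simp add: reduced_cp_def)
    from ops.cl_approx[OF this divide_pos_pos[OF e n]]
    obtain y where y: "y \<in> lin_span bounded_ops (gens rg)" "nrm bounded_ops (a \<ominus>\<^bsub>bounded_ops\<^esub> y) < e / ?n" by blast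
    have yc: "y \<in> carrier bounded_ops" by (rule ops.lin_span_carrier[OF U y(1)])
    have d: "norm (a - y) < e / ?n" using y(2) ops_minus[OF yc] by (simp add: ops_simps)
    have b: "cmod (coord (app (a - y) \<zeta>) k) \<le> norm (a - y) * norm \<zeta>" for \<zeta> k
      using coord_le_norm norm_blinfun by (rule order_trans)
    have "coord (app a \<xi>) i - coord (app a \<eta>) j = coord (app (a - y) \<xi>) i - coord (app (a - y) \<eta>) j"
      using l[OF y(1)] by (simp add: blinfun.diff_left)
    then have "cmod (coord (app a \<xi>) i - coord (app a \<eta>) j) \<le> norm (a - y) * norm \<xi> + norm (a - y) * norm \<eta>"
      using norm_triangle_ineq4[of "coord (app (a - y) \<xi>) i" "coord (app (a - y) \<eta>) j"] b[of \<xi> i] b[of \<eta> j] by simp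
    also have "\<dots> \<le> norm (a - y) * ?n" by (simp add: distrib_left)
    also have "\<dots> \<le> e" using d n by (simp add: pos_less_divide_eq)
    finally show ?thesis by simp
  qed
  then have "cmod (coord (app a \<xi>) i - coord (app a \<eta>) j) \<le> 0" by (rule field_le_epsilon)
  then show ?thesis by simp
qed

lemma Er_star:
  assumes "a \<in> carrier Red"
  shows "Er (star Red a \<otimes>\<^bsub>Red\<^esub> a) x = complex_of_real ((norm (app a (ket (\<one>, x))))\<^sup>2)"
  using cinner_adj2[OF Red_carrier[OF assms], of "ket (\<one>, x)" "app a (ket (\<one>, x))"]
  by (simp add: Red_simps cinner_ket cinner_norm)

text \<open>By \<open>Er_star\<close> the hypothesis says that \<open>a\<close> kills
  \<open>ket (\<one>, y)\<close> for every boundary point \<open>y\<close>. The coefficients of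
  \<open>a\<close> are invariant under right translation, which moves the column at
  \<open>(h, x)\<close> to the one at \<open>(\<one>, act h x)\<close>; so all columns
  vanish.\<close>

lemma Er_faithful:
  assumes a: "a \<in> carrier Red" and E: "\<And>x. x \<in> X \<Longrightarrow> Er (star Red a \<otimes>\<^bsub>Red\<^esub> a) x = 0"
  shows "a = \<zero>\<^bsub>Red\<^esub>"
proof -
  have e: "app a (ket (\<one>, x)) = 0" if "x \<in> X" for x using E[OF that] unfolding Er_star[OF a] by simp
  have z: "coord (app a (ket (k, x))) j = 0"
    if "\<And>g f. g \<in> carrier G \<Longrightarrow> f \<in> fib g \<Longrightarrow> coord (app (rg g f) (ket (k, x))) j = 0" for k x j
    using Red_coord_eq[OF a, of "ket (k, x)" j 0 j] that by simp
  have "coord (app a (ket (h, x))) (k, x') = 0" for h x k x'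
  proof (cases "h \<in> carrier G \<and> x \<in> bd h \<and> k \<in> carrier G \<and> x' = x")
    case False
    show ?thesis by (rule z) (use False in \<open>auto simp: rg_ket coord_ket\<close>)
  next
    case True
    let ?y = "act h x"
    have y: "?y \<in> X" using True act_X by blast
    have "coord (app a (ket (h, x))) (k, x') = coord (app a (ket (\<one>, ?y))) (k \<otimes> inv h, ?y)"
    proof (rule Red_coord_eq[OF a])
      fix g f assume g: "g \<in> carrier G" and f: "f \<in> fib g"
      have "k = g \<otimes> h \<longleftrightarrow> k \<otimes> inv h = g" using True g inv_solve_right[of g k h] by auto
      then show "coord (app (rg g f) (ket (h, x))) (k, x') = coord (app (rg g f) (ket (\<one>, ?y))) (k \<otimes> inv h, ?y)"
        using True y X_bd_one[OF y] act_one[OF y] g by (simp add: rg_ket[OF g f] coord_ket)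
    qed
    then show ?thesis using e[OF y] by simp
  qed
  then have "app a (ket j) = 0" for j by (intro ell2_eqI) (cases j; simp add: split_paired_all)
  then have "a = 0" using ops_eqI[OF Red_carrier[OF a] ops.zero_closed] by (simp add: ops_simps)
  then show ?thesis by (simp add: Red_simps)
qed

theorem faithful_Red: "faithful_cond_exp G P Red rg Er"
proof -
  interpret R: crossed_gen G P Red rg by (rule crossed_gen_Red)
  have g1: "g \<in> carrier G \<Longrightarrow> \<one> = g \<longleftrightarrow> g = \<one>" for g by auto
  show ?thesis
  proof (unfold_locales, goal_cases)
    case (1 a x)
    have "cmod (Er a x) \<le> norm (app a (ket (\<one>, x)))" by (rule coord_le_norm)
    also have "\<dots> \<le> norm a * norm (ket (\<one>, x))" by (rule norm_blinfun)
    also have "\<dots> \<le> 2 * norm a" by simp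
    finally show ?case by (simp add: Red_simps)
  next
    case (4 g S x)
    have "app (rg g (cyl S)) (ket (\<one>, x)) = (if x \<in> bd g then scaleC (cyl S (act g x)) (ket (g, x)) else 0)"
      using 4 X_bd_one act_one by (simp add: rg_ket cyl_fib)
    then show ?case using 4 g1 X_bd_one act_one by (auto simp: R.t_def coord_ket cyl_def)
  next
    case (5 a x)
    show ?case unfolding Er_star[OF 5(1)] by (intro exI[of _ "(norm (app a (ket (\<one>, x))))\<^sup>2"]) simp
  next
    case (6 a)
    then show ?case by (intro Er_faithful)
  qed (simp_all add: Red_simps smult_ops blinfun.add_left)
qed

text \<open>The expectation of the reduced crossed product is pulled back along the canonical map.
  The result need not be faithful, but \<open>ideal_E_zero\<close> applies to it.\<close>

lemma cond_exp_Full: "cond_exp G P Full fg (\<lambda>a. Er (\<Lambda>0 a))"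
proof -
  interpret F: crossed_gen G P Full fg by (rule crossed_gen_Full)
  interpret R: faithful_cond_exp G P Red rg Er by (rule faithful_Red)
  interpret C: calg_pair Full Red by (intro calg_pair.intro F.A.calg_axioms R.A.calg_axioms)
  note h = C.star_homD[OF star_hom_full_to_reduced]
  show ?thesis
  proof (unfold_locales, goal_cases)
    case (1 a x)
    have "cmod (Er (\<Lambda>0 a) x) \<le> norm (app (\<Lambda>0 a) (ket (\<one>, x)))" by (rule coord_le_norm)
    also have "\<dots> \<le> norm (\<Lambda>0 a) * norm (ket (\<one>, x))" by (rule norm_blinfun)
    also have "\<dots> \<le> 2 * nrm Full a"
      using C.star_hom_bounded[OF star_hom_full_to_reduced 1(1)] by (simp add: Red_simps)
    finally show ?case .
  next
    case (4 g S x)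
    then show ?case using R.E_t[of g S x] by (simp add: F.t_def R.t_def full_to_reduced_gen cyl_fib)
  qed (simp_all add: h Red_simps smult_ops blinfun.add_left)
qed

section \<open>Ideals of the covariance algebra\<close>

abbreviation "Lam \<equiv> Lambda_boundary G P"

lemma Lam_apply: "a \<in> carrier Cov \<Longrightarrow> Lam a = \<Lambda>0 (\<Phi>0 a)"
  by (simp add: Lambda_boundary_def covariance_iso_eq compose_def)

lemma calg_pairs: "calg_pair Cov Full" "calg_pair Full Cov" "calg_pair Full Red" "calg_pair Cov Red" "calg_pair Red Cov"
proof -
  interpret F: crossed G P Full fg by (rule crossed_Full)
  interpret R: crossed G P Red rg by (rule crossed_Red)
  show "calg_pair Cov Full" "calg_pair Full Cov" "calg_pair Full Red" "calg_pair Cov Red" "calg_pair Red Cov"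
    by (intro calg_pair.intro calg_Cov F.A.calg_axioms R.A.calg_axioms)+
qed

definition cond5 :: bool where
  "cond5 \<longleftrightarrow> (\<forall>I. cstar_ideal Cov I \<and> I \<noteq> carrier Cov \<longrightarrow> I \<subseteq> a_kernel Cov Red Lam)"

lemma mem_kernel: "a \<in> a_kernel Cov Red Lam \<longleftrightarrow> a \<in> carrier Cov \<and> Lam a = \<zero>\<^bsub>Red\<^esub>"
  by (simp add: a_kernel_def kernel_def)

text \<open>For an element of a proper ideal, \<open>ideal_E_zero\<close> in the full crossed
  product shows that the expectation of its square vanishes. This expectation is computed in the
  reduced crossed product, where it is faithful, so the element is in the kernel.\<close>

lemma cond4_cond5:
  assumes c4: cond4
  shows cond5
  unfolding cond5_def
proof (intro allI impI subsetI)
  fix I a assume I: "cstar_ideal Cov I \<and> I \<noteq> carrier Cov" and a: "a \<in> I"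
  interpret I: ideal I Cov using I by (simp add: cstar_ideal_def)
  interpret F: cond_exp G P Full fg "\<lambda>a. Er (\<Lambda>0 a)" by (rule cond_exp_Full)
  let ?f = "restrict \<Phi>0 (carrier Cov)" and ?b = "\<Phi>0 a"
  have ac: "a \<in> carrier Cov" using I.a_Hcarr[OF a] .
  have bc: "?b \<in> carrier Full" by (rule \<Phi>0_Full[OF ac])
  have fI: "cstar_ideal Full (?f ` I)" "?f ` I \<noteq> carrier Full"
    using star_iso_ideal[OF calg_pairs(1,2) star_iso_\<Phi>0] I by blast+
  interpret J: ideal "?f ` I" Full using fI(1) by (simp add: cstar_ideal_def)
  have bI: "?b \<in> ?f ` I" using a ac by (intro image_eqI[of _ _ a]) simp_all
  note h = calg_pair.star_homD[OF calg_pairs(3) star_hom_full_to_reduced]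
  have "\<Lambda>0 ?b = \<zero>\<^bsub>Red\<^esub>"
  proof (rule Er_faithful)
    show "\<Lambda>0 ?b \<in> carrier Red" by (rule h(1)[OF bc])
    fix x assume x: "x \<in> X"
    have "star Full ?b \<otimes>\<^bsub>Full\<^esub> ?b \<in> ?f ` I" using bI bc by (intro J.I_l_closed) simp_all
    then have "Er (\<Lambda>0 (star Full ?b \<otimes>\<^bsub>Full\<^esub> ?b)) x = 0" by (rule F.ideal_E_zero[OF c4 fI _ x])
    then show "Er (star Red (\<Lambda>0 ?b) \<otimes>\<^bsub>Red\<^esub> \<Lambda>0 ?b) x = 0" using bc by (simp add: h)
  qed
  then show "a \<in> a_kernel Cov Red Lam" using ac by (simp add: mem_kernel Lam_apply)
qed

text \<open>An isomorphism carries a proper ideal to a proper ideal of a simple algebra, hence to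
  zero.\<close>

lemma star_iso_cond5:
  assumes iso: "star_iso Cov Red Lam" and simple: "simple_cstar Red"
  shows cond5
  unfolding cond5_def
proof (intro allI impI subsetI)
  fix I a assume I: "cstar_ideal Cov I \<and> I \<noteq> carrier Cov" and a: "a \<in> I"
  interpret I: ideal I Cov using I by (simp add: cstar_ideal_def)
  have "cstar_ideal Red (Lam ` I)" "Lam ` I \<noteq> carrier Red"
    using star_iso_ideal[OF calg_pairs(4,5) iso] I by blast+
  then have "Lam ` I = {\<zero>\<^bsub>Red\<^esub>}" using simple by (auto simp: simple_cstar_def)
  then have "Lam a = \<zero>\<^bsub>Red\<^esub>" using a by blast
  then show "a \<in> a_kernel Cov Red Lam" using I.a_Hcarr[OF a] by (simp add: mem_kernel)
qed

text \<open>If \<open>T\<close> were in the image of \<open>x\<close> under \<open>p\<close> but not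
  under \<open>t\<close>, an element \<open>s\<close> deciding the two pullbacks would put
  \<open>psP\<close> inside \<open>T\<close> and make \<open>tsP\<close> disjoint from
  \<open>T\<close>, against \<open>meet\<close>.\<close>

lemma not_cond4_act:
  assumes p: "p \<in> P" "t \<in> P" and meet: "\<And>s. s \<in> P \<Longrightarrow> ((p \<otimes> s) <# P) \<inter> ((t \<otimes> s) <# P) \<noteq> {}" and x: "x \<in> X"
  shows "act p x = act t x"
proof -
  have imp: "act t x T" if p: "p \<in> P" "t \<in> P" and T: "T \<in> J" "act p x T"
    and meet: "\<And>s. s \<in> P \<Longrightarrow> ((p \<otimes> s) <# P) \<inter> ((t \<otimes> s) <# P) \<noteq> {}" for p t T
  proof (rule ccontr)
    assume n: "\<not> act t x T"
    let ?A = "{q \<in> P. p \<otimes> q \<in> T}" and ?B = "{q \<in> P. t \<otimes> q \<in> T}"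
    have AB: "x ?A" "\<not> x ?B" using act_P[OF p(1) x T(1)] act_P[OF p(2) x T(1)] T(2) n by simp_all
    have "?A \<in> J" "?B \<in> J" using pullback_jd[OF P_jd] p T(1) jd_J by blast+
    then obtain s where s: "decides s x {?A, ?B}" using X_decides[OF x, of "{?A, ?B}"] by auto
    then have sP: "s \<in> P" and sA: "p \<otimes> s \<in> T" and sB: "(s <# P) \<inter> ?B = {}" using AB by (simp_all add: decides_def)
    obtain a b where ab: "a \<in> P" "b \<in> P" "p \<otimes> s \<otimes> a = t \<otimes> s \<otimes> b" using meet[OF sP] by (auto simp: pr_iff)
    have "p \<otimes> s \<otimes> a \<in> T" using J_ideal[OF T(1) sA ab(1)] .
    then have "t \<otimes> (s \<otimes> b) \<in> T" using ab p sP by (simp add: m_assoc)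
    then have "s \<otimes> b \<in> (s <# P) \<inter> ?B" using sP ab(2) by (auto simp: pr_iff)
    then show False using sB by blast
  qed
  show ?thesis
  proof (rule X_eqI)
    show "act p x \<in> X" "act t x \<in> X" using act_X bd_P p x by blast+
    fix T assume T: "T \<in> J"
    have "((t \<otimes> s) <# P) \<inter> ((p \<otimes> s) <# P) \<noteq> {}" if "s \<in> P" for s using meet[OF that] by blast
    then show "act p x T = act t x T" using imp[OF p T _ meet] imp[OF p(2,1) T] by blast
  qed
qed

text \<open>The indices are points of one orbit instead of group elements, so that elements acting
  equally on the orbit give the same permutation of basis vectors.\<close>

lemma pact_orbit: "pact G P {act h x | h. x \<in> bd h} (\<lambda>y. y) act"
proof (unfold_locales, goal_cases)
  case (2 y g)
  then obtain h where h: "x \<in> bd h" "y = act h x" by blast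
  then have "x \<in> bd (g \<otimes> h)" "act g y = act (g \<otimes> h) x" using act_comp[OF h(1), of g] 2(2) by simp_all
  then show ?case by blast
next
  case (4 y)
  then show ?case using act_X act_one by blast
next
  case (5 y h g)
  then show ?case using act_comp(2) by simp
qed (use act_X in blast)+

text \<open>A multiple of the permutation representation on the orbit of a point has equal
  isometries at \<open>p\<close> and \<open>t\<close>. Labelling each orbit point by a group element
  \<open>e y\<close> that reaches it makes the orbit small enough for
  \<open>amplify\<close>.\<close>

lemma cov_rep_collapse:
  assumes p: "p \<in> P" "t \<in> P" and act: "\<And>x. x \<in> X \<Longrightarrow> act p x = act t x"
  shows "\<exists>w\<in>cov_reps G P. w p = w t"
proof -
  obtain x where x: "x \<in> X" using X_exists[OF P_one] by blast
  let ?Y = "{act h x | h. x \<in> bd h}"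
  interpret o: pact G P ?Y "\<lambda>y. y" act by (rule pact_orbit)
  have ne: "?Y \<noteq> {}" using X_bd_one[OF x] by blast
  define e where "e y = (SOME h. x \<in> bd h \<and> y = act h x)" for y
  have e: "y = act (e y) x" if "y \<in> ?Y" for y
    unfolding e_def by (rule conjunct2[OF someI_ex]) (use that in blast)
  have "inj_on e ?Y"
  proof (rule inj_onI)
    fix y z assume yz: "y \<in> ?Y" "z \<in> ?Y" "e y = e z"
    show "y = z" using e[OF yz(1)] e[OF yz(2)] yz(3) by (simp only:)
  qed
  from o.amplify[OF ne this] obtain \<beta> :: "'g \<times> nat \<Rightarrow> ('g set \<Rightarrow> bool) \<times> ('g \<times> nat)" where
    pa: "pact G P UNIV (\<lambda>i. fst (\<beta> i)) (\<lambda>g i. inv_into UNIV \<beta> (act g (fst (\<beta> i)), snd (\<beta> i)))" by blast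
  interpret a: pact G P UNIV "\<lambda>i. fst (\<beta> i)" "\<lambda>g i. inv_into UNIV \<beta> (act g (fst (\<beta> i)), snd (\<beta> i))" by (rule pa)
  let ?r = "prep UNIV (\<lambda>i. fst (\<beta> i)) (\<lambda>g i. inv_into UNIV \<beta> (act g (fst (\<beta> i)), snd (\<beta> i)))"
  have r: "?r \<in> reps" using a.reps_prep by (simp add: cp_rep_iff)
  have k: "app (?r q (cyl (q <# P))) (ket j) = ket (inv_into UNIV \<beta> (act q (fst (\<beta> j)), snd (\<beta> j)))"
    if q: "q \<in> P" for q j
  proof -
    have X: "fst (\<beta> j) \<in> X" using a.kX by blast
    have b: "fst (\<beta> j) \<in> bd q" by (rule bd_P[OF q X])
    have "act q (fst (\<beta> j)) (q <# P)" using act_bd[OF b] bd_inv_P[OF q] by blast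
    then have "cyl (q <# P) (act q (fst (\<beta> j))) = 1" using act_X[OF b] by (simp add: cyl_def)
    then show ?thesis using q b by (simp add: a.prep_ket cyl_fib pr_jd)
  qed
  have "?r p (cyl (p <# P)) = ?r t (cyl (t <# P))"
  proof (rule ops_eqI)
    show "?r p (cyl (p <# P)) \<in> carrier bounded_ops" "?r t (cyl (t <# P)) \<in> carrier bounded_ops"
      using p by (simp_all add: a.prep_carrier cyl_fib pr_jd)
    fix j
    show "app (?r p (cyl (p <# P))) (ket j) = app (?r t (cyl (t <# P))) (ket j)"
      using act[OF a.kX] by (simp add: k p)
  qed
  then have "isom ?r p = isom ?r t" using isom_apply[OF r] p by simp
  then show ?thesis using isom_cov[OF r] by blast
qed

text \<open>Evaluation at a representation with \<open>w p = w t\<close> has a proper ideal as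
  kernel, and \<open>cg p - cg t\<close> belongs to it. So \<open>Lam\<close> would identify the two
  generators, whereas the regular representation sends \<open>ket (\<one>, x)\<close> to the
  distinct vectors \<open>ket (p, x)\<close> and \<open>ket (t, x)\<close>.\<close>

lemma cond5_cond4:
  assumes c5: cond5
  shows cond4
proof (rule ccontr)
  assume "\<not> cond4"
  then obtain p t where p: "p \<in> P" "t \<in> P" "p \<noteq> t"
    and meet: "\<And>s. s \<in> P \<Longrightarrow> ((p \<otimes> s) <# P) \<inter> ((t \<otimes> s) <# P) \<noteq> {}" unfolding cond4_def by blast
  obtain w where w: "w \<in> cov_reps G P" "w p = w t" using cov_rep_collapse[OF p(1,2) not_cond4_act[OF p(1,2) meet]] by blast
  interpret C: calg Cov by (rule calg_Cov)
  interpret CR: calg_pair Cov Red by (rule calg_pairs(4))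
  interpret CO: calg_pair Cov "bounded_ops :: ('g \<times> nat) op cstar" by (intro calg_pair.intro calg_Cov calg_ops)
  have sub: "carrier Cov \<subseteq> carrier Cov_prod" using Cov_sub by (simp add: cstar_sub_def)
  let ?ev = "\<lambda>a\<in>carrier Cov. a w"
  have CC: "x \<otimes>\<^bsub>Cov\<^esub> y = x \<otimes>\<^bsub>Cov_prod\<^esub> y" "x \<oplus>\<^bsub>Cov\<^esub> y = x \<oplus>\<^bsub>Cov_prod\<^esub> y" "star Cov x = star Cov_prod x"
    "c \<odot>\<^bsub>Cov\<^esub> x = c \<odot>\<^bsub>Cov_prod\<^esub> x" for x y c
    by (simp_all add: covariance_algebra_def Let_def)
  have aw: "a w \<in> carrier bounded_ops" if "a \<in> carrier Cov" for a
    using ops.fam_carrier(1)[OF subsetD[OF sub that] w(1)] .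
  have ev: "star_hom Cov bounded_ops ?ev"
    unfolding star_hom_def ring_hom_def
    using w(1) aw C.m_closed C.a_closed C.star_closed C.smult_closed C.one_closed
    by (auto simp: CC Cov_eq(2) families_simps(2-))
  let ?I = "{a \<in> carrier Cov. ?ev a \<in> {\<zero>\<^bsub>bounded_ops\<^esub>}}"
  have I: "cstar_ideal Cov ?I" by (rule CO.ideal_preimage[OF ev CO.ideal_zero])
  have "?ev \<one>\<^bsub>Cov\<^esub> = \<one>\<^bsub>bounded_ops\<^esub>" by (rule CO.star_homD(4)[OF ev])
  moreover have "(\<one>\<^bsub>bounded_ops\<^esub> :: ('g \<times> nat) op) \<noteq> \<zero>\<^bsub>bounded_ops\<^esub>"
  proof
    assume "(\<one>\<^bsub>bounded_ops\<^esub> :: ('g \<times> nat) op) = \<zero>\<^bsub>bounded_ops\<^esub>"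
    then have "app (id_blinfun :: ('g \<times> nat) op) (ket undefined) = app 0 (ket undefined)" by (simp add: ops_simps)
    then have "norm (ket undefined :: ('g \<times> nat) ell2) = 0" by simp
    then show False by simp
  qed
  ultimately have "\<one>\<^bsub>Cov\<^esub> \<notin> ?I" by simp
  then have "?I \<noteq> carrier Cov" using C.one_closed by blast
  then have sub: "?I \<subseteq> a_kernel Cov Red Lam" using c5 I unfolding cond5_def by blast
  let ?d = "cg p \<ominus>\<^bsub>Cov\<^esub> cg t"
  have c: "cg p \<in> carrier Cov" "cg t \<in> carrier Cov" using p cg_Cov by simp_all
  have "?ev ?d = ?ev (cg p) \<ominus>\<^bsub>bounded_ops\<^esub> ?ev (cg t)" by (rule CO.star_hom_minus[OF ev c])
  also have "\<dots> = \<zero>\<^bsub>bounded_ops\<^esub>"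
  proof -
    have "?ev (cg p) = ?ev (cg t)" using c w by (simp add: cov_gen_def)
    then show ?thesis using CO.star_homD(1)[OF ev c(2)] by (simp add: ops.minus_eq_zero)
  qed
  finally have "?d \<in> ?I" using c by simp
  then have L0: "\<Lambda>0 (\<Phi>0 ?d) = \<zero>\<^bsub>Red\<^esub>" using sub c by (auto simp: mem_kernel Lam_apply)
  let ?F = "restrict \<Phi>0 (carrier Cov)"
  have F: "star_hom Cov Full ?F" using star_iso_\<Phi>0 by (simp add: star_iso_def)
  have Fc: "\<Phi>0 (cg p) \<in> carrier Full" "\<Phi>0 (cg t) \<in> carrier Full" using c \<Phi>0_Full by simp_all
  have "\<Phi>0 ?d = \<Phi>0 (cg p) \<ominus>\<^bsub>Full\<^esub> \<Phi>0 (cg t)" using calg_pair.star_hom_minus[OF calg_pairs(1) F c] c by simp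
  then have "\<Lambda>0 (\<Phi>0 (cg p)) \<ominus>\<^bsub>Red\<^esub> \<Lambda>0 (\<Phi>0 (cg t)) = \<zero>\<^bsub>Red\<^esub>"
    using L0 calg_pair.star_hom_minus[OF calg_pairs(3) star_hom_full_to_reduced Fc] by simp
  then have "\<Lambda>0 (\<Phi>0 (cg p)) = \<Lambda>0 (\<Phi>0 (cg t))"
    using calg_pair.star_homD(1)[OF calg_pairs(3) star_hom_full_to_reduced] Fc by (simp add: CR.B.minus_eq_zero)
  then have eq: "rg p (cyl (p <# P)) = rg t (cyl (t <# P))"
    using p by (simp add: \<Phi>0_cg full_to_reduced_gen cyl_fib pr_jd)
  obtain x where x: "x \<in> X" using X_exists[OF P_one] by blast
  have k: "app (rg q (cyl (q <# P))) (ket (\<one>, x)) = ket (q, x)" if q: "q \<in> P" for q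
  proof -
    have b: "x \<in> bd q" by (rule bd_P[OF q x])
    have "act q x (q <# P)" using act_bd[OF b] bd_inv_P[OF q] by blast
    then have "cyl (q <# P) (act q x) = 1" using act_X[OF b] by (simp add: cyl_def)
    then show ?thesis using q b X_bd_one[OF x] act_one[OF x] by (simp add: rg_ket cyl_fib pr_jd)
  qed
  have "ket (p, x) = ket (t, x)" using k[OF p(1)] k[OF p(2)] eq by simp
  then have "coord (ket (p, x)) (p, x) = coord (ket (t, x)) (p, x)" by simp
  then show False using p(3) by (simp add: coord_ket)
qed

end

theorem corollary6p19:
  fixes G :: "'g monoid" and P :: "'g set"
  assumes "group G" and "submonoid P G" and "P \<noteq> {\<one>\<^bsub>G\<^esub>}"
  shows
    "let
       c1 = topologically_free G (carrier G) (boundary G P) (boundary_dom G P) (Omega_act G P);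
       c2 = topologically_free G (G0 G P) (boundary G P) (boundary_dom G P) (Omega_act G P);
       c3 = (\<forall>g\<in>G0 G P. g \<noteq> \<one>\<^bsub>G\<^esub> \<longrightarrow> (\<forall>p\<in>P. \<exists>q \<in> p <#\<^bsub>G\<^esub> P.
               (q <#\<^bsub>G\<^esub> P) \<inter> ((g \<otimes>\<^bsub>G\<^esub> q) <#\<^bsub>G\<^esub> P) = {}));
       c4 = (\<forall>p\<in>P. \<forall>t\<in>P. p \<noteq> t \<longrightarrow> (\<exists>s\<in>P.
               ((p \<otimes>\<^bsub>G\<^esub> s) <#\<^bsub>G\<^esub> P) \<inter> ((t \<otimes>\<^bsub>G\<^esub> s) <#\<^bsub>G\<^esub> P) = {}));
       c5 = (\<forall>I. cstar_ideal (covariance_algebra G P) I \<and> I \<noteq> carrier (covariance_algebra G P)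
               \<longrightarrow> I \<subseteq> a_kernel (covariance_algebra G P) (boundary_quotient G P) (Lambda_boundary G P))
     in (c1 \<longleftrightarrow> c2) \<and> (c2 \<longleftrightarrow> c3) \<and> (c3 \<longleftrightarrow> c4) \<and> (c4 \<longleftrightarrow> c5) \<and>
        (c1 \<or> c2 \<or> c3 \<or> c4 \<or> c5 \<longrightarrow> purely_infinite_simple (boundary_quotient G P)) \<and>
        (star_iso (covariance_algebra G P) (boundary_quotient G P) (Lambda_boundary G P) \<longrightarrow>
           purely_infinite_simple (boundary_quotient G P) \<longrightarrow> c1 \<and> c2 \<and> c3 \<and> c4 \<and> c5)"
proof -
  interpret group_submonoid G P using assms(1,2) by (intro group_submonoid.intro group_submonoid_axioms.intro)
  have BQ: "boundary_quotient G P = Red" by (simp add: boundary_quotient_def)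
  have 12: "top_free (carrier G) \<Longrightarrow> top_free (G0 G P)" by (rule top_free_mono[OF G0_carrier])
  have pis: "cond4 \<Longrightarrow> purely_infinite_simple Red"
    using faithful_cond_exp.purely_infinite[OF faithful_Red] assms(3) by blast
  have conv: "star_iso Cov Red Lam \<Longrightarrow> purely_infinite_simple Red \<Longrightarrow> cond5"
    using star_iso_cond5 by (simp add: purely_infinite_simple_def)
  \<comment> \<open>The first four conditions close up in the cycle 1, 2, 3, 4, 1; the fifth is
    equivalent to the fourth, and the converse statement passes through the fifth.\<close>
  note eqs = 12 top_free_cond3 cond3_cond4 cond4_top_free cond4_cond5 cond5_cond4 pis conv
  show ?thesis
    unfolding Let_def BQ cond3_def[symmetric] cond4_def[symmetric] cond5_def[symmetric]
    using eqs by blast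
qed

end
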